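(* Suppose that $P_0$ is a Borel probability measure on $\mathbb R^d$ supported in $B_R(0)$ and satisfying the doubling condition (UD) with constant $D_{\mathrm{UD}}$. Let $p\geq1$ be an integer, $0<\delta\leq1$, $T>\delta$, $N\ge1$ an integer, $h=(T-\delta)/N$, $\Lambda_{R,\delta}=(1+R)/\delta$, and assume that $$h\Lambda_{R,\delta}^2\leq1.$$ Let $Q_N^{(p)}$ be the law after $N$ steps of the order-$p$ truncated Taylor scheme started from $N(0,I_d)$ (see context), and let $\mathfrak m_\delta=\sup_{\delta\leq t\leq T}\left(\int_{\mathbb R^d}|x|^2P_t(dx)\right)^{1/2}$. Then $$W_2\bigl(P_\delta,Q_N^{(p)}\bigr)\leq C_p\exp\left(C_p\frac{(1+R)^2}{\delta}\right)\left[e^{-T/2}(R^2+d)^{1/2}+h^p\left(\delta^{-(p+1)}\mathfrak m_\delta+\Lambda_{R,\delta}^{2p+1}\right)\right],$$ where $C_p$ depends only on $p$ and $D_{\mathrm{UD}}$. Moreover, $\mathfrak m_\delta\leq R+\sqrt d$, and hence $$W_2\bigl(P_\delta,Q_N^{(p)}\bigr)\leq C_{p,R,\delta}\left[e^{-T/2}(R^2+d)^{1/2}+h^p(1+\sqrt d)\right],$$ where $C_{p,R,\delta}$ may also depend on $D_{\mathrm{UD}}$ but is independent of the ambient dimension.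
   Context: For $t>0$ let $P_t$ be the law of $e^{-t/2}X_0+\sqrt{1-e^{-t}}\,G$ with $X_0\sim P_0$, $G\sim N(0,I_d)$ independent, and $p_t$ its density. Let $\hat s(t,x)=x+D_x\log p_t(x)$ and let $L=-\partial_t+\frac12\hat s(t,x)\cdot D_x$ act componentwise on smooth vector fields of $(t,x)$; $L^jx$ is $L$ applied $j$ times to the identity field $(t,x)\mapsto x$. Order-$p$ truncated Taylor scheme: with $u_n=nh$, $n=0,\dots,N$, $$Y_{n+1}^h=\Phi_h^{(p)}(u_n,Y_n^h),\quad Y_0^h\sim N(0,I_d),\qquad \Phi_h^{(p)}(u,x)=x+\sum_{j=1}^p\frac{h^j}{j!}(L^jx)(T-u,x),$$ and $Q_n^{(p)}$ is the law of $Y_n^h$. $W_2$ is the quadratic Wasserstein distance. Doubling condition (UD). Let $M=\operatorname{supp}P_0$ (compact). For $\theta\in\mathbb S^{d-1}$ set $U_\theta(y)=\sup_{y'\in M}\langle\theta,y'\rangle-\langle\theta,y\rangle$ and $F_\theta(u)=P_0(\{y:U_\theta(y)\leq u\})$, $u>0$. (UD) with constant $D_{\mathrm{UD}}\geq1$ means $F_\theta(2u)\leq D_{\mathrm{UD}}F_\theta(u)$ for all $\theta\in\mathbb S^{d-1}$ and all $u>0$. *)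

theory Defs
  imports "HOL-Probability.Probability"
begin

text \<open>
  The constants in the main result must not depend on the dimension \<open>d\<close>, so \<open>d\<close> is a natural number
  (not a type) and points of \<open>\<real>\<^sup>d\<close> are functions \<open>nat \<Rightarrow> real\<close> that are extensional on \<open>{..<d}\<close>.
  The Euclidean norm of \<open>x\<close> is \<open>L2_set x {..<d}\<close>.
\<close>

definition Rd :: "nat \<Rightarrow> (nat \<Rightarrow> real) measure" where
  "Rd d = (\<Pi>\<^sub>M i\<in>{..<d}. lborel)"

definition std_gaussian :: "nat \<Rightarrow> (nat \<Rightarrow> real) measure" where
  "std_gaussian d = (\<Pi>\<^sub>M i\<in>{..<d}. std_normal_distribution)"

definition dist_d :: "nat \<Rightarrow> (nat \<Rightarrow> real) \<Rightarrow> (nat \<Rightarrow> real) \<Rightarrow> real" where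
  "dist_d d x y = L2_set (\<lambda>i. x i - y i) {..<d}"

definition supp :: "nat \<Rightarrow> (nat \<Rightarrow> real) measure \<Rightarrow> (nat \<Rightarrow> real) set" where
  "supp d P = {x \<in> space (Rd d). \<forall>r>0. emeasure P {y \<in> space (Rd d). dist_d d x y < r} > 0}"


subsection \<open>The quadratic Wasserstein distance\<close>

definition couplings ::
  "nat \<Rightarrow> (nat \<Rightarrow> real) measure \<Rightarrow> (nat \<Rightarrow> real) measure \<Rightarrow> ((nat \<Rightarrow> real) \<times> (nat \<Rightarrow> real)) measure set"
  where
  "couplings d P Q = {\<gamma>. sets \<gamma> = sets (Rd d \<Otimes>\<^sub>M Rd d) \<and>
     distr \<gamma> (Rd d) fst = P \<and> distr \<gamma> (Rd d) snd = Q}"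

definition sqrt_ennreal :: "ennreal \<Rightarrow> ennreal" where
  "sqrt_ennreal a = (if a = \<infinity> then \<infinity> else ennreal (sqrt (enn2real a)))"

definition W2 :: "nat \<Rightarrow> (nat \<Rightarrow> real) measure \<Rightarrow> (nat \<Rightarrow> real) measure \<Rightarrow> ennreal" where
  "W2 d P Q =
     sqrt_ennreal (INF \<gamma>\<in>couplings d P Q. \<integral>\<^sup>+z. ennreal ((dist_d d (fst z) (snd z))\<^sup>2) \<partial>\<gamma>)"


subsection \<open>The doubling condition\<close>

definition unit_sphere :: "nat \<Rightarrow> (nat \<Rightarrow> real) set" where
  "unit_sphere d = {\<theta> \<in> space (Rd d). L2_set \<theta> {..<d} = 1}"

definition dot :: "nat \<Rightarrow> (nat \<Rightarrow> real) \<Rightarrow> (nat \<Rightarrow> real) \<Rightarrow> real" where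
  "dot d x y = (\<Sum>i<d. x i * y i)"

definition support_gap ::
  "nat \<Rightarrow> (nat \<Rightarrow> real) measure \<Rightarrow> (nat \<Rightarrow> real) \<Rightarrow> (nat \<Rightarrow> real) \<Rightarrow> real" where
  "support_gap d P \<theta> y = (SUP y'\<in>supp d P. dot d \<theta> y') - dot d \<theta> y"

definition gap_cdf :: "nat \<Rightarrow> (nat \<Rightarrow> real) measure \<Rightarrow> (nat \<Rightarrow> real) \<Rightarrow> real \<Rightarrow> real" where
  "gap_cdf d P \<theta> u = measure P {y \<in> space (Rd d). support_gap d P \<theta> y \<le> u}"

definition doubling_UD :: "nat \<Rightarrow> (nat \<Rightarrow> real) measure \<Rightarrow> real \<Rightarrow> bool" where
  "doubling_UD d P D \<longleftrightarrow>
     D \<ge> 1 \<and> (\<forall>\<theta>\<in>unit_sphere d. \<forall>u>0. gap_cdf d P \<theta> (2 * u) \<le> D * gap_cdf d P \<theta> u)"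


subsection \<open>The noised laws and their densities\<close>

definition noised_law :: "nat \<Rightarrow> (nat \<Rightarrow> real) measure \<Rightarrow> real \<Rightarrow> (nat \<Rightarrow> real) measure" where
  "noised_law d P t =
     distr (P \<Otimes>\<^sub>M std_gaussian d) (Rd d)
       (\<lambda>(x, g). \<lambda>i\<in>{..<d}. exp (- t / 2) * x i + sqrt (1 - exp (- t)) * g i)"

text \<open>
  The continuous version of the density of \<open>noised_law d P t\<close>, as a Gaussian mixture; the lemmas
  \<open>noised_law_eq_density\<close> and \<open>continuous_noised_density\<close> below identify it.
\<close>

definition noised_density :: "nat \<Rightarrow> (nat \<Rightarrow> real) measure \<Rightarrow> real \<Rightarrow> (nat \<Rightarrow> real) \<Rightarrow> real" where
  "noised_density d P t x =
     (\<integral>y. (\<Prod>i<d. normal_density (exp (- t / 2) * y i) (sqrt (1 - exp (- t))) (x i)) \<partial>P)"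

definition moment_sup :: "nat \<Rightarrow> (nat \<Rightarrow> real) measure \<Rightarrow> real \<Rightarrow> real \<Rightarrow> real" where
  "moment_sup d P \<delta> T =
     (SUP t\<in>{\<delta>..T}. sqrt (\<integral>x. (L2_set x {..<d})\<^sup>2 \<partial>noised_law d P t))"


subsection \<open>The truncated Taylor scheme\<close>

definition partial :: "nat \<Rightarrow> ((nat \<Rightarrow> real) \<Rightarrow> real) \<Rightarrow> (nat \<Rightarrow> real) \<Rightarrow> real" where
  "partial k f x = deriv (\<lambda>s. f (x(k := s))) (x k)"

definition shat :: "nat \<Rightarrow> (nat \<Rightarrow> real) measure \<Rightarrow> real \<Rightarrow> (nat \<Rightarrow> real) \<Rightarrow> nat \<Rightarrow> real" where
  "shat d P t x = (\<lambda>k\<in>{..<d}. x k + partial k (\<lambda>y. ln (noised_density d P t y)) x)"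

type_synonym vfield = "real \<Rightarrow> (nat \<Rightarrow> real) \<Rightarrow> nat \<Rightarrow> real"

definition L_op :: "nat \<Rightarrow> (nat \<Rightarrow> real) measure \<Rightarrow> vfield \<Rightarrow> vfield" where
  "L_op d P v t x =
     (\<lambda>i\<in>{..<d}. - deriv (\<lambda>s. v s x i) t
        + 1/2 * (\<Sum>k<d. shat d P t x k * partial k (\<lambda>y. v t y i) x))"

definition taylor_step ::
  "nat \<Rightarrow> (nat \<Rightarrow> real) measure \<Rightarrow> nat \<Rightarrow> real \<Rightarrow> real \<Rightarrow> real \<Rightarrow> (nat \<Rightarrow> real) \<Rightarrow> nat \<Rightarrow> real" where
  "taylor_step d P p T h u x =
     (\<lambda>i\<in>{..<d}. x i + (\<Sum>j=1..p. h ^ j / fact j * ((L_op d P ^^ j) (\<lambda>t x. x)) (T - u) x i))"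

primrec taylor_iterate ::
  "nat \<Rightarrow> (nat \<Rightarrow> real) measure \<Rightarrow> nat \<Rightarrow> real \<Rightarrow> real \<Rightarrow> nat \<Rightarrow> (nat \<Rightarrow> real) \<Rightarrow> nat \<Rightarrow> real" where
  "taylor_iterate d P p T h 0 y = y"
| "taylor_iterate d P p T h (Suc n) y =
     taylor_step d P p T h (real n * h) (taylor_iterate d P p T h n y)"

definition taylor_law ::
  "nat \<Rightarrow> (nat \<Rightarrow> real) measure \<Rightarrow> nat \<Rightarrow> real \<Rightarrow> real \<Rightarrow> nat \<Rightarrow> (nat \<Rightarrow> real) measure" where
  "taylor_law d P p T h n = distr (std_gaussian d) (Rd d) (taylor_iterate d P p T h n)"


subsection \<open>Identification of the density\<close>

lemma sets_std_gaussian [measurable_cong]: "sets (std_gaussian d) = sets (Rd d)"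
  unfolding std_gaussian_def Rd_def by (rule sets_PiM_cong) auto

lemma prob_space_std_gaussian: "prob_space (std_gaussian d)"
  unfolding std_gaussian_def
  by (rule prob_space_PiM) (rule prob_space_normal_density, simp)

lemma product_normal_density:
  assumes s: "0 < s"
  shows "(\<Pi>\<^sub>M i\<in>{..<d::nat}. density lborel (\<lambda>z. ennreal (normal_density (m i) s z))) =
         density (Rd d) (\<lambda>x. ennreal (\<Prod>i<d. normal_density (m i) s (x i)))"
proof -
  let ?N = "\<lambda>i. density lborel (\<lambda>z. ennreal (normal_density (m i) s z))"
  interpret N: product_prob_space ?N
    by (intro product_prob_spaceI prob_space_normal_density s)
  interpret B: product_sigma_finite "\<lambda>i::nat. lborel :: real measure"
    by standard
  show ?thesis
  proof (rule N.PiM_eqI[symmetric])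
    show "finite {..<d}" by simp
    show "sets (density (Rd d) (\<lambda>x. ennreal (\<Prod>i<d. normal_density (m i) s (x i)))) = sets (Pi\<^sub>M {..<d} ?N)"
      by (simp add: Rd_def cong: sets_PiM_cong)
    fix A :: "nat \<Rightarrow> real set"
    assume A: "\<And>i. i \<in> {..<d} \<Longrightarrow> A i \<in> sets (?N i)"
    have A': "A i \<in> sets borel" if "i < d" for i using A[of i] that by simp
    have PA: "Pi\<^sub>E {..<d} A \<in> sets (Rd d)"
      unfolding Rd_def using A' by (intro sets_PiM_I_finite) auto
    have "emeasure (density (Rd d) (\<lambda>x. ennreal (\<Prod>i<d. normal_density (m i) s (x i)))) (Pi\<^sub>E {..<d} A)
        = (\<integral>\<^sup>+x. ennreal (\<Prod>i<d. normal_density (m i) s (x i)) * indicator (Pi\<^sub>E {..<d} A) x \<partial>Rd d)"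
      by (rule emeasure_density[OF _ PA]) (simp add: Rd_def)
    also have "\<dots> = (\<integral>\<^sup>+x. (\<Prod>i<d. ennreal (normal_density (m i) s (x i)) * indicator (A i) (x i)) \<partial>Rd d)"
    proof (rule nn_integral_cong)
      fix x assume x: "x \<in> space (Rd d)"
      have "indicator (Pi\<^sub>E {..<d} A) x = (\<Prod>i<d. indicator (A i) (x i) :: ennreal)"
        using x by (auto simp: Rd_def space_PiM indicator_def PiE_iff)
      then show "ennreal (\<Prod>i<d. normal_density (m i) s (x i)) * indicator (Pi\<^sub>E {..<d} A) x
        = (\<Prod>i<d. ennreal (normal_density (m i) s (x i)) * indicator (A i) (x i))"
        by (simp add: prod.distrib prod_ennreal)
    qed
    also have "\<dots> = (\<Prod>i<d. \<integral>\<^sup>+z. ennreal (normal_density (m i) s z) * indicator (A i) z \<partial>lborel)"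
      unfolding Rd_def
      by (rule B.product_nn_integral_prod) (auto intro!: borel_measurable_times_ennreal borel_measurable_indicator A')
    also have "\<dots> = (\<Prod>i<d. emeasure (?N i) (A i))"
      by (intro prod.cong refl emeasure_density[symmetric]) (auto intro: A')
    finally show "emeasure (density (Rd d) (\<lambda>x. ennreal (\<Prod>i<d. normal_density (m i) s (x i)))) (Pi\<^sub>E {..<d} A)
       = (\<Prod>i<d. emeasure (?N i) (A i))" .
  qed
qed

lemma measurable_gaussian_affine:
  "(\<lambda>g. \<lambda>i\<in>{..<d}. m i + s * g i) \<in> std_gaussian d \<rightarrow>\<^sub>M Rd d" for m :: "nat \<Rightarrow> real"
  unfolding std_gaussian_def Rd_def by measurable

lemma gaussian_affine:
  assumes s: "0 < s"
  shows "distr (std_gaussian d) (Rd d) (\<lambda>g. \<lambda>i\<in>{..<d}. m i + s * g i) =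
         density (Rd d) (\<lambda>x. ennreal (\<Prod>i<d. normal_density (m i) s (x i)))"
proof -
  let ?G = "\<lambda>i::nat. density lborel (\<lambda>z. ennreal (std_normal_density z))"
  let ?N = "\<lambda>i. density lborel (\<lambda>z. ennreal (normal_density (m i) s z))"
  interpret N: product_prob_space ?N
    by (intro product_prob_spaceI prob_space_normal_density s)
  interpret G: product_prob_space ?G
    by (intro product_prob_spaceI prob_space_normal_density) simp
  have G1: "prob_space std_normal_distribution"
    by (rule prob_space_normal_density) simp
  have one: "distr (?G i) lborel (\<lambda>z. m i + s * z) = ?N i" for i
  proof -
    have "distributed (?G i) lborel (\<lambda>z. z) (\<lambda>z. ennreal (std_normal_density z))"
      by (simp add: distributed_def distr_id2)
    from prob_space.normal_density_affine[OF G1 this, of s "m i"] s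
    have "distributed (?G i) lborel (\<lambda>z. m i + s * z) (\<lambda>z. ennreal (normal_density (m i) s z))"
      by simp
    then show ?thesis by (simp add: distributed_def)
  qed
  have meas [measurable]: "(\<lambda>g. \<lambda>i\<in>{..<d}. m i + s * g i) \<in> std_gaussian d \<rightarrow>\<^sub>M Rd d"
    by (rule measurable_gaussian_affine)
  have "distr (std_gaussian d) (Rd d) (\<lambda>g. \<lambda>i\<in>{..<d}. m i + s * g i) = Pi\<^sub>M {..<d} ?N"
  proof (rule N.PiM_eqI)
    show "finite {..<d}" by simp
    show "sets (distr (std_gaussian d) (Rd d) (\<lambda>g. \<lambda>i\<in>{..<d}. m i + s * g i)) = sets (Pi\<^sub>M {..<d} ?N)"
      by (simp add: Rd_def cong: sets_PiM_cong)
    fix A :: "nat \<Rightarrow> real set"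
    assume A: "\<And>i. i \<in> {..<d} \<Longrightarrow> A i \<in> sets (?N i)"
    have A': "A i \<in> sets borel" if "i < d" for i using A[of i] that by simp
    have PA: "Pi\<^sub>E {..<d} A \<in> sets (Rd d)"
      unfolding Rd_def using A' by (intro sets_PiM_I_finite) auto
    have vim: "(\<lambda>g. \<lambda>i\<in>{..<d}. m i + s * g i) -` Pi\<^sub>E {..<d} A \<inter> space (std_gaussian d)
      = Pi\<^sub>E {..<d} (\<lambda>i. (\<lambda>z. m i + s * z) -` A i)"
      by (auto simp: std_gaussian_def space_PiM PiE_iff)
    have vm: "(\<lambda>z. m i + s * z) -` A i \<in> sets borel" if "i < d" for i
      using measurable_sets[of "\<lambda>z. m i + s * z" borel borel "A i"] A'[OF that] by simp
    have "emeasure (distr (std_gaussian d) (Rd d) (\<lambda>g. \<lambda>i\<in>{..<d}. m i + s * g i)) (Pi\<^sub>E {..<d} A)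
       = emeasure (Pi\<^sub>M {..<d} ?G) (Pi\<^sub>E {..<d} (\<lambda>i. (\<lambda>z. m i + s * z) -` A i))"
      by (subst emeasure_distr[OF meas PA]) (simp add: vim, simp add: std_gaussian_def)
    also have "\<dots> = (\<Prod>i<d. emeasure (?G i) ((\<lambda>z. m i + s * z) -` A i))"
      by (rule G.emeasure_PiM) (auto simp: vm)
    also have "\<dots> = (\<Prod>i<d. emeasure (?N i) (A i))"
    proof (intro prod.cong refl)
      fix i assume "i \<in> {..<d}"
      then show "emeasure (?G i) ((\<lambda>z. m i + s * z) -` A i) = emeasure (?N i) (A i)"
        using A'[of i] by (subst one[symmetric], subst emeasure_distr) auto
    qed
    finally show "emeasure (distr (std_gaussian d) (Rd d) (\<lambda>g. \<lambda>i\<in>{..<d}. m i + s * g i)) (Pi\<^sub>E {..<d} A)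
       = (\<Prod>i<d. emeasure (?N i) (A i))" .
  qed
  then show ?thesis by (simp add: product_normal_density[OF s])
qed

lemma normal_density_le:
  assumes "0 < s" shows "normal_density m s x \<le> 1 / sqrt (2 * pi * s\<^sup>2)"
  unfolding normal_density_def by (rule mult_left_le) auto

lemma prod_normal_density_le:
  assumes "0 < s"
  shows "\<bar>\<Prod>i<d. normal_density (m i) s (x i)\<bar> \<le> (1 / sqrt (2 * pi * s\<^sup>2)) ^ d"
proof -
  have "(\<Prod>i<d. normal_density (m i) s (x i)) \<le> (\<Prod>i<d. 1 / sqrt (2 * pi * s\<^sup>2))"
    by (rule prod_mono) (use normal_density_le[OF assms] in auto)
  then show ?thesis by (simp add: prod_nonneg)
qed

lemma measurable_Rd_component [measurable]: "i < d \<Longrightarrow> (\<lambda>x. x i) \<in> borel_measurable (Rd d)"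
  unfolding Rd_def by measurable

lemma borel_measurable_mixture_kernel:
  "(\<lambda>z. \<Prod>i<d. normal_density (c * fst z i) s (snd z i)) \<in> borel_measurable (Rd d \<Otimes>\<^sub>M Rd d)"
  unfolding normal_density_def
  by (intro borel_measurable_prod) (auto intro!: borel_measurable_times borel_measurable_exp
    borel_measurable_const borel_measurable_divide borel_measurable_uminus borel_measurable_power
    borel_measurable_diff measurable_compose[OF measurable_fst measurable_Rd_component]
    measurable_compose[OF measurable_snd measurable_Rd_component])

lemma noised_law_eq_density:
  assumes P: "prob_space P" "sets P = sets (Rd d)" and t: "0 < t"
  shows "noised_law d P t = density (Rd d) (\<lambda>x. ennreal (noised_density d P t x))"
proof -
  define a where "a = exp (- t / 2)"
  define s where "s = sqrt (1 - exp (- t))"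
  have s: "0 < s" using t by (simp add: s_def)
  interpret P: prob_space P by fact
  interpret G: prob_space "std_gaussian d" by (rule prob_space_std_gaussian)
  interpret B: finite_product_sigma_finite "\<lambda>i::nat. lborel :: real measure" "{..<d}"
    by standard simp
  have sf: "sigma_finite_measure (Rd d)" unfolding Rd_def by (rule B.sigma_finite_measure_axioms)
  interpret PR: pair_sigma_finite P "Rd d"
    using sf by (simp add: pair_sigma_finite_def P.sigma_finite_measure_axioms)
  note [measurable_cong] = P(2)
  let ?f = "\<lambda>(x, g). \<lambda>i\<in>{..<d}. a * x i + s * g i"
  let ?k = "\<lambda>y x. \<Prod>i<d. normal_density (a * y i) s (x i)"
  have k [measurable]: "(\<lambda>z. ?k (fst z) (snd z)) \<in> borel_measurable (P \<Otimes>\<^sub>M Rd d)"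
    using borel_measurable_mixture_kernel[where d = d and c = a and s = s]
    by (subst measurable_cong_sets[OF sets_pair_measure_cong[OF P(2) refl] refl])
  have f [measurable]: "?f \<in> P \<Otimes>\<^sub>M std_gaussian d \<rightarrow>\<^sub>M Rd d"
  proof -
    have "?f \<in> Rd d \<Otimes>\<^sub>M Rd d \<rightarrow>\<^sub>M Rd d"
      unfolding Rd_def split_beta' by measurable
    then show ?thesis
      by (subst measurable_cong_sets[OF sets_pair_measure_cong[OF P(2) sets_std_gaussian] refl])
  qed
  show ?thesis
  proof (rule measure_eqI)
    show "sets (noised_law d P t) = sets (density (Rd d) (\<lambda>x. ennreal (noised_density d P t x)))"
      by (simp add: noised_law_def)
    fix A assume "A \<in> sets (noised_law d P t)"
    then have A [measurable]: "A \<in> sets (Rd d)" by (simp add: noised_law_def)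
    have fy: "(\<lambda>g. \<lambda>i\<in>{..<d}. a * y i + s * g i) \<in> std_gaussian d \<rightarrow>\<^sub>M Rd d" for y :: "nat \<Rightarrow> real"
      by (rule measurable_gaussian_affine)
    have ky: "?k y \<in> borel_measurable (Rd d)" for y :: "nat \<Rightarrow> real"
      by (intro borel_measurable_prod measurable_compose[OF measurable_Rd_component borel_measurable_normal_density]) simp
    have "emeasure (noised_law d P t) A
        = emeasure (P \<Otimes>\<^sub>M std_gaussian d) (?f -` A \<inter> space (P \<Otimes>\<^sub>M std_gaussian d))"
      unfolding noised_law_def a_def[symmetric] s_def[symmetric] by (rule emeasure_distr[OF f A])
    also have "\<dots> = (\<integral>\<^sup>+y. emeasure (std_gaussian d)
        (Pair y -` (?f -` A \<inter> space (P \<Otimes>\<^sub>M std_gaussian d))) \<partial>P)"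
      by (rule G.emeasure_pair_measure_alt) measurable
    also have "\<dots> = (\<integral>\<^sup>+y. (\<integral>\<^sup>+x. ennreal (?k y x) * indicator A x \<partial>Rd d) \<partial>P)"
    proof (rule nn_integral_cong)
      fix y assume y: "y \<in> space P"
      have "Pair y -` (?f -` A \<inter> space (P \<Otimes>\<^sub>M std_gaussian d))
        = (\<lambda>g. \<lambda>i\<in>{..<d}. a * y i + s * g i) -` A \<inter> space (std_gaussian d)"
        using y by (auto simp: space_pair_measure)
      then have "emeasure (std_gaussian d) (Pair y -` (?f -` A \<inter> space (P \<Otimes>\<^sub>M std_gaussian d)))
        = emeasure (distr (std_gaussian d) (Rd d) (\<lambda>g. \<lambda>i\<in>{..<d}. a * y i + s * g i)) A"
        by (simp add: emeasure_distr[OF fy A])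
      also have "\<dots> = (\<integral>\<^sup>+x. ennreal (?k y x) * indicator A x \<partial>Rd d)"
        unfolding gaussian_affine[OF s] using ky by (intro emeasure_density A) simp
      finally show "emeasure (std_gaussian d) (Pair y -` (?f -` A \<inter> space (P \<Otimes>\<^sub>M std_gaussian d)))
        = (\<integral>\<^sup>+x. ennreal (?k y x) * indicator A x \<partial>Rd d)" .
    qed
    also have "\<dots> = (\<integral>\<^sup>+x. (\<integral>\<^sup>+y. ennreal (?k y x) * indicator A x \<partial>P) \<partial>Rd d)"
    proof (rule PR.Fubini'[symmetric])
      show "(\<lambda>(y, x). ennreal (?k y x) * indicator A x) \<in> borel_measurable (P \<Otimes>\<^sub>M Rd d)"
        unfolding split_beta' using k by measurable
    qed
    also have "\<dots> = (\<integral>\<^sup>+x. ennreal (noised_density d P t x) * indicator A x \<partial>Rd d)"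
    proof (rule nn_integral_cong)
      fix x assume x: "x \<in> space (Rd d)"
      have kx: "(\<lambda>y. ?k y x) \<in> borel_measurable P"
        using measurable_compose[OF measurable_Pair2'[OF x, of P] k] by simp
      have "integrable P (\<lambda>y. ?k y x)"
        by (rule P.integrable_const_bound[OF _ kx, of "(1 / sqrt (2 * pi * s\<^sup>2)) ^ d"])
          (use prod_normal_density_le[OF s] in auto)
      then have "(\<integral>\<^sup>+y. ennreal (?k y x) \<partial>P) = ennreal (noised_density d P t x)"
        unfolding noised_density_def a_def[symmetric] s_def[symmetric]
        by (rule nn_integral_eq_integral) (simp add: prod_nonneg)
      then show "(\<integral>\<^sup>+y. ennreal (?k y x) * indicator A x \<partial>P)
        = ennreal (noised_density d P t x) * indicator A x"
        using kx by (subst nn_integral_multc) auto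
    qed
    also have "\<dots> = emeasure (density (Rd d) (\<lambda>x. ennreal (noised_density d P t x))) A"
    proof (rule emeasure_density[symmetric])
      have "(\<lambda>x. \<integral>y. ?k y x \<partial>P) \<in> borel_measurable (Rd d)"
        using measurable_compose[OF measurable_pair_swap' k]
        by (intro P.borel_measurable_lebesgue_integral) (simp add: split_beta')
      then show "(\<lambda>x. ennreal (noised_density d P t x)) \<in> borel_measurable (Rd d)"
        unfolding noised_density_def a_def[symmetric] s_def[symmetric] by simp
    qed (rule A)
    finally show "emeasure (noised_law d P t) A
      = emeasure (density (Rd d) (\<lambda>x. ennreal (noised_density d P t x))) A" .
  qed
qed

lemma continuous_noised_density:
  assumes P: "prob_space P" "sets P = sets (Rd d)" and t: "0 < t"
  shows "continuous_on UNIV (noised_density d P t)"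
proof -
  define a where "a = exp (- t / 2)"
  define s where "s = sqrt (1 - exp (- t))"
  have s: "0 < s" using t by (simp add: s_def)
  interpret P: prob_space P by fact
  let ?k = "\<lambda>y x. \<Prod>i<d. normal_density (a * y i) s (x i)"
  have kx: "(\<lambda>y. ?k y x) \<in> borel_measurable P" for x
  proof -
    have "(\<lambda>y. ?k y x) \<in> borel_measurable (Rd d)"
      unfolding normal_density_def
      by (intro borel_measurable_prod) (auto intro!: borel_measurable_times borel_measurable_exp
        borel_measurable_const borel_measurable_divide borel_measurable_uminus borel_measurable_power
        borel_measurable_diff measurable_Rd_component)
    then show ?thesis by (subst measurable_cong_sets[OF P(2) refl])
  qed
  show ?thesis
    unfolding continuous_on_sequentially
  proof (intro allI ballI impI, elim conjE)
    fix X :: "nat \<Rightarrow> nat \<Rightarrow> real" and x assume X: "X \<longlonglongrightarrow> x"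
    have Xi: "(\<lambda>n. X n i) \<longlonglongrightarrow> x i" for i
      using continuous_on_tendsto_compose[OF continuous_on_product_coordinates X, of i] by simp
    have "(\<lambda>n. \<integral>y. ?k y (X n) \<partial>P) \<longlonglongrightarrow> (\<integral>y. ?k y x \<partial>P)"
    proof (rule integral_dominated_convergence[where w = "\<lambda>_. (1 / sqrt (2 * pi * s\<^sup>2)) ^ d"])
      show "AE y in P. (\<lambda>n. ?k y (X n)) \<longlonglongrightarrow> ?k y x"
        unfolding normal_density_def using s by (intro AE_I2 tendsto_intros Xi) auto
    qed (use kx prod_normal_density_le[OF s] in auto)
    then show "(noised_density d P t \<circ> X) \<longlonglongrightarrow> noised_density d P t x"
      unfolding noised_density_def a_def[symmetric] s_def[symmetric] comp_def .
  qed
qed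

end

theory Submission
  imports Defs
begin

text \<open>
  In the signal-to-noise time \<open>\<rho> = (exp t - 1)\<^sup>-\<^sup>1\<^sup>/\<^sup>2\<close> the law of \<open>X\<^sub>t / \<sigma>\<close> is that of
  \<open>\<rho> Y + G\<close> with \<open>Y\<close> distributed as \<open>P\<^sub>0\<close>, and the probability flow becomes \<open>dw/d\<rho> = E[Y | \<rho> Y + G = w]\<close>,
  which is bounded by \<open>R\<close> and Lipschitz with constant \<open>2 \<rho> R\<^sup>2\<close>.  Each \<open>L\<^sup>j x\<close> is a multiple of \<open>x\<close> plus a
  posterior expectation over finitely many independent replicas of \<open>Y\<close> of a polynomial in
  \<open>\<rho> \<langle>w, Y\<^sub>a - Y\<^sub>b\<rangle>\<close> and \<open>\<langle>Y\<^sub>a, Y\<^sub>b\<rangle>\<close> that does not depend on \<open>d\<close>.  The differences are dominated by the support gaps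
  \<open>sup \<langle>w, \<cdot>\<rangle> - \<langle>w, Y\<^sub>a\<rangle>\<close>, whose posterior exponential moments are bounded by \<open>D\<close> through the doubling condition;
  this yields a dimension-free local Taylor error.  The global error is then propagated along couplings of
  the law of \<open>\<rho> Y + G\<close> with the law of the scheme.
\<close>

text \<open>That the flow transports the law of rho Y + G is never shown. Couplings are instead
  moved by small steps w -> w + eps Y with Y drawn from its posterior given w; this keeps the first
  marginal exactly of that form, and only the distance to the deterministic flow through the point
  of the scheme has to be controlled. The exponential of (1+R)^2/delta has two sources: the
  Lipschitz constant 2 rho R^2 of the flow, integrated up to rho of order delta^(-1/2), and the loss
  exp(rho^2 R^2/2) in the posterior exponential moments. Uniformity in T comes from a factor
  exp(-t/2) in each local error, whose sum over the steps stays bounded: for j >= 1 the coefficient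
  of x in L^j x is divisible by rho^2, and that of the posterior average is at most exp(-t/2)/delta.
  The condition on the step size is used as h <= delta^2, which keeps the accumulated multiplicative
  error of order (1+R)^2/delta. Bounds on transport costs are passed on with an arbitrarily small
  excess, since no limit of couplings is taken.\<close>

section \<open>Euclidean norm and inner product on the first d coordinates\<close>

abbreviation nrm :: "nat \<Rightarrow> (nat \<Rightarrow> real) \<Rightarrow> real" where
  "nrm d x \<equiv> L2_set x {..<d}"

lemma dot_self: "dot d x x = (nrm d x)\<^sup>2"
  by (simp add: dot_def L2_set_def sum_nonneg power2_eq_square)

lemma dot_commute: "dot d x y = dot d y x"
  by (simp add: dot_def mult.commute)

lemma dot_diff_right: "dot d x (\<lambda>i. y i - z i) = dot d x y - dot d x z"
  by (simp add: dot_def algebra_simps sum_subtractf)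

lemma dot_diff_left: "dot d (\<lambda>i. x i - y i) z = dot d x z - dot d y z"
  by (simp add: dot_def algebra_simps sum_subtractf)

lemma dot_scale_left: "dot d (\<lambda>i. c * x i) y = c * dot d x y"
  by (simp add: dot_def sum_distrib_left mult.assoc)

lemma dot_scale_right: "dot d x (\<lambda>i. c * y i) = c * dot d x y"
  by (simp add: dot_def sum_distrib_left mult.left_commute)

lemma abs_dot_le: "\<bar>dot d x y\<bar> \<le> nrm d x * nrm d y"
proof -
  have "\<bar>dot d x y\<bar> \<le> (\<Sum>i<d. \<bar>x i\<bar> * \<bar>y i\<bar>)"
    unfolding dot_def by (rule order_trans[OF sum_abs]) (simp add: abs_mult)
  also have "\<dots> \<le> nrm d x * nrm d y" by (rule L2_set_mult_ineq)
  finally show ?thesis .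
qed

text \<open>Pairing with a test vector \<open>c\<close> reduces vector remainders to scalar mean
  value arguments without a factor depending on \<open>d\<close>. Only c = v is used to
  conclude.\<close>

lemma nrm_le_dual:
  assumes "\<And>c. dot d c v \<le> B * nrm d c" and "B \<ge> 0"
  shows "nrm d v \<le> B"
proof (cases "nrm d v = 0")
  case False
  then have "nrm d v > 0" using L2_set_nonneg[of v "{..<d}"] by linarith
  moreover have "nrm d v * nrm d v \<le> B * nrm d v"
    using assms(1)[of v] by (simp add: dot_self power2_eq_square)
  ultimately show ?thesis by simp
qed (use assms in simp)

lemma nrm_scale: "nrm d (\<lambda>i. c * x i) = \<bar>c\<bar> * nrm d x"
  by (simp add: L2_set_def power_mult_distrib flip: sum_distrib_left) (simp add: real_sqrt_mult)

lemma abs_le_nrm: "i < d \<Longrightarrow> \<bar>x i\<bar> \<le> nrm d x"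
  using member_le_L2_set[of "{..<d}" i "\<lambda>i. \<bar>x i\<bar>"] by (simp add: L2_set_def)

lemma nrm_cong: "(\<And>i. i < d \<Longrightarrow> x i = y i) \<Longrightarrow> nrm d x = nrm d y"
  by (rule L2_set_cong) auto

lemma nrm_triangle_diff: "nrm d (\<lambda>i. x i - z i) \<le> nrm d (\<lambda>i. x i - y i) + nrm d (\<lambda>i. y i - z i)"
  using L2_set_triangle_ineq[of "\<lambda>i. x i - y i" "\<lambda>i. y i - z i" "{..<d}"] by simp

lemma nrm_diff_commute: "nrm d (\<lambda>i. x i - y i) = nrm d (\<lambda>i. y i - x i)"
  by (simp add: L2_set_def power2_commute)

section \<open>Differentiation under the integral sign\<close>

text \<open>Dominated convergence for the difference quotients along an arbitrary sequence; the mean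
  value inequality on a ball inside \<open>S\<close> turns the bound on \<open>f'\<close> into the
  same bound \<open>C\<close> on the quotients.\<close>

lemma has_real_derivative_integral:
  fixes f f' :: "real \<Rightarrow> 'a \<Rightarrow> real"
  assumes M: "finite_measure M" and S: "open S" "s0 \<in> S"
    and m: "\<And>s. s \<in> S \<Longrightarrow> f s \<in> borel_measurable M" "f' s0 \<in> borel_measurable M"
    and b: "AE y in M. y \<in> G" "\<And>s y. s \<in> S \<Longrightarrow> y \<in> G \<Longrightarrow> \<bar>f s y\<bar> \<le> C"
      "\<And>s y. s \<in> S \<Longrightarrow> y \<in> G \<Longrightarrow> \<bar>f' s y\<bar> \<le> C"
    and D: "\<And>s y. s \<in> S \<Longrightarrow> y \<in> G \<Longrightarrow> ((\<lambda>s. f s y) has_real_derivative f' s y) (at s)"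
  shows "((\<lambda>s. \<integral>y. f s y \<partial>M) has_real_derivative (\<integral>y. f' s0 y \<partial>M)) (at s0)"
proof -
  interpret finite_measure M by fact
  obtain e where e: "e > 0" "ball s0 e \<subseteq> S" using S openE by blast
  have int: "integrable M (f s)" if "s \<in> S" for s
    by (rule integrable_const_bound[of _ C]) (use b m(1)[OF that] that in auto)
  have "((\<lambda>s. ((\<integral>y. f s y \<partial>M) - (\<integral>y. f s0 y \<partial>M)) / (s - s0)) \<longlongrightarrow> (\<integral>y. f' s0 y \<partial>M)) (at s0)"
    unfolding tendsto_at_iff_sequentially
  proof (intro allI impI)
    fix X :: "nat \<Rightarrow> real" assume X: "\<forall>i. X i \<in> UNIV - {s0}" "X \<longlonglongrightarrow> s0"
    have ev: "\<forall>\<^sub>F n in sequentially. X n \<in> ball s0 e"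
      using X(2) e(1) by (simp add: tendsto_iff dist_commute)
    \<comment> \<open>The sequence is shifted by \<open>n0\<close> so that all its terms lie in the
      ball; \<open>LIMSEQ_offset\<close> removes the shift at the end.\<close>
    then obtain n0 where n0: "\<And>n. n \<ge> n0 \<Longrightarrow> X n \<in> ball s0 e"
      by (auto simp: eventually_sequentially)
    have q: "(\<lambda>n. \<integral>y. (f (X (n + n0)) y - f s0 y) / (X (n + n0) - s0) \<partial>M) \<longlonglongrightarrow> (\<integral>y. f' s0 y \<partial>M)"
    proof (rule integral_dominated_convergence[where w = "\<lambda>_. C"])
      show "AE y in M. (\<lambda>n. (f (X (n + n0)) y - f s0 y) / (X (n + n0) - s0)) \<longlonglongrightarrow> f' s0 y"
        using b(1)
      proof eventually_elim
        case (elim y)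
        have "((\<lambda>s. (f s y - f s0 y) / (s - s0)) \<longlongrightarrow> f' s0 y) (at s0)"
          using D[OF S(2) elim] by (simp add: has_field_derivative_iff)
        then have "(\<lambda>n. (f (X n) y - f s0 y) / (X n - s0)) \<longlonglongrightarrow> f' s0 y"
          using X unfolding tendsto_at_iff_sequentially comp_def by blast
        then show ?case by (rule LIMSEQ_ignore_initial_segment)
      qed
      show "AE y in M. norm ((f (X (n + n0)) y - f s0 y) / (X (n + n0) - s0)) \<le> C" for n
        using b(1)
      proof eventually_elim
        case (elim y)
        have in_b: "X (n + n0) \<in> ball s0 e" using n0 by simp
        have "norm (f (X (n + n0)) y - f s0 y) \<le> C * norm (X (n + n0) - s0)"
        proof (rule field_differentiable_bound[where S = "ball s0 e" and f' = "\<lambda>s. f' s y"])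
          fix z assume "z \<in> ball s0 e"
          then have z: "z \<in> S" using e by auto
          show "((\<lambda>s. f s y) has_field_derivative f' z y) (at z within ball s0 e)"
            by (rule has_field_derivative_at_within[OF D[OF z elim]])
          show "norm (f' z y) \<le> C" using b(3)[OF z elim] by simp
        qed (use in_b e in auto)
        moreover have "X (n + n0) \<noteq> s0" using X by auto
        ultimately show ?case by (simp add: divide_simps)
      qed
      show "f' s0 \<in> borel_measurable M" by fact
      show "(\<lambda>y. (f (X (n + n0)) y - f s0 y) / (X (n + n0) - s0)) \<in> borel_measurable M" for n
        using m(1)[of "X (n + n0)"] m(1)[OF S(2)] n0[of "n + n0"] e by auto
    qed simp
    have eq: "(\<integral>y. (f (X (n + n0)) y - f s0 y) / (X (n + n0) - s0) \<partial>M)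
      = ((\<integral>y. f (X (n + n0)) y \<partial>M) - (\<integral>y. f s0 y \<partial>M)) / (X (n + n0) - s0)" for n
      using int[of "X (n + n0)"] int[OF S(2)] n0[of "n + n0"] e by (subst Bochner_Integration.integral_diff[symmetric]) auto
    have "(\<lambda>n. ((\<integral>y. f (X (n + n0)) y \<partial>M) - (\<integral>y. f s0 y \<partial>M)) / (X (n + n0) - s0)) \<longlonglongrightarrow> (\<integral>y. f' s0 y \<partial>M)"
      using q unfolding eq .
    then have "(\<lambda>n. ((\<integral>y. f (X n) y \<partial>M) - (\<integral>y. f s0 y \<partial>M)) / (X n - s0)) \<longlonglongrightarrow> (\<integral>y. f' s0 y \<partial>M)"
      by (rule LIMSEQ_offset[where k = n0])
    then show "((\<lambda>s. ((\<integral>y. f s y \<partial>M) - (\<integral>y. f s0 y \<partial>M)) / (s - s0)) \<circ> X) \<longlonglongrightarrow> (\<integral>y. f' s0 y \<partial>M)"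
      by (simp add: comp_def)
  qed
  then show ?thesis by (simp add: has_field_derivative_iff)
qed

text \<open>\<open>nice M G S f f'\<close> packages what is needed to differentiate \<open>\<integral>y. f s y \<partial>M\<close> in \<open>s \<in> S\<close> under the
  integral sign, for integrands that are controlled only on a set \<open>G\<close> of full measure.\<close>

definition nice :: "'a measure \<Rightarrow> 'a set \<Rightarrow> real set \<Rightarrow> (real \<Rightarrow> 'a \<Rightarrow> real) \<Rightarrow> (real \<Rightarrow> 'a \<Rightarrow> real) \<Rightarrow> bool" where
  "nice M G S f f' \<longleftrightarrow>
     (\<forall>s\<in>S. f s \<in> borel_measurable M \<and> f' s \<in> borel_measurable M) \<and>
     (\<exists>C. \<forall>s\<in>S. \<forall>y\<in>G. \<bar>f s y\<bar> \<le> C \<and> \<bar>f' s y\<bar> \<le> C) \<and>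
     (\<forall>s\<in>S. \<forall>y\<in>G. ((\<lambda>s. f s y) has_real_derivative f' s y) (at s))"

lemma niceI:
  assumes "\<And>s. s \<in> S \<Longrightarrow> f s \<in> borel_measurable M" "\<And>s. s \<in> S \<Longrightarrow> f' s \<in> borel_measurable M"
    "\<And>s y. s \<in> S \<Longrightarrow> y \<in> G \<Longrightarrow> \<bar>f s y\<bar> \<le> C" "\<And>s y. s \<in> S \<Longrightarrow> y \<in> G \<Longrightarrow> \<bar>f' s y\<bar> \<le> C'"
    "\<And>s y. s \<in> S \<Longrightarrow> y \<in> G \<Longrightarrow> ((\<lambda>s. f s y) has_real_derivative f' s y) (at s)"
  shows "nice M G S f f'"
  unfolding nice_def using assms by (auto intro!: exI[of _ "max C C'"] simp: le_max_iff_disj)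

lemma nice_bounded:
  assumes "nice M G S f f'"
  obtains C where "C \<ge> 0" "\<And>s y. s \<in> S \<Longrightarrow> y \<in> G \<Longrightarrow> \<bar>f s y\<bar> \<le> C" "\<And>s y. s \<in> S \<Longrightarrow> y \<in> G \<Longrightarrow> \<bar>f' s y\<bar> \<le> C"
proof -
  obtain C where "\<forall>s\<in>S. \<forall>y\<in>G. \<bar>f s y\<bar> \<le> C \<and> \<bar>f' s y\<bar> \<le> C" using assms unfolding nice_def by auto
  then have "\<bar>f s y\<bar> \<le> \<bar>C\<bar>" "\<bar>f' s y\<bar> \<le> \<bar>C\<bar>" if "s \<in> S" "y \<in> G" for s y using that by fastforce+
  then show ?thesis using that[of "\<bar>C\<bar>"] by auto
qed

lemma nice_measurable:
  assumes "nice M G S f f'" "s \<in> S" shows "f s \<in> borel_measurable M" "f' s \<in> borel_measurable M"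
  using assms unfolding nice_def by auto

lemma nice_deriv:
  assumes "nice M G S f f'" "s \<in> S" "y \<in> G" shows "((\<lambda>s. f s y) has_real_derivative f' s y) (at s)"
  using assms unfolding nice_def by auto

lemma nice_integral:
  assumes "nice M G S f f'" "finite_measure M" "open S" "s \<in> S" "AE y in M. y \<in> G"
  shows "((\<lambda>s. \<integral>y. f s y \<partial>M) has_real_derivative (\<integral>y. f' s y \<partial>M)) (at s)"
proof -
  obtain C where "\<And>s y. s \<in> S \<Longrightarrow> y \<in> G \<Longrightarrow> \<bar>f s y\<bar> \<le> C" "\<And>s y. s \<in> S \<Longrightarrow> y \<in> G \<Longrightarrow> \<bar>f' s y\<bar> \<le> C"
    by (rule nice_bounded[OF assms(1)]; blast)
  then show ?thesis
    by (intro has_real_derivative_integral[where G = G and C = C and S = S])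
      (use assms nice_measurable[OF assms(1)] nice_deriv[OF assms(1)] in auto)
qed

lemma nice_add:
  assumes "nice M G S f f'" "nice M G S g g'"
  shows "nice M G S (\<lambda>s y. f s y + g s y) (\<lambda>s y. f' s y + g' s y)"
proof -
  obtain C where C: "\<And>s y. s \<in> S \<Longrightarrow> y \<in> G \<Longrightarrow> \<bar>f s y\<bar> \<le> C" "\<And>s y. s \<in> S \<Longrightarrow> y \<in> G \<Longrightarrow> \<bar>f' s y\<bar> \<le> C"
    by (rule nice_bounded[OF assms(1)]; blast)
  obtain D where D: "\<And>s y. s \<in> S \<Longrightarrow> y \<in> G \<Longrightarrow> \<bar>g s y\<bar> \<le> D" "\<And>s y. s \<in> S \<Longrightarrow> y \<in> G \<Longrightarrow> \<bar>g' s y\<bar> \<le> D"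
    by (rule nice_bounded[OF assms(2)]; blast)
  show ?thesis
  proof (rule niceI[where C = "C + D" and C' = "C + D"])
    fix s y assume sy: "s \<in> S" "y \<in> G"
    show "\<bar>f s y + g s y\<bar> \<le> C + D" "\<bar>f' s y + g' s y\<bar> \<le> C + D"
      using C[OF sy] D[OF sy] by auto
    show "((\<lambda>s. f s y + g s y) has_real_derivative f' s y + g' s y) (at s)"
      by (intro DERIV_add nice_deriv[OF assms(1) sy] nice_deriv[OF assms(2) sy])
  qed (use nice_measurable[OF assms(1)] nice_measurable[OF assms(2)] in auto)
qed

lemma nice_mult:
  assumes "nice M G S f f'" "nice M G S g g'"
  shows "nice M G S (\<lambda>s y. f s y * g s y) (\<lambda>s y. f' s y * g s y + g' s y * f s y)"
proof -
  obtain C where C: "C \<ge> 0" "\<And>s y. s \<in> S \<Longrightarrow> y \<in> G \<Longrightarrow> \<bar>f s y\<bar> \<le> C" "\<And>s y. s \<in> S \<Longrightarrow> y \<in> G \<Longrightarrow> \<bar>f' s y\<bar> \<le> C"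
    by (rule nice_bounded[OF assms(1)]; blast)
  obtain D where D: "D \<ge> 0" "\<And>s y. s \<in> S \<Longrightarrow> y \<in> G \<Longrightarrow> \<bar>g s y\<bar> \<le> D" "\<And>s y. s \<in> S \<Longrightarrow> y \<in> G \<Longrightarrow> \<bar>g' s y\<bar> \<le> D"
    by (rule nice_bounded[OF assms(2)]; blast)
  show ?thesis
  proof (rule niceI[where C = "C * D" and C' = "C * D + D * C"])
    fix s y assume sy: "s \<in> S" "y \<in> G"
    show "\<bar>f s y * g s y\<bar> \<le> C * D"
      unfolding abs_mult by (intro mult_mono C D sy) (use C D in auto)
    have "\<bar>f' s y * g s y\<bar> \<le> C * D" "\<bar>g' s y * f s y\<bar> \<le> D * C"
      unfolding abs_mult by (intro mult_mono C D sy; use C D in auto)+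
    then show "\<bar>f' s y * g s y + g' s y * f s y\<bar> \<le> C * D + D * C" by linarith
    show "((\<lambda>s. f s y * g s y) has_real_derivative f' s y * g s y + g' s y * f s y) (at s)"
      by (rule DERIV_mult[OF nice_deriv[OF assms(1) sy] nice_deriv[OF assms(2) sy]])
  qed (use nice_measurable[OF assms(1)] nice_measurable[OF assms(2)] in auto)
qed

lemma nice_param:
  assumes "\<And>s. s \<in> S \<Longrightarrow> (g has_real_derivative g' s) (at s)" "\<And>s. s \<in> S \<Longrightarrow> \<bar>g s\<bar> \<le> C" "\<And>s. s \<in> S \<Longrightarrow> \<bar>g' s\<bar> \<le> C"
  shows "nice M G S (\<lambda>s y. g s) (\<lambda>s y. g' s)"
  by (rule niceI[where C = C and C' = C]) (use assms in auto)

lemma nice_point: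
  assumes "h \<in> borel_measurable M" "\<And>y. y \<in> G \<Longrightarrow> \<bar>h y\<bar> \<le> C"
  shows "nice M G S (\<lambda>s y. h y) (\<lambda>s y. 0)"
  by (rule niceI[where C = C and C' = 0]) (use assms in auto)

lemma nice_sum:
  assumes "\<And>i. i \<in> I \<Longrightarrow> nice M G S (f i) (f' i)"
  shows "nice M G S (\<lambda>s y. \<Sum>i\<in>I. f i s y) (\<lambda>s y. \<Sum>i\<in>I. f' i s y)"
  using assms
proof (induction I rule: infinite_finite_induct)
  case (insert i I)
  then show ?case using nice_add[of M G S "f i" "f' i"] by simp
qed (simp_all add: nice_point[where h = "\<lambda>_. 0" and C = 0])

lemma nice_exp:
  assumes "nice M G S f f'"
  shows "nice M G S (\<lambda>s y. exp (f s y)) (\<lambda>s y. exp (f s y) * f' s y)"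
proof -
  obtain C where C: "C \<ge> 0" "\<And>s y. s \<in> S \<Longrightarrow> y \<in> G \<Longrightarrow> \<bar>f s y\<bar> \<le> C" "\<And>s y. s \<in> S \<Longrightarrow> y \<in> G \<Longrightarrow> \<bar>f' s y\<bar> \<le> C"
    by (rule nice_bounded[OF assms(1)]; blast)
  show ?thesis
  proof (rule niceI[where C = "exp C" and C' = "exp C * C"])
    fix s y assume sy: "s \<in> S" "y \<in> G"
    have "f s y \<le> C" using C(2)[OF sy] by linarith
    then show "\<bar>exp (f s y)\<bar> \<le> exp C" by simp
    show "\<bar>exp (f s y) * f' s y\<bar> \<le> exp C * C"
      unfolding abs_mult by (intro mult_mono C sy) (use \<open>f s y \<le> C\<close> in auto)
    show "((\<lambda>s. exp (f s y)) has_real_derivative exp (f s y) * f' s y) (at s)"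
      by (rule DERIV_fun_exp[OF nice_deriv[OF assms(1) sy]])
  qed (use nice_measurable[OF assms(1)] in auto)
qed

text \<open>The closure rules produce derivatives in the shape of the sum, product and chain rules;
  this replaces them by the intended expressions.\<close>

lemma nice_cong:
  assumes "nice M G S f f'" "\<And>s y. f s y = g s y" "\<And>s y. f' s y = g' s y"
  shows "nice M G S g g'"
proof -
  have "f = g" "f' = g'" using assms(2,3) by (intro ext; simp)+
  then show ?thesis using assms(1) by simp
qed

section \<open>Picard-Lindelof on a compact interval\<close>

text \<open>One Picard step in the sup norm with weight exp(-beta |r - s|): integrating away from
  \<open>s\<close> gains a factor 1/beta. Monotonicity of B/beta exp(beta |q - s|) minus
  plus-or-minus D(q) on either side of \<open>s\<close> replaces the integral.\<close>

lemma abs_le_exp_of_deriv: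
  fixes D D' :: "real \<Rightarrow> real"
  assumes s: "s \<in> {a..b}" and r: "r \<in> {a..b}" and B: "B \<ge> 0" "\<beta> > 0" and D0: "D s = 0"
    and D: "\<And>q. q \<in> {a..b} \<Longrightarrow> (D has_real_derivative D' q) (at q within {a..b})"
    and D': "\<And>q. q \<in> {a..b} \<Longrightarrow> \<bar>D' q\<bar> \<le> B * exp (\<beta> * \<bar>q - s\<bar>)"
  shows "\<bar>D r\<bar> \<le> B / \<beta> * exp (\<beta> * \<bar>r - s\<bar>)"
proof -
  have cont: "continuous_on {a..b} D"
    using D by (intro DERIV_continuous_on[where D = D']) auto
  have two: "(D has_real_derivative D' q) (at q)" if "a < q" "q < b" for q
    using D[of q] that at_within_interior[of q "{a..b}"] by (simp add: less_imp_le)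
  have pos: "\<eta> * D r \<le> B / \<beta> * exp (\<beta> * \<bar>r - s\<bar>)" if \<eta>: "\<bar>\<eta>\<bar> = 1" for \<eta> :: real
  proof (cases "s \<le> r")
    case True
    let ?g = "\<lambda>q. B / \<beta> * exp (\<beta> * (q - s)) - \<eta> * D q"
    have "?g s \<le> ?g r"
    proof (rule DERIV_nonneg_imp_increasing_open[OF True])
      fix q assume q: "s < q" "q < r"
      then have q': "a < q" "q < b" using s r by auto
      have "(?g has_real_derivative B * exp (\<beta> * (q - s)) - \<eta> * D' q) (at q)"
        using B by (auto intro!: derivative_eq_intros two[OF q'])
      moreover have "\<eta> * D' q \<le> B * exp (\<beta> * (q - s))"
        using D'[of q] q q' \<eta> abs_ge_self[of "\<eta> * D' q"] by (simp add: abs_mult)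
      ultimately show "\<exists>y. (?g has_real_derivative y) (at q) \<and> 0 \<le> y" by (intro exI conjI) auto
    next
      show "continuous_on {s..r} ?g"
        by (intro continuous_intros continuous_on_subset[OF cont]) (use s r in auto)
    qed
    moreover have "0 \<le> B / \<beta>" using B by simp
    moreover have "\<bar>r - s\<bar> = r - s" using True by simp
    ultimately show ?thesis using D0 by (simp del: zero_le_divide_iff)
  next
    case False
    then have False': "r \<le> s" by simp
    let ?g = "\<lambda>q. B / \<beta> * exp (\<beta> * (s - q)) - \<eta> * D q"
    have "?g r \<ge> ?g s"
    proof (rule DERIV_nonpos_imp_decreasing_open[OF False'])
      fix q assume q: "r < q" "q < s"
      then have q': "a < q" "q < b" using s r by auto
      have "(?g has_real_derivative - (B * exp (\<beta> * (s - q))) - \<eta> * D' q) (at q)"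
        using B by (auto intro!: derivative_eq_intros two[OF q'])
      moreover have "- (\<eta> * D' q) \<le> B * exp (\<beta> * (s - q))"
        using D'[of q] q q' \<eta> abs_ge_minus_self[of "\<eta> * D' q"] by (simp add: abs_mult)
      ultimately show "\<exists>y. (?g has_real_derivative y) (at q) \<and> y \<le> 0" by (intro exI conjI) auto
    next
      show "continuous_on {r..s} ?g"
        by (intro continuous_intros continuous_on_subset[OF cont]) (use s r in auto)
    qed
    moreover have "0 \<le> B / \<beta>" using B by simp
    moreover have "\<bar>r - s\<bar> = s - r" using False by simp
    ultimately show ?thesis using D0 by (simp del: zero_le_divide_iff)
  qed
  from pos[of 1] pos[of "-1"] show ?thesis by (simp add: abs_le_iff)
qed

text \<open>In the weighted norm the iteration contracts by 1/2 on the whole of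
  \<open>{a..b}\<close>, so no local solutions have to be glued. Only coordinates below
  \<open>d\<close> follow the equation, and the starting time \<open>s\<close> may be any point of
  the interval, so solutions extend in both directions.\<close>

lemma picard_lindelof:
  fixes F :: "real \<Rightarrow> (nat \<Rightarrow> real) \<Rightarrow> nat \<Rightarrow> real" and w0 :: "nat \<Rightarrow> real"
  assumes s: "s \<in> {a..b}" and K: "K \<ge> 0"
    and lip: "\<And>r u v i. r \<in> {a..b} \<Longrightarrow> i < d \<Longrightarrow> \<bar>F r u i - F r v i\<bar> \<le> K * (\<Sum>k<d. \<bar>u k - v k\<bar>)"
    and cont: "\<And>u i. (\<And>k. k < d \<Longrightarrow> continuous_on {a..b} (\<lambda>r. u r k)) \<Longrightarrow> i < d \<Longrightarrow> continuous_on {a..b} (\<lambda>r. F r (u r) i)"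
  shows "\<exists>u. u s = w0 \<and>
    (\<forall>k<d. \<forall>r\<in>{a..b}. ((\<lambda>r. u r k) has_real_derivative F r (u r) k) (at r within {a..b}))"
proof -
  \<comment> \<open>The integral from \<open>s\<close> to \<open>r\<close>, written as a difference
    so that r < s needs no separate case.\<close>
  define I where "I g r = integral {a..r} g - integral {a..s} g" for g :: "real \<Rightarrow> real" and r
  have I_s: "I g s = 0" for g by (simp add: I_def)
  have I_deriv: "(I g has_real_derivative g r) (at r within {a..b})" if "continuous_on {a..b} g" "r \<in> {a..b}" for g r
    unfolding I_def using integral_has_real_derivative[OF that]
    by (auto intro!: derivative_eq_intros)
  define U where "U = rec_nat (\<lambda>r k. w0 k) (\<lambda>n u r k. w0 k + I (\<lambda>q. F q (u q) k) r)"
  have U0: "U 0 r k = w0 k" and US: "U (Suc n) r k = w0 k + I (\<lambda>q. F q (U n q) k) r" for n r k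
    by (simp_all add: U_def)
  have U_s: "U n s k = w0 k" for n k by (cases n) (simp_all add: U0 US I_s)
  have U_cont: "continuous_on {a..b} (\<lambda>r. U n r k)" if "k < d" for n k
    using that
  proof (induction n arbitrary: k)
    case (Suc n)
    have "continuous_on {a..b} (\<lambda>q. F q (U n q) k)" by (rule cont) (use Suc in auto)
    then have "continuous_on {a..b} (I (\<lambda>q. F q (U n q) k))"
      using I_deriv by (intro DERIV_continuous_on) auto
    then show ?case unfolding US by (intro continuous_intros) (simp add: eta_contract_eq)
  qed (simp add: U0)
  have F_cont: "continuous_on {a..b} (\<lambda>q. F q (U n q) k)" if "k < d" for n k
    by (rule cont) (use U_cont that in auto)
  have U_deriv: "((\<lambda>r. U (Suc n) r k) has_real_derivative F r (U n r) k) (at r within {a..b})"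
    if "k < d" "r \<in> {a..b}" for n k r
    unfolding US using I_deriv[OF F_cont[OF that(1)] that(2)] by (auto intro!: derivative_eq_intros)
  \<comment> \<open>A Picard step multiplies the weighted norm by at most K d / beta, which this
    choice makes at most 1/2.\<close>
  define \<beta> where "\<beta> = 2 * K * real d + 1"
  have \<beta>: "\<beta> > 0" using K by (simp add: \<beta>_def add_nonneg_pos)
  obtain M where M: "M \<ge> 0" "\<And>r. r \<in> {a..b} \<Longrightarrow> (\<Sum>k<d. \<bar>U 1 r k - U 0 r k\<bar>) \<le> M"
  proof -
    have "continuous_on {a..b} (\<lambda>r. \<Sum>k<d. \<bar>U 1 r k - U 0 r k\<bar>)"
      by (intro continuous_intros U_cont) auto
    then have "compact ((\<lambda>r. \<Sum>k<d. \<bar>U 1 r k - U 0 r k\<bar>) ` {a..b})"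
      by (rule compact_continuous_image) auto
    from compact_imp_bounded[OF this] obtain M where M: "\<forall>x\<in>(\<lambda>r. \<Sum>k<d. \<bar>U 1 r k - U 0 r k\<bar>) ` {a..b}. norm x \<le> M"
      unfolding bounded_iff by blast
    show ?thesis
    proof (rule that[of "max M 0"])
      fix r assume "r \<in> {a..b}"
      then have "norm (\<Sum>k<d. \<bar>U 1 r k - U 0 r k\<bar>) \<le> M" using M by blast
      then show "(\<Sum>k<d. \<bar>U 1 r k - U 0 r k\<bar>) \<le> max M 0" by simp
    qed simp
  qed
  have diff: "(\<Sum>k<d. \<bar>U (Suc n) r k - U n r k\<bar>) \<le> M * (1/2)^n * exp (\<beta> * \<bar>r - s\<bar>)" if "r \<in> {a..b}" for n r
    using that
  proof (induction n arbitrary: r)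
    case 0
    have "M * 1 \<le> M * exp (\<beta> * \<bar>r - s\<bar>)" using M(1) \<beta> by (intro mult_left_mono) auto
    then show ?case using M(2)[OF 0] by simp
  next
    case (Suc n)
    let ?B = "K * (M * (1/2)^n)"
    have one: "\<bar>U (Suc (Suc n)) r k - U (Suc n) r k\<bar> \<le> ?B / \<beta> * exp (\<beta> * \<bar>r - s\<bar>)" if k: "k < d" for k
    proof (rule abs_le_exp_of_deriv[OF s Suc.prems])
      show "((\<lambda>r. U (Suc (Suc n)) r k - U (Suc n) r k) has_real_derivative F q (U (Suc n) q) k - F q (U n q) k)
        (at q within {a..b})" if "q \<in> {a..b}" for q
        by (intro DERIV_diff U_deriv k that)
      show "\<bar>F q (U (Suc n) q) k - F q (U n q) k\<bar> \<le> ?B * exp (\<beta> * \<bar>q - s\<bar>)" if q: "q \<in> {a..b}" for q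
        using order_trans[OF lip[OF q k] mult_left_mono[OF Suc.IH[OF q] K]] by (simp add: mult_ac)
    qed (use K M \<beta> U_s in auto)
    have "(\<Sum>k<d. \<bar>U (Suc (Suc n)) r k - U (Suc n) r k\<bar>) \<le> (\<Sum>k<d. ?B / \<beta> * exp (\<beta> * \<bar>r - s\<bar>))"
      by (intro sum_mono one) auto
    also have "\<dots> = (2 * K * real d / \<beta>) * (M * (1/2)^Suc n * exp (\<beta> * \<bar>r - s\<bar>))" by simp
    also have "\<dots> \<le> 1 * (M * (1/2)^Suc n * exp (\<beta> * \<bar>r - s\<bar>))"
      using \<beta> M(1) by (intro mult_right_mono) (auto simp: \<beta>_def)
    finally show ?case by simp
  qed
  define E where "E = M * exp (\<beta> * (b - a))"
  have E: "\<bar>U (Suc n) r k - U n r k\<bar> \<le> E * (1/2)^n" if r: "r \<in> {a..b}" and k: "k < d" for n r k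
  proof -
    have "\<bar>U (Suc n) r k - U n r k\<bar> \<le> (\<Sum>k<d. \<bar>U (Suc n) r k - U n r k\<bar>)"
      by (rule member_le_sum) (use k in auto)
    also have "\<dots> \<le> M * (1/2)^n * exp (\<beta> * \<bar>r - s\<bar>)" by (rule diff[OF r])
    also have "\<dots> \<le> M * (1/2)^n * exp (\<beta> * (b - a))"
      using M(1) \<beta> r s by (intro mult_left_mono) auto
    finally show ?thesis by (simp add: E_def mult_ac)
  qed
  have unif: "uniform_limit {a..b} (\<lambda>n r. U n r k) (\<lambda>r. w0 k + (\<Sum>n. U (Suc n) r k - U n r k)) sequentially"
    if k: "k < d" for k
  proof -
    have "uniform_limit {a..b} (\<lambda>n r. \<Sum>i<n. U (Suc i) r k - U i r k) (\<lambda>r. \<Sum>i. U (Suc i) r k - U i r k) sequentially"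
      by (rule Weierstrass_m_test[where M = "\<lambda>n. E * (1/2)^n"])
        (use E k in \<open>auto intro!: summable_mult summable_geometric\<close>)
    then have "uniform_limit {a..b} (\<lambda>n r. w0 k + (\<Sum>i<n. U (Suc i) r k - U i r k)) (\<lambda>r. w0 k + (\<Sum>i. U (Suc i) r k - U i r k)) sequentially"
      by (intro uniform_limit_intros)
    moreover have "(\<Sum>i<n. U (Suc i) r k - U i r k) = U n r k - w0 k" for n r
      by (subst sum_lessThan_telescope) (simp add: U0)
    ultimately show ?thesis by simp
  qed
  define u where "u r k = w0 k + (\<Sum>n. U (Suc n) r k - U n r k)" for r k
  have unif: "uniform_limit {a..b} (\<lambda>n r. U n r k) (\<lambda>r. u r k) sequentially" if "k < d" for k
    using unif[OF that] by (simp add: u_def)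
  have u_cont: "continuous_on {a..b} (\<lambda>r. u r k)" if "k < d" for k
    by (rule uniform_limit_theorem[OF _ unif[OF that]]) (use U_cont that in auto)
  have Fu_cont: "continuous_on {a..b} (\<lambda>q. F q (u q) k)" if "k < d" for k
    by (rule cont) (use u_cont that in auto)
  have pt: "(\<lambda>n. U n r k) \<longlonglongrightarrow> u r k" if "k < d" "r \<in> {a..b}" for r k
    by (rule tendsto_uniform_limitI[OF unif]) (use that in auto)
  have Funif: "uniform_limit {a..b} (\<lambda>n r. F r (U n r) i) (\<lambda>r. F r (u r) i) sequentially" if i: "i < d" for i
  proof -
    show ?thesis
      unfolding uniform_limit_iff
    proof (intro allI impI)
      fix e :: real assume e: "e > 0"
      define e' where "e' = e / (K * real d + 1)"
      have pos: "K * real d + 1 > 0" using K by (simp add: add_nonneg_pos)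
      have e': "e' > 0" using e pos by (simp add: e'_def)
      have "\<forall>\<^sub>F n in sequentially. \<forall>k\<in>{..<d}. \<forall>r\<in>{a..b}. dist (U n r k) (u r k) < e'"
        using unif e' unfolding uniform_limit_iff by (intro eventually_ball_finite) auto
      then show "\<forall>\<^sub>F n in sequentially. \<forall>r\<in>{a..b}. dist (F r (U n r) i) (F r (u r) i) < e"
      proof eventually_elim
        case (elim n)
        show ?case
        proof
          fix r assume r: "r \<in> {a..b}"
          have "dist (F r (U n r) i) (F r (u r) i) \<le> K * (\<Sum>k<d. \<bar>U n r k - u r k\<bar>)"
            using lip[OF r i] by (simp add: dist_real_def)
          also have "\<dots> \<le> K * (\<Sum>k<d. e')"
            using elim r K by (intro mult_left_mono sum_mono) (auto simp: dist_real_def intro: less_imp_le)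
          also have "\<dots> < (K * real d + 1) * e'" using e' by (simp add: algebra_simps)
          also have "\<dots> = e" using pos by (simp add: e'_def)
          finally show "dist (F r (U n r) i) (F r (u r) i) < e" .
        qed
      qed
    qed
  qed
  have Ilim: "(\<lambda>n. integral {a..r} (\<lambda>q. F q (U n q) i)) \<longlonglongrightarrow> integral {a..r} (\<lambda>q. F q (u q) i)"
    if i: "i < d" and r: "r \<in> {a..b}" for i r
  proof -
    have u: "uniform_limit {a..r} (\<lambda>n q. F q (U n q) i) (\<lambda>q. F q (u q) i) sequentially"
      by (rule uniform_limit_on_subset[OF Funif[OF i]]) (use r in auto)
    have c: "continuous_on {a..r} (\<lambda>q. F q (U n q) i)" for n
      by (rule continuous_on_subset[OF F_cont[OF i]]) (use r in auto)
    obtain A B where AB: "\<And>n. ((\<lambda>q. F q (U n q) i) has_integral A n) {a..r}"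
        "((\<lambda>q. F q (u q) i) has_integral B) {a..r}" "A \<longlonglongrightarrow> B"
      by (rule uniform_limit_integral[OF u c]) auto
    have "A = (\<lambda>n. integral {a..r} (\<lambda>q. F q (U n q) i))" using AB(1) by (intro ext integral_unique[symmetric])
    then show ?thesis using AB(2,3) by (simp add: integral_unique)
  qed
  \<comment> \<open>Both sides are limits of the same Picard sequence, the right one because the
    integrands converge uniformly.\<close>
  have fix_eq: "u r i = w0 i + I (\<lambda>q. F q (u q) i) r" if i: "i < d" and r: "r \<in> {a..b}" for i r
  proof (rule LIMSEQ_unique)
    show "(\<lambda>n. U (Suc n) r i) \<longlonglongrightarrow> u r i" by (rule LIMSEQ_Suc[OF pt[OF i r]])
    show "(\<lambda>n. U (Suc n) r i) \<longlonglongrightarrow> w0 i + I (\<lambda>q. F q (u q) i) r"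
      unfolding US I_def by (intro tendsto_intros Ilim i r s)
  qed
  show ?thesis
  proof (intro exI[of _ u] conjI allI impI ballI)
    show "u s = w0" by (simp add: u_def U_s fun_eq_iff)
    fix k r assume k: "k < d" and r: "r \<in> {a..b}"
    have "((\<lambda>r. w0 k + I (\<lambda>q. F q (u q) k) r) has_real_derivative F r (u r) k) (at r within {a..b})"
      using I_deriv[OF Fu_cont[OF k] r] by (auto intro!: derivative_eq_intros)
    then show "((\<lambda>r. u r k) has_real_derivative F r (u r) k) (at r within {a..b})"
      by (rule has_field_derivative_transform_within[where d = 1]) (use fix_eq k r in auto)
  qed
qed

section \<open>Posterior averages over replicas\<close>

text \<open>The density at \<open>w\<close> of N(rho y, I) with respect to N(0, I), that is, the
  likelihood of Y = y when rho Y + G = w is observed.\<close>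

definition Efac :: "nat \<Rightarrow> real \<Rightarrow> (nat \<Rightarrow> real) \<Rightarrow> (nat \<Rightarrow> real) \<Rightarrow> real" where
  "Efac d \<rho> w y = exp (\<rho> * dot d w y - \<rho>\<^sup>2 / 2 * dot d y y)"

lemma Efac_pos: "Efac d \<rho> w y > 0"
  by (simp add: Efac_def)

locale bounded_prior = prob_space P for P :: "(nat \<Rightarrow> real) measure" +
  fixes d :: nat and R :: real
  assumes sets_P: "sets P = sets (Rd d)" and R_nonneg: "0 \<le> R" and AE_R: "AE y in P. nrm d y \<le> R"
begin

abbreviation PN :: "nat \<Rightarrow> (nat \<Rightarrow> nat \<Rightarrow> real) measure" where
  "PN n \<equiv> PiM {..<n} (\<lambda>_. P)"

text \<open>A set of full measure (\<open>AE_gs\<close>) on which all pointwise estimates are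
  made.\<close>

definition gs :: "nat \<Rightarrow> (nat \<Rightarrow> nat \<Rightarrow> real) set" where
  "gs n = {Y. \<forall>a<n. nrm d (Y a) \<le> R}"

definition Zf :: "real \<Rightarrow> (nat \<Rightarrow> real) \<Rightarrow> real" where
  "Zf \<rho> w = (\<integral>y. Efac d \<rho> w y \<partial>P)"

text \<open>The posterior expectation of g(Y) given rho Y + G = w.\<close>

definition pm :: "((nat \<Rightarrow> real) \<Rightarrow> real) \<Rightarrow> real \<Rightarrow> (nat \<Rightarrow> real) \<Rightarrow> real" where
  "pm g \<rho> w = (\<integral>y. g y * Efac d \<rho> w y \<partial>P) / Zf \<rho> w"

definition Wt :: "nat \<Rightarrow> real \<Rightarrow> (nat \<Rightarrow> real) \<Rightarrow> (nat \<Rightarrow> nat \<Rightarrow> real) \<Rightarrow> real" where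
  "Wt n \<rho> w Y = (\<Prod>a<n. Efac d \<rho> w (Y a))"

definition Nm :: "nat \<Rightarrow> ((nat \<Rightarrow> nat \<Rightarrow> real) \<Rightarrow> real) \<Rightarrow> real \<Rightarrow> (nat \<Rightarrow> real) \<Rightarrow> real" where
  "Nm n f \<rho> w = (\<integral>Y. f Y * Wt n \<rho> w Y \<partial>PN n)"

text \<open>The expectation of \<open>f\<close> over \<open>n\<close> replicas of Y that are
  independent given rho Y + G = w: the weight and the normaliser both factorise over the
  replicas.\<close>

definition Av :: "nat \<Rightarrow> ((nat \<Rightarrow> nat \<Rightarrow> real) \<Rightarrow> real) \<Rightarrow> real \<Rightarrow> (nat \<Rightarrow> real) \<Rightarrow> real" where
  "Av n f \<rho> w = Nm n f \<rho> w / Zf \<rho> w ^ n"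

lemma prob_space_PN: "prob_space (PN n)"
  by (rule prob_space_PiM) (rule prob_space_axioms)

lemma AE_gs: "AE Y in PN n. Y \<in> gs n"
proof -
  have "AE Y in PN n. \<forall>a\<in>{..<n}. nrm d (Y a) \<le> R"
    by (intro AE_finite_allI ballI AE_PiM_component[where P = "\<lambda>y. nrm d y \<le> R"])
      (use AE_R prob_space_axioms in auto)
  then show ?thesis by (simp add: gs_def lessThan_def)
qed

lemma measurable_P_component [measurable]: "l < d \<Longrightarrow> (\<lambda>y. y l) \<in> borel_measurable P"
  using measurable_Rd_component[of l d] by (simp add: measurable_cong_sets[OF sets_P refl])

lemma measurable_PN_component: "a < n \<Longrightarrow> l < d \<Longrightarrow> (\<lambda>Y. Y a l) \<in> borel_measurable (PN n)"
  by (rule measurable_compose[OF measurable_component_singleton[of a "{..<n}"] measurable_P_component]) auto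

lemma measurable_dot_P [measurable]: "dot d w \<in> borel_measurable P"
  unfolding dot_def by (intro borel_measurable_sum borel_measurable_times measurable_P_component) auto

lemma measurable_dot_self_P [measurable]: "(\<lambda>y. dot d y y) \<in> borel_measurable P"
  unfolding dot_def by (intro borel_measurable_sum borel_measurable_times measurable_P_component) auto

lemma measurable_Efac [measurable]: "Efac d \<rho> w \<in> borel_measurable P"
proof -
  have "(\<lambda>y. exp (\<rho> * dot d w y - \<rho>\<^sup>2 / 2 * dot d y y)) \<in> borel_measurable P" by measurable
  then show ?thesis by (simp add: Efac_def[abs_def])
qed

text \<open>The last clause, dependence on the first \<open>n\<close> replicas only, allows the same
  function to be averaged over more replicas (\<open>bd_mono\<close>,
  \<open>Av_extend\<close>).\<close>

definition bd :: "nat \<Rightarrow> ((nat \<Rightarrow> nat \<Rightarrow> real) \<Rightarrow> real) \<Rightarrow> bool" where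
  "bd n f \<longleftrightarrow> f \<in> borel_measurable (PN n) \<and> (\<exists>C. \<forall>Y\<in>gs n. \<bar>f Y\<bar> \<le> C) \<and> (\<forall>Y Y'. (\<forall>a<n. Y a = Y' a) \<longrightarrow> f Y = f Y')"

lemma bdI:
  "f \<in> borel_measurable (PN n) \<Longrightarrow> (\<And>Y. Y \<in> gs n \<Longrightarrow> \<bar>f Y\<bar> \<le> C) \<Longrightarrow> (\<And>Y Y'. (\<And>a. a < n \<Longrightarrow> Y a = Y' a) \<Longrightarrow> f Y = f Y') \<Longrightarrow> bd n f"
  unfolding bd_def by blast

lemma bdE:
  assumes "bd n f"
  obtains C where "C \<ge> 0" "\<And>Y. Y \<in> gs n \<Longrightarrow> \<bar>f Y\<bar> \<le> C"
proof -
  obtain C where "\<forall>Y\<in>gs n. \<bar>f Y\<bar> \<le> C" using assms unfolding bd_def by blast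
  then show ?thesis by (intro that[of "max C 0"]) (auto simp: le_max_iff_disj)
qed

lemma bd_measurable: "bd n f \<Longrightarrow> f \<in> borel_measurable (PN n)"
  unfolding bd_def by blast

lemma bd_dep: "bd n f \<Longrightarrow> (\<And>a. a < n \<Longrightarrow> Y a = Y' a) \<Longrightarrow> f Y = f Y'"
  unfolding bd_def by blast

lemma bd_const: "bd n (\<lambda>_. c)"
  by (rule bdI[of _ _ "\<bar>c\<bar>"]) auto

lemma bd_add: assumes "bd n f" "bd n g" shows "bd n (\<lambda>Y. f Y + g Y)"
proof -
  obtain C where C: "\<And>Y. Y \<in> gs n \<Longrightarrow> \<bar>f Y\<bar> \<le> C" by (rule bdE[OF assms(1)]; blast)
  obtain D where D: "\<And>Y. Y \<in> gs n \<Longrightarrow> \<bar>g Y\<bar> \<le> D" by (rule bdE[OF assms(2)]; blast)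
  show ?thesis
  proof (rule bdI[of _ _ "C + D"])
    show "\<bar>f Y + g Y\<bar> \<le> C + D" if "Y \<in> gs n" for Y using C[OF that] D[OF that] by linarith
    show "f Y + g Y = f Y' + g Y'" if "\<And>a. a < n \<Longrightarrow> Y a = Y' a" for Y Y'
      using bd_dep[OF assms(1), of Y Y'] bd_dep[OF assms(2), of Y Y'] that by simp
  qed (use assms bd_measurable in auto)
qed

lemma bd_mult: assumes "bd n f" "bd n g" shows "bd n (\<lambda>Y. f Y * g Y)"
proof -
  obtain C where C: "C \<ge> 0" "\<And>Y. Y \<in> gs n \<Longrightarrow> \<bar>f Y\<bar> \<le> C" by (rule bdE[OF assms(1)]; blast)
  obtain D where D: "D \<ge> 0" "\<And>Y. Y \<in> gs n \<Longrightarrow> \<bar>g Y\<bar> \<le> D" by (rule bdE[OF assms(2)]; blast)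
  show ?thesis
  proof (rule bdI[of _ _ "C * D"])
    show "\<bar>f Y * g Y\<bar> \<le> C * D" if "Y \<in> gs n" for Y
      unfolding abs_mult by (intro mult_mono C D that) auto
    show "f Y * g Y = f Y' * g Y'" if "\<And>a. a < n \<Longrightarrow> Y a = Y' a" for Y Y'
      using bd_dep[OF assms(1), of Y Y'] bd_dep[OF assms(2), of Y Y'] that by simp
  qed (use assms bd_measurable in auto)
qed

lemma bd_cmult: "bd n f \<Longrightarrow> bd n (\<lambda>Y. c * f Y)"
  by (intro bd_mult bd_const)

lemma bd_diff: "bd n f \<Longrightarrow> bd n g \<Longrightarrow> bd n (\<lambda>Y. f Y - g Y)"
  using bd_add[OF _ bd_cmult, of n f g "-1"] by simp

lemma bd_abs: assumes "bd n f" shows "bd n (\<lambda>Y. \<bar>f Y\<bar>)"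
proof -
  obtain C where C: "C \<ge> 0" "\<And>Y. Y \<in> gs n \<Longrightarrow> \<bar>f Y\<bar> \<le> C" by (rule bdE[OF assms(1)]; blast)
  show ?thesis
  proof (rule bdI[of _ _ C])
    show "\<bar>f Y\<bar> = \<bar>f Y'\<bar>" if "\<And>a. a < n \<Longrightarrow> Y a = Y' a" for Y Y'
      using bd_dep[OF assms(1), of Y Y'] that by simp
  qed (use assms bd_measurable C in auto)
qed

lemma bd_sum: "(\<And>i. i \<in> I \<Longrightarrow> bd n (f i)) \<Longrightarrow> bd n (\<lambda>Y. \<Sum>i\<in>I. f i Y)"
  by (induction I rule: infinite_finite_induct) (auto intro: bd_add bd_const)

lemma bd_component: assumes "a < n" "l < d" shows "bd n (\<lambda>Y. Y a l)"
proof (rule bdI[of _ _ R])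
  fix Y assume "Y \<in> gs n"
  then show "\<bar>Y a l\<bar> \<le> R" using abs_le_nrm[OF assms(2), of "Y a"] assms(1) by (force simp: gs_def)
qed (use assms measurable_PN_component in auto)

lemma bd_dot_left: "a < n \<Longrightarrow> bd n (\<lambda>Y. dot d w (Y a))"
  unfolding dot_def by (intro bd_sum bd_cmult bd_component) auto

lemma bd_dot: "a < n \<Longrightarrow> b < n \<Longrightarrow> bd n (\<lambda>Y. dot d (Y a) (Y b))"
  unfolding dot_def by (intro bd_sum bd_mult bd_component) auto

lemma bd_exp: assumes "bd n f" shows "bd n (\<lambda>Y. exp (f Y))"
proof -
  obtain C where C: "C \<ge> 0" "\<And>Y. Y \<in> gs n \<Longrightarrow> \<bar>f Y\<bar> \<le> C" by (rule bdE[OF assms(1)]; blast)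
  show ?thesis
  proof (rule bdI[of _ _ "exp C"])
    show "\<bar>exp (f Y)\<bar> \<le> exp C" if "Y \<in> gs n" for Y using C(2)[OF that] by simp
    show "exp (f Y) = exp (f Y')" if "\<And>a. a < n \<Longrightarrow> Y a = Y' a" for Y Y'
      using bd_dep[OF assms(1), of Y Y'] that by simp
  qed (use assms bd_measurable in auto)
qed

lemma bd_mono: assumes "bd n f" "n \<le> m" shows "bd m f"
proof -
  obtain C where C: "C \<ge> 0" "\<And>Y. Y \<in> gs n \<Longrightarrow> \<bar>f Y\<bar> \<le> C" by (rule bdE[OF assms(1)]; blast)
  show ?thesis
  proof (rule bdI[of _ _ C])
    \<comment> \<open>Restriction maps \<open>PN m\<close> measurably to \<open>PN n\<close>, and it
      does not change the value of \<open>f\<close> because \<open>f\<close> only sees the first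
      \<open>n\<close> replicas.\<close>
    have "(\<lambda>Y. f (restrict Y {..<n})) \<in> borel_measurable (PN m)"
      by (rule measurable_compose[OF measurable_restrict_subset bd_measurable[OF assms(1)]]) (use assms in auto)
    moreover have "f (restrict Y {..<n}) = f Y" for Y
      by (rule bd_dep[OF assms(1)]) auto
    ultimately show "f \<in> borel_measurable (PN m)" by simp
    show "\<bar>f Y\<bar> \<le> C" if "Y \<in> gs m" for Y
      by (rule C(2)) (use that assms(2) in \<open>auto simp: gs_def\<close>)
    show "f Y = f Y'" if "\<And>a. a < m \<Longrightarrow> Y a = Y' a" for Y Y'
      by (rule bd_dep[OF assms(1)]) (use that assms(2) in auto)
  qed
qed

lemma Wt_exp: "Wt n \<rho> w Y = exp (\<Sum>a<n. \<rho> * dot d w (Y a) - \<rho>\<^sup>2 / 2 * dot d (Y a) (Y a))"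
  by (simp add: Wt_def Efac_def exp_sum)

lemma Wt_pos: "Wt n \<rho> w Y > 0"
  by (simp add: Wt_exp)

lemma bd_Wt: "bd n (Wt n \<rho> w)"
proof -
  have "bd n (\<lambda>Y. exp (\<Sum>a<n. \<rho> * dot d w (Y a) - \<rho>\<^sup>2 / 2 * dot d (Y a) (Y a)))"
    by (intro bd_exp bd_sum bd_diff bd_cmult bd_dot bd_dot_left) auto
  then show ?thesis by (simp add: Wt_exp[abs_def])
qed

lemma bd_integrable: assumes "bd n f" shows "integrable (PN n) f"
proof -
  interpret N: prob_space "PN n" by (rule prob_space_PN)
  obtain C where C: "C \<ge> 0" "\<And>Y. Y \<in> gs n \<Longrightarrow> \<bar>f Y\<bar> \<le> C" by (rule bdE[OF assms(1)]; blast)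
  show ?thesis
    by (rule N.integrable_const_bound[of _ C]) (use AE_gs[of n] bd_measurable[OF assms] C in auto)
qed

lemma integrable_P_bounded:
  fixes g :: "(nat \<Rightarrow> real) \<Rightarrow> real"
  assumes "g \<in> borel_measurable P" "\<And>y. nrm d y \<le> R \<Longrightarrow> \<bar>g y\<bar> \<le> C"
  shows "integrable P g"
  by (rule integrable_const_bound[of _ C]) (use AE_R assms in auto)

lemma abs_dot_le_R: "nrm d y \<le> R \<Longrightarrow> \<bar>dot d w y\<bar> \<le> nrm d w * R"
  using abs_dot_le[of d w y] mult_left_mono[of "nrm d y" R "nrm d w"] by (simp add: order_trans)

lemma dot_self_le: "nrm d y \<le> R \<Longrightarrow> dot d y y \<le> R\<^sup>2"
  unfolding dot_self by (rule power_mono) auto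

lemma Efac_bounds:
  assumes "nrm d y \<le> R"
  shows "Efac d \<rho> w y \<le> exp (\<bar>\<rho>\<bar> * (nrm d w * R))"
    and "exp (- (\<bar>\<rho>\<bar> * (nrm d w * R)) - \<rho>\<^sup>2 / 2 * R\<^sup>2) \<le> Efac d \<rho> w y"
proof -
  have 1: "\<bar>\<rho> * dot d w y\<bar> \<le> \<bar>\<rho>\<bar> * (nrm d w * R)"
    unfolding abs_mult by (intro mult_left_mono abs_dot_le_R assms) auto
  have 2: "\<rho>\<^sup>2 / 2 * dot d y y \<le> \<rho>\<^sup>2 / 2 * R\<^sup>2" by (intro mult_left_mono dot_self_le assms) auto
  have 3: "\<rho>\<^sup>2 / 2 * dot d y y \<ge> 0" by (simp add: dot_self)
  show "Efac d \<rho> w y \<le> exp (\<bar>\<rho>\<bar> * (nrm d w * R))"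
    using 1 3 unfolding Efac_def by simp
  show "exp (- (\<bar>\<rho>\<bar> * (nrm d w * R)) - \<rho>\<^sup>2 / 2 * R\<^sup>2) \<le> Efac d \<rho> w y"
    using 1 2 unfolding Efac_def by (simp only: exp_le_cancel_iff)
qed

lemma integrable_Efac:
  fixes g :: "(nat \<Rightarrow> real) \<Rightarrow> real"
  assumes "g \<in> borel_measurable P" "\<And>y. nrm d y \<le> R \<Longrightarrow> \<bar>g y\<bar> \<le> C"
  shows "integrable P (\<lambda>y. g y * Efac d \<rho> w y)"
proof (rule integrable_P_bounded)
  fix y assume y: "nrm d y \<le> R"
  have "C \<ge> 0" using assms(2)[OF y] by linarith
  then show "\<bar>g y * Efac d \<rho> w y\<bar> \<le> C * exp (\<bar>\<rho>\<bar> * (nrm d w * R))"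
    unfolding abs_mult using assms(2)[OF y] Efac_bounds(1)[OF y, of \<rho> w] Efac_pos[of d \<rho> w y]
    by (intro mult_mono) auto
qed (use assms in measurable)

lemma Zf_pos: "Zf \<rho> w > 0"
proof -
  let ?c = "exp (- (\<bar>\<rho>\<bar> * (nrm d w * R)) - \<rho>\<^sup>2 / 2 * R\<^sup>2)"
  have "(\<integral>y. ?c \<partial>P) \<le> Zf \<rho> w"
    unfolding Zf_def
    by (rule integral_mono_AE) (use AE_R Efac_bounds(2) integrable_Efac[of "\<lambda>_. 1" 1] in auto)
  then have "?c \<le> Zf \<rho> w" by (simp only: lebesgue_integral_const prob_space) simp
  then show ?thesis by (rule less_le_trans[OF exp_gt_zero])
qed

lemma Av_add: "bd n f \<Longrightarrow> bd n g \<Longrightarrow> Av n (\<lambda>Y. f Y + g Y) \<rho> w = Av n f \<rho> w + Av n g \<rho> w"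
  unfolding Av_def Nm_def
  by (simp add: distrib_right Bochner_Integration.integral_add bd_integrable bd_mult bd_Wt add_divide_distrib)

lemma Av_cmult: "Av n (\<lambda>Y. c * f Y) \<rho> w = c * Av n f \<rho> w"
  unfolding Av_def Nm_def by (simp add: mult.assoc)

lemma Av_diff: "bd n f \<Longrightarrow> bd n g \<Longrightarrow> Av n (\<lambda>Y. f Y - g Y) \<rho> w = Av n f \<rho> w - Av n g \<rho> w"
  using Av_add[OF _ bd_cmult, of n f g "-1"] Av_cmult[of n "-1" g] by simp

lemma Av_sum: "finite I \<Longrightarrow> (\<And>i. i \<in> I \<Longrightarrow> bd n (f i)) \<Longrightarrow> Av n (\<lambda>Y. \<Sum>i\<in>I. f i Y) \<rho> w = (\<Sum>i\<in>I. Av n (f i) \<rho> w)"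
proof (induction I rule: finite_induct)
  case empty
  then show ?case using Av_cmult[of n 0 "\<lambda>_. 0"] by simp
next
  case (insert i I)
  then show ?case by (simp add: Av_add bd_sum)
qed

lemma Av_mono:
  assumes "bd n f" "bd n g" "\<And>Y. Y \<in> gs n \<Longrightarrow> f Y \<le> g Y"
  shows "Av n f \<rho> w \<le> Av n g \<rho> w"
proof -
  have "Nm n f \<rho> w \<le> Nm n g \<rho> w"
    unfolding Nm_def
  proof (rule integral_mono_AE)
    show "AE Y in PN n. f Y * Wt n \<rho> w Y \<le> g Y * Wt n \<rho> w Y"
      using AE_gs[of n] by eventually_elim (intro mult_right_mono assms less_imp_le[OF Wt_pos])
  qed (intro bd_integrable bd_mult bd_Wt assms)+
  then show ?thesis unfolding Av_def by (intro divide_right_mono zero_le_power less_imp_le[OF Zf_pos])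
qed

lemma Av_abs_le:
  assumes "bd n f" shows "\<bar>Av n f \<rho> w\<bar> \<le> Av n (\<lambda>Y. \<bar>f Y\<bar>) \<rho> w"
proof -
  have "Av n f \<rho> w \<le> Av n (\<lambda>Y. \<bar>f Y\<bar>) \<rho> w" by (intro Av_mono assms bd_abs) auto
  moreover have "Av n (\<lambda>Y. (-1) * f Y) \<rho> w \<le> Av n (\<lambda>Y. \<bar>f Y\<bar>) \<rho> w"
    by (intro Av_mono assms bd_abs bd_cmult) auto
  ultimately show ?thesis unfolding Av_cmult by linarith
qed

text \<open>Fubini in the last replica: the weight factorises and \<open>f\<close> does not see
  replica \<open>n\<close>, so a function of that replica alone splits off.\<close>

lemma Nm_Suc:
  assumes f: "bd n f" and g: "g \<in> borel_measurable P" "\<And>y. nrm d y \<le> R \<Longrightarrow> \<bar>g y\<bar> \<le> C"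
  shows "Nm (Suc n) (\<lambda>Y. f Y * g (Y n)) \<rho> w = Nm n f \<rho> w * (\<integral>y. g y * Efac d \<rho> w y \<partial>P)"
    and "bd (Suc n) (\<lambda>Y. f Y * g (Y n))"
proof -
  interpret PP: product_sigma_finite "\<lambda>_::nat. P" by standard
  have gm: "bd (Suc n) (\<lambda>Y. g (Y n))"
  proof (rule bdI[of _ _ C])
    show "(\<lambda>Y. g (Y n)) \<in> borel_measurable (PN (Suc n))"
      by (rule measurable_compose[OF measurable_component_singleton[of n "{..<Suc n}"] g(1)]) auto
  qed (use g(2) in \<open>auto simp: gs_def\<close>)
  show bd: "bd (Suc n) (\<lambda>Y. f Y * g (Y n))"
    by (intro bd_mult gm bd_mono[OF f]) auto
  have "integrable (PN (Suc n)) (\<lambda>Y. f Y * g (Y n) * Wt (Suc n) \<rho> w Y)"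
    by (intro bd_integrable bd_mult[OF bd] bd_Wt)
  then have int: "integrable (PiM (insert n {..<n}) (\<lambda>_. P)) (\<lambda>Y. f Y * g (Y n) * Wt (Suc n) \<rho> w Y)"
    by (simp add: lessThan_Suc)
  have "Nm (Suc n) (\<lambda>Y. f Y * g (Y n)) \<rho> w
    = (\<integral>x. (\<integral>y. f (x(n:=y)) * g ((x(n:=y)) n) * Wt (Suc n) \<rho> w (x(n:=y)) \<partial>P) \<partial>PN n)"
    unfolding Nm_def lessThan_Suc by (rule PP.product_integral_insert[OF _ _ int]) auto
  also have "\<dots> = (\<integral>x. f x * Wt n \<rho> w x * (\<integral>y. g y * Efac d \<rho> w y \<partial>P) \<partial>PN n)"
  proof (rule Bochner_Integration.integral_cong[OF refl])
    fix x
    have "f (x(n:=y)) = f x" for y by (rule bd_dep[OF f]) auto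
    moreover have "Wt (Suc n) \<rho> w (x(n:=y)) = Wt n \<rho> w x * Efac d \<rho> w y" for y
      by (simp add: Wt_def)
    ultimately have "(\<integral>y. f (x(n:=y)) * g ((x(n:=y)) n) * Wt (Suc n) \<rho> w (x(n:=y)) \<partial>P)
      = (\<integral>y. (f x * Wt n \<rho> w x) * (g y * Efac d \<rho> w y) \<partial>P)"
      by (intro Bochner_Integration.integral_cong) auto
    then show "(\<integral>y. f (x(n:=y)) * g ((x(n:=y)) n) * Wt (Suc n) \<rho> w (x(n:=y)) \<partial>P)
      = f x * Wt n \<rho> w x * (\<integral>y. g y * Efac d \<rho> w y \<partial>P)" by simp
  qed
  finally show "Nm (Suc n) (\<lambda>Y. f Y * g (Y n)) \<rho> w = Nm n f \<rho> w * (\<integral>y. g y * Efac d \<rho> w y \<partial>P)"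
    by (simp add: Nm_def)
qed

lemma Av_Suc:
  assumes "bd n f" "g \<in> borel_measurable P" "\<And>y. nrm d y \<le> R \<Longrightarrow> \<bar>g y\<bar> \<le> C"
  shows "Av (Suc n) (\<lambda>Y. f Y * g (Y n)) \<rho> w = Av n f \<rho> w * pm g \<rho> w"
  unfolding Av_def pm_def by (simp add: Nm_Suc[OF assms])

lemma pm_one: "pm (\<lambda>_. 1) \<rho> w = 1"
  using Zf_pos[of \<rho> w] by (simp add: pm_def Zf_def)

lemma Av_extend: "bd n f \<Longrightarrow> Av (Suc n) f \<rho> w = Av n f \<rho> w"
  using Av_Suc[of n f "\<lambda>_. 1" 1 \<rho> w] by (simp add: pm_one)

text \<open>The empty product measure is the point mass at the everywhere undefined
  function.\<close>

lemma Av_0: "Av 0 f \<rho> w = f (\<lambda>_. undefined)"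
proof -
  interpret N: prob_space "PN 0" by (rule prob_space_PN)
  have "Nm 0 f \<rho> w = (\<integral>Y. f (\<lambda>_. undefined) \<partial>PN 0)"
    unfolding Nm_def by (rule Bochner_Integration.integral_cong) (auto simp: space_PiM Wt_def)
  then show ?thesis using N.prob_space by (simp add: Av_def)
qed

lemma Av_1:
  assumes "g \<in> borel_measurable P" "\<And>y. nrm d y \<le> R \<Longrightarrow> \<bar>g y\<bar> \<le> C"
  shows "Av 1 (\<lambda>Y. g (Y 0)) \<rho> w = pm g \<rho> w"
  using Av_Suc[of 0 "\<lambda>_. 1" g C \<rho> w, OF bd_const assms] by (simp add: Av_0)

lemma Av_const: "Av n (\<lambda>_. c) \<rho> w = c"
  by (induction n) (simp_all add: Av_0 Av_extend bd_const)

section \<open>Derivatives of posterior averages along curves\<close>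

text \<open>A single differentiation formula along curves (rho(s), w(s)) serves for the time
  derivative, for the partial derivatives in x and for the derivative along the flow. The
  boundedness clause supplies the dominating constants.\<close>

definition curve_on :: "real set \<Rightarrow> (real \<Rightarrow> real) \<Rightarrow> (real \<Rightarrow> real) \<Rightarrow> (real \<Rightarrow> nat \<Rightarrow> real) \<Rightarrow> (real \<Rightarrow> nat \<Rightarrow> real) \<Rightarrow> bool" where
  "curve_on S \<rho> \<rho>' w w' \<longleftrightarrow>
    (\<forall>s\<in>S. (\<rho> has_real_derivative \<rho>' s) (at s) \<and> (\<forall>l<d. ((\<lambda>s. w s l) has_real_derivative w' s l) (at s))) \<and>
    (\<exists>C. \<forall>s\<in>S. \<bar>\<rho> s\<bar> \<le> C \<and> \<bar>\<rho>' s\<bar> \<le> C \<and> (\<forall>l<d. \<bar>w s l\<bar> \<le> C \<and> \<bar>w' s l\<bar> \<le> C))"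

text \<open>The logarithmic derivative of \<open>Efac\<close> along such a curve.\<close>

definition dE :: "real \<Rightarrow> real \<Rightarrow> (nat \<Rightarrow> real) \<Rightarrow> (nat \<Rightarrow> real) \<Rightarrow> (nat \<Rightarrow> real) \<Rightarrow> real" where
  "dE \<rho> \<rho>' w w' y = \<rho>' * dot d w y + \<rho> * dot d w' y - \<rho> * \<rho>' * dot d y y"

text \<open>Boundedness is obtained by shrinking to a ball whose closure is a compact subset of
  \<open>S\<close>.\<close>

lemma curve_on_C1:
  assumes S: "open S" "s \<in> S"
    and D: "\<And>s. s \<in> S \<Longrightarrow> (\<rho> has_real_derivative \<rho>' s) (at s)" "\<And>s l. s \<in> S \<Longrightarrow> l < d \<Longrightarrow> ((\<lambda>s. w s l) has_real_derivative w' s l) (at s)"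
    and C: "continuous_on S \<rho>'" "\<And>l. l < d \<Longrightarrow> continuous_on S (\<lambda>s. w' s l)"
  shows "\<exists>S'. open S' \<and> s \<in> S' \<and> curve_on S' \<rho> \<rho>' w w'"
proof -
  obtain e where e: "e > 0" "cball s e \<subseteq> S" using S open_contains_cball by blast
  have C0: "continuous_on S \<rho>" "\<And>l. l < d \<Longrightarrow> continuous_on S (\<lambda>s. w s l)"
    using D S(1) by (auto intro!: continuous_at_imp_continuous_on DERIV_isCont)
  let ?f = "\<lambda>s. \<bar>\<rho> s\<bar> + \<bar>\<rho>' s\<bar> + (\<Sum>l<d. \<bar>w s l\<bar> + \<bar>w' s l\<bar>)"
  have "continuous_on S ?f"
    by (intro continuous_intros C C0) auto
  then have "continuous_on (cball s e) ?f" using e(2) continuous_on_subset by blast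
  then have "compact (?f ` cball s e)" by (rule compact_continuous_image) auto
  from compact_imp_bounded[OF this] obtain B where "\<forall>x\<in>?f ` cball s e. norm x \<le> B"
    unfolding bounded_iff by blast
  then have B: "?f q \<le> B" if "q \<in> cball s e" for q using that by force
  have "curve_on (ball s e) \<rho> \<rho>' w w'"
    unfolding curve_on_def
  proof (intro conjI ballI allI impI exI[of _ B])
    fix q assume q: "q \<in> ball s e"
    then have q': "q \<in> cball s e" "q \<in> S" using e by auto
    show "(\<rho> has_real_derivative \<rho>' q) (at q)" by (rule D(1)[OF q'(2)])
    show "((\<lambda>s. w s l) has_real_derivative w' q l) (at q)" if "l < d" for l by (rule D(2)[OF q'(2) that])
    have n: "(\<Sum>l<d. \<bar>w q l\<bar> + \<bar>w' q l\<bar>) \<ge> 0" by (intro sum_nonneg) auto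
    show "\<bar>\<rho> q\<bar> \<le> B" "\<bar>\<rho>' q\<bar> \<le> B" using B[OF q'(1)] n by linarith+
    fix l assume "l < d"
    then have "\<bar>w q l\<bar> + \<bar>w' q l\<bar> \<le> (\<Sum>l<d. \<bar>w q l\<bar> + \<bar>w' q l\<bar>)" by (intro member_le_sum) auto
    then show "\<bar>w q l\<bar> \<le> B" "\<bar>w' q l\<bar> \<le> B" using B[OF q'(1)] by linarith+
  qed
  then show ?thesis using e(1) by (intro exI[of _ "ball s e"]) auto
qed

lemma nice_bd: assumes "bd n f" shows "nice (PN n) (gs n) S (\<lambda>s Y. f Y) (\<lambda>s Y. 0)"
proof -
  obtain C where C: "C \<ge> 0" "\<And>Y. Y \<in> gs n \<Longrightarrow> \<bar>f Y\<bar> \<le> C" by (rule bdE[OF assms(1)]; blast)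
  show ?thesis by (rule nice_point[OF bd_measurable[OF assms] C(2)])
qed

lemma nice_rho:
  assumes "curve_on S \<rho> \<rho>' w w'" shows "nice M G S (\<lambda>s y. \<rho> s) (\<lambda>s y. \<rho>' s)"
proof -
  obtain C where "\<forall>s\<in>S. \<bar>\<rho> s\<bar> \<le> C \<and> \<bar>\<rho>' s\<bar> \<le> C" using assms unfolding curve_on_def by blast
  then show ?thesis using assms by (intro nice_param[where C = C]) (auto simp: curve_on_def)
qed

lemma nice_w:
  assumes "curve_on S \<rho> \<rho>' w w'" "l < d" shows "nice M G S (\<lambda>s y. w s l) (\<lambda>s y. w' s l)"
proof -
  obtain C where "\<forall>s\<in>S. \<bar>w s l\<bar> \<le> C \<and> \<bar>w' s l\<bar> \<le> C" using assms unfolding curve_on_def by blast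
  then show ?thesis using assms by (intro nice_param[where C = C]) (auto simp: curve_on_def)
qed

lemma nice_dot:
  assumes c: "curve_on S \<rho> \<rho>' w w'" and a: "a < n"
  shows "nice (PN n) (gs n) S (\<lambda>s Y. dot d (w s) (Y a)) (\<lambda>s Y. dot d (w' s) (Y a))"
proof -
  have "nice (PN n) (gs n) S (\<lambda>s Y. \<Sum>l<d. w s l * Y a l) (\<lambda>s Y. \<Sum>l<d. w' s l * Y a l + 0 * w s l)"
    by (intro nice_sum nice_mult nice_w[OF c] nice_bd bd_component a) auto
  then show ?thesis by (simp add: dot_def)
qed

lemma nice_Wt:
  assumes c: "curve_on S \<rho> \<rho>' w w'"
  shows "nice (PN n) (gs n) S (\<lambda>s. Wt n (\<rho> s) (w s))
    (\<lambda>s Y. Wt n (\<rho> s) (w s) Y * (\<Sum>a<n. dE (\<rho> s) (\<rho>' s) (w s) (w' s) (Y a)))"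
proof -
  have "nice (PN n) (gs n) S
    (\<lambda>s Y. exp (\<Sum>a<n. \<rho> s * dot d (w s) (Y a) + \<rho> s * \<rho> s * (- (1/2) * dot d (Y a) (Y a))))
    (\<lambda>s Y. exp (\<Sum>a<n. \<rho> s * dot d (w s) (Y a) + \<rho> s * \<rho> s * (- (1/2) * dot d (Y a) (Y a))) *
      (\<Sum>a<n. (\<rho>' s * dot d (w s) (Y a) + dot d (w' s) (Y a) * \<rho> s) +
        ((\<rho>' s * \<rho> s + \<rho>' s * \<rho> s) * (- (1/2) * dot d (Y a) (Y a)) + 0 * (\<rho> s * \<rho> s))))"
    by (intro nice_exp nice_sum nice_add nice_mult nice_rho[OF c] nice_dot[OF c] nice_bd bd_cmult bd_dot) auto
  then show ?thesis
    by (rule nice_cong) (auto simp: Wt_exp dE_def power2_eq_square algebra_simps intro!: sum.cong)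
qed

lemma Nm_deriv:
  assumes c: "curve_on S \<rho> \<rho>' w w'" and S: "open S" "s \<in> S" and f: "nice (PN n) (gs n) S f f'"
  shows "((\<lambda>s. Nm n (f s) (\<rho> s) (w s)) has_real_derivative
    Nm n (\<lambda>Y. f' s Y + f s Y * (\<Sum>a<n. dE (\<rho> s) (\<rho>' s) (w s) (w' s) (Y a))) (\<rho> s) (w s)) (at s)"
proof -
  interpret N: prob_space "PN n" by (rule prob_space_PN)
  have "((\<lambda>s. \<integral>Y. f s Y * Wt n (\<rho> s) (w s) Y \<partial>PN n) has_real_derivative
    (\<integral>Y. f' s Y * Wt n (\<rho> s) (w s) Y +
      Wt n (\<rho> s) (w s) Y * (\<Sum>a<n. dE (\<rho> s) (\<rho>' s) (w s) (w' s) (Y a)) * f s Y \<partial>PN n)) (at s)"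
    by (rule nice_integral[OF nice_mult[OF f nice_Wt[OF c]] N.finite_measure_axioms S AE_gs])
  then show ?thesis unfolding Nm_def
    by (rule back_subst[where P = "\<lambda>x. (_ has_real_derivative x) (at s)"]) (simp add: algebra_simps)
qed

lemma measurable_dE [measurable]: "dE \<rho> \<rho>' w w' \<in> borel_measurable P"
proof -
  have "(\<lambda>y. \<rho>' * dot d w y + \<rho> * dot d w' y - \<rho> * \<rho>' * dot d y y) \<in> borel_measurable P" by measurable
  then show ?thesis by (simp add: dE_def[abs_def])
qed

lemma abs_dE_le:
  assumes "nrm d y \<le> R"
  shows "\<bar>dE \<rho> \<rho>' w w' y\<bar> \<le> \<bar>\<rho>'\<bar> * (nrm d w * R) + \<bar>\<rho>\<bar> * (nrm d w' * R) + \<bar>\<rho> * \<rho>'\<bar> * R\<^sup>2"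
proof -
  have "\<bar>\<rho>' * dot d w y\<bar> \<le> \<bar>\<rho>'\<bar> * (nrm d w * R)" "\<bar>\<rho> * dot d w' y\<bar> \<le> \<bar>\<rho>\<bar> * (nrm d w' * R)"
    unfolding abs_mult by (intro mult_left_mono abs_dot_le_R assms; simp)+
  moreover have "\<bar>\<rho> * \<rho>' * dot d y y\<bar> \<le> \<bar>\<rho> * \<rho>'\<bar> * R\<^sup>2"
    unfolding abs_mult[of "\<rho> * \<rho>'"] using dot_self_le[OF assms] by (intro mult_left_mono) (auto simp: dot_self)
  ultimately show ?thesis unfolding dE_def by linarith
qed

lemma Zf_pow: "Zf \<rho> w ^ n = Nm n (\<lambda>_. 1) \<rho> w"
  using Av_const[of n 1 \<rho> w] Zf_pos[of \<rho> w] by (simp add: Av_def)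

lemma Zf_deriv:
  assumes c: "curve_on S \<rho> \<rho>' w w'" and S: "open S" "s \<in> S"
  shows "((\<lambda>s. Zf (\<rho> s) (w s)) has_real_derivative
    pm (dE (\<rho> s) (\<rho>' s) (w s) (w' s)) (\<rho> s) (w s) * Zf (\<rho> s) (w s)) (at s)"
proof -
  let ?dE = "dE (\<rho> s) (\<rho>' s) (w s) (w' s)"
  let ?Z = "Zf (\<rho> s) (w s)"
  have Z0: "?Z > 0" by (rule Zf_pos)
  have "((\<lambda>s. Nm 1 (\<lambda>Y. 1) (\<rho> s) (w s)) has_real_derivative
     Nm 1 (\<lambda>Y. 0 + 1 * (\<Sum>a<1. ?dE (Y a))) (\<rho> s) (w s)) (at s)"
    by (rule Nm_deriv[OF c S nice_bd[OF bd_const]])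
  moreover have "Nm 1 (\<lambda>Y. 0 + 1 * (\<Sum>a<1. ?dE (Y a))) (\<rho> s) (w s) = pm ?dE (\<rho> s) (w s) * ?Z"
    using Av_1[OF measurable_dE abs_dE_le, of "\<rho> s" "\<rho>' s" "w s" "w' s" "\<rho> s" "w s"] Z0
    by (simp add: Av_def divide_simps)
  ultimately show ?thesis
    by (simp add: Zf_pow[of _ _ 1, simplified])
qed

text \<open>Quotient rule: the numerator contributes the sum of the logarithmic derivatives of the
  replica weights, and the power of \<open>Zf\<close> subtracts \<open>n\<close> times their
  posterior mean.\<close>

lemma Av_deriv:
  assumes c: "curve_on S \<rho> \<rho>' w w'" and S: "open S" "s \<in> S" and f: "nice (PN n) (gs n) S f f'"
  shows "((\<lambda>s. Av n (f s) (\<rho> s) (w s)) has_real_derivative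
    Av n (\<lambda>Y. f' s Y + f s Y * (\<Sum>a<n. dE (\<rho> s) (\<rho>' s) (w s) (w' s) (Y a))) (\<rho> s) (w s)
     - real n * Av n (f s) (\<rho> s) (w s) * pm (dE (\<rho> s) (\<rho>' s) (w s) (w' s)) (\<rho> s) (w s)) (at s)"
proof -
  let ?dE = "dE (\<rho> s) (\<rho>' s) (w s) (w' s)"
  let ?Z = "Zf (\<rho> s) (w s)"
  let ?N' = "Nm n (\<lambda>Y. f' s Y + f s Y * (\<Sum>a<n. ?dE (Y a))) (\<rho> s) (w s)"
  have Z0: "?Z > 0" by (rule Zf_pos)
  have Zn: "((\<lambda>s. Zf (\<rho> s) (w s) ^ n) has_real_derivative real n * pm ?dE (\<rho> s) (w s) * ?Z ^ n) (at s)"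
  proof (cases n)
    case (Suc k)
    have "((\<lambda>s. Zf (\<rho> s) (w s) ^ n) has_real_derivative real n * ((pm ?dE (\<rho> s) (w s) * ?Z) * ?Z ^ (n - Suc 0))) (at s)"
      by (rule DERIV_power[OF Zf_deriv[OF c S]])
    then show ?thesis by (simp add: Suc mult_ac)
  qed simp
  have "((\<lambda>s. Nm n (f s) (\<rho> s) (w s) / Zf (\<rho> s) (w s) ^ n) has_real_derivative
    (?N' * ?Z ^ n - Nm n (f s) (\<rho> s) (w s) * (real n * pm ?dE (\<rho> s) (w s) * ?Z ^ n)) / (?Z ^ n * ?Z ^ n)) (at s)"
    by (rule DERIV_divide[OF Nm_deriv[OF c S f] Zn]) (use Z0 in simp)
  moreover have "(a * z - b * (m * c * z)) / (z * z) = a / z - m * (b / z) * c" if "z \<noteq> 0" for a b c m z :: real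
    using that by (simp add: field_simps)
  moreover have "?Z ^ n \<noteq> 0" using Z0 by simp
  ultimately show ?thesis unfolding Av_def by simp
qed

end

section \<open>Replica polynomials and their derivative along the flow\<close>

text \<open>
  The replicas enter only through the differences \<open>\<rho> \<langle>w, Y\<^sub>a - Y\<^sub>b\<rangle>\<close>, never through \<open>\<langle>w, Y\<^sub>a\<rangle>\<close> itself, which would not
  be bounded uniformly in the dimension.
\<close>

datatype ex = Pl "real poly" | Sx nat nat | Qx nat nat | Ad ex ex | Mu ex ex

primrec eval :: "nat \<Rightarrow> ex \<Rightarrow> real \<Rightarrow> (nat \<Rightarrow> real) \<Rightarrow> (nat \<Rightarrow> nat \<Rightarrow> real) \<Rightarrow> real" where
  "eval d (Pl p) \<rho> w Y = poly p \<rho>"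
| "eval d (Sx a b) \<rho> w Y = \<rho> * (dot d w (Y a) - dot d w (Y b))"
| "eval d (Qx a b) \<rho> w Y = dot d (Y a) (Y b)"
| "eval d (Ad e f) \<rho> w Y = eval d e \<rho> w Y + eval d f \<rho> w Y"
| "eval d (Mu e f) \<rho> w Y = eval d e \<rho> w Y * eval d f \<rho> w Y"

primrec fits :: "nat \<Rightarrow> ex \<Rightarrow> bool" where
  "fits n (Pl p) = True"
| "fits n (Sx a b) = (a < n \<and> b < n)"
| "fits n (Qx a b) = (a < n \<and> b < n)"
| "fits n (Ad e f) = (fits n e \<and> fits n f)"
| "fits n (Mu e f) = (fits n e \<and> fits n f)"

text \<open>The partial derivative of \<open>eval\<close> in rho at fixed \<open>w\<close>;
  \<open>evB\<close> is the one in the coordinate w_l.\<close>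

primrec evA :: "nat \<Rightarrow> ex \<Rightarrow> real \<Rightarrow> (nat \<Rightarrow> real) \<Rightarrow> (nat \<Rightarrow> nat \<Rightarrow> real) \<Rightarrow> real" where
  "evA d (Pl p) \<rho> w Y = poly (pderiv p) \<rho>"
| "evA d (Sx a b) \<rho> w Y = dot d w (Y a) - dot d w (Y b)"
| "evA d (Qx a b) \<rho> w Y = 0"
| "evA d (Ad e f) \<rho> w Y = evA d e \<rho> w Y + evA d f \<rho> w Y"
| "evA d (Mu e f) \<rho> w Y = evA d e \<rho> w Y * eval d f \<rho> w Y + evA d f \<rho> w Y * eval d e \<rho> w Y"

primrec evB :: "nat \<Rightarrow> nat \<Rightarrow> ex \<Rightarrow> real \<Rightarrow> (nat \<Rightarrow> real) \<Rightarrow> (nat \<Rightarrow> nat \<Rightarrow> real) \<Rightarrow> real" where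
  "evB d l (Pl p) \<rho> w Y = 0"
| "evB d l (Sx a b) \<rho> w Y = \<rho> * (Y a l - Y b l)"
| "evB d l (Qx a b) \<rho> w Y = 0"
| "evB d l (Ad e f) \<rho> w Y = evB d l e \<rho> w Y + evB d l f \<rho> w Y"
| "evB d l (Mu e f) \<rho> w Y = evB d l e \<rho> w Y * eval d f \<rho> w Y + evB d l f \<rho> w Y * eval d e \<rho> w Y"

text \<open>The speed of rho in reversed time: d rho/dt = -kap(rho), see
  \<open>rho_deriv\<close>.\<close>

definition kap :: "real poly" where "kap = [:0, 1/2, 0, 1/2:]"

lemma poly_kap: "poly kap \<rho> = (\<rho> + \<rho>^3) / 2"
  by (simp add: kap_def power3_eq_cube field_simps)

text \<open>The derivative in reversed time when \<open>w\<close> moves with velocity kap(rho) Y_c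
  (\<open>eval_der\<close>), so that replica \<open>c\<close> stands for the drift. The coefficient
  1/2 + rho^2/2 is kap(rho)/rho: it compensates the factor rho inside \<open>Sx\<close>.\<close>

primrec der :: "nat \<Rightarrow> ex \<Rightarrow> ex" where
  "der c (Pl p) = Pl (pderiv p * kap)"
| "der c (Sx a b) = Ad (Mu (Pl [:1/2, 0, 1/2:]) (Sx a b))
     (Mu (Pl (pCons 0 kap)) (Ad (Qx c a) (Mu (Pl [:-1:]) (Qx c b))))"
| "der c (Qx a b) = Pl 0"
| "der c (Ad e f) = Ad (der c e) (der c f)"
| "der c (Mu e f) = Ad (Mu (der c e) f) (Mu (der c f) e)"

text \<open>The logarithmic derivative of the weight of replica \<open>a\<close> minus that of
  replica \<open>n\<close>, with drift replica \<open>c\<close> (\<open>eval_tdiff\<close>). The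
  subtraction leaves \<open>w\<close> paired with the difference Y_a - Y_n only.\<close>

definition tdiff :: "nat \<Rightarrow> nat \<Rightarrow> nat \<Rightarrow> ex" where
  "tdiff c a n = Ad (Mu (Pl [:1/2, 0, 1/2:]) (Sx a n))
     (Mu (Pl (pCons 0 kap)) (Ad (Ad (Qx c a) (Mu (Pl [:-1:]) (Qx c n))) (Ad (Mu (Pl [:-1:]) (Qx a a)) (Qx n n))))"

primrec sumE :: "(nat \<Rightarrow> ex) \<Rightarrow> nat \<Rightarrow> ex" where
  "sumE f 0 = Pl 0"
| "sumE f (Suc m) = Ad (sumE f m) (f m)"

text \<open>
  Differentiating an average over \<open>n\<close> replicas produces two new ones: replica \<open>n\<close> normalises the
  weights, replica \<open>n + 1\<close> represents the drift \<open>E[Y | w]\<close>.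
\<close>

definition dd :: "nat \<Rightarrow> ex \<Rightarrow> ex" where
  "dd n e = Ad (der (Suc n) e) (Mu e (sumE (\<lambda>a. tdiff (Suc n) a n) n))"

lemma fits_mono: "fits n e \<Longrightarrow> n \<le> m \<Longrightarrow> fits m e"
  by (induction e) auto

lemma fits_der: "fits n e \<Longrightarrow> n \<le> c \<Longrightarrow> fits (Suc c) (der c e)"
  by (induction e) (auto intro: fits_mono)

lemma fits_sumE: "(\<And>a. a < m \<Longrightarrow> fits n (f a)) \<Longrightarrow> fits n (sumE f m)"
  by (induction m) auto

lemma fits_dd: "fits n e \<Longrightarrow> fits (n + 2) (dd n e)"
  using fits_der[of n e "Suc n"] by (auto simp: dd_def tdiff_def intro!: fits_sumE intro: fits_mono)

lemma eval_sumE: "eval d (sumE f m) \<rho> w Y = (\<Sum>a<m. eval d (f a) \<rho> w Y)"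
  by (induction m) auto

lemma eval_der: "eval d (der c e) \<rho> w Y = poly kap \<rho> * (evA d e \<rho> w Y + (\<Sum>l<d. Y c l * evB d l e \<rho> w Y))"
proof (induction e)
  case (Sx a b)
  have "(\<Sum>l<d. Y c l * (\<rho> * (Y a l - Y b l))) = \<rho> * (dot d (Y c) (Y a) - dot d (Y c) (Y b))"
    by (simp add: dot_def algebra_simps sum_distrib_left sum_subtractf)
  then show ?case by (simp add: poly_kap) (simp add: field_simps power3_eq_cube power2_eq_square)
next
  case (Ad e f)
  then show ?case by (simp add: algebra_simps sum.distrib)
next
  case (Mu e f)
  have "(\<Sum>l<d. Y c l * (evB d l e \<rho> w Y * eval d f \<rho> w Y + evB d l f \<rho> w Y * eval d e \<rho> w Y))
    = (\<Sum>l<d. Y c l * evB d l e \<rho> w Y) * eval d f \<rho> w Y + (\<Sum>l<d. Y c l * evB d l f \<rho> w Y) * eval d e \<rho> w Y"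
    by (simp add: sum.distrib sum_distrib_left algebra_simps)
  then show ?case by (simp add: Mu) (simp add: algebra_simps)
qed simp_all

text \<open>The factor of the speed of rho in \<open>dE\<close>, see \<open>dE_eq\<close>.\<close>

definition dA :: "nat \<Rightarrow> real \<Rightarrow> (nat \<Rightarrow> real) \<Rightarrow> (nat \<Rightarrow> real) \<Rightarrow> real" where
  "dA d \<rho> w y = dot d w y - \<rho> * dot d y y"

lemma eval_tdiff: "eval d (tdiff c a n) \<rho> w Y =
  poly kap \<rho> * (dA d \<rho> w (Y a) + (\<Sum>l<d. Y c l * (\<rho> * Y a l)) - dA d \<rho> w (Y n) - (\<Sum>l<d. Y c l * (\<rho> * Y n l)))"
proof -
  have "(\<Sum>l<d. Y c l * (\<rho> * Y a l)) = \<rho> * dot d (Y c) (Y a)" for a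
    by (simp add: dot_def sum_distrib_left mult_ac)
  then show ?thesis
    by (simp add: tdiff_def dA_def poly_kap) (simp add: field_simps power3_eq_cube power2_eq_square)
qed

lemma poly_bounded: "\<exists>B. \<forall>x. \<bar>x\<bar> \<le> C \<longrightarrow> \<bar>poly p x\<bar> \<le> (B::real)"
proof (induction p)
  case (pCons a p)
  then obtain B where B: "\<And>x. \<bar>x\<bar> \<le> C \<Longrightarrow> \<bar>poly p x\<bar> \<le> B" by blast
  have "\<bar>poly (pCons a p) x\<bar> \<le> \<bar>a\<bar> + C * B" if x: "\<bar>x\<bar> \<le> C" for x
  proof -
    have "\<bar>x * poly p x\<bar> \<le> C * B" unfolding abs_mult using x B[OF x] by (intro mult_mono) auto
    then show ?thesis by simp
  qed
  then show ?case by blast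
qed auto

context bounded_prior
begin

lemma bd_eval: "fits n e \<Longrightarrow> bd n (eval d e \<rho> w)"
proof (induction e)
  case (Pl p) show ?case using bd_const[of n "poly p \<rho>"] by simp
next
  case (Sx a b)
  then have "bd n (\<lambda>Y. \<rho> * (dot d w (Y a) - dot d w (Y b)))" by (intro bd_cmult bd_diff bd_dot_left) auto
  then show ?case by simp
next
  case (Qx a b)
  then have "bd n (\<lambda>Y. dot d (Y a) (Y b))" by (intro bd_dot) auto
  then show ?case by simp
next
  case (Ad e f)
  then show ?case using bd_add[of n "eval d e \<rho> w" "eval d f \<rho> w"] by simp
next
  case (Mu e f)
  then show ?case using bd_mult[of n "eval d e \<rho> w" "eval d f \<rho> w"] by simp
qed

lemma bd_evA: "fits n e \<Longrightarrow> bd n (evA d e \<rho> w)"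
proof (induction e)
  case (Pl p) show ?case using bd_const[of n "poly (pderiv p) \<rho>"] by simp
next
  case (Sx a b)
  then have "bd n (\<lambda>Y. dot d w (Y a) - dot d w (Y b))" by (intro bd_diff bd_dot_left) auto
  then show ?case by simp
next
  case (Qx a b) show ?case using bd_const[of n 0] by simp
next
  case (Ad e f)
  then show ?case using bd_add[of n "evA d e \<rho> w" "evA d f \<rho> w"] by simp
next
  case (Mu e f)
  then have "bd n (\<lambda>Y. evA d e \<rho> w Y * eval d f \<rho> w Y + evA d f \<rho> w Y * eval d e \<rho> w Y)"
    by (intro bd_add bd_mult bd_eval) auto
  then show ?case by simp
qed

lemma bd_evB: "fits n e \<Longrightarrow> l < d \<Longrightarrow> bd n (evB d l e \<rho> w)"
proof (induction e)
  case (Pl p) show ?case using bd_const[of n 0] by simp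
next
  case (Sx a b)
  then have "bd n (\<lambda>Y. \<rho> * (Y a l - Y b l))" by (intro bd_cmult bd_diff bd_component) auto
  then show ?case by simp
next
  case (Qx a b) show ?case using bd_const[of n 0] by simp
next
  case (Ad e f)
  then show ?case using bd_add[of n "evB d l e \<rho> w" "evB d l f \<rho> w"] by simp
next
  case (Mu e f)
  then have "bd n (\<lambda>Y. evB d l e \<rho> w Y * eval d f \<rho> w Y + evB d l f \<rho> w Y * eval d e \<rho> w Y)"
    by (intro bd_add bd_mult bd_eval) auto
  then show ?case by simp
qed

lemma nice_poly:
  assumes c: "curve_on S \<rho> \<rho>' w w'"
  shows "nice M G S (\<lambda>s y. poly p (\<rho> s)) (\<lambda>s y. poly (pderiv p) (\<rho> s) * \<rho>' s)"
proof -
  obtain C where C: "\<And>s. s \<in> S \<Longrightarrow> \<bar>\<rho> s\<bar> \<le> C" "\<And>s. s \<in> S \<Longrightarrow> \<bar>\<rho>' s\<bar> \<le> C"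
    using c unfolding curve_on_def by blast
  obtain B where B: "\<And>x. \<bar>x\<bar> \<le> C \<Longrightarrow> \<bar>poly p x\<bar> \<le> B" using poly_bounded[of C p] by blast
  obtain B' where B': "\<And>x. \<bar>x\<bar> \<le> C \<Longrightarrow> \<bar>poly (pderiv p) x\<bar> \<le> B'" using poly_bounded[of C "pderiv p"] by blast
  show ?thesis
  proof (rule niceI[where C = B and C' = "B' * C"])
    fix s assume s: "s \<in> S"
    show "\<bar>poly p (\<rho> s)\<bar> \<le> B" by (intro B C s)
    have "\<bar>poly (pderiv p) (\<rho> s)\<bar> \<le> B'" by (intro B' C s)
    then show "\<bar>poly (pderiv p) (\<rho> s) * \<rho>' s\<bar> \<le> B' * C"
      unfolding abs_mult using C(2)[OF s] by (intro mult_mono) auto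
    show "((\<lambda>s. poly p (\<rho> s)) has_real_derivative poly (pderiv p) (\<rho> s) * \<rho>' s) (at s)"
      by (rule DERIV_chain2[OF poly_DERIV]) (use c s in \<open>auto simp: curve_on_def\<close>)
  qed auto
qed

lemma nice_eval:
  assumes c: "curve_on S \<rho> \<rho>' w w'" and "fits n e"
  shows "nice (PN n) (gs n) S (\<lambda>s. eval d e (\<rho> s) (w s))
    (\<lambda>s Y. \<rho>' s * evA d e (\<rho> s) (w s) Y + (\<Sum>l<d. w' s l * evB d l e (\<rho> s) (w s) Y))"
  using assms(2)
proof (induction e)
  case (Pl p)
  show ?case by (rule nice_cong[OF nice_poly[OF c, of _ _ p]]) auto
next
  case (Sx a b)
  then have "nice (PN n) (gs n) S (\<lambda>s Y. \<rho> s * (dot d (w s) (Y a) + (- 1) * dot d (w s) (Y b)))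
    (\<lambda>s Y. \<rho>' s * (dot d (w s) (Y a) + (- 1) * dot d (w s) (Y b))
      + (dot d (w' s) (Y a) + (0 * dot d (w s) (Y b) + dot d (w' s) (Y b) * (- 1))) * \<rho> s)"
    by (intro nice_mult nice_add nice_rho[OF c] nice_dot[OF c] nice_bd bd_const) auto
  moreover have "(\<Sum>l<d. w' s l * (\<rho> s * (Y a l - Y b l))) = \<rho> s * (dot d (w' s) (Y a) - dot d (w' s) (Y b))" for s Y
    by (simp add: dot_def sum_distrib_left sum_subtractf[symmetric] algebra_simps)
  ultimately show ?case
    by (elim nice_cong) (simp_all add: algebra_simps)
next
  case (Qx a b)
  then show ?case by (intro nice_cong[OF nice_bd[OF bd_dot[of a n b]]]) auto
next
  case (Ad e f)
  then have "nice (PN n) (gs n) S (\<lambda>s. eval d e (\<rho> s) (w s))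
    (\<lambda>s Y. \<rho>' s * evA d e (\<rho> s) (w s) Y + (\<Sum>l<d. w' s l * evB d l e (\<rho> s) (w s) Y))"
   "nice (PN n) (gs n) S (\<lambda>s. eval d f (\<rho> s) (w s))
    (\<lambda>s Y. \<rho>' s * evA d f (\<rho> s) (w s) Y + (\<Sum>l<d. w' s l * evB d l f (\<rho> s) (w s) Y))" by auto
  from nice_add[OF this] show ?case
    by (rule nice_cong) (auto simp: algebra_simps sum.distrib)
next
  case (Mu e f)
  then have "nice (PN n) (gs n) S (\<lambda>s. eval d e (\<rho> s) (w s))
    (\<lambda>s Y. \<rho>' s * evA d e (\<rho> s) (w s) Y + (\<Sum>l<d. w' s l * evB d l e (\<rho> s) (w s) Y))"
   "nice (PN n) (gs n) S (\<lambda>s. eval d f (\<rho> s) (w s))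
    (\<lambda>s Y. \<rho>' s * evA d f (\<rho> s) (w s) Y + (\<Sum>l<d. w' s l * evB d l f (\<rho> s) (w s) Y))" by auto
  from nice_mult[OF this] show ?case
    by (rule nice_cong) (auto simp: algebra_simps sum.distrib sum_distrib_left)
qed

lemma measurable_dA [measurable]: "dA d \<rho> w \<in> borel_measurable P"
proof -
  have "(\<lambda>y. dot d w y - \<rho> * dot d y y) \<in> borel_measurable P" by measurable
  then show ?thesis by (simp add: dA_def[abs_def])
qed

lemma abs_dA_le:
  assumes "nrm d y \<le> R" shows "\<bar>dA d \<rho> w y\<bar> \<le> nrm d w * R + \<bar>\<rho>\<bar> * R\<^sup>2"
proof -
  have "\<bar>\<rho> * dot d y y\<bar> \<le> \<bar>\<rho>\<bar> * R\<^sup>2"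
    unfolding abs_mult using dot_self_le[OF assms] by (intro mult_left_mono) (auto simp: dot_self)
  then show ?thesis using abs_dot_le_R[OF assms, of w] unfolding dA_def by linarith
qed

lemma abs_component_le: "nrm d y \<le> R \<Longrightarrow> l < d \<Longrightarrow> \<bar>y l\<bar> \<le> R"
  using abs_le_nrm[of l d y] by simp

lemma abs_scaled_component_le: "nrm d y \<le> R \<Longrightarrow> l < d \<Longrightarrow> \<bar>\<rho> * y l\<bar> \<le> \<bar>\<rho>\<bar> * R"
  unfolding abs_mult by (intro mult_left_mono abs_component_le) auto

lemma bd_dA: "a < n \<Longrightarrow> bd n (\<lambda>Y. dA d \<rho> w (Y a))"
  unfolding dA_def by (intro bd_diff bd_cmult bd_dot_left bd_dot)

lemma dE_eq: "dE \<rho> \<rho>' w w' y = \<rho>' * dA d \<rho> w y + (\<Sum>l<d. w' l * (\<rho> * y l))"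
  by (simp add: dE_def dA_def dot_def algebra_simps sum_distrib_left)

lemma Av_lin:
  assumes "bd n f" "\<And>l. l < d \<Longrightarrow> bd n (h l)"
  shows "Av n (\<lambda>Y. c * f Y + (\<Sum>l<d. v l * h l Y)) \<rho> w = c * Av n f \<rho> w + (\<Sum>l<d. v l * Av n (h l) \<rho> w)"
proof -
  have b: "bd n (\<lambda>Y. v l * h l Y)" if "l \<in> {..<d}" for l using that by (intro bd_cmult assms) auto
  have "Av n (\<lambda>Y. c * f Y + (\<Sum>l<d. v l * h l Y)) \<rho> w = Av n (\<lambda>Y. c * f Y) \<rho> w + Av n (\<lambda>Y. \<Sum>l<d. v l * h l Y) \<rho> w"
    by (intro Av_add bd_cmult assms bd_sum b)
  also have "Av n (\<lambda>Y. \<Sum>l<d. v l * h l Y) \<rho> w = (\<Sum>l<d. Av n (\<lambda>Y. v l * h l Y) \<rho> w)"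
    by (intro Av_sum b) auto
  finally show ?thesis by (simp add: Av_cmult)
qed

lemma pm_dE: "pm (dE \<rho> \<rho>' w w') \<rho> w = \<rho>' * pm (dA d \<rho> w) \<rho> w + (\<Sum>l<d. w' l * pm (\<lambda>y. \<rho> * y l) \<rho> w)"
proof -
  have "Av 1 (\<lambda>Y. dE \<rho> \<rho>' w w' (Y 0)) \<rho> w
    = \<rho>' * Av 1 (\<lambda>Y. dA d \<rho> w (Y 0)) \<rho> w + (\<Sum>l<d. w' l * Av 1 (\<lambda>Y. \<rho> * Y 0 l) \<rho> w)"
    unfolding dE_eq by (intro Av_lin bd_dA bd_cmult bd_component) auto
  moreover have "Av 1 (\<lambda>Y. \<rho> * Y 0 l) \<rho> w = pm (\<lambda>y. \<rho> * y l) \<rho> w" if "l < d" for l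
    by (rule Av_1[where C = "\<bar>\<rho>\<bar> * R"]) (use that abs_scaled_component_le in auto)
  ultimately show ?thesis
    using Av_1[OF measurable_dA abs_dA_le, of \<rho> w \<rho> w] Av_1[OF measurable_dE abs_dE_le, of \<rho> \<rho>' w w' \<rho> w]
    by simp
qed

text \<open>The partial derivative in rho of the average of Y_0i times \<open>e\<close>;
  \<open>GB\<close> is the one in w_l. \<open>Av_eval_deriv\<close> is the chain rule that combines
  them.\<close>

definition GA :: "nat \<Rightarrow> nat \<Rightarrow> ex \<Rightarrow> real \<Rightarrow> (nat \<Rightarrow> real) \<Rightarrow> real" where
  "GA n i e \<rho> w = Av n (\<lambda>Y. Y 0 i * (evA d e \<rho> w Y + eval d e \<rho> w Y * (\<Sum>a<n. dA d \<rho> w (Y a)))) \<rho> w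
     - real n * Av n (\<lambda>Y. Y 0 i * eval d e \<rho> w Y) \<rho> w * pm (dA d \<rho> w) \<rho> w"

definition GB :: "nat \<Rightarrow> nat \<Rightarrow> ex \<Rightarrow> nat \<Rightarrow> real \<Rightarrow> (nat \<Rightarrow> real) \<Rightarrow> real" where
  "GB n i e l \<rho> w = Av n (\<lambda>Y. Y 0 i * (evB d l e \<rho> w Y + eval d e \<rho> w Y * (\<Sum>a<n. \<rho> * Y a l))) \<rho> w
     - real n * Av n (\<lambda>Y. Y 0 i * eval d e \<rho> w Y) \<rho> w * pm (\<lambda>y. \<rho> * y l) \<rho> w"

lemma lin_regroup:
  fixes r F :: real
  shows "r * F + (\<Sum>l<d. v l * H l) - m * e * (r * pA + (\<Sum>l<d. v l * pB l)) =
    r * (F - m * e * pA) + (\<Sum>l<d. v l * (H l - m * e * pB l))"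
  by (simp add: algebra_simps sum_subtractf sum_distrib_left)

lemma Av_eval_deriv:
  assumes c: "curve_on S \<rho> \<rho>' w w'" and S: "open S" "s \<in> S" and e: "fits n e" "1 \<le> n" and i: "i < d"
  shows "((\<lambda>s. Av n (\<lambda>Y. Y 0 i * eval d e (\<rho> s) (w s) Y) (\<rho> s) (w s)) has_real_derivative
    \<rho>' s * GA n i e (\<rho> s) (w s) + (\<Sum>l<d. w' s l * GB n i e l (\<rho> s) (w s))) (at s)"
proof -
  let ?r = "\<rho> s" and ?w = "w s" and ?e0 = "\<lambda>Y. Y 0 i * eval d e (\<rho> s) (w s) Y"
  let ?F = "\<lambda>Y. Y 0 i * (evA d e ?r ?w Y + eval d e ?r ?w Y * (\<Sum>a<n. dA d ?r ?w (Y a)))"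
  let ?H = "\<lambda>l Y. Y 0 i * (evB d l e ?r ?w Y + eval d e ?r ?w Y * (\<Sum>a<n. ?r * Y a l))"
  have bF: "bd n ?F" by (intro bd_mult bd_add bd_sum bd_component bd_evA bd_eval bd_dA e i) (use e in auto)
  have bH: "bd n (?H l)" if "l < d" for l
    by (intro bd_mult bd_add bd_sum bd_component bd_evB bd_eval bd_cmult e i that) (use e in auto)
  let ?f' = "\<lambda>s Y. 0 * eval d e (\<rho> s) (w s) Y
    + (\<rho>' s * evA d e (\<rho> s) (w s) Y + (\<Sum>l<d. w' s l * evB d l e (\<rho> s) (w s) Y)) * Y 0 i"
  have n: "nice (PN n) (gs n) S (\<lambda>s Y. Y 0 i * eval d e (\<rho> s) (w s) Y) ?f'"
    by (intro nice_mult nice_bd bd_component nice_eval[OF c] e i) (use e in auto)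
  have eq: "?f' s Y + ?e0 Y * (\<Sum>a<n. dE ?r (\<rho>' s) ?w (w' s) (Y a)) = \<rho>' s * ?F Y + (\<Sum>l<d. w' s l * ?H l Y)" for Y
  proof -
    have "(\<Sum>a<n. \<Sum>l<d. w' s l * (?r * Y a l)) = (\<Sum>l<d. w' s l * (\<Sum>a<n. ?r * Y a l))"
      by (subst sum.swap) (simp add: sum_distrib_left)
    then have "(\<Sum>a<n. dE ?r (\<rho>' s) ?w (w' s) (Y a))
      = \<rho>' s * (\<Sum>a<n. dA d ?r ?w (Y a)) + (\<Sum>l<d. w' s l * (\<Sum>a<n. ?r * Y a l))"
      by (simp add: dE_eq sum.distrib sum_distrib_left)
    moreover have "(\<Sum>l<d. w' s l * ?H l Y) = Y 0 i * ((\<Sum>l<d. w' s l * evB d l e ?r ?w Y)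
       + eval d e ?r ?w Y * (\<Sum>l<d. w' s l * (\<Sum>a<n. ?r * Y a l)))"
      by (simp add: sum_distrib_left sum.distrib algebra_simps)
    ultimately show ?thesis by (simp add: algebra_simps)
  qed
  have "Av n (\<lambda>Y. ?f' s Y + ?e0 Y * (\<Sum>a<n. dE ?r (\<rho>' s) ?w (w' s) (Y a))) ?r ?w
    = \<rho>' s * Av n ?F ?r ?w + (\<Sum>l<d. w' s l * Av n (?H l) ?r ?w)"
    unfolding eq by (rule Av_lin[OF bF bH])
  then show ?thesis
    using Av_deriv[OF c S n] unfolding pm_dE GA_def GB_def by (simp only: lin_regroup)
qed

text \<open>Given \<open>w\<close>, replica \<open>n\<close> is independent of the earlier ones and
  reproduces the normalising term, \<open>n\<close> times because \<open>dd\<close> sums over all a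
  < n. Replica n + 1 turns the factor Y_l into the posterior mean, which is the drift of the
  flow.\<close>

lemma Av_dd:
  assumes e: "fits n e" "1 \<le> n" and i: "i < d"
  shows "Av (n + 2) (\<lambda>Y. Y 0 i * eval d (dd n e) \<rho> w Y) \<rho> w =
    poly kap \<rho> * (GA n i e \<rho> w + (\<Sum>l<d. pm (\<lambda>y. y l) \<rho> w * GB n i e l \<rho> w))"
proof -
  let ?e0 = "\<lambda>Y. Y 0 i * eval d e \<rho> w Y"
  let ?F = "\<lambda>Y. Y 0 i * (evA d e \<rho> w Y + eval d e \<rho> w Y * (\<Sum>a<n. dA d \<rho> w (Y a)))"
  let ?H = "\<lambda>l Y. Y 0 i * (evB d l e \<rho> w Y + eval d e \<rho> w Y * (\<Sum>a<n. \<rho> * Y a l))"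
  have b0: "bd n ?e0" by (intro bd_mult bd_component bd_eval e i) (use e in auto)
  have bF: "bd n ?F" by (intro bd_mult bd_add bd_sum bd_component bd_evA bd_eval bd_dA e i) (use e in auto)
  have bH: "bd n (?H l)" if "l < d" for l
    by (intro bd_mult bd_add bd_sum bd_component bd_evB bd_eval bd_cmult e i that) (use e in auto)
  note cm = measurable_P_component and cb = abs_component_le
  have scm: "(\<lambda>y. \<rho> * y l) \<in> borel_measurable P" if "l < d" for l using that by measurable
  have b0A: "bd (Suc n) (\<lambda>Y. ?e0 Y * dA d \<rho> w (Y n))"
    by (rule Nm_Suc(2)[OF b0 measurable_dA abs_dA_le])
  have b0B: "bd (Suc n) (\<lambda>Y. ?e0 Y * (\<rho> * Y n l))" if "l < d" for l
    by (rule Nm_Suc(2)[OF b0, where g = "\<lambda>y. \<rho> * y l" and C = "\<bar>\<rho>\<bar> * R"]) (use scm that abs_scaled_component_le in auto)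
  have bH2: "bd (Suc (Suc n)) (\<lambda>Y. ?H l Y * Y (Suc n) l)" if "l < d" for l
    by (rule Nm_Suc(2)[where g = "\<lambda>y. y l" and C = R]) (use that bd_mono[OF bH] abs_component_le in auto)
  have b0B2: "bd (Suc (Suc n)) (\<lambda>Y. ?e0 Y * (\<rho> * Y n l) * Y (Suc n) l)" if "l < d" for l
    by (rule Nm_Suc(2)[OF b0B, where g = "\<lambda>y. y l" and C = R]) (use that abs_component_le in auto)
  have 1: "Av (Suc (Suc n)) ?F \<rho> w = Av n ?F \<rho> w"
    using Av_extend[OF bF] Av_extend[OF bd_mono[OF bF, of "Suc n"]] by simp
  have 2: "Av (Suc (Suc n)) (\<lambda>Y. ?H l Y * Y (Suc n) l) \<rho> w = Av n (?H l) \<rho> w * pm (\<lambda>y. y l) \<rho> w" if l: "l < d" for l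
  proof -
    have "Av (Suc (Suc n)) (\<lambda>Y. ?H l Y * Y (Suc n) l) \<rho> w = Av (Suc n) (?H l) \<rho> w * pm (\<lambda>y. y l) \<rho> w"
      by (rule Av_Suc[where g = "\<lambda>y. y l" and C = R]) (use that bd_mono[OF bH] abs_component_le in auto)
    then show ?thesis unfolding Av_extend[OF bH[OF l]] .
  qed
  have 3: "Av (Suc (Suc n)) (\<lambda>Y. ?e0 Y * dA d \<rho> w (Y n)) \<rho> w = Av n ?e0 \<rho> w * pm (dA d \<rho> w) \<rho> w"
    unfolding Av_extend[OF b0A] by (rule Av_Suc[OF b0 measurable_dA abs_dA_le])
  have 4: "Av (Suc (Suc n)) (\<lambda>Y. ?e0 Y * (\<rho> * Y n l) * Y (Suc n) l) \<rho> w
      = Av n ?e0 \<rho> w * pm (\<lambda>y. \<rho> * y l) \<rho> w * pm (\<lambda>y. y l) \<rho> w" if l: "l < d" for l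
  proof -
    have "Av (Suc (Suc n)) (\<lambda>Y. ?e0 Y * (\<rho> * Y n l) * Y (Suc n) l) \<rho> w
      = Av (Suc n) (\<lambda>Y. ?e0 Y * (\<rho> * Y n l)) \<rho> w * pm (\<lambda>y. y l) \<rho> w"
      by (rule Av_Suc[OF b0B, where g = "\<lambda>y. y l" and C = R]) (use that abs_component_le in auto)
    also have "Av (Suc n) (\<lambda>Y. ?e0 Y * (\<rho> * Y n l)) \<rho> w = Av n ?e0 \<rho> w * pm (\<lambda>y. \<rho> * y l) \<rho> w"
      by (rule Av_Suc[OF b0, where g = "\<lambda>y. \<rho> * y l" and C = "\<bar>\<rho>\<bar> * R"]) (use scm that abs_scaled_component_le in auto)
    finally show ?thesis .
  qed
  \<comment> \<open>The integrand split according to the new replicas: \<open>n\<close> in the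
    subtracted terms, \<open>Suc n\<close> in every term that comes from the motion of
    \<open>w\<close>.\<close>
  have ev: "Y 0 i * eval d (dd n e) \<rho> w Y = poly kap \<rho> * (?F Y + (\<Sum>l<d. ?H l Y * Y (Suc n) l)
     - real n * (?e0 Y * dA d \<rho> w (Y n)) - real n * (\<Sum>l<d. ?e0 Y * (\<rho> * Y n l) * Y (Suc n) l))" for Y
  proof -
    have a: "(\<Sum>a<n. \<Sum>l<d. Y (Suc n) l * (\<rho> * Y a l)) = (\<Sum>l<d. Y (Suc n) l * (\<Sum>a<n. \<rho> * Y a l))"
      by (subst sum.swap) (simp add: sum_distrib_left)
    have b: "(\<Sum>l<d. ?H l Y * Y (Suc n) l) = Y 0 i * ((\<Sum>l<d. Y (Suc n) l * evB d l e \<rho> w Y)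
      + eval d e \<rho> w Y * (\<Sum>l<d. Y (Suc n) l * (\<Sum>a<n. \<rho> * Y a l)))"
      by (simp add: sum_distrib_left sum.distrib algebra_simps)
    have c: "(\<Sum>l<d. ?e0 Y * (\<rho> * Y n l) * Y (Suc n) l) = ?e0 Y * (\<Sum>l<d. Y (Suc n) l * (\<rho> * Y n l))"
      by (simp add: sum_distrib_left mult_ac)
    have E: "eval d (dd n e) \<rho> w Y = poly kap \<rho> * ((evA d e \<rho> w Y + (\<Sum>l<d. Y (Suc n) l * evB d l e \<rho> w Y))
      + eval d e \<rho> w Y * ((\<Sum>a<n. dA d \<rho> w (Y a)) + (\<Sum>l<d. Y (Suc n) l * (\<Sum>a<n. \<rho> * Y a l))
       - real n * dA d \<rho> w (Y n) - real n * (\<Sum>l<d. Y (Suc n) l * (\<rho> * Y n l))))"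
      unfolding dd_def eval.simps eval_der eval_sumE eval_tdiff a[symmetric]
      by (simp add: sum_distrib_left[symmetric] sum.distrib sum_subtractf) (simp add: algebra_simps)
    show ?thesis unfolding b c E by (simp add: algebra_simps)
  qed
  have bs1: "bd (Suc (Suc n)) (\<lambda>Y. \<Sum>l<d. ?H l Y * Y (Suc n) l)" by (intro bd_sum bH2) auto
  have bs2: "bd (Suc (Suc n)) (\<lambda>Y. \<Sum>l<d. ?e0 Y * (\<rho> * Y n l) * Y (Suc n) l)" by (intro bd_sum b0B2) auto
  have bF': "bd (Suc (Suc n)) ?F" by (rule bd_mono[OF bF]) auto
  have b0A': "bd (Suc (Suc n)) (\<lambda>Y. ?e0 Y * dA d \<rho> w (Y n))" by (rule bd_mono[OF b0A]) auto
  have "Av (n + 2) (\<lambda>Y. Y 0 i * eval d (dd n e) \<rho> w Y) \<rho> w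
     = poly kap \<rho> * (Av (Suc (Suc n)) ?F \<rho> w + Av (Suc (Suc n)) (\<lambda>Y. \<Sum>l<d. ?H l Y * Y (Suc n) l) \<rho> w
       - real n * Av (Suc (Suc n)) (\<lambda>Y. ?e0 Y * dA d \<rho> w (Y n)) \<rho> w
       - real n * Av (Suc (Suc n)) (\<lambda>Y. \<Sum>l<d. ?e0 Y * (\<rho> * Y n l) * Y (Suc n) l) \<rho> w)"
    unfolding ev Av_cmult add_2_eq_Suc'
    by (subst Av_diff Av_add; (intro bd_diff bd_add bd_cmult bs1 bs2 bF' b0A')?)+ (simp add: Av_cmult)
  also have "Av (Suc (Suc n)) (\<lambda>Y. \<Sum>l<d. ?H l Y * Y (Suc n) l) \<rho> w = (\<Sum>l<d. Av n (?H l) \<rho> w * pm (\<lambda>y. y l) \<rho> w)"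
    using bH2 2 by (subst Av_sum) auto
  also have "Av (Suc (Suc n)) (\<lambda>Y. \<Sum>l<d. ?e0 Y * (\<rho> * Y n l) * Y (Suc n) l) \<rho> w
    = (\<Sum>l<d. Av n ?e0 \<rho> w * pm (\<lambda>y. \<rho> * y l) \<rho> w * pm (\<lambda>y. y l) \<rho> w)"
    using b0B2 4 by (subst Av_sum) auto
  finally show ?thesis
    unfolding 1 3 GA_def GB_def
    by (simp add: algebra_simps sum_subtractf sum_distrib_left)
qed

end

section \<open>Iterates of the transport operator\<close>

text \<open>Since sg t rho t = exp(-t/2), the noised variable is \<open>sg t\<close> times rho t Y +
  G. This is why x is replaced by w = x / sg t throughout.\<close>

definition rho :: "real \<Rightarrow> real" where "rho t = 1 / sqrt (exp t - 1)"
definition sg :: "real \<Rightarrow> real" where "sg t = sqrt (1 - exp (- t))"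

lemma rho_pos: "t > 0 \<Longrightarrow> rho t > 0" by (simp add: rho_def)
lemma sg_pos: "t > 0 \<Longrightarrow> sg t > 0" by (simp add: sg_def)

lemma rho_sq: "t > 0 \<Longrightarrow> (rho t)\<^sup>2 = 1 / (exp t - 1)"
  by (simp add: rho_def power_divide)

lemma sg_sq: "t > 0 \<Longrightarrow> (sg t)\<^sup>2 = 1 - exp (- t)"
  by (simp add: sg_def)

lemma inv_sg_sq: "t > 0 \<Longrightarrow> 1 / (sg t)\<^sup>2 = 1 + (rho t)\<^sup>2"
  by (simp add: rho_sq sg_sq exp_minus field_simps)

lemma sg_rho: assumes "t > 0" shows "sg t * rho t = exp (- t / 2)"
proof -
  have "(sg t * rho t)\<^sup>2 = (exp (- t / 2))\<^sup>2"
    using assms by (simp add: power_mult_distrib rho_sq sg_sq exp_minus field_simps flip: exp_double)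
  then show ?thesis using sg_pos[OF assms] rho_pos[OF assms] by (simp add: power2_eq_iff_nonneg)
qed

text \<open>The score contains rho/sg times the posterior mean. By this identity half of that term
  is sg kap(rho) times the mean, so that \<open>w\<close> moves with velocity kap(rho) E[Y | w] in
  reversed time.\<close>

lemma sg_kap: assumes "t > 0" shows "2 * (sg t * poly kap (rho t)) = rho t / sg t"
proof -
  have "2 * (sg t * poly kap (rho t)) = sg t * rho t * (1 + (rho t)\<^sup>2)"
    by (simp add: poly_kap field_simps power3_eq_cube power2_eq_square)
  also have "\<dots> = sg t * rho t * (1 / (sg t)\<^sup>2)" using inv_sg_sq[OF assms] by simp
  also have "\<dots> = rho t / sg t" using sg_pos[OF assms] by (simp add: power2_eq_square)
  finally show ?thesis .
qed

lemma rho_deriv: assumes "t > 0" shows "(rho has_real_derivative - poly kap (rho t)) (at t)"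
proof -
  have e: "exp t - 1 > 0" using assms by simp
  have "((\<lambda>t. 1 / sqrt (exp t - 1)) has_real_derivative - (exp t * inverse (sqrt (exp t - 1)) / 2) / (sqrt (exp t - 1))\<^sup>2) (at t)"
    using e by (auto intro!: derivative_eq_intros simp: power2_eq_square)
  moreover have "- (exp t * inverse (sqrt (exp t - 1)) / 2) / (sqrt (exp t - 1))\<^sup>2 = - poly kap (rho t)"
  proof -
    have "poly kap (rho t) = rho t * (1 + (rho t)\<^sup>2) / 2"
      by (simp add: poly_kap power3_eq_cube power2_eq_square algebra_simps)
    also have "1 + (rho t)\<^sup>2 = exp t / (exp t - 1)" using e by (simp add: rho_sq[OF assms] field_simps)
    finally show ?thesis using e by (simp add: rho_def field_simps)
  qed
  ultimately show ?thesis by (simp add: rho_def[abs_def])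
qed

lemma sg_deriv: assumes "t > 0" shows "(sg has_real_derivative sg t * (rho t)\<^sup>2 / 2) (at t)"
proof -
  have e: "1 - exp (- t) > 0" using assms by simp
  have "((\<lambda>t. sqrt (1 - exp (- t))) has_real_derivative exp (- t) * inverse (sqrt (1 - exp (- t))) / 2) (at t)"
    using e by (auto intro!: derivative_eq_intros)
  moreover have "exp (- t) * inverse (sqrt (1 - exp (- t))) / 2 = sg t * (rho t)\<^sup>2 / 2"
  proof -
    have "(rho t)\<^sup>2 = exp (- t) / (1 - exp (- t))"
      using assms by (simp add: rho_sq exp_minus field_simps)
    moreover have "sg t * (1 / (1 - exp (- t))) = inverse (sqrt (1 - exp (- t)))"
      using e real_sqrt_pow2[of "1 - exp (- t)"] by (simp add: sg_def field_simps power2_eq_square)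
    ultimately show ?thesis by (metis (no_types, lifting) mult.commute mult.left_commute times_divide_eq_right mult_1_right)
  qed
  ultimately show ?thesis by (simp add: sg_def[abs_def])
qed

text \<open>The coefficient of x in L^j x. In the recursion, -d/dt acting on alp_j(rho) gives alp_j'
  kap, and half of the linear part -rho^2 x of \<open>shat\<close> gives the subtracted
  term.\<close>

primrec alp :: "nat \<Rightarrow> real poly" where
  "alp 0 = 1"
| "alp (Suc j) = pderiv (alp j) * kap - [:0, 0, 1/2:] * alp j"

text \<open>The replica polynomial in L^j x. Besides \<open>dd\<close> there are two terms: 1/2 +
  rho^2 is the logarithmic derivative of sg kap(rho) in reversed time, and alp_j arises when the
  posterior mean in the drift acts on alp_j(rho) x. Each step adds two replicas, hence 2 j + 1 of
  them.\<close>

primrec eps :: "nat \<Rightarrow> ex" where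
  "eps 0 = Pl 0"
| "eps (Suc j) = Ad (dd (2 * j + 1) (eps j)) (Ad (Mu (Pl [:1/2, 0, 1:]) (eps j)) (Pl (alp j)))"

lemma fits_eps: "fits (2 * j + 1) (eps j)"
proof (induction j)
  case (Suc j)
  then show ?case using fits_dd[OF Suc] fits_mono[OF Suc, of "2 * Suc j + 1"] by simp
qed simp

context bounded_prior
begin

lemma Av_mono_n: assumes "bd n f" "n \<le> m" shows "Av m f \<rho> w = Av n f \<rho> w"
  using assms(2)
proof (induction m rule: dec_induct)
  case (step k)
  then show ?case using Av_extend[OF bd_mono[OF assms(1), of k]] by simp
qed simp

lemma Av_component: assumes "i < d" "1 \<le> n" shows "Av n (\<lambda>Y. Y 0 i) \<rho> w = pm (\<lambda>y. y i) \<rho> w"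
  using Av_mono_n[OF bd_component[of 0 1 i], of n] Av_1[of "\<lambda>y. y i" R \<rho> w] assms abs_component_le by simp

text \<open>
  The closed form of \<open>L\<^sup>j x\<close>.
\<close>

definition Vf :: "nat \<Rightarrow> real \<Rightarrow> (nat \<Rightarrow> real) \<Rightarrow> nat \<Rightarrow> real" where
  "Vf j t x i = poly (alp j) (rho t) * x i + sg t * poly kap (rho t) *
     Av (2 * j + 1) (\<lambda>Y. Y 0 i * eval d (eps j) (rho t) (\<lambda>l. x l / sg t) Y) (rho t) (\<lambda>l. x l / sg t)"

text \<open>The closed form of \<open>shat\<close> (\<open>shat_eq\<close>); the linear coefficient
  is 1 - 1/sg^2 = -rho^2.\<close>

definition sh :: "real \<Rightarrow> (nat \<Rightarrow> real) \<Rightarrow> nat \<Rightarrow> real" where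
  "sh t x l = - (rho t)\<^sup>2 * x l + 2 * (sg t * poly kap (rho t)) * pm (\<lambda>y. y l) (rho t) (\<lambda>l. x l / sg t)"

text \<open>The time derivative of \<open>Vf\<close> at fixed x. The last sum comes from the motion
  of w = x / sg t, whose time derivative is -rho^2/2 w. \<open>VB\<close> is the partial derivative
  in x_l.\<close>

definition VA :: "nat \<Rightarrow> nat \<Rightarrow> real \<Rightarrow> (nat \<Rightarrow> real) \<Rightarrow> real" where
  "VA j i t x = (let \<rho> = rho t; w = (\<lambda>l. x l / sg t); n = 2 * j + 1; e = eps j; c = sg t * poly kap \<rho> in
     - (poly (pderiv (alp j)) \<rho> * poly kap \<rho>) * x i
     - (1/2 + \<rho>\<^sup>2) * c * Av n (\<lambda>Y. Y 0 i * eval d e \<rho> w Y) \<rho> w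
     + c * (- (poly kap \<rho> * GA n i e \<rho> w) - \<rho>\<^sup>2 / 2 * (\<Sum>l<d. w l * GB n i e l \<rho> w)))"

definition VB :: "nat \<Rightarrow> nat \<Rightarrow> nat \<Rightarrow> real \<Rightarrow> (nat \<Rightarrow> real) \<Rightarrow> real" where
  "VB j i l t x = (let \<rho> = rho t; w = (\<lambda>l. x l / sg t); n = 2 * j + 1; e = eps j; c = sg t * poly kap \<rho> in
     (if l = i then poly (alp j) \<rho> else 0) + c * (GB n i e l \<rho> w / sg t))"

text \<open>The terms with rho^2/2 w from the time derivative and from the linear part of the drift
  cancel. What remains is \<open>w\<close> moving with velocity kap(rho) times the posterior mean,
  which is the situation of \<open>Av_dd\<close>.\<close>

lemma Vf_Suc:
  assumes t: "t > 0" and i: "i < d"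
  shows "- VA j i t x + 1/2 * (\<Sum>l<d. sh t x l * VB j i l t x) = Vf (Suc j) t x i"
proof -
  let ?r = "rho t" and ?w = "\<lambda>l. x l / sg t" and ?n = "2 * j + 1"
  let ?k = "poly kap (rho t)"
  let ?c = "sg t * ?k"
  let ?m = "\<lambda>l. pm (\<lambda>y. y l) ?r ?w"
  let ?G = "\<lambda>l. GB ?n i (eps j) l ?r ?w"
  let ?e0 = "\<lambda>Y. Y 0 i * eval d (eps j) ?r ?w Y"
  have fe: "fits ?n (eps j)" by (rule fits_eps)
  have be0: "bd ?n ?e0" by (intro bd_mult bd_component bd_eval fe i) auto
  have bdd: "bd (?n + 2) (\<lambda>Y. Y 0 i * eval d (dd ?n (eps j)) ?r ?w Y)"
    by (intro bd_mult bd_component bd_eval fits_dd fe i) auto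
  have be0': "bd (?n + 2) ?e0" by (rule bd_mono[OF be0]) simp
  have bi: "bd (?n + 2) (\<lambda>Y. Y 0 i)" by (intro bd_component i) auto
  have "Av (?n + 2) (\<lambda>Y. Y 0 i * eval d (eps (Suc j)) ?r ?w Y) ?r ?w
    = Av (?n + 2) (\<lambda>Y. Y 0 i * eval d (dd ?n (eps j)) ?r ?w Y + ((1/2 + ?r\<^sup>2) * ?e0 Y + poly (alp j) ?r * Y 0 i)) ?r ?w"
    by (rule arg_cong[where f = "\<lambda>f. Av (?n + 2) f ?r ?w"]) (auto simp: algebra_simps power2_eq_square)
  also have "\<dots> = Av (?n + 2) (\<lambda>Y. Y 0 i * eval d (dd ?n (eps j)) ?r ?w Y) ?r ?w
      + ((1/2 + ?r\<^sup>2) * Av (?n + 2) ?e0 ?r ?w + poly (alp j) ?r * Av (?n + 2) (\<lambda>Y. Y 0 i) ?r ?w)"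
    by (simp only: Av_add[OF bdd bd_add[OF bd_cmult[OF be0'] bd_cmult[OF bi]]]
        Av_add[OF bd_cmult[OF be0'] bd_cmult[OF bi]] Av_cmult)
  also have "Av (?n + 2) ?e0 ?r ?w = Av ?n ?e0 ?r ?w" by (rule Av_mono_n[OF be0]) simp
  also have "Av (?n + 2) (\<lambda>Y. Y 0 i) ?r ?w = ?m i" by (rule Av_component[OF i]) simp
  also have "Av (?n + 2) (\<lambda>Y. Y 0 i * eval d (dd ?n (eps j)) ?r ?w Y) ?r ?w
      = ?k * (GA ?n i (eps j) ?r ?w + (\<Sum>l<d. ?m l * ?G l))"
    by (rule Av_dd[OF fe _ i]) simp
  finally have V: "Vf (Suc j) t x i = poly (alp (Suc j)) ?r * x i + ?c * (?k * (GA ?n i (eps j) ?r ?w + (\<Sum>l<d. ?m l * ?G l))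
      + ((1/2 + ?r\<^sup>2) * Av ?n ?e0 ?r ?w + poly (alp j) ?r * ?m i))"
    by (simp add: Vf_def)
  have s1: "sh t x l * (?c * (?G l / sg t)) = ?c * (- ?r\<^sup>2 * (?w l * ?G l)) + ?c * (2 * ?k * (?m l * ?G l))" for l
    using sg_pos[OF t] by (simp add: sh_def field_simps)
  have "(\<Sum>l<d. sh t x l * VB j i l t x)
     = (\<Sum>l<d. sh t x l * (if l = i then poly (alp j) ?r else 0)) + (\<Sum>l<d. sh t x l * (?c * (?G l / sg t)))"
    by (simp add: VB_def Let_def distrib_left sum.distrib)
  also have "(\<Sum>l<d. sh t x l * (if l = i then poly (alp j) ?r else 0)) = sh t x i * poly (alp j) ?r"
    using i by (simp add: if_distrib[of "\<lambda>z. _ * z"] cong: if_cong)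
  also have "(\<Sum>l<d. sh t x l * (?c * (?G l / sg t))) = ?c * (- ?r\<^sup>2 * (\<Sum>l<d. ?w l * ?G l)) + ?c * (2 * ?k * (\<Sum>l<d. ?m l * ?G l))"
    unfolding s1 sum.distrib sum_distrib_left ..
  finally have S: "(\<Sum>l<d. sh t x l * VB j i l t x) = sh t x i * poly (alp j) ?r
    + (?c * (- ?r\<^sup>2 * (\<Sum>l<d. ?w l * ?G l)) + ?c * (2 * ?k * (\<Sum>l<d. ?m l * ?G l)))" .
  show ?thesis
    unfolding S unfolding V VA_def Let_def sh_def by (simp add: algebra_simps power2_eq_square)
qed

text \<open>The chain rule along an arbitrary curve in (t, x). Special curves give
  \<open>deriv_Vf\<close>, \<open>partial_Vf\<close> and \<open>flow_Vf_deriv\<close>.\<close>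

lemma Vf_curve:
  assumes S: "open S" "s \<in> S" and pos: "\<tau> s > 0"
    and D\<tau>: "(\<tau> has_real_derivative \<tau>') (at s)" and D\<xi>: "\<And>l. l < d \<Longrightarrow> ((\<lambda>s. \<xi> s l) has_real_derivative \<xi>' l) (at s)"
    and c: "curve_on S (\<lambda>s. rho (\<tau> s)) \<rho>' (\<lambda>s l. \<xi> s l / sg (\<tau> s)) w'" and i: "i < d"
  shows "((\<lambda>s. Vf j (\<tau> s) (\<xi> s) i) has_real_derivative
    \<tau>' * VA j i (\<tau> s) (\<xi> s) + (\<Sum>l<d. \<xi>' l * VB j i l (\<tau> s) (\<xi> s))) (at s)"
proof -
  let ?r = "rho (\<tau> s)" and ?w = "\<lambda>l. \<xi> s l / sg (\<tau> s)" and ?n = "2 * j + 1"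
  let ?k = "poly kap ?r"
  let ?A = "\<lambda>s. Av ?n (\<lambda>Y. Y 0 i * eval d (eps j) (rho (\<tau> s)) (\<lambda>l. \<xi> s l / sg (\<tau> s)) Y) (rho (\<tau> s)) (\<lambda>l. \<xi> s l / sg (\<tau> s))"
  have sp: "sg (\<tau> s) > 0" by (rule sg_pos[OF pos])
  have Dr: "((\<lambda>s. rho (\<tau> s)) has_real_derivative - ?k * \<tau>') (at s)"
    by (rule DERIV_chain2[OF rho_deriv[OF pos] D\<tau>])
  have Ds: "((\<lambda>s. sg (\<tau> s)) has_real_derivative sg (\<tau> s) * ?r\<^sup>2 / 2 * \<tau>') (at s)"
    by (rule DERIV_chain2[OF sg_deriv[OF pos] D\<tau>])
  have Dw: "((\<lambda>s. \<xi> s l / sg (\<tau> s)) has_real_derivative (\<xi>' l / sg (\<tau> s) - ?r\<^sup>2 / 2 * \<tau>' * ?w l)) (at s)" if l: "l < d" for l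
  proof -
    have "((\<lambda>s. \<xi> s l / sg (\<tau> s)) has_real_derivative
      (\<xi>' l * sg (\<tau> s) - \<xi> s l * (sg (\<tau> s) * ?r\<^sup>2 / 2 * \<tau>')) / (sg (\<tau> s) * sg (\<tau> s))) (at s)"
      by (rule DERIV_divide[OF D\<xi>[OF l] Ds]) (use sp in simp)
    moreover have "(\<xi>' l * sg (\<tau> s) - \<xi> s l * (sg (\<tau> s) * ?r\<^sup>2 / 2 * \<tau>')) / (sg (\<tau> s) * sg (\<tau> s))
      = \<xi>' l / sg (\<tau> s) - ?r\<^sup>2 / 2 * \<tau>' * ?w l" using sp by (simp add: field_simps)
    ultimately show ?thesis by simp
  qed
  \<comment> \<open>The velocities \<open>\<rho>'\<close> and \<open>w'\<close> are parameters of
    \<open>curve_on\<close>; uniqueness of derivatives identifies them with those computed from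
    \<open>\<tau>\<close> and \<open>\<xi>\<close>.\<close>
  have r': "\<rho>' s = - ?k * \<tau>'"
    using c S(2) by (intro DERIV_unique[OF _ Dr]) (auto simp: curve_on_def)
  have w': "w' s l = \<xi>' l / sg (\<tau> s) - ?r\<^sup>2 / 2 * \<tau>' * ?w l" if l: "l < d" for l
    using c S(2) l by (intro DERIV_unique[OF _ Dw[OF l]]) (auto simp: curve_on_def)
  have DA: "(?A has_real_derivative (- ?k * \<tau>') * GA ?n i (eps j) ?r ?w + (\<Sum>l<d. (\<xi>' l / sg (\<tau> s) - ?r\<^sup>2 / 2 * \<tau>' * ?w l) * GB ?n i (eps j) l ?r ?w)) (at s)"
    using Av_eval_deriv[OF c S fits_eps _ i, of j] w' unfolding r' by simp
  have Dk: "((\<lambda>s. poly kap (rho (\<tau> s))) has_real_derivative poly (pderiv kap) ?r * (- ?k * \<tau>')) (at s)"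
    by (rule DERIV_chain2[OF poly_DERIV Dr])
  have Dc: "((\<lambda>s. sg (\<tau> s) * poly kap (rho (\<tau> s))) has_real_derivative - (1/2 + ?r\<^sup>2) * (sg (\<tau> s) * ?k) * \<tau>') (at s)"
  proof -
    have "((\<lambda>s. sg (\<tau> s) * poly kap (rho (\<tau> s))) has_real_derivative
      sg (\<tau> s) * ?r\<^sup>2 / 2 * \<tau>' * ?k + poly (pderiv kap) ?r * (- ?k * \<tau>') * sg (\<tau> s)) (at s)"
      by (rule DERIV_mult[OF Ds Dk])
    moreover have "poly (pderiv kap) ?r = 1/2 + 3/2 * ?r\<^sup>2"
      by (simp add: kap_def pderiv_pCons power2_eq_square algebra_simps)
    ultimately show ?thesis by (simp add: algebra_simps)
  qed
  have Da: "((\<lambda>s. poly (alp j) (rho (\<tau> s))) has_real_derivative poly (pderiv (alp j)) ?r * (- ?k * \<tau>')) (at s)"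
    by (rule DERIV_chain2[OF poly_DERIV Dr])
  have V: "((\<lambda>s. Vf j (\<tau> s) (\<xi> s) i) has_real_derivative
      (poly (pderiv (alp j)) ?r * (- ?k * \<tau>') * \<xi> s i + \<xi>' i * poly (alp j) ?r) +
      (- (1/2 + ?r\<^sup>2) * (sg (\<tau> s) * ?k) * \<tau>' * ?A s +
       ((- ?k * \<tau>') * GA ?n i (eps j) ?r ?w + (\<Sum>l<d. (\<xi>' l / sg (\<tau> s) - ?r\<^sup>2 / 2 * \<tau>' * ?w l) * GB ?n i (eps j) l ?r ?w)) * (sg (\<tau> s) * ?k))) (at s)"
    unfolding Vf_def by (rule DERIV_add[OF DERIV_mult[OF Da D\<xi>[OF i]] DERIV_mult[OF Dc DA]])
  have G: "(\<Sum>l<d. (\<xi>' l / sg (\<tau> s) - ?r\<^sup>2 / 2 * \<tau>' * ?w l) * GB ?n i (eps j) l ?r ?w)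
    = (\<Sum>l<d. \<xi>' l * (GB ?n i (eps j) l ?r ?w / sg (\<tau> s))) - ?r\<^sup>2 / 2 * \<tau>' * (\<Sum>l<d. ?w l * GB ?n i (eps j) l ?r ?w)"
    by (simp add: sum_distrib_left sum_subtractf[symmetric] algebra_simps)
  have B: "(\<Sum>l<d. \<xi>' l * VB j i l (\<tau> s) (\<xi> s)) = \<xi>' i * poly (alp j) ?r
    + sg (\<tau> s) * ?k * (\<Sum>l<d. \<xi>' l * (GB ?n i (eps j) l ?r ?w / sg (\<tau> s)))"
  proof -
    have "(\<Sum>l<d. \<xi>' l * VB j i l (\<tau> s) (\<xi> s)) = (\<Sum>l<d. \<xi>' l * (if l = i then poly (alp j) ?r else 0))
      + (\<Sum>l<d. \<xi>' l * (sg (\<tau> s) * ?k * (GB ?n i (eps j) l ?r ?w / sg (\<tau> s))))"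
      by (simp only: VB_def Let_def distrib_left sum.distrib)
    also have "(\<Sum>l<d. \<xi>' l * (if l = i then poly (alp j) ?r else 0)) = \<xi>' i * poly (alp j) ?r"
      using i by (simp add: if_distrib[of "\<lambda>z. _ * z"] cong: if_cong)
    also have "(\<Sum>l<d. \<xi>' l * (sg (\<tau> s) * ?k * (GB ?n i (eps j) l ?r ?w / sg (\<tau> s))))
      = sg (\<tau> s) * ?k * (\<Sum>l<d. \<xi>' l * (GB ?n i (eps j) l ?r ?w / sg (\<tau> s)))"
      by (simp only: sum_distrib_left mult.left_commute[of "\<xi>' _"])
    finally show ?thesis .
  qed
  show ?thesis
    using V unfolding G B VA_def Let_def
    by (elim back_subst[where P = "\<lambda>x. (_ has_real_derivative x) (at s)"]) (simp only: field_simps, simp add: algebra_simps)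
qed

end

section \<open>Identification of the closed form with the operator of the scheme\<close>

context bounded_prior
begin

lemma pm_bound:
  assumes "l < d" shows "\<bar>pm (\<lambda>y. y l) \<rho> w\<bar> \<le> R"
proof -
  have b: "bd 1 (\<lambda>Y. Y 0 l)" by (rule bd_component[OF _ assms]) simp
  have "\<bar>Av 1 (\<lambda>Y. Y 0 l) \<rho> w\<bar> \<le> Av 1 (\<lambda>Y. \<bar>Y 0 l\<bar>) \<rho> w" by (rule Av_abs_le[OF b])
  also have "\<dots> \<le> Av 1 (\<lambda>Y. R) \<rho> w"
    by (rule Av_mono[OF bd_abs[OF b] bd_const]) (use abs_component_le assms in \<open>auto simp: gs_def\<close>)
  finally show ?thesis using Av_component[OF assms, of 1 \<rho> w] by (simp add: Av_const)
qed

lemma pm_cmult: "pm (\<lambda>y. c * g y) \<rho> w = c * pm g \<rho> w"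
  by (simp add: pm_def mult.assoc)

text \<open>Completing the square in each coordinate separates a Gaussian in x from the normaliser
  \<open>Zf\<close> at (rho t, x / sg t).\<close>

lemma noised_density_eq:
  assumes t: "t > 0"
  shows "noised_density d P t x =
    (1 / sqrt (2 * pi * (sg t)\<^sup>2)) ^ d * exp (- dot d x x / (2 * (sg t)\<^sup>2)) * Zf (rho t) (\<lambda>l. x l / sg t)"
proof -
  let ?s = "sg t" and ?r = "rho t" and ?c = "1 / sqrt (2 * pi * (sg t)\<^sup>2)"
  have s: "?s > 0" by (rule sg_pos[OF t])
  have "(\<Prod>i<d. normal_density (exp (- t / 2) * y i) (sqrt (1 - exp (- t))) (x i))
    = ?c ^ d * exp (- dot d x x / (2 * ?s\<^sup>2)) * Efac d ?r (\<lambda>l. x l / ?s) y" for y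
  proof -
    have one: "normal_density (exp (- t / 2) * y i) (sqrt (1 - exp (- t))) (x i)
      = ?c * exp (- (x i * x i) / (2 * ?s\<^sup>2) + (?r * (x i / ?s * y i) - ?r\<^sup>2 / 2 * (y i * y i)))" for i
    proof -
      have "- (x i - ?s * ?r * y i)\<^sup>2 / (2 * ?s\<^sup>2) = - (x i * x i) / (2 * ?s\<^sup>2) + (?r * (x i / ?s * y i) - ?r\<^sup>2 / 2 * (y i * y i))"
        using s by (simp add: field_simps power2_eq_square)
      then show ?thesis
        unfolding normal_density_def sg_rho[OF t, symmetric] sg_def[symmetric] by simp
    qed
    have "(\<Sum>i<d. - (x i * x i) / (2 * ?s\<^sup>2) + (?r * (x i / ?s * y i) - ?r\<^sup>2 / 2 * (y i * y i)))
      = - dot d x x / (2 * ?s\<^sup>2) + (?r * dot d (\<lambda>l. x l / ?s) y - ?r\<^sup>2 / 2 * dot d y y)"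
      by (simp add: dot_def sum.distrib sum_subtractf sum_distrib_left sum_divide_distrib sum_negf)
    then have E: "exp (\<Sum>i<d. - (x i * x i) / (2 * ?s\<^sup>2) + (?r * (x i / ?s * y i) - ?r\<^sup>2 / 2 * (y i * y i)))
      = exp (- dot d x x / (2 * ?s\<^sup>2)) * Efac d ?r (\<lambda>l. x l / ?s) y"
      by (simp only: exp_add Efac_def)
    show ?thesis
      unfolding one prod.distrib exp_sum[symmetric, OF finite_lessThan] E by simp
  qed
  then show ?thesis unfolding noised_density_def Zf_def by simp
qed

text \<open>Tweedie's formula: the logarithmic derivative of the normaliser is a posterior
  mean.\<close>

lemma partial_ln_noised_density:
  assumes t: "t > 0" and k: "k < d"
  shows "partial k (\<lambda>y. ln (noised_density d P t y)) x
    = - x k / (sg t)\<^sup>2 + rho t / sg t * pm (\<lambda>y. y k) (rho t) (\<lambda>l. x l / sg t)"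
proof -
  let ?s = "sg t" and ?r = "rho t" and ?c = "1 / sqrt (2 * pi * (sg t)\<^sup>2)"
  let ?w = "\<lambda>s l. (x(k := s)) l / ?s" and ?w' = "\<lambda>s l. if l = k then 1 / ?s else 0"
  have s: "?s > 0" by (rule sg_pos[OF t])
  have c: "?c > 0" using s by simp
  have "\<exists>S'. open S' \<and> x k \<in> S' \<and> curve_on S' (\<lambda>_. ?r) (\<lambda>_. 0) ?w ?w'"
  proof (rule curve_on_C1[where S = UNIV])
    fix q l assume "l < d"
    show "((\<lambda>s. (x(k := s)) l / ?s) has_real_derivative (if l = k then 1 / ?s else 0)) (at q)"
      by (cases "l = k") (use s in \<open>auto intro!: derivative_eq_intros\<close>)
  qed auto
  then obtain S where S: "open S" "x k \<in> S" "curve_on S (\<lambda>_. ?r) (\<lambda>_. 0) ?w ?w'" by blast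
  have "dE ?r 0 (?w (x k)) (?w' (x k)) = (\<lambda>y. (?r / ?s) * y k)"
  proof
    fix y
    have "dot d (?w' (x k)) y = (\<Sum>l<d. if l = k then y l / ?s else 0)"
      unfolding dot_def by (rule sum.cong) auto
    then show "dE ?r 0 (?w (x k)) (?w' (x k)) y = (?r / ?s) * y k" using k by (simp add: dE_def)
  qed
  then have "pm (dE ?r 0 (?w (x k)) (?w' (x k))) ?r (?w (x k)) = ?r / ?s * pm (\<lambda>y. y k) ?r (\<lambda>l. x l / ?s)"
    by (simp only: pm_cmult fun_upd_triv)
  then have DZ: "((\<lambda>s. Zf ?r (?w s)) has_real_derivative ?r / ?s * pm (\<lambda>y. y k) ?r (\<lambda>l. x l / ?s) * Zf ?r (\<lambda>l. x l / ?s)) (at (x k))"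
    using Zf_deriv[OF S(3,1,2)] by simp
  have Zp: "Zf ?r (\<lambda>l. x l / ?s) > 0" by (rule Zf_pos)
  have DlnZ: "((\<lambda>s. ln (Zf ?r (?w s))) has_real_derivative ?r / ?s * pm (\<lambda>y. y k) ?r (\<lambda>l. x l / ?s)) (at (x k))"
  proof -
    let ?Z = "Zf ?r (\<lambda>l. x l / ?s)" and ?A = "?r / ?s * pm (\<lambda>y. y k) ?r (\<lambda>l. x l / ?s)"
    have "((\<lambda>s. ln (Zf ?r (?w s))) has_real_derivative inverse ?Z * (?A * ?Z)) (at (x k))"
      using DERIV_chain2[OF DERIV_ln, of "\<lambda>s. Zf ?r (?w s)", OF _ DZ] Zp by simp
    moreover have "inverse ?Z * (?A * ?Z) = ?A" using Zp by simp
    ultimately show ?thesis by (simp only:)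
  qed
  have dots: "dot d (x(k := s)) (x(k := s)) = (\<Sum>i\<in>{..<d}-{k}. x i * x i) + s * s" for s
    unfolding dot_def using k by (subst sum.remove[of _ k]) (auto intro!: sum.cong)
  have "((\<lambda>s. - dot d (x(k := s)) (x(k := s)) / (2 * ?s\<^sup>2)) has_real_derivative - x k / ?s\<^sup>2) (at (x k))"
    unfolding dots using s by (auto intro!: derivative_eq_intros simp: field_simps)
  then have D: "((\<lambda>s. ln (?c ^ d) + (- dot d (x(k := s)) (x(k := s)) / (2 * ?s\<^sup>2)) + ln (Zf ?r (?w s))) has_real_derivative
     0 + (- x k / ?s\<^sup>2) + ?r / ?s * pm (\<lambda>y. y k) ?r (\<lambda>l. x l / ?s)) (at (x k))"
    by (intro DERIV_add DlnZ DERIV_const)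
  have "ln (noised_density d P t (x(k := s))) = ln (?c ^ d) + (- dot d (x(k := s)) (x(k := s)) / (2 * ?s\<^sup>2)) + ln (Zf ?r (?w s))" for s
    unfolding noised_density_eq[OF t] using c Zf_pos[of ?r "?w s"]
    by (subst ln_mult_pos ln_mult; simp)+
  then show ?thesis
    unfolding partial_def using DERIV_imp_deriv[OF D] by simp
qed

lemma shat_eq: assumes "t > 0" "k < d" shows "shat d P t x k = sh t x k"
proof -
  have "- x k / (sg t)\<^sup>2 = - (x k * (1 / (sg t)\<^sup>2))" by simp
  then show ?thesis
    using assms unfolding shat_def sh_def sg_kap[OF assms(1)]
    by (simp only: partial_ln_noised_density inv_sg_sq restrict_apply' lessThan_iff) (simp add: algebra_simps)
qed

lemma deriv_Vf:
  assumes t: "t > 0" and i: "i < d"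
  shows "((\<lambda>s. Vf j s x i) has_real_derivative VA j i t x) (at t)"
proof -
  let ?w' = "\<lambda>s l. - (x l * (sg s * (rho s)\<^sup>2 / 2)) / (sg s * sg s)"
  have cr: "continuous_on {0<..} rho" "continuous_on {0<..} sg"
    by (rule DERIV_continuous_on, rule has_field_derivative_at_within, rule rho_deriv, simp)
      (rule DERIV_continuous_on, rule has_field_derivative_at_within, rule sg_deriv, simp)
  have "\<exists>S'. open S' \<and> t \<in> S' \<and> curve_on S' rho (\<lambda>s. - poly kap (rho s)) (\<lambda>s l. x l / sg s) ?w'"
  proof (rule curve_on_C1[where S = "{0<..}"])
    fix q l :: real assume q: "q \<in> {0<..}"
    show "(rho has_real_derivative - poly kap (rho q)) (at q)" using q by (intro rho_deriv) simp
  next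
    fix q :: real and l :: nat assume q: "q \<in> {0<..}"
    have sq: "sg q > 0" using q by (simp add: sg_pos)
    have "((\<lambda>s. x l / sg s) has_real_derivative (0 * sg q - x l * (sg q * (rho q)\<^sup>2 / 2)) / (sg q * sg q)) (at q)"
      by (rule DERIV_divide[OF DERIV_const sg_deriv]) (use q sq in auto)
    then show "((\<lambda>s. x l / sg s) has_real_derivative ?w' q l) (at q)" by simp
  next
    show "continuous_on {0<..} (\<lambda>s. - poly kap (rho s))" by (rule continuous_on_minus[OF continuous_on_poly[OF cr(1)]])
    fix l
    have "continuous_on {0<..} (\<lambda>s. sg s * (rho s)\<^sup>2 / 2)"
      by (rule continuous_on_divide[OF continuous_on_mult[OF cr(2) continuous_on_power[OF cr(1)]] continuous_on_const]) simp
    note n = continuous_on_minus[OF continuous_on_mult[OF continuous_on_const this, of "x l"]]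
    show "continuous_on {0<..} (\<lambda>s. ?w' s l)"
      by (rule continuous_on_divide[OF n continuous_on_mult[OF cr(2) cr(2)]]) (auto dest: sg_pos)
  qed (use t in auto)
  then obtain S where S: "open S" "t \<in> S" "curve_on S rho (\<lambda>s. - poly kap (rho s)) (\<lambda>s l. x l / sg s) ?w'" by blast
  have "((\<lambda>s. Vf j s x i) has_real_derivative 1 * VA j i t x + (\<Sum>l<d. 0 * VB j i l t x)) (at t)"
    by (rule Vf_curve[where \<tau> = "\<lambda>s. s" and \<xi> = "\<lambda>s. x", OF S(1,2) t DERIV_ident DERIV_const S(3) i])
  then show ?thesis by simp
qed

lemma partial_Vf:
  assumes t: "t > 0" and i: "i < d" and k: "k < d"
  shows "partial k (\<lambda>y. Vf j t y i) x = VB j i k t x"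
proof -
  let ?w = "\<lambda>s l. (x(k := s)) l / sg t" and ?w' = "\<lambda>s l. if l = k then 1 / sg t else 0"
  have s: "sg t > 0" by (rule sg_pos[OF t])
  have "\<exists>S'. open S' \<and> x k \<in> S' \<and> curve_on S' (\<lambda>_. rho t) (\<lambda>_. 0) ?w ?w'"
  proof (rule curve_on_C1[where S = UNIV])
    fix q l assume "l < d"
    show "((\<lambda>s. (x(k := s)) l / sg t) has_real_derivative (if l = k then 1 / sg t else 0)) (at q)"
      by (cases "l = k") (use s in \<open>auto intro!: derivative_eq_intros\<close>)
  qed auto
  then obtain S where S: "open S" "x k \<in> S" "curve_on S (\<lambda>_. rho t) (\<lambda>_. 0) ?w ?w'" by blast
  have "((\<lambda>s. Vf j t (x(k := s)) i) has_real_derivative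
      0 * VA j i t (x(k := x k)) + (\<Sum>l<d. (if l = k then 1 else 0) * VB j i l t (x(k := x k)))) (at (x k))"
  proof (rule Vf_curve[where \<tau> = "\<lambda>s. t" and \<xi> = "\<lambda>s. x(k := s)", OF S(1,2) t DERIV_const _ S(3) i])
    fix l assume "l < d"
    show "((\<lambda>s. (x(k := s)) l) has_real_derivative (if l = k then 1 else 0)) (at (x k))"
      by (cases "l = k") (auto intro!: derivative_eq_intros)
  qed
  also have "0 * VA j i t (x(k := x k)) + (\<Sum>l<d. (if l = k then 1 else 0) * VB j i l t (x(k := x k))) = VB j i k t x"
    using k by (simp add: if_distrib[of "\<lambda>z. z * _"] cong: if_cong)
  finally show ?thesis unfolding partial_def by (rule DERIV_imp_deriv)
qed

lemma L_op_iterate: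
  assumes "t > 0" "i < d" shows "(L_op d P ^^ j) (\<lambda>t x. x) t x i = Vf j t x i"
  using assms
proof (induction j arbitrary: t x i)
  case 0
  have "Av 1 (\<lambda>Y. 0) \<rho> w = 0" for \<rho> w by (rule Av_const)
  then show ?case by (simp add: Vf_def)
next
  case (Suc j)
  let ?v = "(L_op d P ^^ j) (\<lambda>t x. x)"
  \<comment> \<open>\<open>deriv\<close> in time sees a neighbourhood of \<open>t\<close>, so the
    induction hypothesis is used at all positive times near \<open>t\<close>.\<close>
  have ev: "\<forall>\<^sub>F s in nhds t. ?v s x i = Vf j s x i"
    using Suc.prems by (intro eventually_mono[OF eventually_nhds_in_open[of "{0<..}" t]]) (auto intro!: Suc.IH)
  have 1: "deriv (\<lambda>s. ?v s x i) t = VA j i t x"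
    unfolding deriv_cong_ev[OF ev refl] by (rule DERIV_imp_deriv[OF deriv_Vf[OF Suc.prems]])
  have 2: "partial k (\<lambda>y. ?v t y i) x = VB j i k t x" if "k < d" for k
    using partial_Vf[OF Suc.prems that, of j x] Suc.IH[OF Suc.prems] by simp
  have "(L_op d P ^^ Suc j) (\<lambda>t x. x) t x i = - VA j i t x + 1/2 * (\<Sum>k<d. sh t x k * VB j i k t x)"
    using Suc.prems by (simp add: L_op_def 1 2 shat_eq)
  then show ?case using Vf_Suc[OF Suc.prems, of j x] by simp
qed

text \<open>The identity part of the step is the term m = 0, so that the step is the Taylor
  polynomial of the flow.\<close>

lemma taylor_step_eq:
  assumes "T - u > 0" "i < d"
  shows "taylor_step d P p T h u x i = (\<Sum>m<Suc p. Vf m (T - u) x i / fact m * h ^ m)"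
proof -
  have "Vf 0 (T - u) x i = x i" using L_op_iterate[OF assms, of 0] by simp
  then have "(\<Sum>m<Suc p. Vf m (T - u) x i / fact m * h ^ m) = x i + (\<Sum>m\<in>{1..p}. Vf m (T - u) x i / fact m * h ^ m)"
    by (simp add: lessThan_Suc_atMost atMost_atLeast0 sum.atLeast_Suc_atMost del: sum.lessThan_Suc)
  then show ?thesis using assms by (simp add: taylor_step_def L_op_iterate mult.commute del: sum.lessThan_Suc)
qed

text \<open>The probability flow \<open>dw/d\<rho> = E[Y | \<rho> Y + G = w]\<close> in signal-to-noise time.\<close>

definition flow :: "(real \<Rightarrow> nat \<Rightarrow> real) \<Rightarrow> real \<Rightarrow> real \<Rightarrow> bool" where
  "flow w a b \<longleftrightarrow> (\<forall>r\<in>{a..b}. \<forall>l<d. ((\<lambda>r. w r l) has_real_derivative pm (\<lambda>y. y l) r (w r)) (at r within {a..b}))"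

section \<open>Taylor expansion along the probability flow\<close>

lemma flow_at:
  assumes "flow w a b" "r \<in> {a<..<b}" "l < d"
  shows "((\<lambda>r. w r l) has_real_derivative pm (\<lambda>y. y l) r (w r)) (at r)"
proof -
  have "r \<in> {a..b}" "at r within {a..b} = at r" using assms(2) at_within_interior[of r "{a..b}"] by auto
  then show ?thesis using assms(1,3) unfolding flow_def by metis
qed

lemma flow_bounded:
  assumes "flow w a b" obtains B where "\<And>r l. r \<in> {a..b} \<Longrightarrow> l < d \<Longrightarrow> \<bar>w r l\<bar> \<le> B"
proof -
  have "continuous_on {a..b} (\<lambda>r. w r l)" if "l < d" for l
    using assms that unfolding flow_def by (intro DERIV_continuous_on) blast
  then have "continuous_on {a..b} (\<lambda>r. \<Sum>l<d. \<bar>w r l\<bar>)" by (intro continuous_intros) auto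
  then have "compact ((\<lambda>r. \<Sum>l<d. \<bar>w r l\<bar>) ` {a..b})" by (rule compact_continuous_image) auto
  from compact_imp_bounded[OF this] obtain B where B: "\<forall>x\<in>(\<lambda>r. \<Sum>l<d. \<bar>w r l\<bar>) ` {a..b}. norm x \<le> B"
    unfolding bounded_iff by blast
  show ?thesis
  proof (rule that)
    fix r l assume r: "r \<in> {a..b}" and l: "l < d"
    have "\<bar>w r l\<bar> \<le> (\<Sum>l<d. \<bar>w r l\<bar>)" using l by (intro member_le_sum) auto
    also have "\<dots> \<le> B" using B r by force
    finally show "\<bar>w r l\<bar> \<le> B" .
  qed
qed

text \<open>The flow run in reversed noising time s -> rho(t - s), restricted to an open set of
  times at which its derivative is two-sided.\<close>

lemma flow_curve_on:
  assumes f: "flow w a b"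
  shows "open {s. s < t \<and> rho (t - s) \<in> {a<..<b}}"
    and "curve_on {s. s < t \<and> rho (t - s) \<in> {a<..<b}} (\<lambda>s. rho (t - s)) (\<lambda>s. poly kap (rho (t - s)))
      (\<lambda>s. w (rho (t - s))) (\<lambda>s l. pm (\<lambda>y. y l) (rho (t - s)) (w (rho (t - s))) * poly kap (rho (t - s)))"
proof -
  let ?S = "{s. s < t \<and> rho (t - s) \<in> {a<..<b}}"
  have Dr: "((\<lambda>s. rho (t - s)) has_real_derivative poly kap (rho (t - s))) (at s)" if "s < t" for s
  proof -
    have "((\<lambda>s. rho (t - s)) has_real_derivative - poly kap (rho (t - s)) * (0 - 1)) (at s)"
      by (rule DERIV_chain2[OF rho_deriv]) (use that in \<open>auto intro!: derivative_eq_intros\<close>)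
    then show ?thesis by simp
  qed
  have "continuous_on {..<t} (\<lambda>s. rho (t - s))"
    by (rule DERIV_continuous_on, rule has_field_derivative_at_within, rule Dr) simp
  then have "open ({..<t} \<inter> (\<lambda>s. rho (t - s)) -` {a<..<b})"
    by (rule continuous_open_preimage) auto
  moreover have "{..<t} \<inter> (\<lambda>s. rho (t - s)) -` {a<..<b} = ?S" by auto
  ultimately show "open ?S" by simp
  obtain B where B: "\<And>r l. r \<in> {a..b} \<Longrightarrow> l < d \<Longrightarrow> \<bar>w r l\<bar> \<le> B" by (rule flow_bounded[OF f]; blast)
  obtain K where K: "\<And>x. \<bar>x\<bar> \<le> max \<bar>a\<bar> \<bar>b\<bar> \<Longrightarrow> \<bar>poly kap x\<bar> \<le> K" using poly_bounded[of "max \<bar>a\<bar> \<bar>b\<bar>" kap] by blast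
  show "curve_on ?S (\<lambda>s. rho (t - s)) (\<lambda>s. poly kap (rho (t - s)))
      (\<lambda>s. w (rho (t - s))) (\<lambda>s l. pm (\<lambda>y. y l) (rho (t - s)) (w (rho (t - s))) * poly kap (rho (t - s)))"
    unfolding curve_on_def
  proof (intro conjI ballI allI impI exI[of _ "max (max \<bar>a\<bar> \<bar>b\<bar>) (max B (max K (R * K)))"])
    fix s assume s: "s \<in> ?S"
    show "((\<lambda>s. rho (t - s)) has_real_derivative poly kap (rho (t - s))) (at s)" using s by (intro Dr) simp
    have r: "\<bar>rho (t - s)\<bar> \<le> max \<bar>a\<bar> \<bar>b\<bar>" using s by auto
    show "\<bar>rho (t - s)\<bar> \<le> max (max \<bar>a\<bar> \<bar>b\<bar>) (max B (max K (R * K)))" by (rule order_trans[OF r]) simp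
    show "\<bar>poly kap (rho (t - s))\<bar> \<le> max (max \<bar>a\<bar> \<bar>b\<bar>) (max B (max K (R * K)))" using K[OF r] by simp
    fix l assume l: "l < d"
    show "((\<lambda>s. w (rho (t - s)) l) has_real_derivative pm (\<lambda>y. y l) (rho (t - s)) (w (rho (t - s))) * poly kap (rho (t - s))) (at s)"
      by (rule DERIV_chain2[OF flow_at[OF f _ l] Dr]) (use s in auto)
    show "\<bar>w (rho (t - s)) l\<bar> \<le> max (max \<bar>a\<bar> \<bar>b\<bar>) (max B (max K (R * K)))" using B[of "rho (t - s)", OF _ l] s by (simp add: le_max_iff_disj)
    have "\<bar>pm (\<lambda>y. y l) (rho (t - s)) (w (rho (t - s))) * poly kap (rho (t - s))\<bar> \<le> R * K"
      unfolding abs_mult by (intro mult_mono pm_bound l K r R_nonneg) auto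
    then show "\<bar>pm (\<lambda>y. y l) (rho (t - s)) (w (rho (t - s))) * poly kap (rho (t - s))\<bar> \<le> max (max \<bar>a\<bar> \<bar>b\<bar>) (max B (max K (R * K)))"
      by simp
  qed
qed

text \<open>In the original variable, sg(t - s) w(rho(t - s)) moves with velocity half of
  \<open>shat\<close> while time runs backwards, so d/ds along it is the operator L.\<close>

lemma flow_Vf_deriv:
  assumes f: "flow w a b" and s: "s < t" "rho (t - s) \<in> {a<..<b}" and i: "i < d"
  shows "((\<lambda>s. Vf j (t - s) (\<lambda>l. sg (t - s) * w (rho (t - s)) l) i) has_real_derivative
    Vf (Suc j) (t - s) (\<lambda>l. sg (t - s) * w (rho (t - s)) l) i) (at s)"
proof -
  let ?S = "{s. s < t \<and> rho (t - s) \<in> {a<..<b}}"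
  let ?X = "\<lambda>s l. sg (t - s) * w (rho (t - s)) l"
  note o = flow_curve_on(1)[OF f, of t] and c = flow_curve_on(2)[OF f, of t]
  have sS: "s \<in> ?S" using s by simp
  have pos: "t - s > 0" using s by simp
  have eq: "?X s l / sg (t - s) = w (rho (t - s)) l" if "s \<in> ?S" for s l
    using sg_pos[of "t - s"] that by simp
  have c': "curve_on ?S (\<lambda>s. rho (t - s)) (\<lambda>s. poly kap (rho (t - s)))
     (\<lambda>s l. ?X s l / sg (t - s)) (\<lambda>s l. pm (\<lambda>y. y l) (rho (t - s)) (w (rho (t - s))) * poly kap (rho (t - s)))"
    unfolding curve_on_def
  proof (intro conjI ballI allI impI)
    fix q l assume q: "q \<in> ?S" and l: "l < d"
    have "((\<lambda>s. w (rho (t - s)) l) has_real_derivative pm (\<lambda>y. y l) (rho (t - q)) (w (rho (t - q))) * poly kap (rho (t - q))) (at q)"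
      using c q l unfolding curve_on_def by blast
    then show "((\<lambda>s. ?X s l / sg (t - s)) has_real_derivative pm (\<lambda>y. y l) (rho (t - q)) (w (rho (t - q))) * poly kap (rho (t - q))) (at q)"
      by (rule has_field_derivative_transform_within_open[OF _ o q]) (use eq in simp)
  next
    show "\<exists>C. \<forall>s\<in>?S. \<bar>rho (t - s)\<bar> \<le> C \<and> \<bar>poly kap (rho (t - s))\<bar> \<le> C \<and>
      (\<forall>l<d. \<bar>?X s l / sg (t - s)\<bar> \<le> C \<and> \<bar>pm (\<lambda>y. y l) (rho (t - s)) (w (rho (t - s))) * poly kap (rho (t - s))\<bar> \<le> C)"
      using c unfolding curve_on_def by (simp add: eq cong: ball_cong_simp)
  qed (use c in \<open>auto simp: curve_on_def\<close>)
  have D1: "((\<lambda>s. t - s) has_real_derivative - 1) (at s)" by (auto intro!: derivative_eq_intros)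
  have Dsg: "((\<lambda>s. sg (t - s)) has_real_derivative sg (t - s) * (rho (t - s))\<^sup>2 / 2 * (- 1)) (at s)"
    by (rule DERIV_chain2[OF sg_deriv[OF pos] D1])
  have DX: "((\<lambda>s. ?X s l) has_real_derivative 1/2 * sh (t - s) (?X s) l) (at s)" if l: "l < d" for l
  proof -
    have "((\<lambda>s. w (rho (t - s)) l) has_real_derivative pm (\<lambda>y. y l) (rho (t - s)) (w (rho (t - s))) * poly kap (rho (t - s))) (at s)"
      using c sS l unfolding curve_on_def by blast
    from DERIV_mult[OF Dsg this] show ?thesis
      using eq[OF sS] by (simp add: sh_def algebra_simps)
  qed
  have "((\<lambda>s. Vf j (t - s) (?X s) i) has_real_derivative
    - 1 * VA j i (t - s) (?X s) + (\<Sum>l<d. 1/2 * sh (t - s) (?X s) l * VB j i l (t - s) (?X s))) (at s)"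
    by (rule Vf_curve[where \<tau> = "\<lambda>s. t - s" and \<xi> = ?X, OF o sS pos D1 DX c' i])
  moreover have "- 1 * VA j i (t - s) (?X s) + (\<Sum>l<d. 1/2 * sh (t - s) (?X s) l * VB j i l (t - s) (?X s)) = Vf (Suc j) (t - s) (?X s) i"
    unfolding Vf_Suc[OF pos i, symmetric] by (simp add: sum_distrib_left mult.assoc)
  ultimately show ?thesis by simp
qed

text \<open>Lagrange remainder for the scalar function <c, X(s)>. The intermediate time depends on
  \<open>c\<close>, which is harmless because \<open>B\<close> is uniform over [0, h]; the norm is
  then recovered by duality.\<close>

lemma flow_taylor:
  assumes f: "flow w a b" and h: "0 < h" "h < t" and r: "a < rho t" "rho (t - h) < b"
    and B: "\<And>s c. 0 \<le> s \<Longrightarrow> s \<le> h \<Longrightarrow> \<bar>\<Sum>i<d. c i * Vf (Suc p) (t - s) (\<lambda>l. sg (t - s) * w (rho (t - s)) l) i\<bar> \<le> B * nrm d c"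
    and B0: "B \<ge> 0"
  shows "nrm d (\<lambda>i. sg (t - h) * w (rho (t - h)) i - (\<Sum>m<Suc p. Vf m t (\<lambda>l. sg t * w (rho t) l) i / fact m * h ^ m))
     \<le> h ^ Suc p * B"
proof (rule nrm_le_dual)
  fix c :: "nat \<Rightarrow> real"
  let ?X = "\<lambda>s l. sg (t - s) * w (rho (t - s)) l"
  define F where "F m s = (\<Sum>i<d. c i * Vf m (t - s) (?X s) i)" for m s
  have mono: "rho u \<le> rho v" if "0 < v" "v \<le> u" for u v
    unfolding rho_def using that by (intro divide_left_mono) auto
  have D: "(F m has_real_derivative F (Suc m) s) (at s)" if "0 \<le> s" "s \<le> h" for m s
    unfolding F_def
  proof (intro DERIV_sum DERIV_cmult flow_Vf_deriv[OF f])
    show "s < t" using that h by simp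
    show "rho (t - s) \<in> {a<..<b}"
      using mono[of "t - s" t] mono[of "t - h" "t - s"] r that h by auto
  qed auto
  have "\<exists>s. 0 < s \<and> s < h \<and> F 0 h = (\<Sum>m<Suc p. F m 0 / fact m * h ^ m) + F (Suc p) s / fact (Suc p) * h ^ Suc p"
    by (rule Maclaurin[OF h(1)]) (use D in auto)
  then obtain s where s: "0 < s" "s < h" "F 0 h = (\<Sum>m<Suc p. F m 0 / fact m * h ^ m) + F (Suc p) s / fact (Suc p) * h ^ Suc p" by blast
  have V0: "Vf 0 q x i = x i" if "q > 0" "i < d" for q x i using L_op_iterate[OF that, of 0] by simp
  have "dot d c (\<lambda>i. ?X h i - (\<Sum>m<Suc p. Vf m t (?X 0) i / fact m * h ^ m))
    = F 0 h - (\<Sum>m<Suc p. F m 0 / fact m * h ^ m)"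
  proof -
    have "(\<Sum>m<Suc p. F m 0 / fact m * h ^ m) = (\<Sum>i<d. c i * (\<Sum>m<Suc p. Vf m t (?X 0) i / fact m * h ^ m))"
      unfolding F_def sum_divide_distrib sum_distrib_right sum_distrib_left
      by (subst sum.swap) (simp add: mult.assoc)
    moreover have "F 0 h = (\<Sum>i<d. c i * ?X h i)" unfolding F_def using h by (intro sum.cong) (auto simp: V0)
    ultimately show ?thesis by (simp add: dot_def sum_subtractf right_diff_distrib)
  qed
  also have "\<dots> = F (Suc p) s / fact (Suc p) * h ^ Suc p" using s(3) by simp
  also have "\<dots> \<le> B * nrm d c / 1 * h ^ Suc p"
  proof (intro mult_right_mono)
    have "F (Suc p) s / fact (Suc p) \<le> \<bar>F (Suc p) s\<bar> / fact (Suc p)" by (intro divide_right_mono) auto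
    also have "\<dots> \<le> B * nrm d c / 1"
      using B[of s c] s(1,2) fact_ge_1[of "Suc p", where 'a = real] unfolding F_def by (intro frac_le) auto
    finally show "F (Suc p) s / fact (Suc p) \<le> B * nrm d c / 1" .
  qed (use h in auto)
  finally show "dot d c (\<lambda>i. sg (t - h) * w (rho (t - h)) i - (\<Sum>m<Suc p. Vf m t (\<lambda>l. sg t * w (rho t) l) i / fact m * h ^ m))
    \<le> h ^ Suc p * B * nrm d c" by (simp add: mult_ac)
qed (use B0 h in auto)

end

section \<open>Exponential moments of the support gap\<close>

declare measurable_Rd_component [measurable del]

lemma measurable_dist_d: "(\<lambda>y. dist_d d q y) \<in> borel_measurable (Rd d)"
proof -
  have [measurable]: "(\<lambda>y. y i) \<in> borel_measurable (Rd d)" if "i \<in> {..<d}" for i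
    using that by (simp add: measurable_Rd_component)
  show ?thesis unfolding dist_d_def L2_set_def by measurable
qed

lemma borel_measurable_dist_d_ball: "{y \<in> space (Rd d). dist_d d q y < c} \<in> sets (Rd d)"
  using measurable_dist_d by measurable

lemma dist_d_le_sum: "dist_d d x y \<le> (\<Sum>i<d. \<bar>x i - y i\<bar>)"
  unfolding dist_d_def by (rule L2_set_le_sum_abs)

lemma dist_d_triangle: "dist_d d x z \<le> dist_d d x y + dist_d d y z"
  unfolding dist_d_def by (rule nrm_triangle_diff)

text \<open>Outside the support every point lies in a null ball with rational centre and radius 1/(n
  + 1), and there are countably many of these.\<close>

lemma AE_supp:
  assumes P: "prob_space P" "sets P = sets (Rd d)"
  shows "AE y in P. y \<in> supp d P"
proof -
  interpret prob_space P by fact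
  have sp: "space P = space (Rd d)" by (rule sets_eq_imp_space_eq[OF P(2)])
  define Q where "Q = (\<Pi>\<^sub>E i\<in>{..<d}. (\<rat> :: real set))"
  define B where "B z = {y \<in> space (Rd d). dist_d d (fst z) y < 1 / real (Suc (snd z))}" for z :: "(nat \<Rightarrow> real) \<times> nat"
  define I where "I = {z \<in> Q \<times> UNIV. emeasure P (B z) = 0}"
  have "countable Q" unfolding Q_def by (rule countable_PiE) (auto simp: countable_rat)
  then have "countable (Q \<times> (UNIV :: nat set))" by (intro countable_SIGMA) auto
  then have I: "countable I" unfolding I_def by (rule countable_subset[rotated]) auto
  have B: "B z \<in> sets P" for z unfolding B_def P(2) by (rule borel_measurable_dist_d_ball)
  have "(\<Union>z\<in>I. B z) \<in> null_sets P"
    by (rule null_sets_UN'[OF I]) (use B in \<open>auto simp: I_def null_sets_def\<close>)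
  moreover have "{y \<in> space P. y \<notin> supp d P} \<subseteq> (\<Union>z\<in>I. B z)"
  proof
    fix x assume x: "x \<in> {y \<in> space P. y \<notin> supp d P}"
    then have xs: "x \<in> space (Rd d)" using sp by simp
    then obtain r where r: "r > 0" "emeasure P {y \<in> space (Rd d). dist_d d x y < r} = 0"
      using x unfolding supp_def by (auto simp: not_less)
    obtain n where n: "1 / real (Suc n) < r / 2" using reals_Archimedean[of "r / 2"] r(1) by (auto simp: inverse_eq_divide)
    \<comment> \<open>Coordinates this close keep the sum distance, which dominates the Euclidean
      one, at most d eps < 1/(n + 1).\<close>
    define \<epsilon> where "\<epsilon> = 1 / (real (Suc n) * (real d + 1))"
    have \<epsilon>: "\<epsilon> > 0" by (simp add: \<epsilon>_def)
    have "\<exists>q. q \<in> \<rat> \<and> \<bar>q - x i\<bar> < \<epsilon>" for i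
    proof -
      obtain q where "q \<in> \<rat>" "x i - \<epsilon> < q" "q < x i + \<epsilon>" using Rats_dense_in_real[of "x i - \<epsilon>" "x i + \<epsilon>"] \<epsilon> by auto
      then show ?thesis by (intro exI[of _ q]) auto
    qed
    then obtain q where q: "\<And>i. q i \<in> \<rat>" "\<And>i. \<bar>q i - x i\<bar> < \<epsilon>" by metis
    define q' where "q' = restrict q {..<d}"
    have "dist_d d q' x \<le> (\<Sum>i<d. \<bar>q' i - x i\<bar>)" by (rule dist_d_le_sum)
    also have "\<dots> \<le> (\<Sum>i<d. \<epsilon>)" using q(2) by (intro sum_mono) (auto simp: q'_def less_imp_le)
    also have "\<dots> = real d * \<epsilon>" by simp
    also have "\<dots> < (real d + 1) * \<epsilon>" using \<epsilon> by simp
    also have "\<dots> = 1 / real (Suc n)" by (simp add: \<epsilon>_def)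
    finally have d1: "dist_d d q' x < 1 / real (Suc n)" .
    have "B (q', n) \<subseteq> {y \<in> space (Rd d). dist_d d x y < r}"
    proof
      fix y assume y: "y \<in> B (q', n)"
      have "dist_d d x y \<le> dist_d d x q' + dist_d d q' y" by (rule dist_d_triangle)
      also have "dist_d d x q' = dist_d d q' x" unfolding dist_d_def by (rule nrm_diff_commute)
      finally have "dist_d d x y < r" using d1 n y by (simp add: B_def)
      then show "y \<in> {y \<in> space (Rd d). dist_d d x y < r}" using y by (simp add: B_def)
    qed
    then have "emeasure P (B (q', n)) \<le> emeasure P {y \<in> space (Rd d). dist_d d x y < r}"
      by (rule emeasure_mono) (simp add: P(2) borel_measurable_dist_d_ball)
    then have "(q', n) \<in> I" using r(2) q(1) by (auto simp: I_def Q_def q'_def)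
    moreover have "x \<in> B (q', n)" using xs d1 by (simp add: B_def)
    ultimately show "x \<in> (\<Union>z\<in>I. B z)" by blast
  qed
  ultimately show ?thesis by (rule AE_I')
qed

lemma nn_integral_exp_Ici: "(\<integral>\<^sup>+s. ennreal (exp (- s)) * indicator {c..} s \<partial>lborel) = ennreal (exp (- c))"
proof -
  have "(\<integral>\<^sup>+s. ennreal (exp (- s)) * indicator {c..} s \<partial>lborel) = ennreal (0 - (- exp (- c)))"
  proof (rule nn_integral_FTC_atLeast)
    show "((\<lambda>s. - exp (- s)) has_real_derivative exp (- x)) (at x)" for x :: real
      by (auto intro!: derivative_eq_intros)
    have "((\<lambda>s::real. - exp (- s)) \<longlongrightarrow> - 0) at_top"
      by (intro tendsto_minus filterlim_compose[OF exp_at_bot filterlim_uminus_at_bot_at_top])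
    then show "((\<lambda>s::real. - exp (- s)) \<longlongrightarrow> 0) at_top" by simp
  qed auto
  then show ?thesis by simp
qed

text \<open>Layer cake: \<open>exp (- r U) = \<integral> exp (- s) [r U \<le> s] ds\<close> turns doubling of the distribution function of
  \<open>U\<close> into doubling of its Laplace transform.\<close>

lemma laplace_doubling:
  fixes U :: "'a \<Rightarrow> real"
  assumes M: "prob_space M" and U: "U \<in> borel_measurable M" "AE y in M. U y \<ge> 0" and r: "r > 0" and D: "D \<ge> 0"
    and dbl: "\<And>u. u > 0 \<Longrightarrow> measure M {y \<in> space M. U y \<le> 2 * u} \<le> D * measure M {y \<in> space M. U y \<le> u}"
  shows "(\<integral>y. exp (- (r * U y) / 2) \<partial>M) \<le> D * (\<integral>y. exp (- (r * U y)) \<partial>M)"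
proof -
  interpret prob_space M by fact
  interpret pair_sigma_finite M "lborel :: real measure" by standard
  \<comment> \<open>The restriction to s > 0 is kept because doubling is available at positive
    levels only; the point s = 0 is a null set.\<close>
  have cake: "(\<integral>\<^sup>+y. ennreal (exp (- (c * U y))) \<partial>M)
    = (\<integral>\<^sup>+s. ennreal (exp (- s)) * indicator {0<..} s * ennreal (measure M {y \<in> space M. U y \<le> s / c}) \<partial>lborel)"
    if c: "c > 0" for c
  proof -
    have m: "(\<lambda>(y, s). ennreal (exp (- s)) * indicator {0<..} s * indicator {z. c * U (fst z) \<le> snd z} (y, s))
      \<in> borel_measurable (M \<Otimes>\<^sub>M lborel)"
      using U(1) by measurable
    have "(\<integral>\<^sup>+y. ennreal (exp (- (c * U y))) \<partial>M)
      = (\<integral>\<^sup>+y. (\<integral>\<^sup>+s. ennreal (exp (- s)) * indicator {0<..} s * indicator {z. c * U (fst z) \<le> snd z} (y, s) \<partial>lborel) \<partial>M)"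
    proof (rule nn_integral_cong_AE)
      show "AE y in M. ennreal (exp (- (c * U y))) =
        (\<integral>\<^sup>+s. ennreal (exp (- s)) * indicator {0<..} s * indicator {z. c * U (fst z) \<le> snd z} (y, s) \<partial>lborel)"
        using U(2)
      proof eventually_elim
        case (elim y)
        have "(\<integral>\<^sup>+s. ennreal (exp (- s)) * indicator {0<..} s * indicator {z. c * U (fst z) \<le> snd z} (y, s) \<partial>lborel)
          = (\<integral>\<^sup>+s. ennreal (exp (- s)) * indicator {c * U y..} s \<partial>lborel)"
        proof (rule nn_integral_cong_AE)
          have "AE s in lborel. s \<noteq> (0::real)" by (rule AE_lborel_singleton)
          then show "AE s in lborel. ennreal (exp (- s)) * indicator {0<..} s * indicator {z. c * U (fst z) \<le> snd z} (y, s)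
            = ennreal (exp (- s)) * indicator {c * U y..} s"
          proof eventually_elim
            case (elim s)
            have "0 \<le> c * U y" using \<open>0 \<le> U y\<close> c by simp
            then show ?case using elim by (auto simp: indicator_def)
          qed
        qed
        then show ?case by (simp add: nn_integral_exp_Ici)
      qed
    qed
    also have "\<dots> = (\<integral>\<^sup>+s. (\<integral>\<^sup>+y. ennreal (exp (- s)) * indicator {0<..} s * indicator {z. c * U (fst z) \<le> snd z} (y, s) \<partial>M) \<partial>lborel)"
      by (rule Fubini'[symmetric, OF m])
    also have "\<dots> = (\<integral>\<^sup>+s. ennreal (exp (- s)) * indicator {0<..} s * ennreal (measure M {y \<in> space M. U y \<le> s / c}) \<partial>lborel)"
    proof (rule nn_integral_cong)
      fix s :: real
      have "(\<integral>\<^sup>+y. ennreal (exp (- s)) * indicator {0<..} s * indicator {z. c * U (fst z) \<le> snd z} (y, s) \<partial>M)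
        = (\<integral>\<^sup>+y. ennreal (exp (- s)) * indicator {0<..} s * indicator {y \<in> space M. U y \<le> s / c} y \<partial>M)"
        by (rule nn_integral_cong) (use c in \<open>auto simp: indicator_def field_simps\<close>)
      also have "\<dots> = ennreal (exp (- s)) * indicator {0<..} s * emeasure M {y \<in> space M. U y \<le> s / c}"
        by (rule nn_integral_cmult_indicator) (use U(1) in measurable)
      finally show "(\<integral>\<^sup>+y. ennreal (exp (- s)) * indicator {0<..} s * indicator {z. c * U (fst z) \<le> snd z} (y, s) \<partial>M)
        = ennreal (exp (- s)) * indicator {0<..} s * ennreal (measure M {y \<in> space M. U y \<le> s / c})"
        by (simp add: emeasure_eq_measure)
    qed
    finally show ?thesis .
  qed
  have int: "integrable M (\<lambda>y. exp (- (c * U y)))" if "c > 0" for c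
  proof (rule integrable_const_bound[of _ 1])
    show "AE y in M. norm (exp (- (c * U y))) \<le> 1" using U(2) by eventually_elim (use that in auto)
  qed (use U(1) in measurable)
  have "ennreal (\<integral>y. exp (- (r * U y) / 2) \<partial>M) = (\<integral>\<^sup>+y. ennreal (exp (- (r / 2 * U y))) \<partial>M)"
    using int[of "r / 2"] r by (subst nn_integral_eq_integral) (auto simp: mult.commute)
  \<comment> \<open>At rate r/2 the level is 2 s / r, twice the level s / r that belongs to rate
    \<open>r\<close>, so doubling applies under the integral.\<close>
  also have "\<dots> \<le> (\<integral>\<^sup>+s. ennreal D * (ennreal (exp (- s)) * indicator {0<..} s * ennreal (measure M {y \<in> space M. U y \<le> s / r})) \<partial>lborel)"
  proof (subst cake, use r in simp, rule nn_integral_mono)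
    fix s :: real
    show "ennreal (exp (- s)) * indicator {0<..} s * ennreal (measure M {y \<in> space M. U y \<le> s / (r / 2)})
      \<le> ennreal D * (ennreal (exp (- s)) * indicator {0<..} s * ennreal (measure M {y \<in> space M. U y \<le> s / r}))"
    proof (cases "s > 0")
      case True
      have "measure M {y \<in> space M. U y \<le> s / (r / 2)} \<le> D * measure M {y \<in> space M. U y \<le> s / r}"
        using dbl[of "s / r"] True r by (simp add: mult.commute)
      then have "ennreal (measure M {y \<in> space M. U y \<le> s / (r / 2)}) \<le> ennreal (D * measure M {y \<in> space M. U y \<le> s / r})"
        by (rule ennreal_leI)
      also have "\<dots> = ennreal D * ennreal (measure M {y \<in> space M. U y \<le> s / r})"
        by (rule ennreal_mult[OF D measure_nonneg])
      finally have "ennreal (exp (- s)) * ennreal (measure M {y \<in> space M. U y \<le> s / (r / 2)})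
        \<le> ennreal (exp (- s)) * (ennreal D * ennreal (measure M {y \<in> space M. U y \<le> s / r}))"
        by (rule mult_left_mono) simp
      then show ?thesis using True by (simp only: indicator_simps greaterThan_iff mult_1_right mult.left_commute)
    qed simp
  qed
  also have "\<dots> = ennreal D * (\<integral>\<^sup>+y. ennreal (exp (- (r * U y))) \<partial>M)"
  proof -
    have "(\<lambda>s. measure M {y \<in> space M. U y \<le> s / r}) \<in> borel_measurable lborel"
    proof -
      have "mono (\<lambda>s. measure M {y \<in> space M. U y \<le> s / r})"
      proof (rule monoI)
        fix s s' :: real assume "s \<le> s'"
        then have "s / r \<le> s' / r" using r by (simp add: divide_right_mono)
        then show "measure M {y \<in> space M. U y \<le> s / r} \<le> measure M {y \<in> space M. U y \<le> s' / r}"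
          by (intro finite_measure_mono) (use U(1) in \<open>auto intro: order_trans\<close>)
      qed
      then show ?thesis by (simp add: borel_measurable_mono)
    qed
    note m = measurable_compose[OF this measurable_ennreal]
    have e: "(\<lambda>s. ennreal (exp (- s))) \<in> borel_measurable lborel" by measurable
    show ?thesis
      unfolding cake[OF r]
      by (rule nn_integral_cmult, rule borel_measurable_times_ennreal[OF borel_measurable_times_ennreal[OF e] m]) simp
  qed
  also have "\<dots> = ennreal D * ennreal (\<integral>y. exp (- (r * U y)) \<partial>M)"
    using int[OF r] by (subst nn_integral_eq_integral) auto
  also have "\<dots> = ennreal (D * (\<integral>y. exp (- (r * U y)) \<partial>M))"
    using D by (simp add: ennreal_mult')
  finally show ?thesis using D by (subst (asm) ennreal_le_iff) auto
qed

locale ud_prior = bounded_prior +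
  fixes D :: real
  assumes supp_R: "supp d P \<subseteq> {x. nrm d x \<le> R}" and UD: "doubling_UD d P D"
begin

lemma D_ge_1: "D \<ge> 1" using UD by (simp add: doubling_UD_def)

text \<open>Extensional, so that it is a point of \<open>unit_sphere d\<close>. When
  \<open>w\<close> has norm zero its value is irrelevant to the gap, where it is multiplied by that
  norm.\<close>

definition dir :: "(nat \<Rightarrow> real) \<Rightarrow> nat \<Rightarrow> real" where
  "dir w = (\<lambda>l\<in>{..<d}. w l / nrm d w)"

text \<open>The gap sup <w, .> - <w, y> over the support. It is nonnegative almost surely; the
  absolute value makes it so at every point.\<close>

definition gap :: "(nat \<Rightarrow> real) \<Rightarrow> (nat \<Rightarrow> real) \<Rightarrow> real" where
  "gap w y = \<bar>nrm d w * support_gap d P (dir w) y\<bar>"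

lemma dot_dir: "nrm d w * dot d (dir w) y = dot d w y"
proof (cases "nrm d w = 0")
  case True
  then have "w l = 0" if "l < d" for l using abs_le_nrm[OF that, of w] by simp
  then have "dot d w y = 0" by (simp add: dot_def)
  then show ?thesis using True by simp
next
  case False
  then show ?thesis by (simp add: dot_def dir_def sum_distrib_left)
qed

lemma AE_gap_nonneg: "AE y in P. support_gap d P \<theta> y \<ge> 0"
  using AE_supp[OF prob_space_axioms sets_P]
proof eventually_elim
  case (elim y)
  have "bdd_above (dot d \<theta> ` supp d P)"
  proof (rule bdd_aboveI2)
    fix x assume "x \<in> supp d P"
    then have "nrm d x \<le> R" using supp_R by auto
    then show "dot d \<theta> x \<le> nrm d \<theta> * R" using abs_dot_le_R[of x \<theta>] by simp
  qed
  then have "dot d \<theta> y \<le> (SUP y'\<in>supp d P. dot d \<theta> y')" using elim by (rule cSUP_upper[rotated])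
  then show ?case by (simp add: support_gap_def)
qed

lemma measurable_support_gap [measurable]: "support_gap d P \<theta> \<in> borel_measurable P"
proof -
  have "(\<lambda>y. (SUP y'\<in>supp d P. dot d \<theta> y') - dot d \<theta> y) \<in> borel_measurable P" by measurable
  then show ?thesis by (simp add: support_gap_def[abs_def])
qed

lemma measurable_gap [measurable]: "gap w \<in> borel_measurable P"
proof -
  have "(\<lambda>y. \<bar>nrm d w * support_gap d P (dir w) y\<bar>) \<in> borel_measurable P" by measurable
  then show ?thesis by (simp add: gap_def[abs_def])
qed

lemma gap_bounded: "\<exists>C. \<forall>y. nrm d y \<le> R \<longrightarrow> gap w y \<le> C"
proof (intro exI allI impI)
  let ?S = "SUP y'\<in>supp d P. dot d (dir w) y'"
  fix y assume y: "nrm d y \<le> R"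
  have "gap w y = \<bar>nrm d w * ?S - dot d w y\<bar>"
    by (simp add: gap_def support_gap_def right_diff_distrib dot_dir)
  also have "\<dots> \<le> \<bar>nrm d w * ?S\<bar> + nrm d w * R" using abs_dot_le_R[OF y, of w] by linarith
  finally show "gap w y \<le> \<bar>nrm d w * ?S\<bar> + nrm d w * R" .
qed

lemma gap_nonneg: "gap w y \<ge> 0" by (simp add: gap_def)

text \<open>The supremum cancels in the difference, so the triangle inequality suffices, for points
  of the support and others alike.\<close>

lemma abs_dot_diff_le_gap: "\<bar>dot d w y - dot d w z\<bar> \<le> gap w y + gap w z"
proof -
  let ?S = "nrm d w * (SUP y'\<in>supp d P. dot d (dir w) y')"
  have "gap w y = \<bar>?S - dot d w y\<bar>" for y
    by (simp add: gap_def support_gap_def right_diff_distrib dot_dir)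
  then show ?thesis by simp
qed

lemma exp_gap_bounded:
  assumes "\<rho> \<ge> 0" obtains C where "\<And>y. nrm d y \<le> R \<Longrightarrow> \<bar>exp (\<rho> * gap w y / 2)\<bar> \<le> C"
proof -
  obtain C where C: "\<And>y. nrm d y \<le> R \<Longrightarrow> gap w y \<le> C" using gap_bounded by blast
  show ?thesis
  proof (rule that[of "exp (\<rho> * C / 2)"])
    fix y assume "nrm d y \<le> R"
    then have "\<rho> * gap w y \<le> \<rho> * C" using C assms by (intro mult_left_mono) auto
    then show "\<bar>exp (\<rho> * gap w y / 2)\<bar> \<le> exp (\<rho> * C / 2)" by simp
  qed
qed

text \<open>\<open>laplace_doubling\<close> at rate rho |w| for the unit direction of
  \<open>w\<close>. When the rate vanishes both integrals are 1 and D >= 1 suffices.\<close>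

lemma laplace_gap:
  assumes "\<rho> \<ge> 0"
  shows "(\<integral>y. exp (- (\<rho> * gap w y) / 2) \<partial>P) \<le> D * (\<integral>y. exp (- (\<rho> * gap w y)) \<partial>P)"
proof (cases "\<rho> * nrm d w = 0")
  case True
  then have z: "\<rho> * gap w y = 0" for y by (auto simp: gap_def)
  show ?thesis using D_ge_1 unfolding z by (simp add: prob_space)
next
  case False
  then have r: "\<rho> * nrm d w > 0" and w: "nrm d w > 0"
    using assms L2_set_nonneg[of w "{..<d}"] by (auto simp: less_le)
  have \<theta>: "dir w \<in> unit_sphere d"
  proof -
    have "nrm d (dir w) = nrm d (\<lambda>l. 1 / nrm d w * w l)" by (rule nrm_cong) (simp add: dir_def)
    also have "\<dots> = \<bar>1 / nrm d w\<bar> * nrm d w" by (rule nrm_scale)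
    finally have "nrm d (dir w) = 1" using w by simp
    then show ?thesis by (auto simp: unit_sphere_def Rd_def space_PiM dir_def)
  qed
  have sp: "space P = space (Rd d)" by (rule sets_eq_imp_space_eq[OF sets_P])
  have "(\<integral>y. exp (- ((\<rho> * nrm d w) * support_gap d P (dir w) y) / 2) \<partial>P)
      \<le> D * (\<integral>y. exp (- ((\<rho> * nrm d w) * support_gap d P (dir w) y)) \<partial>P)"
  proof (rule laplace_doubling[OF prob_space_axioms measurable_support_gap AE_gap_nonneg r])
    show "measure P {y \<in> space P. support_gap d P (dir w) y \<le> 2 * u} \<le> D * measure P {y \<in> space P. support_gap d P (dir w) y \<le> u}"
      if "u > 0" for u
      using UD \<theta> that unfolding doubling_UD_def gap_cdf_def sp by blast
  qed (use D_ge_1 in simp)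
  moreover have "AE y in P. \<rho> * gap w y = (\<rho> * nrm d w) * support_gap d P (dir w) y"
    using AE_gap_nonneg[of "dir w"] by eventually_elim (use w in \<open>simp add: gap_def\<close>)
  then have "(\<integral>y. exp (- (\<rho> * gap w y) / 2) \<partial>P) = (\<integral>y. exp (- ((\<rho> * nrm d w) * support_gap d P (dir w) y) / 2) \<partial>P)"
    "(\<integral>y. exp (- (\<rho> * gap w y)) \<partial>P) = (\<integral>y. exp (- ((\<rho> * nrm d w) * support_gap d P (dir w) y)) \<partial>P)"
    by (intro integral_cong_AE; measurable; auto)+
  ultimately show ?thesis by simp
qed

text \<open>With S = sup <w, .> over the support, almost surely Efac = exp(rho S) exp(-rho gap)
  exp(-rho^2 |y|^2/2). Hence the numerator is essentially the Laplace transform of the gap at half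
  the rate of the denominator, and doubling compares the two. Bounding the last factor between
  exp(-rho^2 R^2/2) and 1 costs the exponential on the right.\<close>

lemma pm_exp_gap:
  assumes \<rho>: "\<rho> \<ge> 0"
  shows "pm (\<lambda>y. exp (\<rho> * gap w y / 2)) \<rho> w \<le> D * exp (\<rho>\<^sup>2 / 2 * R\<^sup>2)"
proof -
  let ?S = "nrm d w * (SUP y'\<in>supp d P. dot d (dir w) y')"
  obtain C where C: "\<And>y. nrm d y \<le> R \<Longrightarrow> \<bar>exp (\<rho> * gap w y / 2)\<bar> \<le> C" by (rule exp_gap_bounded[OF \<rho>]; blast)
  have e: "AE y in P. Efac d \<rho> w y = exp (\<rho> * ?S) * exp (- (\<rho> * gap w y)) * exp (- (\<rho>\<^sup>2 / 2 * dot d y y))"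
    using AE_gap_nonneg[of "dir w"]
  proof eventually_elim
    case (elim y)
    then have g: "gap w y = ?S - dot d w y"
      by (simp add: gap_def abs_of_nonneg mult_nonneg_nonneg) (simp add: support_gap_def right_diff_distrib dot_dir)
    show ?case unfolding g by (simp add: Efac_def exp_add[symmetric] algebra_simps)
  qed
  have b1: "integrable P (\<lambda>y. exp (- (c * gap w y)))" if "c \<ge> 0" for c
    by (rule integrable_const_bound[of _ 1]) (use that gap_nonneg in auto)
  have 1: "(\<integral>y. exp (\<rho> * gap w y / 2) * Efac d \<rho> w y \<partial>P) \<le> (\<integral>y. exp (\<rho> * ?S) * exp (- (\<rho> * gap w y) / 2) \<partial>P)"
  proof (rule integral_mono_AE)
    show "AE y in P. exp (\<rho> * gap w y / 2) * Efac d \<rho> w y \<le> exp (\<rho> * ?S) * exp (- (\<rho> * gap w y) / 2)"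
      using e
    proof eventually_elim
      case (elim y)
      have "exp (\<rho> * gap w y / 2) * Efac d \<rho> w y
        = exp (\<rho> * ?S) * exp (- (\<rho> * gap w y) / 2) * exp (- (\<rho>\<^sup>2 / 2 * dot d y y))"
        unfolding elim by (simp add: exp_add[symmetric])
      also have "\<dots> \<le> exp (\<rho> * ?S) * exp (- (\<rho> * gap w y) / 2) * 1"
        by (intro mult_left_mono) (auto simp: dot_self)
      finally show ?case by simp
    qed
    show "integrable P (\<lambda>y. exp (\<rho> * gap w y / 2) * Efac d \<rho> w y)" by (rule integrable_Efac[OF _ C]) measurable
    show "integrable P (\<lambda>y. exp (\<rho> * ?S) * exp (- (\<rho> * gap w y) / 2))" using b1[of "\<rho> / 2"] \<rho> by simp
  qed
  have 2: "(\<integral>y. exp (\<rho> * ?S) * exp (- (\<rho>\<^sup>2 / 2 * R\<^sup>2)) * exp (- (\<rho> * gap w y)) \<partial>P) \<le> Zf \<rho> w"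
    unfolding Zf_def
  proof (rule integral_mono_AE)
    show "AE y in P. exp (\<rho> * ?S) * exp (- (\<rho>\<^sup>2 / 2 * R\<^sup>2)) * exp (- (\<rho> * gap w y)) \<le> Efac d \<rho> w y"
      using e AE_R
    proof eventually_elim
      case (elim y)
      have "exp (\<rho> * ?S) * exp (- (\<rho> * gap w y)) * exp (- (\<rho>\<^sup>2 / 2 * R\<^sup>2)) \<le> Efac d \<rho> w y"
        unfolding elim(1) using dot_self_le[OF elim(2)] by (intro mult_left_mono) (auto intro!: mult_left_mono)
      then show ?case by (simp add: mult_ac)
    qed
    show "integrable P (\<lambda>y. exp (\<rho> * ?S) * exp (- (\<rho>\<^sup>2 / 2 * R\<^sup>2)) * exp (- (\<rho> * gap w y)))" using b1[OF \<rho>] by simp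
    show "integrable P (Efac d \<rho> w)" using integrable_Efac[of "\<lambda>_. 1" 1 \<rho> w] by simp
  qed
  have "(\<integral>y. exp (\<rho> * gap w y / 2) * Efac d \<rho> w y \<partial>P) \<le> exp (\<rho> * ?S) * (\<integral>y. exp (- (\<rho> * gap w y) / 2) \<partial>P)"
    using 1 by simp
  also have "\<dots> \<le> exp (\<rho> * ?S) * (D * (\<integral>y. exp (- (\<rho> * gap w y)) \<partial>P))"
    by (intro mult_left_mono laplace_gap \<rho>) simp
  also have "\<dots> = (D * exp (\<rho>\<^sup>2 / 2 * R\<^sup>2)) * (exp (\<rho> * ?S) * exp (- (\<rho>\<^sup>2 / 2 * R\<^sup>2)) * (\<integral>y. exp (- (\<rho> * gap w y)) \<partial>P))"
    by (simp add: exp_minus)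
  also have "\<dots> \<le> (D * exp (\<rho>\<^sup>2 / 2 * R\<^sup>2)) * Zf \<rho> w"
    using 2 D_ge_1 by (intro mult_left_mono) auto
  finally show ?thesis using Zf_pos[of \<rho> w] unfolding pm_def by (simp add: divide_le_eq)
qed

end

section \<open>Bounds along the flow\<close>

lemma poly_kap_pos: "\<rho> > 0 \<Longrightarrow> poly kap \<rho> > 0"
  by (simp add: poly_kap add_pos_pos)

definition pabs :: "real poly \<Rightarrow> real" where
  "pabs p = (\<Sum>i\<le>degree p. \<bar>coeff p i\<bar>)"

lemma pabs_nonneg: "pabs p \<ge> 0" by (simp add: pabs_def sum_nonneg)

lemma abs_poly_le:
  assumes "\<rho> \<ge> 0" shows "\<bar>poly p \<rho>\<bar> \<le> pabs p * (1 + \<rho>) ^ degree p"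
proof -
  have "\<bar>poly p \<rho>\<bar> \<le> (\<Sum>i\<le>degree p. \<bar>coeff p i\<bar> * \<rho> ^ i)"
    unfolding poly_altdef by (rule order_trans[OF sum_abs]) (use assms in \<open>simp add: abs_mult\<close>)
  also have "\<dots> \<le> (\<Sum>i\<le>degree p. \<bar>coeff p i\<bar> * (1 + \<rho>) ^ degree p)"
  proof (intro sum_mono mult_left_mono)
    fix i assume "i \<in> {..degree p}"
    then have "\<rho> ^ i \<le> (1 + \<rho>) ^ i" "(1 + \<rho>) ^ i \<le> (1 + \<rho>) ^ degree p"
      using assms by (auto intro!: power_mono power_increasing)
    then show "\<rho> ^ i \<le> (1 + \<rho>) ^ degree p" by linarith
  qed simp
  finally show ?thesis by (simp add: pabs_def sum_distrib_right)
qed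

text \<open>Coefficient and, in \<open>dg\<close>, degree for the bound \<open>abs_eval_le\<close>.
  Adding degrees at \<open>Ad\<close> as well is crude but safe, since the base of the power is at
  least 1; what matters is that both depend on the expression alone.\<close>

primrec cst :: "ex \<Rightarrow> real" where
  "cst (Pl p) = pabs p"
| "cst (Sx a b) = 2"
| "cst (Qx a b) = 1"
| "cst (Ad e f) = cst e + cst f"
| "cst (Mu e f) = cst e * cst f"

primrec dg :: "ex \<Rightarrow> nat" where
  "dg (Pl p) = degree p"
| "dg (Sx a b) = 1"
| "dg (Qx a b) = 1"
| "dg (Ad e f) = dg e + dg f"
| "dg (Mu e f) = dg e + dg f"

lemma cst_nonneg: "cst e \<ge> 0"
  by (induction e) (auto simp: pabs_nonneg)

text \<open>From x <= exp x at x = (1 + s)/(2 k), raised to the power \<open>k\<close>. The rate 1/2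
  is the one that \<open>pm_exp_gap\<close> controls.\<close>

lemma power_le_exp:
  assumes "s \<ge> 0" shows "(1 + s) ^ k \<le> (2 * real k) ^ k * exp ((1 + s) / 2)"
proof (cases "k = 0")
  case True
  then show ?thesis using assms by simp
next
  case False
  have "(1 + s) / (2 * real k) \<le> exp ((1 + s) / (2 * real k))"
    using exp_ge_add_one_self[of "(1 + s) / (2 * real k)"] by linarith
  then have "1 + s \<le> 2 * real k * exp ((1 + s) / (2 * real k))"
    using False by (simp add: divide_le_eq mult.commute)
  then have "(1 + s) ^ k \<le> (2 * real k * exp ((1 + s) / (2 * real k))) ^ k"
    using assms by (intro power_mono) auto
  also have "\<dots> = (2 * real k) ^ k * exp ((1 + s) / 2)"
    using False by (simp add: power_mult_distrib exp_of_nat_mult[symmetric])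
  finally show ?thesis .
qed

text \<open>Continuity in the product topology gives Borel measurability on all functions, and
  \<open>Rd d\<close> embeds measurably because coordinates from \<open>d\<close> on are constantly
  \<open>undefined\<close> there.\<close>

lemma lipschitz_measurable_Rd:
  fixes f :: "(nat \<Rightarrow> real) \<Rightarrow> real"
  assumes "\<And>u v. \<bar>f u - f v\<bar> \<le> C * nrm d (\<lambda>l. u l - v l)"
  shows "f \<in> borel_measurable (Rd d)"
proof -
  have "continuous_on UNIV f"
    unfolding continuous_on_sequentially
  proof (intro allI ballI impI, elim conjE)
    fix X :: "nat \<Rightarrow> nat \<Rightarrow> real" and x assume X: "X \<longlonglongrightarrow> x"
    have Xi: "(\<lambda>n. X n i) \<longlonglongrightarrow> x i" for i
      using continuous_on_tendsto_compose[OF continuous_on_product_coordinates X, of i] by simp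
    have "(\<lambda>n. C * nrm d (\<lambda>l. X n l - x l)) \<longlonglongrightarrow> C * nrm d (\<lambda>l. x l - x l)"
      unfolding L2_set_def by (intro tendsto_intros Xi)
    then have z: "(\<lambda>n. C * nrm d (\<lambda>l. X n l - x l)) \<longlonglongrightarrow> 0" by (simp add: L2_set_def)
    have "(\<lambda>n. f (X n) - f x) \<longlonglongrightarrow> 0"
      by (rule Lim_null_comparison[OF always_eventually z]) (use assms in auto)
    then show "(f \<circ> X) \<longlonglongrightarrow> f x" unfolding comp_def by (rule LIM_zero_cancel)
  qed
  then have f: "f \<in> borel_measurable borel" by (rule borel_measurable_continuous_onI)
  have "(\<lambda>x. x) \<in> Rd d \<rightarrow>\<^sub>M PiM UNIV (\<lambda>_. borel)"
  proof (rule measurable_PiM_single')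
    show "(\<lambda>x. x i) \<in> Rd d \<rightarrow>\<^sub>M borel" for i
    proof (cases "i < d")
      case False
      have "(\<lambda>x. undefined) \<in> Rd d \<rightarrow>\<^sub>M borel" by simp
      then show ?thesis
        by (rule measurable_cong[THEN iffD1, rotated]) (use False in \<open>auto simp: Rd_def space_PiM PiE_def extensional_def\<close>)
    qed (rule measurable_Rd_component)
  qed auto
  then have "(\<lambda>x. x) \<in> Rd d \<rightarrow>\<^sub>M borel"
    by (subst (asm) measurable_cong_sets[OF refl sets_PiM_equal_borel])
  from measurable_compose[OF this f] show ?thesis .
qed

section \<open>Regularity of the posterior mean and of its flow\<close>

context bounded_prior
begin

lemma dot_pm: "(\<Sum>l<d. c l * pm (\<lambda>y. y l) \<rho> w) = Av 1 (\<lambda>Y. dot d c (Y 0)) \<rho> w"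
proof -
  have "Av 1 (\<lambda>Y. \<Sum>l<d. c l * Y 0 l) \<rho> w = (\<Sum>l<d. Av 1 (\<lambda>Y. c l * Y 0 l) \<rho> w)"
    by (rule Av_sum) (auto intro!: bd_cmult bd_component)
  then show ?thesis by (simp add: dot_def Av_cmult Av_component[of _ 1, simplified])
qed

text \<open>The derivative of <c, E[Y | w]> in direction a is rho times the posterior covariance of
  <c, Y> and <a, Y>, hence at most 2 rho R^2 |c| |a| for rho >= 0; the mean value theorem is applied
  on the segment from \<open>v\<close> to \<open>u\<close>.\<close>

lemma pm_lipschitz:
  "nrm d (\<lambda>l. pm (\<lambda>y. y l) \<rho> u - pm (\<lambda>y. y l) \<rho> v) \<le> 2 * \<bar>\<rho>\<bar> * R\<^sup>2 * nrm d (\<lambda>l. u l - v l)"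
proof (rule nrm_le_dual)
  fix c :: "nat \<Rightarrow> real"
  let ?a = "\<lambda>l. u l - v l"
  let ?w = "\<lambda>s l. v l + s * ?a l"
  let ?f = "\<lambda>s. Av 1 (\<lambda>Y. dot d c (Y 0)) \<rho> (?w s)"
  let ?f' = "\<lambda>s. Av 1 (\<lambda>Y. 0 + dot d c (Y 0) * (\<Sum>a<1. dE \<rho> 0 (?w s) ?a (Y a))) \<rho> (?w s)
     - real 1 * Av 1 (\<lambda>Y. dot d c (Y 0)) \<rho> (?w s) * pm (dE \<rho> 0 (?w s) ?a) \<rho> (?w s)"
  have D: "(?f has_real_derivative ?f' s) (at s)" for s
  proof -
    have "\<exists>S'. open S' \<and> s \<in> S' \<and> curve_on S' (\<lambda>_. \<rho>) (\<lambda>_. 0) ?w (\<lambda>_. ?a)"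
      by (rule curve_on_C1[where S = UNIV]) (auto intro!: derivative_eq_intros)
    then obtain S where S: "open S" "s \<in> S" "curve_on S (\<lambda>_. \<rho>) (\<lambda>_. 0) ?w (\<lambda>_. ?a)" by blast
    show ?thesis by (rule Av_deriv[OF S(3,1,2) nice_bd[OF bd_dot_left]]) simp
  qed
  have bc: "bd 1 (\<lambda>Y. dot d c (Y 0))" by (rule bd_dot_left) simp
  have bE: "bd 1 (\<lambda>Y. dE \<rho> 0 w ?a (Y 0))" for w
    unfolding dE_def by (intro bd_add bd_diff bd_cmult bd_dot_left bd_dot) auto
  have bound: "\<bar>?f' s\<bar> \<le> 2 * \<bar>\<rho>\<bar> * R\<^sup>2 * nrm d ?a * nrm d c" for s
  proof -
    let ?E = "\<lambda>Y. dE \<rho> 0 (?w s) ?a (Y 0)"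
    let ?N = "nrm d c * R" and ?M = "\<bar>\<rho>\<bar> * (nrm d ?a * R)"
    have c: "\<bar>dot d c (Y 0)\<bar> \<le> ?N" if "Y \<in> gs 1" for Y using that by (intro abs_dot_le_R) (simp add: gs_def)
    have E: "\<bar>?E Y\<bar> \<le> ?M" if "Y \<in> gs 1" for Y
      using abs_dE_le[of "Y 0" \<rho> 0 "?w s" ?a] that by (simp add: gs_def)
    have N0: "?N \<ge> 0" "?M \<ge> 0" using R_nonneg by auto
    have "\<bar>Av 1 (\<lambda>Y. dot d c (Y 0) * ?E Y) \<rho> (?w s)\<bar> \<le> Av 1 (\<lambda>Y. \<bar>dot d c (Y 0) * ?E Y\<bar>) \<rho> (?w s)"
      by (intro Av_abs_le bd_mult bc bE)
    also have "\<dots> \<le> Av 1 (\<lambda>Y. ?N * ?M) \<rho> (?w s)"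
      by (intro Av_mono bd_abs bd_mult bc bE bd_const) (auto simp: abs_mult intro!: mult_mono c E N0)
    finally have 1: "\<bar>Av 1 (\<lambda>Y. dot d c (Y 0) * ?E Y) \<rho> (?w s)\<bar> \<le> ?N * ?M" by (simp add: Av_const)
    have "\<bar>Av 1 (\<lambda>Y. dot d c (Y 0)) \<rho> (?w s)\<bar> \<le> Av 1 (\<lambda>Y. \<bar>dot d c (Y 0)\<bar>) \<rho> (?w s)" by (intro Av_abs_le bc)
    also have "\<dots> \<le> Av 1 (\<lambda>Y. ?N) \<rho> (?w s)" by (intro Av_mono bd_abs bc bd_const c)
    finally have 2: "\<bar>Av 1 (\<lambda>Y. dot d c (Y 0)) \<rho> (?w s)\<bar> \<le> ?N" by (simp add: Av_const)
    have "\<bar>Av 1 ?E \<rho> (?w s)\<bar> \<le> Av 1 (\<lambda>Y. \<bar>?E Y\<bar>) \<rho> (?w s)" by (intro Av_abs_le bE)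
    also have "\<dots> \<le> Av 1 (\<lambda>Y. ?M) \<rho> (?w s)" by (intro Av_mono bd_abs bE bd_const E)
    finally have 3: "\<bar>pm (dE \<rho> 0 (?w s) ?a) \<rho> (?w s)\<bar> \<le> ?M"
      using Av_1[OF measurable_dE abs_dE_le, of \<rho> 0 "?w s" ?a \<rho> "?w s"] by (simp add: Av_const)
    have "\<bar>Av 1 (\<lambda>Y. dot d c (Y 0)) \<rho> (?w s) * pm (dE \<rho> 0 (?w s) ?a) \<rho> (?w s)\<bar> \<le> ?N * ?M"
      unfolding abs_mult by (intro mult_mono 2 3 N0) auto
    then have "\<bar>?f' s\<bar> \<le> 2 * (?N * ?M)" using 1 by simp
    also have "\<dots> = 2 * \<bar>\<rho>\<bar> * R\<^sup>2 * nrm d ?a * nrm d c" by (simp add: power2_eq_square)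
    finally show ?thesis .
  qed
  have "\<exists>z>0. z < 1 \<and> ?f 1 - ?f 0 = (1 - 0) * ?f' z" by (rule MVT2) (use D in auto)
  then obtain z where z: "?f 1 - ?f 0 = ?f' z" by auto
  have "dot d c (\<lambda>l. pm (\<lambda>y. y l) \<rho> u - pm (\<lambda>y. y l) \<rho> v) = ?f 1 - ?f 0"
    unfolding dot_diff_right unfolding dot_def[of d c "\<lambda>l. pm (\<lambda>y. y l) _ _"] dot_pm by simp
  also have "\<dots> \<le> 2 * \<bar>\<rho>\<bar> * R\<^sup>2 * nrm d ?a * nrm d c" unfolding z using bound[of z] by linarith
  finally show "dot d c (\<lambda>l. pm (\<lambda>y. y l) \<rho> u - pm (\<lambda>y. y l) \<rho> v) \<le> 2 * \<bar>\<rho>\<bar> * R\<^sup>2 * nrm d ?a * nrm d c" .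
qed auto

lemma pm_mean_bound: "nrm d (\<lambda>l. pm (\<lambda>y. y l) \<rho> w) \<le> R"
proof (rule nrm_le_dual)
  fix c :: "nat \<Rightarrow> real"
  have b: "bd 1 (\<lambda>Y. dot d c (Y 0))" by (rule bd_dot_left) simp
  have "dot d c (\<lambda>l. pm (\<lambda>y. y l) \<rho> w) = Av 1 (\<lambda>Y. dot d c (Y 0)) \<rho> w"
    unfolding dot_def[of d c "\<lambda>l. pm (\<lambda>y. y l) _ _"] dot_pm ..
  also have "\<dots> \<le> Av 1 (\<lambda>Y. nrm d c * R) \<rho> w"
  proof (rule Av_mono[OF b bd_const])
    fix Y assume "Y \<in> gs 1"
    then show "dot d c (Y 0) \<le> nrm d c * R" using abs_dot_le_R[of "Y 0" c] by (simp add: gs_def)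
  qed
  finally show "dot d c (\<lambda>l. pm (\<lambda>y. y l) \<rho> w) \<le> R * nrm d c" by (simp add: Av_const mult.commute)
qed (rule R_nonneg)

text \<open>Dominated convergence along a convergent sequence of parameters, on which rho and the
  norm of \<open>w\<close> are bounded.\<close>

lemma integral_Efac_continuous:
  fixes w :: "real \<Rightarrow> nat \<Rightarrow> real"
  assumes w: "\<And>k. k < d \<Longrightarrow> continuous_on A (\<lambda>r. w r k)"
    and g: "g \<in> borel_measurable P" "\<And>y. nrm d y \<le> R \<Longrightarrow> \<bar>g y\<bar> \<le> C"
  shows "continuous_on A (\<lambda>r. \<integral>y. g y * Efac d r (w r) y \<partial>P)"
  unfolding continuous_on_sequentially
proof (intro allI ballI impI, elim conjE)
  fix X r assume r: "r \<in> A" and XA: "\<forall>n. X n \<in> A" and X: "X \<longlonglongrightarrow> r"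
  have wk: "(\<lambda>n. w (X n) k) \<longlonglongrightarrow> w r k" if "k < d" for k
    using w[OF that] X XA r unfolding continuous_on_sequentially comp_def by blast
  have nw: "(\<lambda>n. nrm d (w (X n))) \<longlonglongrightarrow> nrm d (w r)"
    unfolding L2_set_def by (intro tendsto_intros wk) simp
  obtain B1 where B1: "\<And>n. \<bar>X n\<bar> \<le> B1"
    using convergent_imp_Bseq[of X] X unfolding Bseq_def convergent_def by auto
  obtain B2 where B2: "\<And>n. nrm d (w (X n)) \<le> B2"
    using convergent_imp_Bseq[of "\<lambda>n. nrm d (w (X n))"] nw unfolding Bseq_def convergent_def by auto
  have "(\<lambda>n. \<integral>y. g y * Efac d (X n) (w (X n)) y \<partial>P) \<longlonglongrightarrow> (\<integral>y. g y * Efac d r (w r) y \<partial>P)"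
  proof (rule integral_dominated_convergence[where w = "\<lambda>_. C * exp (B1 * (B2 * R))"])
    show "AE y in P. (\<lambda>n. g y * Efac d (X n) (w (X n)) y) \<longlonglongrightarrow> g y * Efac d r (w r) y"
      unfolding Efac_def dot_def by (intro AE_I2 tendsto_intros X wk) auto
    show "AE y in P. norm (g y * Efac d (X n) (w (X n)) y) \<le> C * exp (B1 * (B2 * R))" for n
      using AE_R
    proof eventually_elim
      case (elim y)
      have "\<bar>X n\<bar> * (nrm d (w (X n)) * R) \<le> B1 * (B2 * R)"
        using B1[of n] B2[of n] R_nonneg order_trans[OF L2_set_nonneg B2[of n]]
        by (intro mult_mono) (auto intro: order_trans)
      then have "Efac d (X n) (w (X n)) y \<le> exp (B1 * (B2 * R))"
        using Efac_bounds(1)[OF elim, of "X n" "w (X n)"] by (meson exp_le_cancel_iff order_trans)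
      moreover have "0 \<le> C" using g(2)[OF elim] by linarith
      ultimately show ?case
        unfolding real_norm_def abs_mult using g(2)[OF elim] Efac_pos[of d "X n" "w (X n)" y]
        by (intro mult_mono) auto
    qed
  qed (use borel_measurable_times[OF g(1) measurable_Efac] in auto)
  then show "((\<lambda>r. \<integral>y. g y * Efac d r (w r) y \<partial>P) \<circ> X) \<longlonglongrightarrow> (\<integral>y. g y * Efac d r (w r) y \<partial>P)"
    by (simp add: comp_def)
qed

lemma pm_continuous:
  assumes w: "\<And>k. k < d \<Longrightarrow> continuous_on A (\<lambda>r. w r k)" and l: "l < d"
  shows "continuous_on A (\<lambda>r. pm (\<lambda>y. y l) r (w r))"
proof -
  have "continuous_on A (\<lambda>r. \<integral>y. y l * Efac d r (w r) y \<partial>P)"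
    by (rule integral_Efac_continuous[where C = R]) (use w l abs_component_le in auto)
  moreover have "continuous_on A (\<lambda>r. \<integral>y. 1 * Efac d r (w r) y \<partial>P)"
    by (rule integral_Efac_continuous[where C = 1]) (use w in auto)
  ultimately show ?thesis
    unfolding pm_def Zf_def using Zf_pos by (intro continuous_on_divide) (auto simp: Zf_def less_le)
qed

text \<open>The sum norm makes the construction depend on the dimension, but the estimates for the
  solution come from \<open>flow_lipschitz\<close> and \<open>flow_speed\<close> and do not.\<close>

lemma flow_exists:
  assumes "s \<in> {a..b}" shows "\<exists>w. flow w a b \<and> w s = w0"
proof -
  let ?K = "2 * max \<bar>a\<bar> \<bar>b\<bar> * R\<^sup>2"
  have "\<exists>u. u s = w0 \<and>
    (\<forall>k<d. \<forall>r\<in>{a..b}. ((\<lambda>r. u r k) has_real_derivative pm (\<lambda>y. y k) r (u r)) (at r within {a..b}))"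
  proof (rule picard_lindelof[where F = "\<lambda>r u k. pm (\<lambda>y. y k) r u" and K = ?K, OF assms])
    fix r u v i assume r: "r \<in> {a..b}" and i: "i < d"
    have "\<bar>pm (\<lambda>y. y i) r u - pm (\<lambda>y. y i) r v\<bar> \<le> nrm d (\<lambda>l. pm (\<lambda>y. y l) r u - pm (\<lambda>y. y l) r v)"
      by (rule abs_le_nrm[OF i])
    also have "\<dots> \<le> 2 * \<bar>r\<bar> * R\<^sup>2 * nrm d (\<lambda>l. u l - v l)" by (rule pm_lipschitz)
    also have "\<dots> \<le> ?K * (\<Sum>k<d. \<bar>u k - v k\<bar>)"
      using r by (intro mult_mono mult_nonneg_nonneg L2_set_le_sum_abs) auto
    finally show "\<bar>pm (\<lambda>y. y i) r u - pm (\<lambda>y. y i) r v\<bar> \<le> ?K * (\<Sum>k<d. \<bar>u k - v k\<bar>)" .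
  qed (auto intro: pm_continuous)
  then show ?thesis unfolding flow_def by blast
qed

text \<open>Gronwall: the squared distance times exp(-4 b R^2 q) is nonincreasing in q, by
  \<open>pm_lipschitz\<close>.\<close>

lemma flow_lipschitz:
  assumes f: "flow u a b" "flow v a b" and ab: "0 \<le> a" "a \<le> s" "s \<le> r" "r \<le> b"
  shows "nrm d (\<lambda>l. u r l - v r l) \<le> exp (2 * b * R\<^sup>2 * (r - s)) * nrm d (\<lambda>l. u s l - v s l)"
proof -
  let ?L = "2 * b * R\<^sup>2"
  let ?z = "\<lambda>q l. u q l - v q l"
  let ?m = "\<lambda>q l. pm (\<lambda>y. y l) q (u q) - pm (\<lambda>y. y l) q (v q)"
  let ?g = "\<lambda>q. dot d (?z q) (?z q) * exp (- (2 * ?L * q))"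
  have "?g r \<le> ?g s"
  proof (rule DERIV_nonpos_imp_decreasing_open[OF ab(3)])
    fix q assume q: "s < q" "q < r"
    then have q': "q \<in> {a<..<b}" using ab by auto
    have Dz: "((\<lambda>q. ?z q l) has_real_derivative ?m q l) (at q)" if "l < d" for l
      by (rule DERIV_diff[OF flow_at[OF f(1) q' that] flow_at[OF f(2) q' that]])
    have "((\<lambda>q. dot d (?z q) (?z q)) has_real_derivative (\<Sum>l<d. ?m q l * ?z q l + ?m q l * ?z q l)) (at q)"
      unfolding dot_def by (intro DERIV_sum DERIV_mult Dz) auto
    then have "((\<lambda>q. dot d (?z q) (?z q)) has_real_derivative 2 * dot d (?z q) (?m q)) (at q)"
      by (simp add: dot_def sum_distrib_left mult_ac)
    moreover have "((\<lambda>q. exp (- (2 * ?L * q))) has_real_derivative - (2 * ?L) * exp (- (2 * ?L * q))) (at q)"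
      by (auto intro!: derivative_eq_intros)
    ultimately have "(?g has_real_derivative 2 * dot d (?z q) (?m q) * exp (- (2 * ?L * q))
       + - (2 * ?L) * exp (- (2 * ?L * q)) * dot d (?z q) (?z q)) (at q)"
      by (rule DERIV_mult)
    moreover have "2 * dot d (?z q) (?m q) * exp (- (2 * ?L * q))
       + - (2 * ?L) * exp (- (2 * ?L * q)) * dot d (?z q) (?z q) \<le> 0"
    proof -
      have "dot d (?z q) (?m q) \<le> nrm d (?z q) * nrm d (?m q)" using abs_dot_le[of d "?z q" "?m q"] by linarith
      also have "\<dots> \<le> nrm d (?z q) * (2 * \<bar>q\<bar> * R\<^sup>2 * nrm d (?z q))"
        by (intro mult_left_mono pm_lipschitz) auto
      also have "\<dots> \<le> nrm d (?z q) * (?L * nrm d (?z q))"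
        using q ab by (intro mult_left_mono mult_right_mono) auto
      also have "\<dots> = ?L * dot d (?z q) (?z q)" by (simp add: dot_self power2_eq_square)
      finally have le: "dot d (?z q) (?m q) \<le> ?L * dot d (?z q) (?z q)" .
      have "2 * x * e + - (2 * l) * e * z \<le> 0" if "x \<le> l * z" "e \<ge> 0" for x l z e :: real
        using mult_right_mono[OF that] by (simp add: algebra_simps)
      from this[OF le exp_ge_zero] show ?thesis .
    qed
    ultimately show "\<exists>y. (?g has_real_derivative y) (at q) \<and> y \<le> 0" by blast
  next
    have c: "continuous_on {a..b} (\<lambda>q. w q l)" if "flow w a b" "l < d" for w l
      using that unfolding flow_def by (intro DERIV_continuous_on) blast
    have "continuous_on {a..b} ?g"
      unfolding dot_def by (intro continuous_intros c f) auto
    then show "continuous_on {s..r} ?g" by (rule continuous_on_subset) (use ab in auto)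
  qed
  then have "(nrm d (?z r))\<^sup>2 \<le> (nrm d (?z s))\<^sup>2 * exp (- (2 * ?L * s)) / exp (- (2 * ?L * r))"
    by (simp add: dot_self pos_le_divide_eq)
  also have "\<dots> = (exp (?L * (r - s)) * nrm d (?z s))\<^sup>2"
    by (simp add: power_mult_distrib exp_minus exp_diff field_simps flip: exp_double exp_add)
  finally show ?thesis by (rule power2_le_imp_le) auto
qed

lemma flow_speed:
  assumes f: "flow w a b" and ab: "a \<le> s" "s \<le> r" "r \<le> b"
  shows "nrm d (\<lambda>l. w r l - w s l) \<le> R * (r - s)"
proof (cases "s = r")
  case False
  show ?thesis
  proof (rule nrm_le_dual)
    fix c :: "nat \<Rightarrow> real"
    have cont: "continuous_on {a..b} (\<lambda>q. w q l)" if "l < d" for l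
      using f that unfolding flow_def by (intro DERIV_continuous_on) blast
    have D: "((\<lambda>q. dot d c (w q)) has_real_derivative dot d c (\<lambda>l. pm (\<lambda>y. y l) q (w q))) (at q)" if "q \<in> {a<..<b}" for q
      unfolding dot_def by (intro DERIV_sum DERIV_cmult flow_at[OF f that]) auto
    have "\<exists>l z. s < z \<and> z < r \<and> ((\<lambda>q. dot d c (w q)) has_real_derivative l) (at z) \<and> dot d c (w r) - dot d c (w s) = (r - s) * l"
    proof (rule MVT)
      show "continuous_on {s..r} (\<lambda>q. dot d c (w q))"
        unfolding dot_def by (intro continuous_intros continuous_on_subset[OF cont]) (use ab in auto)
      show "(\<lambda>q. dot d c (w q)) differentiable at x" if "s < x" "x < r" for x
        using D[of x] ab that real_differentiable_def by force
    qed (use ab False in auto)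
    then obtain l z where z: "s < z" "z < r" "((\<lambda>q. dot d c (w q)) has_real_derivative l) (at z)" "dot d c (w r) - dot d c (w s) = (r - s) * l" by blast
    have "l = dot d c (\<lambda>l. pm (\<lambda>y. y l) z (w z))" by (rule DERIV_unique[OF z(3) D]) (use z ab in auto)
    also have "\<dots> \<le> nrm d c * nrm d (\<lambda>l. pm (\<lambda>y. y l) z (w z))" using abs_dot_le[of d c "\<lambda>l. pm (\<lambda>y. y l) z (w z)"] by linarith
    also have "\<dots> \<le> nrm d c * R" by (intro mult_left_mono pm_mean_bound) auto
    finally have "(r - s) * l \<le> (r - s) * (nrm d c * R)" using ab by (intro mult_left_mono) auto
    then show "dot d c (\<lambda>l. w r l - w s l) \<le> R * (r - s) * nrm d c"
      unfolding dot_diff_right z(4) by (simp add: mult_ac)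
  qed (use ab R_nonneg in auto)
qed (simp add: L2_set_def)

end

section \<open>Dimension-free bounds under doubling\<close>

context ud_prior
begin

text \<open>Bound for the average of |eval e| over \<open>n\<close> replicas. Up to
  \<open>cst\<close>, each atom is at most (1 + R^2)(1 + rho)(1 + sum of rho times the gaps), to its
  degree; \<open>power_le_exp\<close> trades the power of the last factor for exponentials, and
  every replica then costs one factor from \<open>pm_exp_gap\<close>.\<close>

definition Kb :: "ex \<Rightarrow> nat \<Rightarrow> real \<Rightarrow> real" where
  "Kb e n \<rho> = cst e * ((1 + R\<^sup>2) * (1 + \<rho>)) ^ dg e * ((2 * real (dg e)) ^ dg e * exp (1/2)) * (D * exp (\<rho>\<^sup>2 / 2 * R\<^sup>2)) ^ n"

lemma Kb_nonneg: "\<rho> \<ge> 0 \<Longrightarrow> Kb e n \<rho> \<ge> 0"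
  unfolding Kb_def using D_ge_1 R_nonneg by (intro mult_nonneg_nonneg zero_le_power cst_nonneg add_nonneg_nonneg) auto

lemma Kb_mono: "0 \<le> \<rho> \<Longrightarrow> \<rho> \<le> \<rho>' \<Longrightarrow> Kb e n \<rho> \<le> Kb e n \<rho>'"
  unfolding Kb_def using D_ge_1 R_nonneg
  by (intro mult_mono power_mono mult_nonneg_nonneg zero_le_power cst_nonneg add_nonneg_nonneg add_mono)
    (auto intro!: mult_right_mono divide_right_mono power_mono)

lemma abs_eval_le:
  assumes Y: "Y \<in> gs n" and \<rho>: "\<rho> \<ge> 0" and e: "fits n e"
  shows "\<bar>eval d e \<rho> w Y\<bar> \<le> cst e * ((1 + R\<^sup>2) * (1 + \<rho>) * (1 + (\<Sum>a<n. \<rho> * gap w (Y a)))) ^ dg e"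
  using e
proof (induction e)
  case (Pl p)
  let ?s = "\<Sum>a<n. \<rho> * gap w (Y a)"
  have s0: "?s \<ge> 0" by (intro sum_nonneg mult_nonneg_nonneg \<rho> gap_nonneg)
  have "1 * (1 + \<rho>) * 1 \<le> (1 + R\<^sup>2) * (1 + \<rho>) * (1 + ?s)"
    using \<rho> s0 by (intro mult_mono) auto
  then have "(1 + \<rho>) ^ degree p \<le> ((1 + R\<^sup>2) * (1 + \<rho>) * (1 + ?s)) ^ degree p"
    using \<rho> by (intro power_mono) auto
  from mult_left_mono[OF this pabs_nonneg[of p]] show ?case using abs_poly_le[OF \<rho>, of p] by simp
next
  case (Sx a b)
  let ?s = "\<Sum>a<n. \<rho> * gap w (Y a)"
  have g0: "\<rho> * gap w y \<ge> 0" for y using \<rho> gap_nonneg by simp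
  have s0: "?s \<ge> 0" by (intro sum_nonneg g0)
  have m: "\<rho> * gap w (Y a) \<le> ?s" if "a < n" for a using that by (intro member_le_sum g0) auto
  have "\<bar>\<rho> * (dot d w (Y a) - dot d w (Y b))\<bar> \<le> \<rho> * (gap w (Y a) + gap w (Y b))"
    unfolding abs_mult using \<rho> by (intro mult_mono abs_dot_diff_le_gap) auto
  also have "\<dots> \<le> 2 * ?s" using m[of a] m[of b] Sx by (simp add: distrib_left)
  also have "\<dots> \<le> 2 * (1 * (1 + ?s))" by simp
  also have "1 * (1 + ?s) \<le> (1 + R\<^sup>2) * (1 + \<rho>) * (1 + ?s)"
    using \<rho> s0 by (intro mult_right_mono) (auto simp: algebra_simps intro!: add_nonneg_nonneg)
  finally show ?case by simp
next
  case (Qx a b)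
  let ?s = "\<Sum>a<n. \<rho> * gap w (Y a)"
  have s0: "?s \<ge> 0" by (intro sum_nonneg mult_nonneg_nonneg \<rho> gap_nonneg)
  have "\<bar>dot d (Y a) (Y b)\<bar> \<le> nrm d (Y a) * nrm d (Y b)" by (rule abs_dot_le)
  also have "\<dots> \<le> R * R" using Y Qx R_nonneg by (intro mult_mono) (auto simp: gs_def)
  also have "\<dots> \<le> (1 + R\<^sup>2) * 1 * 1" by (simp add: power2_eq_square)
  also have "\<dots> \<le> (1 + R\<^sup>2) * (1 + \<rho>) * (1 + ?s)" using \<rho> s0 by (intro mult_mono) auto
  finally show ?case by simp
next
  case (Ad e f)
  let ?B = "(1 + R\<^sup>2) * (1 + \<rho>) * (1 + (\<Sum>a<n. \<rho> * gap w (Y a)))"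
  have s0: "(\<Sum>a<n. \<rho> * gap w (Y a)) \<ge> 0" by (intro sum_nonneg mult_nonneg_nonneg \<rho> gap_nonneg)
  have "1 * 1 * 1 \<le> ?B" using \<rho> s0 by (intro mult_mono) auto
  then have B: "1 \<le> ?B" by simp
  have "cst e * ?B ^ dg e \<le> cst e * ?B ^ (dg e + dg f)" "cst f * ?B ^ dg f \<le> cst f * ?B ^ (dg e + dg f)"
    by (intro mult_left_mono power_increasing B cst_nonneg; simp)+
  then show ?case using Ad unfolding eval.simps fits.simps cst.simps dg.simps distrib_right by (smt (verit))
next
  case (Mu e f)
  let ?B = "(1 + R\<^sup>2) * (1 + \<rho>) * (1 + (\<Sum>a<n. \<rho> * gap w (Y a)))"
  have "\<bar>eval d e \<rho> w Y\<bar> * \<bar>eval d f \<rho> w Y\<bar> \<le> (cst e * ?B ^ dg e) * (cst f * ?B ^ dg f)"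
    by (intro mult_mono) (use Mu order_trans[OF abs_ge_zero] in auto)
  then show ?case by (simp add: abs_mult power_add mult_ac)
qed

lemma Av_prod_exp_gap:
  assumes \<rho>: "\<rho> \<ge> 0"
  shows "bd n (\<lambda>Y. \<Prod>a<n. exp (\<rho> * gap w (Y a) / 2))"
    and "Av n (\<lambda>Y. \<Prod>a<n. exp (\<rho> * gap w (Y a) / 2)) \<rho> w = pm (\<lambda>y. exp (\<rho> * gap w y / 2)) \<rho> w ^ n"
proof -
  obtain C where C: "\<And>y. nrm d y \<le> R \<Longrightarrow> \<bar>exp (\<rho> * gap w y / 2)\<bar> \<le> C" by (rule exp_gap_bounded[OF \<rho>]; blast)
  have m: "(\<lambda>y. exp (\<rho> * gap w y / 2)) \<in> borel_measurable P" by measurable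
  have "bd n (\<lambda>Y. \<Prod>a<n. exp (\<rho> * gap w (Y a) / 2)) \<and>
    Av n (\<lambda>Y. \<Prod>a<n. exp (\<rho> * gap w (Y a) / 2)) \<rho> w = pm (\<lambda>y. exp (\<rho> * gap w y / 2)) \<rho> w ^ n" for n
  proof (induction n)
    case 0
    then show ?case using bd_const[of 0 1] Av_const[of 0 1] by simp
  next
    case (Suc n)
    then have b: "bd n (\<lambda>Y. \<Prod>a<n. exp (\<rho> * gap w (Y a) / 2))" by blast
    show ?case
      using Nm_Suc(2)[OF b, where g = "\<lambda>y. exp (\<rho> * gap w y / 2)", OF m C]
        Av_Suc[OF b, where g = "\<lambda>y. exp (\<rho> * gap w y / 2)", OF m C, of \<rho> w] Suc by simp
  qed
  then show "bd n (\<lambda>Y. \<Prod>a<n. exp (\<rho> * gap w (Y a) / 2))"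
    and "Av n (\<lambda>Y. \<Prod>a<n. exp (\<rho> * gap w (Y a) / 2)) \<rho> w = pm (\<lambda>y. exp (\<rho> * gap w y / 2)) \<rho> w ^ n" by blast+
qed

lemma Av_abs_eval_le:
  assumes \<rho>: "\<rho> \<ge> 0" and e: "fits n e"
  shows "Av n (\<lambda>Y. \<bar>eval d e \<rho> w Y\<bar>) \<rho> w \<le> Kb e n \<rho>"
proof -
  let ?c = "cst e * ((1 + R\<^sup>2) * (1 + \<rho>)) ^ dg e * ((2 * real (dg e)) ^ dg e * exp (1/2))"
  have c0: "?c \<ge> 0" using \<rho> R_nonneg by (intro mult_nonneg_nonneg cst_nonneg zero_le_power add_nonneg_nonneg) auto
  have "Av n (\<lambda>Y. \<bar>eval d e \<rho> w Y\<bar>) \<rho> w \<le> Av n (\<lambda>Y. ?c * (\<Prod>a<n. exp (\<rho> * gap w (Y a) / 2))) \<rho> w"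
  proof (rule Av_mono[OF bd_abs[OF bd_eval[OF e]] bd_cmult[OF Av_prod_exp_gap(1)[OF \<rho>]]])
    fix Y assume Y: "Y \<in> gs n"
    let ?s = "\<Sum>a<n. \<rho> * gap w (Y a)"
    have s0: "?s \<ge> 0" by (intro sum_nonneg mult_nonneg_nonneg \<rho> gap_nonneg)
    have "exp ((1 + ?s) / 2) = exp (1/2) * (\<Prod>a<n. exp (\<rho> * gap w (Y a) / 2))"
      by (simp add: exp_sum[symmetric] exp_add[symmetric] add_divide_distrib sum_divide_distrib)
    then have p: "(1 + ?s) ^ dg e \<le> (2 * real (dg e)) ^ dg e * exp (1/2) * (\<Prod>a<n. exp (\<rho> * gap w (Y a) / 2))"
      using power_le_exp[OF s0, of "dg e"] by (simp add: mult.assoc)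
    have "\<bar>eval d e \<rho> w Y\<bar> \<le> cst e * ((1 + R\<^sup>2) * (1 + \<rho>)) ^ dg e * (1 + ?s) ^ dg e"
      using abs_eval_le[OF Y \<rho> e, of w] by (simp add: power_mult_distrib mult_ac)
    also have "\<dots> \<le> cst e * ((1 + R\<^sup>2) * (1 + \<rho>)) ^ dg e * ((2 * real (dg e)) ^ dg e * exp (1/2) * (\<Prod>a<n. exp (\<rho> * gap w (Y a) / 2)))"
      using \<rho> R_nonneg by (intro mult_left_mono[OF p] mult_nonneg_nonneg cst_nonneg zero_le_power add_nonneg_nonneg) auto
    finally show "\<bar>eval d e \<rho> w Y\<bar> \<le> ?c * (\<Prod>a<n. exp (\<rho> * gap w (Y a) / 2))" by (simp add: mult_ac)
  qed
  also have "\<dots> = ?c * pm (\<lambda>y. exp (\<rho> * gap w y / 2)) \<rho> w ^ n"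
    by (simp add: Av_cmult Av_prod_exp_gap(2)[OF \<rho>])
  also have "\<dots> \<le> ?c * (D * exp (\<rho>\<^sup>2 / 2 * R\<^sup>2)) ^ n"
  proof (intro mult_left_mono[OF _ c0] power_mono pm_exp_gap \<rho>)
    show "0 \<le> pm (\<lambda>y. exp (\<rho> * gap w y / 2)) \<rho> w"
      unfolding pm_def using Zf_pos less_imp_le[OF Efac_pos] by (intro divide_nonneg_pos Bochner_Integration.integral_nonneg) auto
  qed
  finally show ?thesis unfolding Kb_def .
qed

text \<open>The free index is contracted with \<open>c\<close> before estimating, so that |<c, Y_0>|
  <= R |c| applies and no factor of \<open>d\<close> appears.\<close>

lemma dot_Av_eval_le:
  assumes \<rho>: "\<rho> \<ge> 0" and e: "fits n e" "1 \<le> n"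
  shows "\<bar>\<Sum>i<d. c i * Av n (\<lambda>Y. Y 0 i * eval d e \<rho> w Y) \<rho> w\<bar> \<le> nrm d c * (R * Kb e n \<rho>)"
proof -
  have b: "bd n (\<lambda>Y. dot d c (Y 0) * eval d e \<rho> w Y)" using e by (intro bd_mult bd_dot_left bd_eval) auto
  have "(\<Sum>i<d. c i * Av n (\<lambda>Y. Y 0 i * eval d e \<rho> w Y) \<rho> w) = Av n (\<lambda>Y. \<Sum>i<d. c i * (Y 0 i * eval d e \<rho> w Y)) \<rho> w"
    unfolding Av_cmult[symmetric] using e by (intro Av_sum[symmetric] bd_cmult bd_mult bd_component bd_eval) auto
  also have "\<dots> = Av n (\<lambda>Y. dot d c (Y 0) * eval d e \<rho> w Y) \<rho> w"
    by (simp add: dot_def sum_distrib_right mult.assoc)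
  finally have "\<bar>\<Sum>i<d. c i * Av n (\<lambda>Y. Y 0 i * eval d e \<rho> w Y) \<rho> w\<bar> \<le> Av n (\<lambda>Y. \<bar>dot d c (Y 0) * eval d e \<rho> w Y\<bar>) \<rho> w"
    using Av_abs_le[OF b] by simp
  also have "\<dots> \<le> Av n (\<lambda>Y. (nrm d c * R) * \<bar>eval d e \<rho> w Y\<bar>) \<rho> w"
  proof (rule Av_mono[OF bd_abs[OF b] bd_cmult[OF bd_abs[OF bd_eval[OF e(1)]]]])
    fix Y assume "Y \<in> gs n"
    then have "\<bar>dot d c (Y 0)\<bar> \<le> nrm d c * R" using e by (intro abs_dot_le_R) (simp add: gs_def)
    then show "\<bar>dot d c (Y 0) * eval d e \<rho> w Y\<bar> \<le> nrm d c * R * \<bar>eval d e \<rho> w Y\<bar>"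
      unfolding abs_mult by (intro mult_right_mono) auto
  qed
  also have "\<dots> \<le> (nrm d c * R) * Kb e n \<rho>"
    unfolding Av_cmult using R_nonneg by (intro mult_left_mono Av_abs_eval_le \<rho> e) auto
  finally show ?thesis by (simp add: mult.assoc)
qed

lemma dot_Vf_le:
  assumes t: "t > 0"
  shows "\<bar>\<Sum>i<d. c i * Vf j t x i\<bar> \<le>
    (\<bar>poly (alp j) (rho t)\<bar> * nrm d x + sg t * poly kap (rho t) * (R * Kb (eps j) (2 * j + 1) (rho t))) * nrm d c"
proof -
  let ?A = "\<lambda>i. Av (2 * j + 1) (\<lambda>Y. Y 0 i * eval d (eps j) (rho t) (\<lambda>l. x l / sg t) Y) (rho t) (\<lambda>l. x l / sg t)"
  have r: "rho t > 0" "sg t > 0" by (auto intro: rho_pos sg_pos t)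
  have k: "poly kap (rho t) > 0" by (rule poly_kap_pos[OF r(1)])
  have "(\<Sum>i<d. c i * Vf j t x i) = poly (alp j) (rho t) * dot d c x + sg t * poly kap (rho t) * (\<Sum>i<d. c i * ?A i)"
    by (simp add: Vf_def dot_def sum_distrib_left sum.distrib algebra_simps)
  moreover have "\<bar>poly (alp j) (rho t) * dot d c x\<bar> \<le> \<bar>poly (alp j) (rho t)\<bar> * (nrm d c * nrm d x)"
    unfolding abs_mult by (intro mult_left_mono abs_dot_le) auto
  moreover have "\<bar>sg t * poly kap (rho t) * (\<Sum>i<d. c i * ?A i)\<bar> \<le> sg t * poly kap (rho t) * (nrm d c * (R * Kb (eps j) (2 * j + 1) (rho t)))"
    unfolding abs_mult[of "sg t * poly kap (rho t)"] using r k
    by (intro mult_mono dot_Av_eval_le fits_eps) auto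
  ultimately have "\<bar>\<Sum>i<d. c i * Vf j t x i\<bar> \<le> \<bar>poly (alp j) (rho t)\<bar> * (nrm d c * nrm d x)
      + sg t * poly kap (rho t) * (nrm d c * (R * Kb (eps j) (2 * j + 1) (rho t)))" by linarith
  then show ?thesis by (simp add: algebra_simps)
qed

text \<open>The second derivative of the flow is d/dr E[Y | w(r)], the average of
  \<open>dd 1 (Pl 1)\<close> over three replicas divided by kap(r). The size of the constant does
  not reach the final bound, because it is only used for steps \<open>\<epsilon>\<close> tending to
  zero.\<close>

lemma flow_second_order:
  assumes f: "flow w a b" and ab: "0 < a" "a < q" "0 \<le> \<epsilon>" "q + \<epsilon> < b"
  shows "nrm d (\<lambda>l. w (q + \<epsilon>) l - w q l - \<epsilon> * pm (\<lambda>y. y l) q (w q))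
    \<le> \<epsilon>\<^sup>2 * (R * Kb (dd 1 (Pl 1)) 3 b / poly kap a)"
proof (cases "\<epsilon> = 0")
  case False
  let ?K = "R * Kb (dd 1 (Pl 1)) 3 b / poly kap a"
  have ka: "poly kap a > 0" by (rule poly_kap_pos[OF ab(1)])
  have K0: "?K \<ge> 0" using ka R_nonneg ab by (intro divide_nonneg_pos mult_nonneg_nonneg Kb_nonneg) auto
  let ?m = "\<lambda>r l. pm (\<lambda>y. y l) r (w r)"
  have curve: "curve_on {a<..<b} (\<lambda>s. s) (\<lambda>s. 1) w ?m"
  proof -
    obtain B where B: "\<And>r l. r \<in> {a..b} \<Longrightarrow> l < d \<Longrightarrow> \<bar>w r l\<bar> \<le> B" by (rule flow_bounded[OF f]; blast)
    have "\<bar>s\<bar> \<le> max (max b 1) (max B R) \<and> \<bar>1::real\<bar> \<le> max (max b 1) (max B R) \<and>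
       (\<forall>l<d. \<bar>w s l\<bar> \<le> max (max b 1) (max B R) \<and> \<bar>?m s l\<bar> \<le> max (max b 1) (max B R))" if "s \<in> {a<..<b}" for s
    proof (intro conjI allI impI)
      fix l assume l: "l < d"
      show "\<bar>w s l\<bar> \<le> max (max b 1) (max B R)" using B[of s l] l that by (simp add: le_max_iff_disj)
      show "\<bar>?m s l\<bar> \<le> max (max b 1) (max B R)" using pm_bound[OF l, of s "w s"] by (simp add: le_max_iff_disj)
    qed (use that ab in auto)
    then show ?thesis
      unfolding curve_on_def using flow_at[OF f] by (auto intro!: exI[of _ "max (max b 1) (max B R)"])
  qed
  show ?thesis
  proof (rule nrm_le_dual)
    fix c :: "nat \<Rightarrow> real"
    let ?g = "\<lambda>r. dot d c (?m r)"
    let ?g' = "\<lambda>r. \<Sum>l<d. c l * (1 * GA 1 l (Pl 1) r (w r) + (\<Sum>k<d. ?m r k * GB 1 l (Pl 1) k r (w r)))"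
    have m1: "?m r l = Av 1 (\<lambda>Y. Y 0 l * eval d (Pl 1) r (w r) Y) r (w r)" if "l < d" for r l
      using Av_component[OF that, of 1 r "w r"] by simp
    have Dg: "(?g has_real_derivative ?g' r) (at r)" if r: "r \<in> {a<..<b}" for r
    proof -
      have "((\<lambda>s. Av 1 (\<lambda>Y. Y 0 l * eval d (Pl 1) s (w s) Y) s (w s)) has_real_derivative
         1 * GA 1 l (Pl 1) r (w r) + (\<Sum>k<d. ?m r k * GB 1 l (Pl 1) k r (w r))) (at r)" if "l < d" for l
        by (rule Av_eval_deriv[OF curve _ r _ _ that]) auto
      then have "((\<lambda>s. \<Sum>l<d. c l * Av 1 (\<lambda>Y. Y 0 l * eval d (Pl 1) s (w s) Y) s (w s)) has_real_derivative ?g' r) (at r)"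
        by (intro DERIV_sum DERIV_cmult) auto
      moreover have "(\<lambda>s. \<Sum>l<d. c l * Av 1 (\<lambda>Y. Y 0 l * eval d (Pl 1) s (w s) Y) s (w s)) = ?g"
        unfolding dot_def using m1 by (intro ext sum.cong) auto
      ultimately show ?thesis by simp
    qed
    have g'_bound: "\<bar>?g' r\<bar> \<le> ?K * nrm d c" if r: "r \<in> {a<..<b}" for r
    proof -
      have kr: "poly kap r \<ge> poly kap a" unfolding poly_kap using r ab by (intro divide_right_mono add_mono power_mono) auto
      have "poly kap r * ?g' r = (\<Sum>l<d. c l * Av 3 (\<lambda>Y. Y 0 l * eval d (dd 1 (Pl 1)) r (w r) Y) r (w r))"
        unfolding sum_distrib_left
      proof (rule sum.cong[OF refl])
        fix l assume "l \<in> {..<d}"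
        then have "Av (1 + 2) (\<lambda>Y. Y 0 l * eval d (dd 1 (Pl 1)) r (w r) Y) r (w r)
          = poly kap r * (GA 1 l (Pl 1) r (w r) + (\<Sum>k<d. ?m r k * GB 1 l (Pl 1) k r (w r)))"
          by (intro Av_dd) auto
        then show "poly kap r * (c l * (1 * GA 1 l (Pl 1) r (w r) + (\<Sum>k<d. ?m r k * GB 1 l (Pl 1) k r (w r))))
          = c l * Av 3 (\<lambda>Y. Y 0 l * eval d (dd 1 (Pl 1)) r (w r) Y) r (w r)"
          by (simp add: numeral_3_eq_3 numeral_2_eq_2 mult.left_commute)
      qed
      also have "\<bar>\<dots>\<bar> \<le> nrm d c * (R * Kb (dd 1 (Pl 1)) 3 r)"
        using fits_dd[of 1 "Pl 1"] r ab by (intro dot_Av_eval_le) (auto simp: numeral_3_eq_3)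
      also have "\<dots> \<le> nrm d c * (R * Kb (dd 1 (Pl 1)) 3 b)"
        using r ab R_nonneg by (intro mult_left_mono Kb_mono) auto
      finally have "\<bar>poly kap r\<bar> * \<bar>?g' r\<bar> \<le> nrm d c * (R * Kb (dd 1 (Pl 1)) 3 b)" by (simp only: abs_mult)
      moreover have "poly kap a * \<bar>?g' r\<bar> \<le> \<bar>poly kap r\<bar> * \<bar>?g' r\<bar>" using kr by (intro mult_right_mono) auto
      ultimately have "poly kap a * \<bar>?g' r\<bar> \<le> nrm d c * (R * Kb (dd 1 (Pl 1)) 3 b)" by linarith
      then show ?thesis using ka by (simp add: pos_le_divide_eq mult_ac)
    qed
    have Dw: "((\<lambda>r. dot d c (w r)) has_real_derivative ?g r) (at r)" if "r \<in> {a<..<b}" for r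
      unfolding dot_def by (intro DERIV_sum DERIV_cmult flow_at[OF f that]) auto
    have "\<exists>z>q. z < q + \<epsilon> \<and> dot d c (w (q + \<epsilon>)) - dot d c (w q) = (q + \<epsilon> - q) * ?g z"
      by (rule MVT2) (use False ab in \<open>auto intro!: Dw\<close>)
    then obtain z where z: "q < z" "z < q + \<epsilon>" "dot d c (w (q + \<epsilon>)) - dot d c (w q) = \<epsilon> * ?g z" by auto
    have "\<exists>y>q. y < z \<and> ?g z - ?g q = (z - q) * ?g' y"
      by (rule MVT2[OF z(1) Dg]) (use z ab in auto)
    then obtain y where y: "q < y" "y < z" "?g z - ?g q = (z - q) * ?g' y" by auto
    have "?g z - ?g q \<le> \<epsilon> * (?K * nrm d c)"
    proof -
      have "(z - q) * ?g' y \<le> (z - q) * \<bar>?g' y\<bar>" using z by (intro mult_left_mono) auto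
      also have "\<dots> \<le> \<epsilon> * (?K * nrm d c)" using z y ab by (intro mult_mono g'_bound) auto
      finally show ?thesis using y by simp
    qed
    then have "\<epsilon> * (?g z - ?g q) \<le> \<epsilon> * (\<epsilon> * (?K * nrm d c))" using ab by (intro mult_left_mono) auto
    then show "dot d c (\<lambda>l. w (q + \<epsilon>) l - w q l - \<epsilon> * ?m q l) \<le> \<epsilon>\<^sup>2 * ?K * nrm d c"
      unfolding dot_diff_right dot_scale_right z(3) by (simp add: algebra_simps power2_eq_square)
  qed (rule mult_nonneg_nonneg[OF zero_le_power2 K0])
next
  case True
  then show ?thesis by (simp add: L2_set_def)
qed

end

section \<open>Couplings\<close>

lemma nn_integral_distr_on:
  "T \<in> M \<rightarrow>\<^sub>M M' \<Longrightarrow> f \<in> borel_measurable M' \<Longrightarrow> (\<integral>\<^sup>+x. f x \<partial>distr M M' T) = (\<integral>\<^sup>+x. f (T x) \<partial>M)"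
  by (rule nn_integral_distr) simp_all

lemma emeasure_distr_nn_integral:
  assumes "T \<in> M \<rightarrow>\<^sub>M M'" "A \<in> sets M'"
  shows "emeasure (distr M M' T) A = (\<integral>\<^sup>+x. indicator A (T x) \<partial>M)"
  using nn_integral_indicator[of A "distr M M' T"] assms(2) nn_integral_distr_on[OF assms(1) borel_measurable_indicator[OF assms(2)]]
  by simp

lemma std_gaussian_density:
  "std_gaussian d = density (Rd d) (\<lambda>x. ennreal (\<Prod>i<d. std_normal_density (x i)))"
  unfolding std_gaussian_def using product_normal_density[of 1 d "\<lambda>_. 0"] by simp

lemma normal_density_shift: "normal_density m 1 x = std_normal_density x * exp (m * x - m\<^sup>2 / 2)"
proof -
  have "- (x - m)\<^sup>2 / 2 = - x\<^sup>2 / 2 + (m * x - m\<^sup>2 / 2)"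
    by (simp add: power2_diff algebra_simps add_divide_distrib diff_divide_distrib)
  then have "exp (- (x - m)\<^sup>2 / 2) = exp (- x\<^sup>2 / 2) * exp (m * x - m\<^sup>2 / 2)" by (simp only: exp_add)
  then show ?thesis by (simp add: normal_density_def)
qed

lemma prod_normal_density_shift:
  "(\<Prod>i<d. normal_density (q * y i) 1 (x i)) = (\<Prod>i<d. std_normal_density (x i)) * Efac d q x y"
proof -
  have "(\<Sum>i<d. q * y i * x i - (q * y i)\<^sup>2 / 2) = q * dot d x y - q\<^sup>2 / 2 * dot d y y"
    by (simp add: dot_def sum_subtractf sum_distrib_left power2_eq_square algebra_simps)
  moreover have "(\<Prod>i<d. normal_density (q * y i) 1 (x i)) = (\<Prod>i<d. std_normal_density (x i) * exp (q * y i * x i - (q * y i)\<^sup>2 / 2))"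
    by (intro prod.cong refl normal_density_shift)
  ultimately show ?thesis
    unfolding prod.distrib exp_sum[symmetric, OF finite_lessThan] Efac_def by simp
qed

lemma measurable_prod_std_normal: "(\<lambda>x. \<Prod>i<d. std_normal_density (x i)) \<in> borel_measurable (Rd d)"
  by (intro borel_measurable_prod measurable_compose[OF measurable_Rd_component borel_measurable_normal_density]) simp

lemma measurable_Efac_left: "(\<lambda>x. Efac d q x y) \<in> borel_measurable (Rd d)"
  unfolding Efac_def dot_def
  by (intro borel_measurable_exp measurable_compose[OF _ borel_measurable_exp] borel_measurable_diff borel_measurable_times
      borel_measurable_sum measurable_Rd_component borel_measurable_const) auto

text \<open>Cameron-Martin: a shifted standard Gaussian has density \<open>Efac\<close> with respect
  to the unshifted one.\<close>

lemma nn_integral_gaussian_shift: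
  assumes F: "F \<in> borel_measurable (Rd d)"
  shows "(\<integral>\<^sup>+g. F (\<lambda>i\<in>{..<d}. q * y i + g i) \<partial>std_gaussian d) = (\<integral>\<^sup>+w. F w * ennreal (Efac d q w y) \<partial>std_gaussian d)"
proof -
  let ?\<phi> = "\<lambda>x. \<Prod>i<d. std_normal_density (x i)"
  have m: "(\<lambda>g. \<lambda>i\<in>{..<d}. q * y i + 1 * g i) \<in> std_gaussian d \<rightarrow>\<^sub>M Rd d"
    by (rule measurable_gaussian_affine)
  have \<phi>: "(\<lambda>x. ennreal (?\<phi> x)) \<in> borel_measurable (Rd d)" using measurable_prod_std_normal by simp
  have E: "(\<lambda>x. ennreal (Efac d q x y)) \<in> borel_measurable (Rd d)" using measurable_Efac_left by simp
  have "(\<integral>\<^sup>+g. F (\<lambda>i\<in>{..<d}. q * y i + g i) \<partial>std_gaussian d)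
    = (\<integral>\<^sup>+w. F w \<partial>distr (std_gaussian d) (Rd d) (\<lambda>g. \<lambda>i\<in>{..<d}. q * y i + 1 * g i))"
    by (subst nn_integral_distr_on[OF m F]) simp
  also have "\<dots> = (\<integral>\<^sup>+w. F w \<partial>density (Rd d) (\<lambda>x. ennreal (?\<phi> x) * ennreal (Efac d q x y)))"
    by (subst gaussian_affine) (simp_all add: prod_normal_density_shift ennreal_mult prod_nonneg less_imp_le[OF Efac_pos])
  also have "\<dots> = (\<integral>\<^sup>+w. ennreal (?\<phi> w) * ennreal (Efac d q w y) * F w \<partial>Rd d)"
    by (rule nn_integral_density[OF borel_measurable_times_ennreal[OF \<phi> E] F])
  also have "\<dots> = (\<integral>\<^sup>+w. ennreal (?\<phi> w) * (F w * ennreal (Efac d q w y)) \<partial>Rd d)"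
    by (simp add: mult_ac)
  also have "\<dots> = (\<integral>\<^sup>+w. F w * ennreal (Efac d q w y) \<partial>std_gaussian d)"
    unfolding std_gaussian_density by (rule nn_integral_density[symmetric, OF \<phi> borel_measurable_times_ennreal[OF F E]])
  finally show ?thesis .
qed

lemma measurable_Rd_restrict:
  assumes "\<And>i. i < d \<Longrightarrow> (\<lambda>z. f z i) \<in> borel_measurable M"
  shows "(\<lambda>z. \<lambda>i\<in>{..<d}. f z i) \<in> M \<rightarrow>\<^sub>M Rd d"
  unfolding Rd_def by (rule measurable_restrict) (use assms in simp)

lemma borel_measurable_dot:
  assumes "\<And>i. i < d \<Longrightarrow> (\<lambda>z. f z i) \<in> borel_measurable M" "\<And>i. i < d \<Longrightarrow> (\<lambda>z. g z i) \<in> borel_measurable M"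
  shows "(\<lambda>z. dot d (f z) (g z)) \<in> borel_measurable M"
  unfolding dot_def by (intro borel_measurable_sum borel_measurable_times assms) auto

lemma borel_measurable_nrm:
  assumes "\<And>i. i < d \<Longrightarrow> (\<lambda>z. f z i) \<in> borel_measurable M"
  shows "(\<lambda>z. nrm d (f z)) \<in> borel_measurable M"
proof -
  have "(\<lambda>z. sqrt (dot d (f z) (f z))) \<in> borel_measurable M"
    by (intro measurable_compose[OF borel_measurable_dot[OF assms assms] borel_measurable_sqrt])
  then show ?thesis by (simp add: dot_self)
qed

lemma borel_measurable_Efac:
  assumes "\<And>i. i < d \<Longrightarrow> (\<lambda>z. f z i) \<in> borel_measurable M" "\<And>i. i < d \<Longrightarrow> (\<lambda>z. g z i) \<in> borel_measurable M"
  shows "(\<lambda>z. Efac d q (f z) (g z)) \<in> borel_measurable M"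
  unfolding Efac_def
  by (intro measurable_compose[OF _ borel_measurable_exp] borel_measurable_diff borel_measurable_times borel_measurable_const
      borel_measurable_dot assms)

text \<open>Via \<open>(x + y)\<^sup>2 \<le> (1 + b/a) x\<^sup>2 + (1 + a/b) y\<^sup>2\<close>.\<close>

lemma nn_integral_minkowski:
  fixes f g :: "'a \<Rightarrow> real"
  assumes m: "f \<in> borel_measurable M" "g \<in> borel_measurable M"
    and a: "a > 0" "(\<integral>\<^sup>+x. ennreal ((f x)\<^sup>2) \<partial>M) \<le> ennreal (a\<^sup>2)"
    and b: "b > 0" "(\<integral>\<^sup>+x. ennreal ((g x)\<^sup>2) \<partial>M) \<le> ennreal (b\<^sup>2)"
  shows "(\<integral>\<^sup>+x. ennreal ((f x + g x)\<^sup>2) \<partial>M) \<le> ennreal ((a + b)\<^sup>2)"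
proof -
  have pt: "(x + y)\<^sup>2 \<le> (1 + b / a) * x\<^sup>2 + (1 + a / b) * y\<^sup>2" for x y
  proof -
    have "(1 + b / a) * x\<^sup>2 + (1 + a / b) * y\<^sup>2 - (x + y)\<^sup>2 = (b * x - a * y)\<^sup>2 / (a * b)"
      using a(1) b(1) by (simp add: field_simps power2_eq_square)
    also have "\<dots> \<ge> 0" using a(1) b(1) by simp
    finally show ?thesis by linarith
  qed
  have "(\<integral>\<^sup>+x. ennreal ((f x + g x)\<^sup>2) \<partial>M)
    \<le> (\<integral>\<^sup>+x. ennreal (1 + b / a) * ennreal ((f x)\<^sup>2) + ennreal (1 + a / b) * ennreal ((g x)\<^sup>2) \<partial>M)"
    using pt a(1) b(1) by (intro nn_integral_mono) (simp add: ennreal_plus[symmetric] ennreal_mult[symmetric] del: ennreal_plus)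
  also have "\<dots> = ennreal (1 + b / a) * (\<integral>\<^sup>+x. ennreal ((f x)\<^sup>2) \<partial>M) + ennreal (1 + a / b) * (\<integral>\<^sup>+x. ennreal ((g x)\<^sup>2) \<partial>M)"
    using m by (subst nn_integral_add) (auto simp: nn_integral_cmult)
  also have "\<dots> \<le> ennreal (1 + b / a) * ennreal (a\<^sup>2) + ennreal (1 + a / b) * ennreal (b\<^sup>2)"
    by (intro add_mono mult_left_mono a b) auto
  also have "\<dots> = ennreal ((1 + b / a) * a\<^sup>2 + (1 + a / b) * b\<^sup>2)"
    using a(1) b(1) by (simp add: ennreal_plus[symmetric] ennreal_mult[symmetric] del: ennreal_plus)
  also have "(1 + b / a) * a\<^sup>2 + (1 + a / b) * b\<^sup>2 = (a + b)\<^sup>2"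
    using a(1) b(1) by (simp add: field_simps power2_eq_square)
  finally show ?thesis .
qed

section \<open>Posterior refreshment of couplings\<close>

context bounded_prior
begin

definition mu :: "real \<Rightarrow> (nat \<Rightarrow> real) measure" where
  "mu q = distr (P \<Otimes>\<^sub>M std_gaussian d) (Rd d) (\<lambda>(y, g). \<lambda>i\<in>{..<d}. q * y i + g i)"

lemma sets_pair_P_gauss: "sets (P \<Otimes>\<^sub>M std_gaussian d) = sets (Rd d \<Otimes>\<^sub>M Rd d)"
  by (rule sets_pair_measure_cong[OF sets_P sets_std_gaussian])

lemma measurable_fst_component: "i < d \<Longrightarrow> (\<lambda>z. fst z i) \<in> borel_measurable (Rd d \<Otimes>\<^sub>M N)"
  by (rule measurable_compose[OF measurable_fst measurable_Rd_component])

lemma measurable_snd_component: "i < d \<Longrightarrow> (\<lambda>z. snd z i) \<in> borel_measurable (N \<Otimes>\<^sub>M Rd d)"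
  by (rule measurable_compose[OF measurable_snd measurable_Rd_component])

lemma measurable_mu_map: "(\<lambda>(y, g). \<lambda>i\<in>{..<d}. q * y i + g i) \<in> P \<Otimes>\<^sub>M std_gaussian d \<rightarrow>\<^sub>M Rd d"
  unfolding measurable_cong_sets[OF sets_pair_P_gauss refl] split_beta'
  by (intro measurable_Rd_restrict borel_measurable_add borel_measurable_times borel_measurable_const
      measurable_fst_component measurable_snd_component)

lemma prob_space_mu: "prob_space (mu q)"
proof -
  interpret G: prob_space "std_gaussian d" by (rule prob_space_std_gaussian)
  interpret PG: pair_prob_space P "std_gaussian d" by standard
  show ?thesis unfolding mu_def by (rule PG.prob_space_distr[OF measurable_mu_map])
qed

lemma sets_mu: "sets (mu q) = sets (Rd d)" by (simp add: mu_def)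

text \<open>The joint law of (q Y + G, Y), disintegrated over its first component: Gaussian shift,
  then Fubini.\<close>

lemma bayes:
  assumes F: "F \<in> borel_measurable (Rd d \<Otimes>\<^sub>M Rd d)"
  shows "(\<integral>\<^sup>+y. (\<integral>\<^sup>+g. F (\<lambda>i\<in>{..<d}. q * y i + g i, y) \<partial>std_gaussian d) \<partial>P)
    = (\<integral>\<^sup>+w. (\<integral>\<^sup>+y. F (w, y) * ennreal (Efac d q w y) \<partial>P) \<partial>std_gaussian d)"
proof -
  interpret G: prob_space "std_gaussian d" by (rule prob_space_std_gaussian)
  interpret PG: pair_sigma_finite P "std_gaussian d" by standard
  have Fy: "(\<lambda>w. F (w, y)) \<in> borel_measurable (Rd d)" if "y \<in> space P" for y
  proof -
    have "y \<in> space (Rd d)" using that sets_eq_imp_space_eq[OF sets_P] by simp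
    then show ?thesis by (rule measurable_compose[OF measurable_Pair2' F])
  qed
  have "(\<integral>\<^sup>+y. (\<integral>\<^sup>+g. F (\<lambda>i\<in>{..<d}. q * y i + g i, y) \<partial>std_gaussian d) \<partial>P)
    = (\<integral>\<^sup>+y. (\<integral>\<^sup>+w. F (w, y) * ennreal (Efac d q w y) \<partial>std_gaussian d) \<partial>P)"
    by (rule nn_integral_cong) (rule nn_integral_gaussian_shift[OF Fy])
  also have "\<dots> = (\<integral>\<^sup>+w. (\<integral>\<^sup>+y. F (w, y) * ennreal (Efac d q w y) \<partial>P) \<partial>std_gaussian d)"
  proof (rule PG.Fubini'[symmetric])
    have "(\<lambda>z. F (snd z, fst z)) \<in> borel_measurable (Rd d \<Otimes>\<^sub>M Rd d)"
      using measurable_compose[OF measurable_pair_swap' F] by (simp add: split_beta')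
    moreover have "(\<lambda>z. ennreal (Efac d q (snd z) (fst z))) \<in> borel_measurable (Rd d \<Otimes>\<^sub>M Rd d)"
      by (intro measurable_compose[OF _ measurable_ennreal] borel_measurable_Efac measurable_fst_component measurable_snd_component)
    ultimately show "(\<lambda>(y, w). F (w, y) * ennreal (Efac d q w y)) \<in> borel_measurable (P \<Otimes>\<^sub>M std_gaussian d)"
      unfolding measurable_cong_sets[OF sets_pair_P_gauss refl] split_beta' by (rule borel_measurable_times_ennreal)
  qed
  finally show ?thesis .
qed

lemma nn_integral_mu:
  assumes f: "f \<in> borel_measurable (Rd d)"
  shows "(\<integral>\<^sup>+w. f w \<partial>mu q) = (\<integral>\<^sup>+y. (\<integral>\<^sup>+g. f (\<lambda>i\<in>{..<d}. q * y i + g i) \<partial>std_gaussian d) \<partial>P)"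
proof -
  interpret G: prob_space "std_gaussian d" by (rule prob_space_std_gaussian)
  have "(\<integral>\<^sup>+w. f w \<partial>mu q) = (\<integral>\<^sup>+z. f (case z of (y, g) \<Rightarrow> \<lambda>i\<in>{..<d}. q * y i + g i) \<partial>(P \<Otimes>\<^sub>M std_gaussian d))"
    unfolding mu_def by (rule nn_integral_distr_on[OF measurable_mu_map f])
  also have "\<dots> = (\<integral>\<^sup>+y. (\<integral>\<^sup>+g. f (\<lambda>i\<in>{..<d}. q * y i + g i) \<partial>std_gaussian d) \<partial>P)"
    using G.nn_integral_fst[OF measurable_compose[OF measurable_mu_map[of q] f], symmetric] by simp
  finally show ?thesis .
qed

lemma nn_integral_posterior:
  assumes f: "f \<in> borel_measurable P" "\<And>y. nrm d y \<le> R \<Longrightarrow> \<bar>f y\<bar> \<le> C" "\<And>y. f y \<ge> 0"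
  shows "(\<integral>\<^sup>+y. ennreal (f y) * ennreal (Efac d q w y / Zf q w) \<partial>P) = ennreal (pm f q w)"
proof -
  have Z: "Zf q w > 0" by (rule Zf_pos)
  have "(\<integral>\<^sup>+y. ennreal (f y) * ennreal (Efac d q w y / Zf q w) \<partial>P) = (\<integral>\<^sup>+y. ennreal (f y * Efac d q w y / Zf q w) \<partial>P)"
    using f(3) Z less_imp_le[OF Efac_pos] by (intro nn_integral_cong) (simp add: ennreal_mult[symmetric])
  also have "\<dots> = ennreal (\<integral>y. f y * Efac d q w y / Zf q w \<partial>P)"
    using integrable_Efac[OF f(1,2)] f(3) Z less_imp_le[OF Efac_pos] by (intro nn_integral_eq_integral) auto
  finally show ?thesis by (simp add: pm_def)
qed

lemma measurable_Zf: "Zf q \<in> borel_measurable (Rd d)"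
proof -
  have "(\<lambda>(w, y). Efac d q w y) \<in> borel_measurable (Rd d \<Otimes>\<^sub>M P)"
    unfolding measurable_cong_sets[OF sets_pair_measure_cong[OF refl sets_P] refl] split_beta'
    by (intro borel_measurable_Efac measurable_fst_component measurable_snd_component)
  from borel_measurable_lebesgue_integral[OF this] show ?thesis by (simp add: Zf_def[abs_def])
qed

text \<open>The density weights \<open>y\<close> by its posterior given q Y + G = w. If
  \<open>w\<close> has law \<open>mu q\<close>, the pair (w, y) therefore has the joint law of (q Y
  + G, Y), whatever the second component of the coupling is.\<close>

definition refresh :: "real \<Rightarrow> real \<Rightarrow> ((nat \<Rightarrow> real) \<times> (nat \<Rightarrow> real)) measure \<Rightarrow> ((nat \<Rightarrow> real) \<times> (nat \<Rightarrow> real)) measure" where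
  "refresh q \<epsilon> \<gamma> = distr (density (\<gamma> \<Otimes>\<^sub>M P) (\<lambda>((w, v), y). ennreal (Efac d q w y / Zf q w))) (Rd d \<Otimes>\<^sub>M Rd d)
     (\<lambda>((w, v), y). (\<lambda>i\<in>{..<d}. w i + \<epsilon> * y i, v))"

lemma nn_integral_refresh:
  assumes \<gamma>: "sets \<gamma> = sets (Rd d \<Otimes>\<^sub>M Rd d)" and H: "H \<in> borel_measurable (Rd d \<Otimes>\<^sub>M Rd d)"
  shows "(\<integral>\<^sup>+z. H z \<partial>refresh q \<epsilon> \<gamma>) =
    (\<integral>\<^sup>+z. (\<integral>\<^sup>+y. H (\<lambda>i\<in>{..<d}. fst z i + \<epsilon> * y i, snd z) * ennreal (Efac d q (fst z) y / Zf q (fst z)) \<partial>P) \<partial>\<gamma>)"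
proof -
  let ?k = "\<lambda>((w, v), y). ennreal (Efac d q w y / Zf q w)"
  let ?m = "\<lambda>((w, v), y). (\<lambda>i\<in>{..<d}. w i + \<epsilon> * y i, v)"
  have s: "sets (\<gamma> \<Otimes>\<^sub>M P) = sets ((Rd d \<Otimes>\<^sub>M Rd d) \<Otimes>\<^sub>M Rd d)" by (rule sets_pair_measure_cong[OF \<gamma> sets_P])
  have c1: "(\<lambda>z. fst (fst z) i) \<in> borel_measurable ((Rd d \<Otimes>\<^sub>M Rd d) \<Otimes>\<^sub>M Rd d)" if "i < d" for i
    by (rule measurable_compose[OF measurable_fst measurable_fst_component[OF that]])
  have k: "?k \<in> borel_measurable (\<gamma> \<Otimes>\<^sub>M P)"
    unfolding measurable_cong_sets[OF s refl] split_beta'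
    by (intro measurable_compose[OF _ measurable_ennreal] borel_measurable_divide borel_measurable_Efac c1 measurable_snd_component
        measurable_compose[OF measurable_compose[OF measurable_fst measurable_fst] measurable_Zf])
  have m: "?m \<in> \<gamma> \<Otimes>\<^sub>M P \<rightarrow>\<^sub>M Rd d \<Otimes>\<^sub>M Rd d"
    unfolding measurable_cong_sets[OF s refl] split_beta'
    by (intro measurable_Pair measurable_Rd_restrict borel_measurable_add borel_measurable_times borel_measurable_const c1
        measurable_snd_component measurable_compose[OF measurable_fst measurable_snd])
  have "(\<integral>\<^sup>+z. H z \<partial>refresh q \<epsilon> \<gamma>) = (\<integral>\<^sup>+z. H (?m z) \<partial>density (\<gamma> \<Otimes>\<^sub>M P) ?k)"
    unfolding refresh_def by (rule nn_integral_distr) (use m H in simp_all)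
  also have "\<dots> = (\<integral>\<^sup>+z. ?k z * H (?m z) \<partial>(\<gamma> \<Otimes>\<^sub>M P))"
    by (rule nn_integral_density[OF k measurable_compose[OF m H]])
  also have "\<dots> = (\<integral>\<^sup>+z. (\<integral>\<^sup>+y. ?k (z, y) * H (?m (z, y)) \<partial>P) \<partial>\<gamma>)"
    by (rule nn_integral_fst[symmetric, OF borel_measurable_times_ennreal[OF k measurable_compose[OF m H]]])
  finally show ?thesis by (simp add: split_beta' mult.commute)
qed

text \<open>Adding eps Y to q Y + G gives (q + eps) Y + G, with the same Y; this fixes the first
  marginal by \<open>bayes\<close>. The second survives because the posterior weights integrate to
  1.\<close>

lemma refresh_coupling:
  assumes \<gamma>: "\<gamma> \<in> couplings d (mu q) \<nu>" and \<nu>: "sets \<nu> = sets (Rd d)"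
  shows "refresh q \<epsilon> \<gamma> \<in> couplings d (mu (q + \<epsilon>)) \<nu>"
proof -
  have s: "sets \<gamma> = sets (Rd d \<Otimes>\<^sub>M Rd d)" and f: "distr \<gamma> (Rd d) fst = mu q" and sn: "distr \<gamma> (Rd d) snd = \<nu>"
    using \<gamma> by (auto simp: couplings_def)
  have sr: "sets (refresh q \<epsilon> \<gamma>) = sets (Rd d \<Otimes>\<^sub>M Rd d)" by (simp add: refresh_def)
  have fm: "fst \<in> \<gamma> \<rightarrow>\<^sub>M Rd d" "snd \<in> \<gamma> \<rightarrow>\<^sub>M Rd d"
    unfolding measurable_cong_sets[OF s refl] by simp_all
  have frm: "fst \<in> refresh q \<epsilon> \<gamma> \<rightarrow>\<^sub>M Rd d" "snd \<in> refresh q \<epsilon> \<gamma> \<rightarrow>\<^sub>M Rd d"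
    unfolding measurable_cong_sets[OF sr refl] by simp_all
  have "distr (refresh q \<epsilon> \<gamma>) (Rd d) snd = \<nu>"
  proof (rule measure_eqI)
    fix A assume "A \<in> sets (distr (refresh q \<epsilon> \<gamma>) (Rd d) snd)"
    then have A: "A \<in> sets (Rd d)" by simp
    have H: "(\<lambda>z. indicator A (snd z) :: ennreal) \<in> borel_measurable (Rd d \<Otimes>\<^sub>M Rd d)"
      by (rule measurable_compose[OF measurable_snd borel_measurable_indicator[OF A]])
    have "emeasure (distr (refresh q \<epsilon> \<gamma>) (Rd d) snd) A
      = (\<integral>\<^sup>+z. (\<integral>\<^sup>+y. indicator A (snd z) * ennreal (Efac d q (fst z) y / Zf q (fst z)) \<partial>P) \<partial>\<gamma>)"
      unfolding emeasure_distr_nn_integral[OF frm(2) A] nn_integral_refresh[OF s H] by simp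
    also have "\<dots> = (\<integral>\<^sup>+z. indicator A (snd z) \<partial>\<gamma>)"
    proof (rule nn_integral_cong)
      fix z :: "(nat \<Rightarrow> real) \<times> (nat \<Rightarrow> real)"
      have "(\<integral>\<^sup>+y. indicator A (snd z) * ennreal (Efac d q (fst z) y / Zf q (fst z)) \<partial>P)
        = indicator A (snd z) * (\<integral>\<^sup>+y. ennreal 1 * ennreal (Efac d q (fst z) y / Zf q (fst z)) \<partial>P)"
        by (subst nn_integral_cmult) auto
      also have "\<dots> = indicator A (snd z)" by (subst nn_integral_posterior[where C = 1]) (auto simp: pm_one)
      finally show "(\<integral>\<^sup>+y. indicator A (snd z) * ennreal (Efac d q (fst z) y / Zf q (fst z)) \<partial>P) = indicator A (snd z)" .
    qed
    also have "\<dots> = emeasure \<nu> A"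
      unfolding sn[symmetric] by (rule emeasure_distr_nn_integral[symmetric, OF fm(2) A])
    finally show "emeasure (distr (refresh q \<epsilon> \<gamma>) (Rd d) snd) A = emeasure \<nu> A" .
  qed (simp add: \<nu>)
  moreover have "distr (refresh q \<epsilon> \<gamma>) (Rd d) fst = mu (q + \<epsilon>)"
  proof (rule measure_eqI)
    fix A assume "A \<in> sets (distr (refresh q \<epsilon> \<gamma>) (Rd d) fst)"
    then have A: "A \<in> sets (Rd d)" by simp
    have H: "(\<lambda>z. indicator A (fst z) :: ennreal) \<in> borel_measurable (Rd d \<Otimes>\<^sub>M Rd d)"
      by (rule measurable_compose[OF measurable_fst borel_measurable_indicator[OF A]])
    let ?I = "\<lambda>w y. indicator A (\<lambda>i\<in>{..<d}. w i + \<epsilon> * y i) :: ennreal"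
    let ?h = "\<lambda>w. \<integral>\<^sup>+y. ?I w y * ennreal (Efac d q w y / Zf q w) \<partial>P"
    have I: "(\<lambda>z. ?I (fst z) (snd z)) \<in> borel_measurable (Rd d \<Otimes>\<^sub>M Rd d)"
      by (rule measurable_compose[OF _ borel_measurable_indicator[OF A]])
        (intro measurable_Rd_restrict borel_measurable_add borel_measurable_times borel_measurable_const
          measurable_fst_component measurable_snd_component)
    have E: "(\<lambda>z. ennreal (Efac d q (fst z) (snd z) / Zf q (fst z))) \<in> borel_measurable (Rd d \<Otimes>\<^sub>M Rd d)"
      by (intro measurable_compose[OF _ measurable_ennreal] borel_measurable_divide borel_measurable_Efac
          measurable_fst_component measurable_snd_component measurable_compose[OF measurable_fst measurable_Zf])
    have h: "?h \<in> borel_measurable (Rd d)"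
    proof -
      have "(\<lambda>(w, y). ?I w y * ennreal (Efac d q w y / Zf q w)) \<in> borel_measurable (Rd d \<Otimes>\<^sub>M P)"
        unfolding measurable_cong_sets[OF sets_pair_measure_cong[OF refl sets_P] refl] split_beta'
        by (rule borel_measurable_times_ennreal[OF I E])
      from borel_measurable_nn_integral[OF this] show ?thesis .
    qed
    let ?F = "\<lambda>z. ?h (fst z)"
    have F: "?F \<in> borel_measurable (Rd d \<Otimes>\<^sub>M Rd d)" by (rule measurable_compose[OF measurable_fst h])
    have "emeasure (distr (refresh q \<epsilon> \<gamma>) (Rd d) fst) A = (\<integral>\<^sup>+z. ?h (fst z) \<partial>\<gamma>)"
      unfolding emeasure_distr_nn_integral[OF frm(1) A] nn_integral_refresh[OF s H] by simp
    also have "\<dots> = (\<integral>\<^sup>+w. ?h w \<partial>mu q)"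
      unfolding f[symmetric] by (rule nn_integral_distr_on[symmetric, OF fm(1) h])
    also have "\<dots> = (\<integral>\<^sup>+w. (\<integral>\<^sup>+y. ?F (w, y) * ennreal (Efac d q w y) \<partial>P) \<partial>std_gaussian d)"
      unfolding nn_integral_mu[OF h] bayes[OF F, symmetric] by simp
    also have "\<dots> = (\<integral>\<^sup>+w. (\<integral>\<^sup>+y. ?I w y * ennreal (Efac d q w y) \<partial>P) \<partial>std_gaussian d)"
    proof (rule nn_integral_cong)
      fix w :: "nat \<Rightarrow> real" assume "w \<in> space (std_gaussian d)"
      then have w: "w \<in> space (Rd d)" using sets_eq_imp_space_eq[OF sets_std_gaussian] by simp
      have Z: "Zf q w > 0" by (rule Zf_pos)
      have ZE: "(\<integral>\<^sup>+y. ennreal (Efac d q w y) \<partial>P) = ennreal (Zf q w)"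
        unfolding Zf_def using integrable_Efac[of "\<lambda>_. 1" 1 q w] less_imp_le[OF Efac_pos]
        by (intro nn_integral_eq_integral) auto
      have Iw: "?I w \<in> borel_measurable P"
        unfolding measurable_cong_sets[OF sets_P refl]
        using measurable_compose[OF measurable_Pair1'[OF w] I] by simp
      have "(\<integral>\<^sup>+y. ?F (w, y) * ennreal (Efac d q w y) \<partial>P) = ?h w * ennreal (Zf q w)"
        unfolding ZE[symmetric] by (simp add: nn_integral_cmult)
      also have "\<dots> = (\<integral>\<^sup>+y. ?I w y * ennreal (Efac d q w y / Zf q w) * ennreal (Zf q w) \<partial>P)"
        using Iw by (subst nn_integral_multc) auto
      also have "\<dots> = (\<integral>\<^sup>+y. ?I w y * ennreal (Efac d q w y) \<partial>P)"
        using Z less_imp_le[OF Efac_pos[of d q w]] by (simp add: mult.assoc ennreal_mult[symmetric])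
      finally show "(\<integral>\<^sup>+y. ?F (w, y) * ennreal (Efac d q w y) \<partial>P) = (\<integral>\<^sup>+y. ?I w y * ennreal (Efac d q w y) \<partial>P)" .
    qed
    also have "\<dots> = (\<integral>\<^sup>+y. (\<integral>\<^sup>+g. ?I (\<lambda>i\<in>{..<d}. q * y i + g i) y \<partial>std_gaussian d) \<partial>P)"
      using bayes[OF I, of q] by simp
    also have "\<dots> = (\<integral>\<^sup>+y. (\<integral>\<^sup>+g. indicator A (\<lambda>i\<in>{..<d}. (q + \<epsilon>) * y i + g i) \<partial>std_gaussian d) \<partial>P)"
      by (intro nn_integral_cong arg_cong[where f = "indicator A"]) (auto simp: restrict_def fun_eq_iff algebra_simps)
    also have "\<dots> = emeasure (mu (q + \<epsilon>)) A"
      using nn_integral_mu[OF borel_measurable_indicator[OF A], of "q + \<epsilon>"] A by (simp add: nn_integral_indicator sets_mu)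
    finally show "emeasure (distr (refresh q \<epsilon> \<gamma>) (Rd d) fst) A = emeasure (mu (q + \<epsilon>)) A" .
  qed (simp add: sets_mu)
  ultimately show ?thesis unfolding couplings_def using sr by simp
qed

end

lemma nrm_shift_sq: "(nrm d (\<lambda>i. c i + \<epsilon> * y i))\<^sup>2 = dot d c c + 2 * \<epsilon> * dot d c y + \<epsilon>\<^sup>2 * dot d y y"
  unfolding dot_self[symmetric] dot_def
  by (simp add: sum_distrib_left sum.distrib[symmetric] power2_eq_square algebra_simps)

text \<open>With m and n the posterior means at the flow and at \<open>w\<close>, the first order
  term on the right involves only their difference, which is small when the two points are
  close.\<close>

lemma dot_shift_identity:
  "dot d (\<lambda>i. e i - \<epsilon> * m i) (\<lambda>i. e i - \<epsilon> * m i) + 2 * \<epsilon> * dot d (\<lambda>i. e i - \<epsilon> * m i) n + \<epsilon>\<^sup>2 * K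
    = dot d e e + 2 * \<epsilon> * dot d e (\<lambda>i. n i - m i) + \<epsilon>\<^sup>2 * (dot d m m - 2 * dot d m n + K)"
  unfolding dot_diff_left dot_diff_right dot_scale_left dot_scale_right dot_commute[of d m e]
  by (simp add: algebra_simps power2_eq_square)

context bounded_prior
begin

lemma nrm_shift_bound:
  assumes "nrm d y \<le> R" shows "\<bar>(nrm d (\<lambda>i. c i + \<epsilon> * y i))\<^sup>2\<bar> \<le> (nrm d c + \<bar>\<epsilon>\<bar> * R)\<^sup>2"
proof -
  have "nrm d (\<lambda>i. c i + \<epsilon> * y i) \<le> nrm d c + nrm d (\<lambda>i. \<epsilon> * y i)" by (rule L2_set_triangle_ineq)
  also have "\<dots> \<le> nrm d c + \<bar>\<epsilon>\<bar> * R" using assms by (simp add: nrm_scale mult_left_mono)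
  finally show ?thesis by (simp add: power_mono)
qed

lemma measurable_nrm_shift: "(\<lambda>y. (nrm d (\<lambda>i. c i + \<epsilon> * y i))\<^sup>2) \<in> borel_measurable P"
  by (intro borel_measurable_power borel_measurable_nrm borel_measurable_add borel_measurable_times borel_measurable_const
      measurable_P_component)

lemma pm_quadratic_le:
  "pm (\<lambda>y. (nrm d (\<lambda>i. c i + \<epsilon> * y i))\<^sup>2) q w
    \<le> dot d c c + 2 * \<epsilon> * dot d c (\<lambda>l. pm (\<lambda>y. y l) q w) + \<epsilon>\<^sup>2 * R\<^sup>2"
proof -
  have b: "bd 1 (\<lambda>Y. dot d c (Y 0))" "bd 1 (\<lambda>Y. dot d (Y 0) (Y 0))" by (auto intro: bd_dot_left bd_dot)
  have "pm (\<lambda>y. (nrm d (\<lambda>i. c i + \<epsilon> * y i))\<^sup>2) q w = Av 1 (\<lambda>Y. (nrm d (\<lambda>i. c i + \<epsilon> * Y 0 i))\<^sup>2) q w"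
    by (rule Av_1[OF measurable_nrm_shift nrm_shift_bound, symmetric])
  also have "\<dots> = Av 1 (\<lambda>Y. dot d c c + (2 * \<epsilon> * dot d c (Y 0) + \<epsilon>\<^sup>2 * dot d (Y 0) (Y 0))) q w"
    unfolding nrm_shift_sq by (simp add: add.assoc)
  also have "\<dots> = dot d c c + (2 * \<epsilon> * Av 1 (\<lambda>Y. dot d c (Y 0)) q w + \<epsilon>\<^sup>2 * Av 1 (\<lambda>Y. dot d (Y 0) (Y 0)) q w)"
    by (simp only: Av_add[OF bd_const bd_add[OF bd_cmult[OF b(1)] bd_cmult[OF b(2)]]]
      Av_add[OF bd_cmult[OF b(1)] bd_cmult[OF b(2)]] Av_cmult Av_const)
  also have "Av 1 (\<lambda>Y. dot d c (Y 0)) q w = dot d c (\<lambda>l. pm (\<lambda>y. y l) q w)"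
    unfolding dot_def[of d c "\<lambda>l. pm (\<lambda>y. y l) _ _"] dot_pm ..
  also have "Av 1 (\<lambda>Y. dot d (Y 0) (Y 0)) q w \<le> Av 1 (\<lambda>Y. R\<^sup>2) q w"
    by (intro Av_mono b bd_const dot_self_le) (simp add: gs_def)
  finally show ?thesis by (simp add: Av_const mult_left_mono add.assoc)
qed

text \<open>Averaged over y, the cross term of the squared distance pairs the displacement with the
  difference of the posterior means at \<open>w\<close> and \<open>\<psi>\<close>, which
  \<open>pm_lipschitz\<close> controls. The fluctuation of y and the remainder of the flow
  contribute only at order \<open>\<epsilon>\<^sup>2\<close>.\<close>

lemma refresh_cost_pointwise:
  assumes q: "0 \<le> q" "q \<le> b" and \<epsilon>: "0 \<le> \<epsilon>" "\<epsilon> \<le> 1" and K: "K \<ge> 0"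
    and r: "nrm d (\<lambda>l. \<psi>' l - \<psi> l - \<epsilon> * pm (\<lambda>y. y l) q \<psi>) \<le> \<epsilon>\<^sup>2 * K"
  shows "(\<integral>\<^sup>+y. ennreal ((nrm d (\<lambda>i. (w i + \<epsilon> * y i) - \<psi>' i))\<^sup>2) * ennreal (Efac d q w y / Zf q w) \<partial>P)
    \<le> ennreal ((1 + 2 * \<epsilon> * (2 * b * R\<^sup>2) + \<epsilon>\<^sup>2) * (nrm d (\<lambda>i. w i - \<psi> i))\<^sup>2 + \<epsilon>\<^sup>2 * (2 * K\<^sup>2 + 4 * R * K + 4 * R\<^sup>2))"
proof -
  let ?L = "2 * b * R\<^sup>2"
  let ?mw = "\<lambda>l. pm (\<lambda>y. y l) q w" and ?m\<psi> = "\<lambda>l. pm (\<lambda>y. y l) q \<psi>"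
  let ?a = "\<lambda>i. w i - \<psi> i" and ?r = "\<lambda>l. \<psi>' l - \<psi> l - \<epsilon> * pm (\<lambda>y. y l) q \<psi>"
  let ?c = "\<lambda>i. w i - \<psi>' i" and ?e = "\<lambda>i. ?a i - ?r i" and ?\<Delta> = "\<lambda>l. ?mw l - ?m\<psi> l"
  \<comment> \<open>Here \<open>?e\<close> is the old displacement corrected by the second order
    remainder, and the subtracted term is the first order motion of the flow.\<close>
  have c_eq: "?c = (\<lambda>i. ?e i - \<epsilon> * ?m\<psi> i)" by auto
  have e_le: "nrm d ?e \<le> nrm d ?a + \<epsilon>\<^sup>2 * K"
  proof -
    have "nrm d (\<lambda>i. ?a i - ?r i) \<le> nrm d (\<lambda>i. ?a i - 0) + nrm d (\<lambda>i. 0 - ?r i)" by (rule nrm_triangle_diff)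
    also have "nrm d (\<lambda>i. 0 - ?r i) = nrm d ?r" using nrm_scale[where d = d and c = "-1" and x = ?r] by simp
    finally show ?thesis using r by simp
  qed
  have \<Delta>_le: "nrm d ?\<Delta> \<le> 2 * R"
    using nrm_triangle_diff[where d = d and x = ?mw and z = ?m\<psi> and y = "\<lambda>_. 0"] pm_mean_bound[of q w] pm_mean_bound[of q \<psi>]
      nrm_scale[where d = d and c = "-1" and x = ?m\<psi>] by simp
  have \<Delta>_lip: "nrm d ?\<Delta> \<le> ?L * nrm d ?a"
  proof -
    have "nrm d ?\<Delta> \<le> 2 * \<bar>q\<bar> * R\<^sup>2 * nrm d ?a" by (rule pm_lipschitz)
    also have "\<dots> \<le> ?L * nrm d ?a" using q by (intro mult_right_mono) auto
    finally show ?thesis .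
  qed
  have mm: "\<bar>dot d ?m\<psi> ?mw\<bar> \<le> R\<^sup>2" "dot d ?m\<psi> ?m\<psi> \<le> R\<^sup>2"
  proof -
    have "nrm d ?m\<psi> * nrm d ?mw \<le> R * R" by (intro mult_mono pm_mean_bound R_nonneg) auto
    then show "\<bar>dot d ?m\<psi> ?mw\<bar> \<le> R\<^sup>2" using abs_dot_le[of d ?m\<psi> ?mw] by (simp add: power2_eq_square)
    show "dot d ?m\<psi> ?m\<psi> \<le> R\<^sup>2" unfolding dot_self by (intro power_mono pm_mean_bound) auto
  qed
  have e\<Delta>: "dot d ?e ?\<Delta> \<le> ?L * (nrm d ?a)\<^sup>2 + 2 * R * K * \<epsilon>\<^sup>2"
  proof -
    have "dot d ?a ?\<Delta> \<le> nrm d ?a * nrm d ?\<Delta>" using abs_dot_le[of d ?a ?\<Delta>] by linarith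
    also have "\<dots> \<le> nrm d ?a * (?L * nrm d ?a)" by (intro mult_left_mono \<Delta>_lip) auto
    finally have 1: "dot d ?a ?\<Delta> \<le> ?L * (nrm d ?a)\<^sup>2" by (simp add: power2_eq_square mult_ac)
    have "- dot d ?r ?\<Delta> \<le> nrm d ?r * nrm d ?\<Delta>" using abs_dot_le[of d ?r ?\<Delta>] by linarith
    also have "\<dots> \<le> (\<epsilon>\<^sup>2 * K) * (2 * R)" by (intro mult_mono r \<Delta>_le mult_nonneg_nonneg K) auto
    finally have 2: "- dot d ?r ?\<Delta> \<le> 2 * R * K * \<epsilon>\<^sup>2" by (simp add: mult_ac)
    have "dot d ?e ?\<Delta> = dot d ?a ?\<Delta> - dot d ?r ?\<Delta>" by (rule dot_diff_left)
    then show ?thesis using 1 2 by linarith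
  qed
  have ee: "(nrm d ?e)\<^sup>2 \<le> (1 + \<epsilon>\<^sup>2) * (nrm d ?a)\<^sup>2 + 2 * \<epsilon>\<^sup>2 * K\<^sup>2"
  proof -
    let ?x = "nrm d ?a"
    have "(nrm d ?e)\<^sup>2 \<le> (?x + \<epsilon>\<^sup>2 * K)\<^sup>2" by (rule power_mono[OF e_le]) simp
    also have "\<dots> = ?x\<^sup>2 + \<epsilon>\<^sup>2 * (2 * ?x * K) + \<epsilon>\<^sup>2 * (\<epsilon>\<^sup>2 * K\<^sup>2)" by (simp add: power2_eq_square algebra_simps)
    also have "\<dots> \<le> ?x\<^sup>2 + \<epsilon>\<^sup>2 * (?x\<^sup>2 + K\<^sup>2) + \<epsilon>\<^sup>2 * (1 * K\<^sup>2)"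
    proof (intro add_mono mult_left_mono mult_right_mono)
      show "2 * ?x * K \<le> ?x\<^sup>2 + K\<^sup>2" by (rule sum_squares_bound)
      show "\<epsilon>\<^sup>2 \<le> 1" using \<epsilon> by (simp add: power_le_one)
    qed auto
    finally show ?thesis by (simp add: algebra_simps)
  qed
  have cc: "dot d ?c ?c + 2 * \<epsilon> * dot d ?c ?mw + \<epsilon>\<^sup>2 * R\<^sup>2
    = (nrm d ?e)\<^sup>2 + 2 * \<epsilon> * dot d ?e ?\<Delta> + \<epsilon>\<^sup>2 * (dot d ?m\<psi> ?m\<psi> - 2 * dot d ?m\<psi> ?mw + R\<^sup>2)"
    unfolding c_eq dot_shift_identity unfolding dot_self[of d ?e] ..
  have "dot d ?c ?c + 2 * \<epsilon> * dot d ?c ?mw + \<epsilon>\<^sup>2 * R\<^sup>2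
    \<le> ((1 + \<epsilon>\<^sup>2) * (nrm d ?a)\<^sup>2 + 2 * \<epsilon>\<^sup>2 * K\<^sup>2) + 2 * \<epsilon> * (?L * (nrm d ?a)\<^sup>2 + 2 * R * K * \<epsilon>\<^sup>2) + \<epsilon>\<^sup>2 * (R\<^sup>2 + 2 * R\<^sup>2 + R\<^sup>2)"
    unfolding cc using mm \<epsilon> by (intro add_mono ee mult_left_mono e\<Delta>) auto
  also have "\<dots> = (1 + 2 * \<epsilon> * ?L + \<epsilon>\<^sup>2) * (nrm d ?a)\<^sup>2 + \<epsilon>\<^sup>2 * (2 * K\<^sup>2 + 4 * R * K * \<epsilon> + 4 * R\<^sup>2)"
    by (simp add: algebra_simps power2_eq_square)
  also have "\<dots> \<le> (1 + 2 * \<epsilon> * ?L + \<epsilon>\<^sup>2) * (nrm d ?a)\<^sup>2 + \<epsilon>\<^sup>2 * (2 * K\<^sup>2 + 4 * R * K * 1 + 4 * R\<^sup>2)"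
    using \<epsilon> K R_nonneg by (intro add_mono mult_left_mono order_refl) auto
  finally have le: "dot d ?c ?c + 2 * \<epsilon> * dot d ?c ?mw + \<epsilon>\<^sup>2 * R\<^sup>2
    \<le> (1 + 2 * \<epsilon> * ?L + \<epsilon>\<^sup>2) * (nrm d ?a)\<^sup>2 + \<epsilon>\<^sup>2 * (2 * K\<^sup>2 + 4 * R * K + 4 * R\<^sup>2)" by simp
  have "(\<integral>\<^sup>+y. ennreal ((nrm d (\<lambda>i. (w i + \<epsilon> * y i) - \<psi>' i))\<^sup>2) * ennreal (Efac d q w y / Zf q w) \<partial>P)
    = (\<integral>\<^sup>+y. ennreal ((nrm d (\<lambda>i. ?c i + \<epsilon> * y i))\<^sup>2) * ennreal (Efac d q w y / Zf q w) \<partial>P)"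
    by (simp add: algebra_simps)
  also have "\<dots> = ennreal (pm (\<lambda>y. (nrm d (\<lambda>i. ?c i + \<epsilon> * y i))\<^sup>2) q w)"
    by (rule nn_integral_posterior[OF measurable_nrm_shift nrm_shift_bound]) auto
  also have "\<dots> \<le> ennreal ((1 + 2 * \<epsilon> * ?L + \<epsilon>\<^sup>2) * (nrm d ?a)\<^sup>2 + \<epsilon>\<^sup>2 * (2 * K\<^sup>2 + 4 * R * K + 4 * R\<^sup>2))"
    by (intro ennreal_leI order_trans[OF pm_quadratic_le le])
  finally show ?thesis .
qed

lemma borel_measurable_eval:
  assumes w: "\<And>i. i < d \<Longrightarrow> (\<lambda>z. f z i) \<in> borel_measurable M"
    and Y: "\<And>a i. a < n \<Longrightarrow> i < d \<Longrightarrow> (\<lambda>z. g z a i) \<in> borel_measurable M" and e: "fits n e"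
  shows "(\<lambda>z. eval d e \<rho> (f z) (g z)) \<in> borel_measurable M"
  using e
proof (induction e)
  case (Sx a b)
  then have "(\<lambda>z. \<rho> * (dot d (f z) (g z a) - dot d (f z) (g z b))) \<in> borel_measurable M"
    by (intro borel_measurable_times borel_measurable_const borel_measurable_diff borel_measurable_dot w Y) auto
  then show ?case by simp
next
  case (Qx a b)
  then have "(\<lambda>z. dot d (g z a) (g z b)) \<in> borel_measurable M" by (intro borel_measurable_dot Y) auto
  then show ?case by simp
qed auto

lemma borel_measurable_Vf:
  assumes i: "i < d" shows "(\<lambda>x. Vf j t x i) \<in> borel_measurable (Rd d)"
proof -
  let ?n = "2 * j + 1"
  let ?w = "\<lambda>x l. x l / sg t"
  interpret N: prob_space "PN ?n" by (rule prob_space_PN)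
  have x: "(\<lambda>z. fst z l / sg t) \<in> borel_measurable (Rd d \<Otimes>\<^sub>M PN ?n)" if "l < d" for l
    by (intro borel_measurable_divide borel_measurable_const measurable_fst_component that)
  have Y: "(\<lambda>z. snd z a l) \<in> borel_measurable (Rd d \<Otimes>\<^sub>M PN ?n)" if "a < ?n" "l < d" for a l
    by (rule measurable_compose[OF measurable_snd measurable_PN_component[OF that]])
  have W: "(\<lambda>z. Wt ?n (rho t) (?w (fst z)) (snd z)) \<in> borel_measurable (Rd d \<Otimes>\<^sub>M PN ?n)"
    unfolding Wt_def by (intro borel_measurable_prod borel_measurable_Efac x Y) auto
  have "(\<lambda>(x, Y). Y 0 i * eval d (eps j) (rho t) (?w x) Y * Wt ?n (rho t) (?w x) Y) \<in> borel_measurable (Rd d \<Otimes>\<^sub>M PN ?n)"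
    unfolding split_beta'
    by (intro borel_measurable_times W Y borel_measurable_eval[OF x Y fits_eps] i) auto
  note 1 = N.borel_measurable_lebesgue_integral[OF this]
  have "(\<lambda>(x, y). Efac d (rho t) (?w x) y) \<in> borel_measurable (Rd d \<Otimes>\<^sub>M P)"
    unfolding measurable_cong_sets[OF sets_pair_measure_cong[OF refl sets_P] refl] split_beta'
    by (intro borel_measurable_Efac borel_measurable_divide borel_measurable_const measurable_fst_component measurable_snd_component)
  note 2 = borel_measurable_lebesgue_integral[OF this]
  show ?thesis
    unfolding Vf_def Av_def Nm_def Zf_def
    by (intro borel_measurable_add borel_measurable_times borel_measurable_const borel_measurable_divide borel_measurable_power
        measurable_Rd_component i 1 2)
qed

lemma measurable_taylor_step:
  assumes "T - u > 0" shows "taylor_step d P p T h u \<in> Rd d \<rightarrow>\<^sub>M Rd d"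
proof -
  have "taylor_step d P p T h u = (\<lambda>x. \<lambda>i\<in>{..<d}. \<Sum>m<Suc p. Vf m (T - u) x i / fact m * h ^ m)"
    using taylor_step_eq[OF assms, of _ p h] by (auto simp: fun_eq_iff restrict_def) (simp add: taylor_step_def)
  then show ?thesis
    by (simp only:) (intro measurable_Rd_restrict borel_measurable_sum borel_measurable_times borel_measurable_divide
        borel_measurable_const borel_measurable_Vf)
qed

end

context ud_prior
begin

text \<open>In use, \<open>\<psi> v\<close> is the exact flow started from the rescaled point
  \<open>v\<close> of the scheme, so the second component of a coupling may stay fixed while
  \<open>q\<close> grows.\<close>

definition flow_cost :: "((nat \<Rightarrow> real) \<Rightarrow> real \<Rightarrow> nat \<Rightarrow> real) \<Rightarrow> real \<Rightarrow> (nat \<Rightarrow> real) \<times> (nat \<Rightarrow> real) \<Rightarrow> real" where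
  "flow_cost \<psi> q z = (nrm d (\<lambda>i. fst z i - \<psi> (snd z) q i))\<^sup>2"

lemma flow_cost_measurable:
  assumes "\<And>l. l < d \<Longrightarrow> (\<lambda>v. \<psi> v q l) \<in> borel_measurable (Rd d)"
  shows "flow_cost \<psi> q \<in> borel_measurable (Rd d \<Otimes>\<^sub>M Rd d)"
proof -
  have "(\<lambda>z. (nrm d (\<lambda>i. fst z i - \<psi> (snd z) q i))\<^sup>2) \<in> borel_measurable (Rd d \<Otimes>\<^sub>M Rd d)"
    by (intro borel_measurable_power borel_measurable_nrm borel_measurable_diff measurable_fst_component
        measurable_compose[OF measurable_snd assms])
  then show ?thesis by (simp add: flow_cost_def[abs_def])
qed

lemma coupling_micro_step:
  assumes \<psi>: "\<And>v. flow (\<psi> v) a b" and ab: "0 < a" "a < q" "0 \<le> \<epsilon>" "\<epsilon> \<le> 1" "q + \<epsilon> < b"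
    and m: "\<And>r l. r \<in> {q, q + \<epsilon>} \<Longrightarrow> l < d \<Longrightarrow> (\<lambda>v. \<psi> v r l) \<in> borel_measurable (Rd d)"
    and \<nu>: "sets \<nu> = sets (Rd d)" and \<gamma>: "\<gamma> \<in> couplings d (mu q) \<nu>"
    and c: "(\<integral>\<^sup>+z. ennreal (flow_cost \<psi> q z) \<partial>\<gamma>) \<le> ennreal C" "C \<ge> 0"
    and K: "K = R * Kb (dd 1 (Pl 1)) 3 b / poly kap a"
  shows "\<exists>\<gamma>'\<in>couplings d (mu (q + \<epsilon>)) \<nu>. (\<integral>\<^sup>+z. ennreal (flow_cost \<psi> (q + \<epsilon>) z) \<partial>\<gamma>')
    \<le> ennreal ((1 + 2 * \<epsilon> * (2 * b * R\<^sup>2) + \<epsilon>\<^sup>2) * C + \<epsilon>\<^sup>2 * (2 * K\<^sup>2 + 4 * R * K + 4 * R\<^sup>2))"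
proof (rule bexI[OF _ refresh_coupling[OF \<gamma> \<nu>]])
  let ?L = "2 * b * R\<^sup>2" and ?K2 = "2 * K\<^sup>2 + 4 * R * K + 4 * R\<^sup>2"
  let ?A = "1 + 2 * \<epsilon> * ?L + \<epsilon>\<^sup>2"
  have s: "sets \<gamma> = sets (Rd d \<Otimes>\<^sub>M Rd d)" and f: "distr \<gamma> (Rd d) fst = mu q"
    using \<gamma> by (auto simp: couplings_def)
  have pd: "prob_space (distr \<gamma> (Rd d) fst)" unfolding f by (rule prob_space_mu)
  have "fst \<in> \<gamma> \<rightarrow>\<^sub>M Rd d" unfolding measurable_cong_sets[OF s refl] by (rule measurable_fst)
  then have "prob_space \<gamma>" using pd by (rule prob_space_distrD)
  then have g1: "emeasure \<gamma> (space \<gamma>) = 1" by (rule prob_space.emeasure_space_1)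
  have K0: "K \<ge> 0" unfolding K using poly_kap_pos[OF ab(1)] R_nonneg ab
    by (intro divide_nonneg_pos mult_nonneg_nonneg Kb_nonneg) auto
  have r: "nrm d (\<lambda>l. \<psi> v (q + \<epsilon>) l - \<psi> v q l - \<epsilon> * pm (\<lambda>y. y l) q (\<psi> v q)) \<le> \<epsilon>\<^sup>2 * K" for v
    unfolding K by (rule flow_second_order[OF \<psi> ab(1,2,3,5)])
  have b0: "b \<ge> 0" using ab by simp
  have A0: "?A \<ge> 0" using ab b0 by (intro add_nonneg_nonneg mult_nonneg_nonneg) auto
  have K20: "?K2 \<ge> 0" using K0 R_nonneg by (intro add_nonneg_nonneg mult_nonneg_nonneg) auto
  have H: "(\<lambda>z. ennreal (flow_cost \<psi> (q + \<epsilon>) z)) \<in> borel_measurable (Rd d \<Otimes>\<^sub>M Rd d)"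
    by (intro measurable_compose[OF flow_cost_measurable measurable_ennreal] m) auto
  have Hq: "(\<lambda>z. ennreal (flow_cost \<psi> q z)) \<in> borel_measurable \<gamma>"
    unfolding measurable_cong_sets[OF s refl]
    by (intro measurable_compose[OF flow_cost_measurable measurable_ennreal] m) auto
  have "(\<integral>\<^sup>+z. ennreal (flow_cost \<psi> (q + \<epsilon>) z) \<partial>refresh q \<epsilon> \<gamma>)
    = (\<integral>\<^sup>+z. (\<integral>\<^sup>+y. ennreal ((nrm d (\<lambda>i. (fst z i + \<epsilon> * y i) - \<psi> (snd z) (q + \<epsilon>) i))\<^sup>2) *
        ennreal (Efac d q (fst z) y / Zf q (fst z)) \<partial>P) \<partial>\<gamma>)"
  proof -
    have "nrm d (\<lambda>i. (\<lambda>i\<in>{..<d}. fst z i + \<epsilon> * y i) i - v i) = nrm d (\<lambda>i. (fst z i + \<epsilon> * y i) - v i)" for z :: "(nat \<Rightarrow> real) \<times> (nat \<Rightarrow> real)" and y v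
      by (rule nrm_cong) simp
    then show ?thesis unfolding nn_integral_refresh[OF s H] unfolding flow_cost_def fst_conv snd_conv by (simp only:)
  qed
  also have "\<dots> \<le> (\<integral>\<^sup>+z. ennreal (?A * flow_cost \<psi> q z + \<epsilon>\<^sup>2 * ?K2) \<partial>\<gamma>)"
  proof (rule nn_integral_mono)
    fix z :: "(nat \<Rightarrow> real) \<times> (nat \<Rightarrow> real)"
    show "(\<integral>\<^sup>+y. ennreal ((nrm d (\<lambda>i. (fst z i + \<epsilon> * y i) - \<psi> (snd z) (q + \<epsilon>) i))\<^sup>2) *
        ennreal (Efac d q (fst z) y / Zf q (fst z)) \<partial>P) \<le> ennreal (?A * flow_cost \<psi> q z + \<epsilon>\<^sup>2 * ?K2)"
      unfolding flow_cost_def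
      by (rule refresh_cost_pointwise[OF _ _ ab(3,4) K0 r]) (use ab in auto)
  qed
  also have "\<dots> = (\<integral>\<^sup>+z. ennreal ?A * ennreal (flow_cost \<psi> q z) + ennreal (\<epsilon>\<^sup>2 * ?K2) \<partial>\<gamma>)"
    using A0 K20 by (intro nn_integral_cong) (simp add: ennreal_mult' flow_cost_def)
  also have "\<dots> = ennreal ?A * (\<integral>\<^sup>+z. ennreal (flow_cost \<psi> q z) \<partial>\<gamma>) + ennreal (\<epsilon>\<^sup>2 * ?K2)"
    using Hq by (subst nn_integral_add) (auto simp: nn_integral_cmult g1)
  also have "\<dots> \<le> ennreal ?A * ennreal C + ennreal (\<epsilon>\<^sup>2 * ?K2)"
    by (intro add_right_mono mult_left_mono c) simp
  also have "\<dots> = ennreal (?A * C + \<epsilon>\<^sup>2 * ?K2)"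
    using A0 K20 c(2) by (simp add: ennreal_mult')
  finally show "(\<integral>\<^sup>+z. ennreal (flow_cost \<psi> (q + \<epsilon>) z) \<partial>refresh q \<epsilon> \<gamma>) \<le> ennreal (?A * C + \<epsilon>\<^sup>2 * ?K2)" .
qed

text \<open>Re-sampling \<open>Y\<close> from its posterior after every micro step makes the fluctuation \<open>Y - E[Y | W]\<close> a
  martingale increment, which contributes only \<open>O(\<epsilon>\<^sup>2)\<close> to the squared distance.\<close>

lemma flow_contraction:
  assumes \<psi>: "\<And>v. flow (\<psi> v) a b" and ab: "0 < a" "a < q0" "q0 \<le> q1" "q1 < b"
    and m: "\<And>r l. r \<in> {q0..q1} \<Longrightarrow> l < d \<Longrightarrow> (\<lambda>v. \<psi> v r l) \<in> borel_measurable (Rd d)"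
    and \<nu>: "sets \<nu> = sets (Rd d)" and \<gamma>: "\<gamma> \<in> couplings d (mu q0) \<nu>"
    and c: "(\<integral>\<^sup>+z. ennreal (flow_cost \<psi> q0 z) \<partial>\<gamma>) \<le> ennreal C" "C \<ge> 0"
    and C': "C' > exp (2 * (2 * b * R\<^sup>2) * (q1 - q0)) * C"
  shows "\<exists>\<gamma>'\<in>couplings d (mu q1) \<nu>. (\<integral>\<^sup>+z. ennreal (flow_cost \<psi> q1 z) \<partial>\<gamma>') \<le> ennreal C'"
proof -
  let ?L = "2 * b * R\<^sup>2" and ?\<Delta> = "q1 - q0"
  define K where "K = R * Kb (dd 1 (Pl 1)) 3 b / poly kap a"
  let ?K2 = "2 * K\<^sup>2 + 4 * R * K + 4 * R\<^sup>2"
  have K0: "K \<ge> 0" unfolding K_def using poly_kap_pos[OF ab(1)] R_nonneg ab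
    by (intro divide_nonneg_pos mult_nonneg_nonneg Kb_nonneg) auto
  have K20: "?K2 \<ge> 0" using K0 R_nonneg by (intro add_nonneg_nonneg mult_nonneg_nonneg) auto
  have b0: "b \<ge> 0" using ab by simp
  let ?e = "\<lambda>M. ?\<Delta> / real (Suc M)"
  have e0: "?e \<longlonglongrightarrow> 0" by (rule LIMSEQ_Suc[OF lim_const_over_n])
  have "(\<lambda>M. exp ((2 * ?L + ?e M) * ?\<Delta>) * (C + ?\<Delta> * ?e M * ?K2)) \<longlonglongrightarrow> exp ((2 * ?L + 0) * ?\<Delta>) * (C + ?\<Delta> * 0 * ?K2)"
    by (intro tendsto_intros e0)
  then have "(\<lambda>M. exp ((2 * ?L + ?e M) * ?\<Delta>) * (C + ?\<Delta> * ?e M * ?K2)) \<longlonglongrightarrow> exp (2 * ?L * ?\<Delta>) * C" by simp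
  from order_tendstoD(2)[OF this C'] order_tendstoD(2)[OF e0, of 1]
  have "\<forall>\<^sub>F M in sequentially. exp ((2 * ?L + ?e M) * ?\<Delta>) * (C + ?\<Delta> * ?e M * ?K2) < C' \<and> ?e M < 1"
    by (auto intro: eventually_conj)
  \<comment> \<open>With \<open>Suc M\<close> equal micro steps the additive errors, of second order
    in each step, vanish in the limit; the strict bound on \<open>C'\<close> makes a finite
    \<open>M\<close> sufficient.\<close>
  then obtain M where M: "exp ((2 * ?L + ?e M) * ?\<Delta>) * (C + ?\<Delta> * ?e M * ?K2) < C'" "?e M < 1"
    by (auto simp: eventually_sequentially)
  define \<epsilon> where "\<epsilon> = ?e M"
  have \<epsilon>: "0 \<le> \<epsilon>" "\<epsilon> \<le> 1" "real (Suc M) * \<epsilon> = ?\<Delta>" using ab M(2) by (auto simp: \<epsilon>_def)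
  let ?A = "1 + 2 * \<epsilon> * ?L + \<epsilon>\<^sup>2"
  have A1: "?A \<ge> 1" using \<epsilon> b0 by simp
  \<comment> \<open>The additive errors are put inside the product of growth factors, which is
    coarser but stable under iteration since the factor is at least 1.\<close>
  have step: "n \<le> Suc M \<Longrightarrow> \<exists>\<gamma>'\<in>couplings d (mu (q0 + real n * \<epsilon>)) \<nu>.
    (\<integral>\<^sup>+z. ennreal (flow_cost \<psi> (q0 + real n * \<epsilon>) z) \<partial>\<gamma>') \<le> ennreal (?A ^ n * (C + real n * (\<epsilon>\<^sup>2 * ?K2)))" for n
  proof (induction n)
    case 0
    then show ?case using \<gamma> c by auto
  next
    case (Suc n)
    then obtain \<gamma>' where g: "\<gamma>' \<in> couplings d (mu (q0 + real n * \<epsilon>)) \<nu>"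
      "(\<integral>\<^sup>+z. ennreal (flow_cost \<psi> (q0 + real n * \<epsilon>) z) \<partial>\<gamma>') \<le> ennreal (?A ^ n * (C + real n * (\<epsilon>\<^sup>2 * ?K2)))" by auto
    have qn: "q0 + real n * \<epsilon> + \<epsilon> = q0 + real (Suc n) * \<epsilon>" by (simp add: algebra_simps)
    have le: "real (Suc n) * \<epsilon> \<le> ?\<Delta>" unfolding \<epsilon>(3)[symmetric] using Suc.prems \<epsilon>(1) by (intro mult_right_mono) auto
    have n0: "real n * \<epsilon> \<ge> 0" using \<epsilon>(1) by simp
    have aq: "a < q0 + real n * \<epsilon>" using ab(2) n0 by linarith
    have X0: "?A ^ n * (C + real n * (\<epsilon>\<^sup>2 * ?K2)) \<ge> 0"
      by (rule mult_nonneg_nonneg[OF zero_le_power[OF order_trans[OF zero_le_one A1]]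
          add_nonneg_nonneg[OF c(2) mult_nonneg_nonneg[OF of_nat_0_le_iff mult_nonneg_nonneg[OF zero_le_power2 K20]]]])
    have "\<exists>\<gamma>''\<in>couplings d (mu (q0 + real n * \<epsilon> + \<epsilon>)) \<nu>. (\<integral>\<^sup>+z. ennreal (flow_cost \<psi> (q0 + real n * \<epsilon> + \<epsilon>) z) \<partial>\<gamma>'')
      \<le> ennreal (?A * (?A ^ n * (C + real n * (\<epsilon>\<^sup>2 * ?K2))) + \<epsilon>\<^sup>2 * ?K2)"
    proof (rule coupling_micro_step[OF \<psi> _ _ _ _ _ _ \<nu> g X0 K_def])
      show "q0 + real n * \<epsilon> + \<epsilon> < b" using le qn ab by linarith
      show "(\<lambda>v. \<psi> v r l) \<in> borel_measurable (Rd d)" if "r \<in> {q0 + real n * \<epsilon>, q0 + real n * \<epsilon> + \<epsilon>}" "l < d" for r l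
        using that le qn n0 \<epsilon> by (intro m) auto
    qed (use ab aq \<epsilon> in auto)
    moreover have "?A * (?A ^ n * (C + real n * (\<epsilon>\<^sup>2 * ?K2))) + \<epsilon>\<^sup>2 * ?K2 \<le> ?A ^ Suc n * (C + real (Suc n) * (\<epsilon>\<^sup>2 * ?K2))"
    proof -
      have "1 * (\<epsilon>\<^sup>2 * ?K2) \<le> ?A ^ Suc n * (\<epsilon>\<^sup>2 * ?K2)" by (rule mult_right_mono[OF one_le_power[OF A1] mult_nonneg_nonneg[OF zero_le_power2 K20]])
      moreover have "?A ^ Suc n * (C + real (Suc n) * (\<epsilon>\<^sup>2 * ?K2)) = ?A * (?A ^ n * (C + real n * (\<epsilon>\<^sup>2 * ?K2))) + ?A ^ Suc n * (\<epsilon>\<^sup>2 * ?K2)"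
        by (simp add: distrib_left distrib_right mult.assoc)
      ultimately show ?thesis by linarith
    qed
    ultimately show ?case unfolding qn by (meson ennreal_leI order_trans)
  qed
  have "?A ^ Suc M * (C + real (Suc M) * (\<epsilon>\<^sup>2 * ?K2)) \<le> C'"
  proof -
    have "?A \<le> exp (2 * \<epsilon> * ?L + \<epsilon>\<^sup>2)"
      using exp_ge_add_one_self[of "2 * \<epsilon> * ?L + \<epsilon>\<^sup>2"] by (simp only: add.assoc)
    then have "?A ^ Suc M \<le> exp (2 * \<epsilon> * ?L + \<epsilon>\<^sup>2) ^ Suc M"
      by (rule power_mono[OF _ order_trans[OF zero_le_one A1]])
    also have "\<dots> = exp (real (Suc M) * (2 * \<epsilon> * ?L + \<epsilon>\<^sup>2))" by (rule exp_of_nat_mult[symmetric])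
    also have "real (Suc M) * (2 * \<epsilon> * ?L + \<epsilon>\<^sup>2) = (2 * ?L + \<epsilon>) * (real (Suc M) * \<epsilon>)"
      by (simp add: algebra_simps power2_eq_square)
    finally have le: "?A ^ Suc M \<le> exp ((2 * ?L + \<epsilon>) * ?\<Delta>)" unfolding \<epsilon>(3) .
    have eq: "C + real (Suc M) * (\<epsilon>\<^sup>2 * ?K2) = C + ?\<Delta> * \<epsilon> * ?K2"
      unfolding \<epsilon>(3)[symmetric] by (simp only: power2_eq_square mult.assoc)
    have "?\<Delta> \<ge> 0" using ab by simp
    note X0 = add_nonneg_nonneg[OF c(2) mult_nonneg_nonneg[OF mult_nonneg_nonneg[OF this \<epsilon>(1)] K20]]
    have "?A ^ Suc M * (C + real (Suc M) * (\<epsilon>\<^sup>2 * ?K2)) \<le> exp ((2 * ?L + \<epsilon>) * ?\<Delta>) * (C + ?\<Delta> * \<epsilon> * ?K2)"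
      unfolding eq by (rule mult_right_mono[OF le X0])
    also have "\<dots> < C'" using M(1) unfolding \<epsilon>_def[symmetric] .
    finally show ?thesis by simp
  qed
  moreover have "q0 + real (Suc M) * \<epsilon> = q1" unfolding \<epsilon>(3) by simp
  ultimately show ?thesis using step[OF order_refl] by (meson ennreal_leI order_trans)
qed

end

section \<open>Local and initial errors\<close>

declare eps.simps(2) [simp del]

lemma gauss_second_moment: "(\<integral>\<^sup>+g. ennreal ((nrm d g)\<^sup>2) \<partial>std_gaussian d) = ennreal (real d)"
proof -
  have pr: "prob_space std_normal_distribution" by (rule prob_space_normal_density) simp
  have one: "(\<integral>\<^sup>+x. ennreal (x\<^sup>2) \<partial>std_normal_distribution) = 1"
    using std_normal_distribution_even_moments[of 1] by (subst nn_integral_eq_integral) auto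
  have comp: "(\<integral>\<^sup>+g. ennreal ((g i)\<^sup>2) \<partial>std_gaussian d) = 1" if "i < d" for i
  proof -
    have m: "(\<lambda>g. g i) \<in> std_gaussian d \<rightarrow>\<^sub>M std_normal_distribution"
      unfolding std_gaussian_def using that by (intro measurable_component_singleton) auto
    have "distr (std_gaussian d) std_normal_distribution (\<lambda>g. g i) = std_normal_distribution"
      unfolding std_gaussian_def by (rule distr_PiM_component) (use pr that in auto)
    then have "(\<integral>\<^sup>+x. ennreal (x\<^sup>2) \<partial>distr (std_gaussian d) std_normal_distribution (\<lambda>g. g i)) = 1" using one by simp
    then show ?thesis by (subst (asm) nn_integral_distr_on[OF m]) auto
  qed
  have mi: "(\<lambda>g. ennreal ((g i)\<^sup>2)) \<in> borel_measurable (std_gaussian d)" if "i \<in> {..<d}" for i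
    unfolding measurable_cong_sets[OF sets_std_gaussian refl]
    using that by (intro measurable_compose[OF borel_measurable_power[OF measurable_Rd_component] measurable_ennreal]) simp
  have "(\<integral>\<^sup>+g. ennreal ((nrm d g)\<^sup>2) \<partial>std_gaussian d) = (\<integral>\<^sup>+g. (\<Sum>i<d. ennreal ((g i)\<^sup>2)) \<partial>std_gaussian d)"
    by (intro nn_integral_cong) (simp add: L2_set_def sum_nonneg)
  also have "\<dots> = (\<Sum>i<d. \<integral>\<^sup>+g. ennreal ((g i)\<^sup>2) \<partial>std_gaussian d)" by (rule nn_integral_sum[OF mi])
  also have "\<dots> = (\<Sum>i<d. 1)" by (rule sum.cong) (auto simp: comp)
  finally show ?thesis by (simp add: ennreal_of_nat_eq_real_of_nat)
qed

text \<open>By induction the polynomial is rho^2 times one of degree at most 2 j. The factor rho^2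
  provides the decay in t, and the degree fixes the power of 1/delta.\<close>

lemma alp_bound: "\<exists>C\<ge>0. \<forall>\<rho>\<ge>0. \<bar>poly (alp (Suc j)) \<rho>\<bar> \<le> C * \<rho>\<^sup>2 * (1 + \<rho>\<^sup>2) ^ j"
proof -
  have "\<exists>a. alp (Suc j) = [:0, 0, 1:] * a \<and> degree a \<le> 2 * j"
  proof (induction j)
    case 0
    show ?case by (intro exI[of _ "[:-1/2:]"]) simp
  next
    case (Suc j)
    then obtain a where a: "alp (Suc j) = [:0, 0, 1:] * a" "degree a \<le> 2 * j" by blast
    \<comment> \<open>The next quotient: with alp = rho^2 a, the recursion gives rho^2 ((1 +
      rho^2/2) a + kap a').\<close>
    let ?b = "[:1, 0, 1/2:] * a + [:0, 1/2, 0, 1/2:] * pderiv a"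
    have "alp (Suc (Suc j)) = [:0, 0, 1:] * ?b"
    proof (rule poly_eq_poly_eq_iff[THEN iffD1, OF ext])
      fix x
      have "poly (alp (Suc (Suc j))) x = poly (pderiv ([:0, 0, 1:] * a)) x * poly kap x - x\<^sup>2 / 2 * (x\<^sup>2 * poly a x)"
        unfolding alp.simps(2)[of "Suc j"] a(1) by (simp add: power2_eq_square algebra_simps del: mult_pCons_left)
      also have "poly (pderiv ([:0, 0, 1:] * a)) x = 2 * x * poly a x + x\<^sup>2 * poly (pderiv a) x"
        by (simp add: pderiv_mult pderiv_pCons power2_eq_square algebra_simps del: mult_pCons_left)
      finally show "poly (alp (Suc (Suc j))) x = poly ([:0, 0, 1:] * ?b) x"
        by (simp add: poly_kap power2_eq_square power3_eq_cube field_simps del: mult_pCons_left)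
    qed
    moreover have "degree ?b \<le> 2 * Suc j"
    proof (rule degree_add_le)
      have "degree ([:1, 0, 1/2:] * a) \<le> degree ([:1, 0, 1/2:] :: real poly) + degree a" by (rule degree_mult_le)
      then show "degree ([:1, 0, 1/2:] * a) \<le> 2 * Suc j" using a(2) by simp
      show "degree ([:0, 1/2, 0, 1/2:] * pderiv a) \<le> 2 * Suc j"
      proof (cases "degree a = 0")
        case True
        then have "pderiv a = 0" by (simp add: pderiv_eq_0_iff)
        then show ?thesis by simp
      next
        case False
        have "degree ([:0, 1/2, 0, 1/2:] * pderiv a) \<le> degree ([:0, 1/2, 0, 1/2:] :: real poly) + degree (pderiv a)" by (rule degree_mult_le)
        then show ?thesis using a(2) False by (simp add: degree_pderiv)
      qed
    qed
    ultimately show ?case by blast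
  qed
  then obtain a where a: "alp (Suc j) = [:0, 0, 1:] * a" "degree a \<le> 2 * j" by blast
  show ?thesis
  proof (intro exI[of _ "pabs a * 2 ^ j"] conjI allI impI)
    show "0 \<le> pabs a * 2 ^ j" by (simp add: pabs_nonneg)
    fix \<rho> :: real assume \<rho>: "\<rho> \<ge> 0"
    have "(1 + \<rho>) ^ degree a \<le> (1 + \<rho>) ^ (2 * j)" using \<rho> a(2) by (intro power_increasing) auto
    also have "\<dots> = ((1 + \<rho>)\<^sup>2) ^ j" by (rule power_mult)
    also have "\<dots> \<le> (2 * (1 + \<rho>\<^sup>2)) ^ j"
    proof (rule power_mono)
      have "0 \<le> (1 - \<rho>)\<^sup>2" by simp
      then show "(1 + \<rho>)\<^sup>2 \<le> 2 * (1 + \<rho>\<^sup>2)" by (simp add: power2_eq_square algebra_simps)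
    qed simp
    finally have "\<bar>poly a \<rho>\<bar> \<le> pabs a * (2 * (1 + \<rho>\<^sup>2)) ^ j"
      using abs_poly_le[OF \<rho>, of a] mult_left_mono[OF _ pabs_nonneg[of a]] by (meson order_trans)
    from mult_left_mono[OF this, of "\<rho>\<^sup>2"]
    have "\<rho>\<^sup>2 * \<bar>poly a \<rho>\<bar> \<le> pabs a * 2 ^ j * \<rho>\<^sup>2 * (1 + \<rho>\<^sup>2) ^ j"
      by (simp only: power_mult_distrib zero_le_power2 mult_ac)
    moreover have "\<bar>poly (alp (Suc j)) \<rho>\<bar> = \<rho>\<^sup>2 * \<bar>poly a \<rho>\<bar>"
      unfolding a(1) by (simp add: abs_mult power2_eq_square)
    ultimately show "\<bar>poly (alp (Suc j)) \<rho>\<bar> \<le> pabs a * 2 ^ j * \<rho>\<^sup>2 * (1 + \<rho>\<^sup>2) ^ j" by simp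
  qed
qed

section \<open>Elementary bounds for times at least delta\<close>

context
  fixes \<delta> t :: real assumes \<delta>: "0 < \<delta>" "\<delta> \<le> 1" and t: "\<delta> \<le> t"
begin

lemma t_pos: "t > 0" using \<delta> t by simp

lemma sg_sq_ge: "(sg t)\<^sup>2 \<ge> \<delta> / 2"
proof -
  have "1 \<le> (1 + \<delta>) * (1 - \<delta> / 2)" using \<delta> mult_left_mono[of \<delta> 1 \<delta>] by (simp add: algebra_simps)
  also have "\<dots> \<le> exp \<delta> * (1 - \<delta> / 2)" using \<delta> by (intro mult_right_mono) auto
  finally have "exp (- \<delta>) \<le> 1 - \<delta> / 2" by (simp add: exp_minus field_simps)
  moreover have "exp (- t) \<le> exp (- \<delta>)" using t by simp
  ultimately show ?thesis using sg_sq[OF t_pos] by linarith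
qed

lemma rho_sq_le: "(rho t)\<^sup>2 \<le> 1 / \<delta>"
proof -
  have "\<delta> \<le> exp t - 1" using t exp_ge_add_one_self[of t] by linarith
  moreover from this have "exp t - 1 > 0" using \<delta> by linarith
  ultimately show ?thesis unfolding rho_sq[OF t_pos] using \<delta> by (intro divide_left_mono mult_pos_pos) auto
qed

lemma one_plus_rho_sq_le: "1 + (rho t)\<^sup>2 \<le> 2 / \<delta>"
proof -
  have "1 / (sg t)\<^sup>2 \<le> 1 / (\<delta> / 2)" using sg_sq_ge \<delta> sg_pos[OF t_pos] by (intro divide_left_mono mult_pos_pos) auto
  then show ?thesis using inv_sg_sq[OF t_pos] by simp
qed

lemma inv_sg_le: "1 / sg t \<le> 2 / \<delta>"
proof -
  have "(1 / sg t)\<^sup>2 \<le> 2 / \<delta>" using one_plus_rho_sq_le inv_sg_sq[OF t_pos] by (simp add: power_divide)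
  also have "\<dots> = 2 / \<delta> * 1" by simp
  also have "\<dots> \<le> 2 / \<delta> * (2 / \<delta>)" using \<delta> by (intro mult_left_mono) auto
  finally have "(1 / sg t)\<^sup>2 \<le> (2 / \<delta>)\<^sup>2" by (simp only: power2_eq_square)
  then show ?thesis by (rule power2_le_imp_le) (use \<delta> in simp)
qed

text \<open>Only 1/sg^2 is bounded by 2/delta here; the decay in t is retained through (sg rho)^2 =
  exp(-t).\<close>

lemma rho_sq_le_exp: "(rho t)\<^sup>2 \<le> 2 / \<delta> * exp (- t)"
proof -
  have s: "sg t > 0" by (rule sg_pos[OF t_pos])
  have "(rho t)\<^sup>2 = (sg t * rho t)\<^sup>2 * (1 / (sg t)\<^sup>2)" using s by (simp add: power_mult_distrib)
  also have "(sg t * rho t)\<^sup>2 = exp (- t)" unfolding sg_rho[OF t_pos] by (simp flip: exp_double)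
  also have "exp (- t) * (1 / (sg t)\<^sup>2) \<le> exp (- t) * (2 / \<delta>)"
    using one_plus_rho_sq_le inv_sg_sq[OF t_pos] by (intro mult_left_mono) auto
  finally show ?thesis by (simp add: mult.commute)
qed

lemma sg_kap_le: "sg t * poly kap (rho t) \<le> exp (- t / 2) / \<delta>"
proof -
  have s: "sg t > 0" by (rule sg_pos[OF t_pos])
  have "2 * (sg t * poly kap (rho t)) = (sg t * rho t) * (1 / (sg t)\<^sup>2)"
    unfolding sg_kap[OF t_pos] using s by (simp add: power2_eq_square)
  also have "\<dots> \<le> exp (- t / 2) * (2 / \<delta>)"
    unfolding sg_rho[OF t_pos] using one_plus_rho_sq_le inv_sg_sq[OF t_pos] by (intro mult_left_mono) auto
  finally show ?thesis using \<delta>(1) by (simp add: field_simps)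
qed

end

lemma rho_antimono: "0 < v \<Longrightarrow> v \<le> u \<Longrightarrow> rho u \<le> rho v"
  unfolding rho_def by (intro divide_left_mono) auto

context bounded_prior
begin

text \<open>Minkowski for the two summands. \<open>nn_integral_minkowski\<close> needs strictly
  positive bounds, hence one excess \<open>\<eta>\<close> for each.\<close>

lemma gauss_mix_norm:
  assumes \<eta>: "\<eta> > 0"
  shows "(\<integral>\<^sup>+z. ennreal ((nrm d (\<lambda>i. A * fst z i + B * snd z i))\<^sup>2) \<partial>(P \<Otimes>\<^sub>M std_gaussian d))
    \<le> ennreal ((\<bar>A\<bar> * R + \<bar>B\<bar> * sqrt d + 2 * \<eta>)\<^sup>2)"
proof -
  interpret G: prob_space "std_gaussian d" by (rule prob_space_std_gaussian)
  let ?M = "P \<Otimes>\<^sub>M std_gaussian d"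
  have f1: "(\<lambda>z. nrm d (\<lambda>i. A * fst z i)) \<in> borel_measurable ?M"
    unfolding measurable_cong_sets[OF sets_pair_P_gauss refl]
    by (intro borel_measurable_nrm borel_measurable_times borel_measurable_const measurable_fst_component)
  have f2: "(\<lambda>z. nrm d (\<lambda>i. B * snd z i)) \<in> borel_measurable ?M"
    unfolding measurable_cong_sets[OF sets_pair_P_gauss refl]
    by (intro borel_measurable_nrm borel_measurable_times borel_measurable_const measurable_snd_component)
  note f = f1 f2
  have 1: "(\<integral>\<^sup>+z. ennreal ((nrm d (\<lambda>i. A * fst z i))\<^sup>2) \<partial>?M) \<le> ennreal ((\<bar>A\<bar> * R + \<eta>)\<^sup>2)"
  proof -
    have "(\<integral>\<^sup>+z. ennreal ((nrm d (\<lambda>i. A * fst z i))\<^sup>2) \<partial>?M) = (\<integral>\<^sup>+y. (\<integral>\<^sup>+g. ennreal ((nrm d (\<lambda>i. A * y i))\<^sup>2) \<partial>std_gaussian d) \<partial>P)"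
      by (subst G.nn_integral_fst[symmetric]) (use f(1) in auto)
    also have "\<dots> = (\<integral>\<^sup>+y. ennreal ((nrm d (\<lambda>i. A * y i))\<^sup>2) \<partial>P)" by (simp add: G.emeasure_space_1)
    also have "\<dots> \<le> (\<integral>\<^sup>+y. ennreal ((\<bar>A\<bar> * R + \<eta>)\<^sup>2) \<partial>P)"
    proof (rule nn_integral_mono_AE)
      show "AE y in P. ennreal ((nrm d (\<lambda>i. A * y i))\<^sup>2) \<le> ennreal ((\<bar>A\<bar> * R + \<eta>)\<^sup>2)"
        using AE_R
      proof eventually_elim
        case (elim y)
        have "\<bar>A\<bar> * nrm d y \<le> \<bar>A\<bar> * R" using elim by (intro mult_left_mono) auto
        then have "nrm d (\<lambda>i. A * y i) \<le> \<bar>A\<bar> * R + \<eta>" unfolding nrm_scale using \<eta> by linarith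
        then show ?case by (intro ennreal_leI power_mono) auto
      qed
    qed
    finally show ?thesis by (simp add: emeasure_space_1)
  qed
  have 2: "(\<integral>\<^sup>+z. ennreal ((nrm d (\<lambda>i. B * snd z i))\<^sup>2) \<partial>?M) \<le> ennreal ((\<bar>B\<bar> * sqrt d + \<eta>)\<^sup>2)"
  proof -
    have "(\<integral>\<^sup>+z. ennreal ((nrm d (\<lambda>i. B * snd z i))\<^sup>2) \<partial>?M) = (\<integral>\<^sup>+y. (\<integral>\<^sup>+g. ennreal ((nrm d (\<lambda>i. B * g i))\<^sup>2) \<partial>std_gaussian d) \<partial>P)"
      by (subst G.nn_integral_fst[symmetric]) (use f(2) in auto)
    also have "\<dots> = (\<integral>\<^sup>+g. ennreal ((nrm d (\<lambda>i. B * g i))\<^sup>2) \<partial>std_gaussian d)" by (simp add: emeasure_space_1)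
    also have "\<dots> = (\<integral>\<^sup>+g. ennreal (B\<^sup>2) * ennreal ((nrm d g)\<^sup>2) \<partial>std_gaussian d)"
      by (simp add: nrm_scale power_mult_distrib ennreal_mult')
    also have "\<dots> = ennreal (B\<^sup>2) * ennreal (real d)"
    proof -
      have "(\<lambda>g. ennreal ((nrm d g)\<^sup>2)) \<in> borel_measurable (std_gaussian d)"
        unfolding measurable_cong_sets[OF sets_std_gaussian refl]
        by (intro measurable_compose[OF borel_measurable_power[OF borel_measurable_nrm] measurable_ennreal] measurable_Rd_component)
      then show ?thesis by (simp add: nn_integral_cmult gauss_second_moment)
    qed
    also have "\<dots> = ennreal ((\<bar>B\<bar> * sqrt d)\<^sup>2)" by (simp add: power_mult_distrib ennreal_mult')
    also have "\<dots> \<le> ennreal ((\<bar>B\<bar> * sqrt d + \<eta>)\<^sup>2)" using \<eta> by (intro ennreal_leI power_mono) auto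
    finally show ?thesis .
  qed
  have "(\<integral>\<^sup>+z. ennreal ((nrm d (\<lambda>i. A * fst z i + B * snd z i))\<^sup>2) \<partial>?M)
    \<le> (\<integral>\<^sup>+z. ennreal ((nrm d (\<lambda>i. A * fst z i) + nrm d (\<lambda>i. B * snd z i))\<^sup>2) \<partial>?M)"
    by (intro nn_integral_mono ennreal_leI power_mono L2_set_triangle_ineq) auto
  also have "\<dots> \<le> ennreal (((\<bar>A\<bar> * R + \<eta>) + (\<bar>B\<bar> * sqrt d + \<eta>))\<^sup>2)"
    using \<eta> R_nonneg by (intro nn_integral_minkowski f 1 2 add_nonneg_pos mult_nonneg_nonneg) auto
  finally show ?thesis by (simp add: algebra_simps)
qed

lemma measurable_scale: "(\<lambda>w. \<lambda>i\<in>{..<d}. c * w i) \<in> Rd d \<rightarrow>\<^sub>M Rd d"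
  by (intro measurable_Rd_restrict borel_measurable_times borel_measurable_const measurable_Rd_component)

lemma noised_law_eq_mu:
  assumes "t > 0" shows "noised_law d P t = distr (mu (rho t)) (Rd d) (\<lambda>w. \<lambda>i\<in>{..<d}. sg t * w i)"
proof -
  have "noised_law d P t = distr (P \<Otimes>\<^sub>M std_gaussian d) (Rd d) ((\<lambda>w. \<lambda>i\<in>{..<d}. sg t * w i) \<circ> (\<lambda>(y, g). \<lambda>i\<in>{..<d}. rho t * y i + g i))"
    unfolding noised_law_def sg_rho[OF assms, symmetric] sg_def[symmetric]
    by (rule arg_cong[where f = "distr _ _"]) (auto simp: fun_eq_iff algebra_simps)
  also have "\<dots> = distr (mu (rho t)) (Rd d) (\<lambda>w. \<lambda>i\<in>{..<d}. sg t * w i)"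
    unfolding mu_def by (rule distr_distr[symmetric, OF measurable_scale measurable_mu_map])
  finally show ?thesis .
qed

lemma nrm_sq_measurable: "(\<lambda>x. ennreal ((nrm d x)\<^sup>2)) \<in> borel_measurable (Rd d)"
  by (intro measurable_compose[OF borel_measurable_power[OF borel_measurable_nrm] measurable_ennreal] measurable_Rd_component)

lemma noised_second_moment:
  assumes t: "t > 0"
  shows "(\<integral>\<^sup>+x. ennreal ((nrm d x)\<^sup>2) \<partial>noised_law d P t) = ennreal (\<integral>x. (nrm d x)\<^sup>2 \<partial>noised_law d P t)"
    and "sqrt (\<integral>x. (nrm d x)\<^sup>2 \<partial>noised_law d P t) \<le> R + sqrt d"
proof -
  let ?I = "\<integral>\<^sup>+x. ennreal ((nrm d x)\<^sup>2) \<partial>noised_law d P t"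
  have bound: "?I \<le> ennreal ((R + sqrt d + 2 * \<eta>)\<^sup>2)" if \<eta>: "\<eta> > 0" for \<eta>
  proof -
    have m: "(\<lambda>(x, g). \<lambda>i\<in>{..<d}. exp (- t / 2) * x i + sqrt (1 - exp (- t)) * g i) \<in> P \<Otimes>\<^sub>M std_gaussian d \<rightarrow>\<^sub>M Rd d"
      unfolding measurable_cong_sets[OF sets_pair_P_gauss refl] split_beta'
      by (intro measurable_Rd_restrict borel_measurable_add borel_measurable_times borel_measurable_const
          measurable_fst_component measurable_snd_component)
    have "?I = (\<integral>\<^sup>+z. ennreal ((nrm d (\<lambda>i. exp (- t / 2) * fst z i + sqrt (1 - exp (- t)) * snd z i))\<^sup>2) \<partial>(P \<Otimes>\<^sub>M std_gaussian d))"
      unfolding noised_law_def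
      by (subst nn_integral_distr_on[OF m nrm_sq_measurable])
        (auto intro!: nn_integral_cong arg_cong[where f = "\<lambda>x. ennreal (x\<^sup>2)"] nrm_cong simp: split_beta')
    also have "\<dots> \<le> ennreal ((\<bar>exp (- t / 2)\<bar> * R + \<bar>sqrt (1 - exp (- t))\<bar> * sqrt d + 2 * \<eta>)\<^sup>2)"
      by (rule gauss_mix_norm[OF \<eta>])
    also have "\<dots> \<le> ennreal ((1 * R + 1 * sqrt d + 2 * \<eta>)\<^sup>2)"
      using t \<eta> R_nonneg by (intro ennreal_leI power_mono add_mono mult_right_mono) auto
    finally show ?thesis by simp
  qed
  have "?I < \<infinity>" using bound[of 1] by (simp add: order_le_less_trans)
  then obtain x where x: "x \<ge> 0" "?I = ennreal x" by (cases ?I) auto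
  have m: "(\<lambda>x. (nrm d x)\<^sup>2) \<in> borel_measurable (noised_law d P t)"
    unfolding noised_law_def by (simp, intro borel_measurable_power borel_measurable_nrm measurable_Rd_component)
  have ix: "(\<integral>x. (nrm d x)\<^sup>2 \<partial>noised_law d P t) = x"
    using integral_eq_nn_integral[OF m] x by simp
  then show "?I = ennreal (\<integral>x. (nrm d x)\<^sup>2 \<partial>noised_law d P t)" using x by simp
  show "sqrt (\<integral>x. (nrm d x)\<^sup>2 \<partial>noised_law d P t) \<le> R + sqrt d"
    unfolding ix
  proof (rule field_le_epsilon)
    fix e :: real assume "e > 0"
    then have "x \<le> (R + sqrt d + 2 * (e / 2))\<^sup>2" using bound[of "e / 2"] x by simp
    then show "sqrt x \<le> R + sqrt d + e" using \<open>e > 0\<close> R_nonneg by (intro real_le_lsqrt) auto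
  qed
qed

lemma moment_sup_le:
  assumes "0 < \<delta>" "\<delta> < T" shows "moment_sup d P \<delta> T \<le> R + sqrt d"
  unfolding moment_sup_def by (rule cSUP_least) (use assms noised_second_moment(2) in auto)

lemma moment_sup_ge:
  assumes "0 < \<delta>" "\<delta> \<le> t" "t \<le> T"
  shows "sqrt (\<integral>x. (nrm d x)\<^sup>2 \<partial>noised_law d P t) \<le> moment_sup d P \<delta> T"
  unfolding moment_sup_def
proof (rule cSUP_upper)
  show "bdd_above ((\<lambda>t. sqrt (\<integral>x. (nrm d x)\<^sup>2 \<partial>noised_law d P t)) ` {\<delta>..T})"
    by (rule bdd_aboveI2[where M = "R + sqrt d"]) (use assms noised_second_moment(2) in auto)
qed (use assms in auto)

text \<open>Passing from x to w = x / sg t costs the factor 1/sg t <= 2/delta.\<close>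

lemma mu_second_moment:
  assumes "0 < \<delta>" "\<delta> \<le> 1" "\<delta> \<le> t" "t \<le> T"
  shows "(\<integral>\<^sup>+w. ennreal ((nrm d w)\<^sup>2) \<partial>mu (rho t)) \<le> ennreal ((2 / \<delta> * moment_sup d P \<delta> T)\<^sup>2)"
proof -
  have t: "t > 0" using assms by simp
  have s: "sg t > 0" by (rule sg_pos[OF t])
  let ?x = "\<integral>x. (nrm d x)\<^sup>2 \<partial>noised_law d P t"
  have x0: "?x \<ge> 0" by (rule Bochner_Integration.integral_nonneg) simp
  have "(\<integral>\<^sup>+x. ennreal ((nrm d x)\<^sup>2) \<partial>noised_law d P t) = (\<integral>\<^sup>+w. ennreal ((nrm d (\<lambda>i\<in>{..<d}. sg t * w i))\<^sup>2) \<partial>mu (rho t))"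
    unfolding noised_law_eq_mu[OF t]
    by (rule nn_integral_distr_on) (use measurable_scale nrm_sq_measurable in \<open>simp_all add: measurable_cong_sets[OF sets_mu refl]\<close>)
  also have "\<dots> = (\<integral>\<^sup>+w. ennreal ((sg t)\<^sup>2) * ennreal ((nrm d w)\<^sup>2) \<partial>mu (rho t))"
  proof (rule nn_integral_cong)
    fix w :: "nat \<Rightarrow> real"
    have "nrm d (\<lambda>i\<in>{..<d}. sg t * w i) = nrm d (\<lambda>i. sg t * w i)" by (rule nrm_cong) simp
    then show "ennreal ((nrm d (\<lambda>i\<in>{..<d}. sg t * w i))\<^sup>2) = ennreal ((sg t)\<^sup>2) * ennreal ((nrm d w)\<^sup>2)"
      by (simp add: nrm_scale power_mult_distrib ennreal_mult')
  qed
  also have "\<dots> = ennreal ((sg t)\<^sup>2) * (\<integral>\<^sup>+w. ennreal ((nrm d w)\<^sup>2) \<partial>mu (rho t))"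
    by (rule nn_integral_cmult) (use nrm_sq_measurable in \<open>simp add: measurable_cong_sets[OF sets_mu refl]\<close>)
  finally have "ennreal ((1 / sg t)\<^sup>2) * ennreal ?x
    = ennreal ((1 / sg t)\<^sup>2) * (ennreal ((sg t)\<^sup>2) * (\<integral>\<^sup>+w. ennreal ((nrm d w)\<^sup>2) \<partial>mu (rho t)))"
    using noised_second_moment(1)[OF t] by simp
  also have "\<dots> = (\<integral>\<^sup>+w. ennreal ((nrm d w)\<^sup>2) \<partial>mu (rho t))"
    using s by (simp add: mult.assoc[symmetric] ennreal_mult[symmetric] power_mult_distrib[symmetric])
  finally have "(\<integral>\<^sup>+w. ennreal ((nrm d w)\<^sup>2) \<partial>mu (rho t)) = ennreal ((1 / sg t)\<^sup>2 * ?x)"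
    using x0 by (simp add: ennreal_mult)
  also have "(1 / sg t)\<^sup>2 * ?x = (1 / sg t * sqrt ?x)\<^sup>2"
    using x0 by (simp only: power_mult_distrib real_sqrt_pow2)
  also have "\<dots> \<le> ennreal ((2 / \<delta> * moment_sup d P \<delta> T)\<^sup>2)"
    using assms s x0 by (intro ennreal_leI power_mono mult_mono inv_sg_le moment_sup_ge mult_nonneg_nonneg) auto
  finally show ?thesis .
qed

text \<open>Synchronous coupling: with the same G on both sides the difference is rho Y + (1 - 1/sg)
  G, and both coefficients are at most exp(-T/2)/sg in absolute value.\<close>

lemma initial_coupling:
  assumes t: "T > 0" and \<eta>: "\<eta> > 0"
  shows "\<exists>\<gamma>\<in>couplings d (mu (rho T)) (std_gaussian d).
    (\<integral>\<^sup>+z. ennreal ((nrm d (\<lambda>i. fst z i - snd z i / sg T))\<^sup>2) \<partial>\<gamma>) \<le> ennreal ((2 * exp (- T / 2) * sqrt (R\<^sup>2 + d) / sg T + \<eta>)\<^sup>2)"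
proof -
  interpret G: prob_space "std_gaussian d" by (rule prob_space_std_gaussian)
  let ?M = "P \<Otimes>\<^sub>M std_gaussian d"
  let ?m = "\<lambda>(y, g). (\<lambda>i\<in>{..<d}. rho T * y i + g i, g)"
  define \<gamma> where "\<gamma> = distr ?M (Rd d \<Otimes>\<^sub>M Rd d) ?m"
  have sn: "snd \<in> ?M \<rightarrow>\<^sub>M Rd d"
    unfolding measurable_cong_sets[OF sets_pair_P_gauss refl] by (rule measurable_snd)
  have m: "?m \<in> ?M \<rightarrow>\<^sub>M Rd d \<Otimes>\<^sub>M Rd d"
    using measurable_Pair[OF measurable_mu_map[of "rho T"] sn] by (simp add: split_beta')
  have s: "sg T > 0" by (rule sg_pos[OF t])
  have "distr \<gamma> (Rd d) fst = mu (rho T)"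
    unfolding \<gamma>_def mu_def by (subst distr_distr[OF measurable_fst m]) (auto intro!: arg_cong[where f = "distr _ _"])
  moreover have "distr \<gamma> (Rd d) snd = std_gaussian d"
  proof (rule measure_eqI)
    fix A assume "A \<in> sets (distr \<gamma> (Rd d) snd)"
    then have A: "A \<in> sets (Rd d)" by simp
    have "distr \<gamma> (Rd d) snd = distr ?M (Rd d) snd"
      unfolding \<gamma>_def by (subst distr_distr[OF measurable_snd m]) (auto intro!: arg_cong[where f = "distr _ _"])
    then have "emeasure (distr \<gamma> (Rd d) snd) A = (\<integral>\<^sup>+z. indicator A (snd z) \<partial>?M)"
      using emeasure_distr_nn_integral[OF sn A] by simp
    also have "\<dots> = (\<integral>\<^sup>+y. (\<integral>\<^sup>+g. indicator A g \<partial>std_gaussian d) \<partial>P)"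
      by (subst G.nn_integral_fst[symmetric]) (use measurable_compose[OF sn borel_measurable_indicator[OF A]] in auto)
    also have "\<dots> = emeasure (std_gaussian d) A"
      using A by (simp add: emeasure_space_1 sets_std_gaussian)
    finally show "emeasure (distr \<gamma> (Rd d) snd) A = emeasure (std_gaussian d) A" .
  qed (simp add: sets_std_gaussian)
  ultimately have c: "\<gamma> \<in> couplings d (mu (rho T)) (std_gaussian d)"
    unfolding couplings_def by (simp add: \<gamma>_def)
  have f: "(\<lambda>z. ennreal ((nrm d (\<lambda>i. fst z i - snd z i / sg T))\<^sup>2)) \<in> borel_measurable (Rd d \<Otimes>\<^sub>M Rd d)"
    by (intro measurable_compose[OF _ measurable_ennreal] borel_measurable_power borel_measurable_nrm borel_measurable_diff
        borel_measurable_divide borel_measurable_const measurable_fst_component measurable_snd_component)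
  have "(\<integral>\<^sup>+z. ennreal ((nrm d (\<lambda>i. fst z i - snd z i / sg T))\<^sup>2) \<partial>\<gamma>)
    = (\<integral>\<^sup>+z. ennreal ((nrm d (\<lambda>i. rho T * fst z i + (1 - 1 / sg T) * snd z i))\<^sup>2) \<partial>?M)"
    unfolding \<gamma>_def
    by (subst nn_integral_distr_on[OF m f])
      (auto intro!: nn_integral_cong arg_cong[where f = "\<lambda>x. ennreal (x\<^sup>2)"] nrm_cong simp: split_beta' algebra_simps)
  also have "\<dots> \<le> ennreal ((\<bar>rho T\<bar> * R + \<bar>1 - 1 / sg T\<bar> * sqrt d + 2 * (\<eta> / 2))\<^sup>2)"
    by (rule gauss_mix_norm) (use \<eta> in simp)
  also have "\<dots> \<le> ennreal ((2 * exp (- T / 2) * sqrt (R\<^sup>2 + d) / sg T + \<eta>)\<^sup>2)"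
  proof (intro ennreal_leI power_mono)
    let ?e = "exp (- T / 2)"
    have r: "\<bar>rho T\<bar> = ?e / sg T" using sg_rho[OF t] s rho_pos[OF t] by (simp add: field_simps)
    have "1 - sg T \<le> ?e"
    proof -
      have "sg T \<le> 1" by (simp add: sg_def)
      then have "(sg T)\<^sup>2 \<le> sg T" using s mult_right_mono[of "sg T" 1 "sg T"] by (simp add: power2_eq_square)
      then have "1 - sg T \<le> exp (- T)" using sg_sq[OF t] by simp
      also have "\<dots> \<le> ?e" using t by simp
      finally show ?thesis .
    qed
    moreover have "\<bar>1 - 1 / sg T\<bar> = (1 - sg T) / sg T"
      using s by (simp add: abs_if field_simps sg_def)
    ultimately have o: "\<bar>1 - 1 / sg T\<bar> \<le> ?e / sg T" using s by (simp add: divide_right_mono)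
    have q: "R \<le> sqrt (R\<^sup>2 + d)" "sqrt d \<le> sqrt (R\<^sup>2 + d)" by (auto intro!: real_le_rsqrt)
    have "\<bar>rho T\<bar> * R + \<bar>1 - 1 / sg T\<bar> * sqrt d \<le> ?e / sg T * sqrt (R\<^sup>2 + d) + ?e / sg T * sqrt (R\<^sup>2 + d)"
      unfolding r using s o q R_nonneg by (intro add_mono mult_mono) auto
    then show "\<bar>rho T\<bar> * R + \<bar>1 - 1 / sg T\<bar> * sqrt d + 2 * (\<eta> / 2) \<le> 2 * ?e * sqrt (R\<^sup>2 + d) / sg T + \<eta>" by simp
  qed (use \<eta> R_nonneg in \<open>auto intro!: add_nonneg_nonneg mult_nonneg_nonneg\<close>)
  finally show ?thesis using c by blast
qed

text \<open>The flows are chosen separately for each \<open>v\<close>; measurability in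
  \<open>v\<close> follows from Lipschitz dependence on the starting point, which
  \<open>flow_lipschitz\<close> gives forward from \<open>q\<close>.\<close>

lemma flow_family:
  assumes "0 < a" "a \<le> q" "q \<le> b" and c: "c \<noteq> 0"
  shows "\<exists>\<psi>. (\<forall>v. flow (\<psi> v) a b \<and> \<psi> v q = (\<lambda>l. v l / c)) \<and>
    (\<forall>r\<in>{q..b}. \<forall>l<d. (\<lambda>v. \<psi> v r l) \<in> borel_measurable (Rd d))"
proof -
  have "\<forall>v. \<exists>w. flow w a b \<and> w q = (\<lambda>l. v l / c)" using flow_exists[of q a b] assms by auto
  then obtain \<psi> where \<psi>: "\<And>v. flow (\<psi> v) a b" "\<And>v. \<psi> v q = (\<lambda>l. v l / c)" by metis
  have "(\<lambda>v. \<psi> v r l) \<in> borel_measurable (Rd d)" if r: "r \<in> {q..b}" and l: "l < d" for r l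
  proof (rule lipschitz_measurable_Rd)
    fix u v
    have "\<bar>\<psi> u r l - \<psi> v r l\<bar> \<le> nrm d (\<lambda>l. \<psi> u r l - \<psi> v r l)" by (rule abs_le_nrm[OF l])
    also have "\<dots> \<le> exp (2 * b * R\<^sup>2 * (r - q)) * nrm d (\<lambda>l. \<psi> u q l - \<psi> v q l)"
      by (rule flow_lipschitz[OF \<psi>(1) \<psi>(1)]) (use assms r in auto)
    also have "nrm d (\<lambda>l. \<psi> u q l - \<psi> v q l) = \<bar>1 / c\<bar> * nrm d (\<lambda>l. u l - v l)"
      unfolding \<psi>(2) nrm_scale[symmetric] by (simp add: diff_divide_distrib)
    finally show "\<bar>\<psi> u r l - \<psi> v r l\<bar> \<le> (exp (2 * b * R\<^sup>2 * (r - q)) * \<bar>1 / c\<bar>) * nrm d (\<lambda>l. u l - v l)" by (simp add: mult.assoc)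
  qed
  then show ?thesis using \<psi> by blast
qed

end

context ud_prior
begin

text \<open>\<open>flow_taylor\<close> with the bound \<open>dot_Vf_le\<close>; the return from x to
  w costs another 2/delta. The term from \<open>alp\<close> grows with the starting point while that
  from the replicas does not, and both carry exp(-(t - h)/2).\<close>

lemma local_error:
  assumes \<delta>: "0 < \<delta>" "\<delta> \<le> 1" and h: "0 < h" and t: "\<delta> \<le> t - h" and tu: "t = T - u"
    and f: "flow w a b" and a: "0 < a" "a < rho t" and b: "b = rho \<delta> + 1"
    and w0: "w (rho t) = (\<lambda>l. v l / sg t)"
    and Ca: "Ca \<ge> 0" "\<And>\<rho>. \<rho> \<ge> 0 \<Longrightarrow> \<bar>poly (alp (Suc p)) \<rho>\<bar> \<le> Ca * \<rho>\<^sup>2 * (1 + \<rho>\<^sup>2) ^ p"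
  shows "nrm d (\<lambda>l. w (rho (t - h)) l - taylor_step d P p T h u v l / sg (t - h))
    \<le> h * exp (- (t - h) / 2) * (h ^ p * Ca * (2 / \<delta>) ^ (p + 2)) * nrm d (\<lambda>l. v l / sg t)
     + h * exp (- (t - h) / 2) * (h ^ p * (Ca * (2 / \<delta>) ^ (p + 2) * (R * b) + 2 / \<delta>\<^sup>2 * (R * Kb (eps (Suc p)) (2 * Suc p + 1) b)))"
proof -
  let ?t' = "t - h"
  let ?e = "exp (- ?t' / 2)"
  let ?KB = "R * Kb (eps (Suc p)) (2 * Suc p + 1) b"
  let ?N = "nrm d (\<lambda>l. v l / sg t) + R * b"
  let ?B = "?e * (Ca * (2 / \<delta>) ^ (p + 1) * ?N + ?KB / \<delta>)"
  have tp: "0 < t" "0 < ?t'" "\<delta> \<le> t" using \<delta> h t by auto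
  have b0: "b > 0" using rho_pos[OF \<delta>(1)] b by simp
  have KB0: "?KB \<ge> 0" using R_nonneg b0 by (intro mult_nonneg_nonneg Kb_nonneg) auto
  have N0: "?N \<ge> 0" using R_nonneg b0 by (intro add_nonneg_nonneg mult_nonneg_nonneg) auto
  \<comment> \<open>The summand 1 in \<open>b\<close> keeps all values of rho that occur strictly
    inside the interval of the flow, where its derivative is two-sided.\<close>
  have rb: "rho \<tau> < b" if "\<delta> \<le> \<tau>" for \<tau> using rho_antimono[OF \<delta>(1) that] b by simp
  have B0: "?B \<ge> 0"
    by (rule mult_nonneg_nonneg[OF exp_ge_zero add_nonneg_nonneg[OF mult_nonneg_nonneg[OF mult_nonneg_nonneg[OF Ca(1) zero_le_power] N0]
          divide_nonneg_pos[OF KB0 \<delta>(1)]]]) (use \<delta> in simp)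
  let ?X = "\<lambda>s l. sg (t - s) * w (rho (t - s)) l"
  have X0: "(\<lambda>l. sg t * w (rho t) l) = v" using w0 sg_pos[OF tp(1)] by (simp add: fun_eq_iff)
  have "nrm d (\<lambda>i. sg (t - h) * w (rho (t - h)) i - (\<Sum>m<Suc p. Vf m t (\<lambda>l. sg t * w (rho t) l) i / fact m * h ^ m)) \<le> h ^ Suc p * ?B"
  proof (rule flow_taylor[OF f h _ a(2) rb[OF t] _ B0])
    show "h < t" using tp by simp
    fix s :: real and c :: "nat \<Rightarrow> real" assume s: "0 \<le> s" "s \<le> h"
    let ?\<tau> = "t - s"
    have \<tau>: "\<delta> \<le> ?\<tau>" "0 < ?\<tau>" "?t' \<le> ?\<tau>" using s t \<delta> by auto
    have e: "exp (- ?\<tau>) \<le> ?e" "exp (- ?\<tau> / 2) \<le> ?e" using \<tau> tp by auto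
    have r0: "rho ?\<tau> \<ge> 0" using rho_pos[OF \<tau>(2)] by simp
    have rr: "rho t \<le> rho ?\<tau>" "rho ?\<tau> < b" using rho_antimono[OF \<tau>(2)] s rb[OF \<tau>(1)] by auto
    \<comment> \<open>The flow has speed at most R, so over a range of rho of length at most
      \<open>b\<close> the norm grows by at most R b; sg is at most 1.\<close>
    have X: "nrm d (?X s) \<le> ?N"
    proof -
      have "nrm d (?X s) = \<bar>sg ?\<tau>\<bar> * nrm d (w (rho ?\<tau>))" by (rule nrm_scale)
      also have "\<dots> \<le> 1 * nrm d (w (rho ?\<tau>))" using sg_pos[OF \<tau>(2)] by (intro mult_right_mono) (auto simp: sg_def)
      also have "nrm d (w (rho ?\<tau>)) \<le> nrm d (w (rho t)) + nrm d (\<lambda>l. w (rho ?\<tau>) l - w (rho t) l)"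
        using L2_set_triangle_ineq[of "w (rho t)" "\<lambda>l. w (rho ?\<tau>) l - w (rho t) l" "{..<d}"] by simp
      also have "nrm d (\<lambda>l. w (rho ?\<tau>) l - w (rho t) l) \<le> R * (rho ?\<tau> - rho t)"
        by (rule flow_speed[OF f]) (use a rr in auto)
      also have "\<dots> \<le> R * b" using rr a R_nonneg by (intro mult_left_mono) auto
      finally show ?thesis by (simp add: w0)
    qed
    have al: "\<bar>poly (alp (Suc p)) (rho ?\<tau>)\<bar> \<le> ?e * (Ca * (2 / \<delta>) ^ (p + 1))"
    proof -
      have "\<bar>poly (alp (Suc p)) (rho ?\<tau>)\<bar> \<le> Ca * (rho ?\<tau>)\<^sup>2 * (1 + (rho ?\<tau>)\<^sup>2) ^ p" by (rule Ca(2)[OF r0])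
      also have "\<dots> \<le> Ca * (2 / \<delta> * ?e) * (2 / \<delta>) ^ p"
      proof (intro mult_mono power_mono one_plus_rho_sq_le \<delta> \<tau> mult_nonneg_nonneg Ca(1) order_refl)
        have "(rho ?\<tau>)\<^sup>2 \<le> 2 / \<delta> * exp (- ?\<tau>)" by (rule rho_sq_le_exp[OF \<delta> \<tau>(1)])
        also have "\<dots> \<le> 2 / \<delta> * ?e" using e \<delta> by (intro mult_left_mono) auto
        finally show "(rho ?\<tau>)\<^sup>2 \<le> 2 / \<delta> * ?e" .
      qed (use \<delta> in auto)
      finally show ?thesis by (simp add: mult_ac)
    qed
    have k0: "0 \<le> sg ?\<tau> * poly kap (rho ?\<tau>)"
      using sg_pos[OF \<tau>(2)] poly_kap_pos[OF rho_pos[OF \<tau>(2)]] by simp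
    have "\<bar>poly (alp (Suc p)) (rho ?\<tau>)\<bar> * nrm d (?X s)
        + sg ?\<tau> * poly kap (rho ?\<tau>) * (R * Kb (eps (Suc p)) (2 * Suc p + 1) (rho ?\<tau>))
      \<le> ?e * (Ca * (2 / \<delta>) ^ (p + 1)) * ?N + ?e / \<delta> * ?KB"
    proof (intro add_mono mult_mono al X)
      show "sg ?\<tau> * poly kap (rho ?\<tau>) \<le> ?e / \<delta>"
        using sg_kap_le[OF \<delta> \<tau>(1)] e \<delta> by (meson divide_right_mono less_imp_le order_trans)
      show "Kb (eps (Suc p)) (2 * Suc p + 1) (rho ?\<tau>) \<le> Kb (eps (Suc p)) (2 * Suc p + 1) b"
        using r0 rr by (intro Kb_mono) auto
    qed (use R_nonneg Ca \<delta> r0 in \<open>auto intro!: mult_nonneg_nonneg Kb_nonneg\<close>)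
    also have "\<dots> = ?B" by (simp add: algebra_simps)
    finally have "(\<bar>poly (alp (Suc p)) (rho ?\<tau>)\<bar> * nrm d (?X s)
        + sg ?\<tau> * poly kap (rho ?\<tau>) * (R * Kb (eps (Suc p)) (2 * Suc p + 1) (rho ?\<tau>))) * nrm d c \<le> ?B * nrm d c"
      by (rule mult_right_mono) simp
    with dot_Vf_le[OF \<tau>(2), of c "Suc p" "?X s"]
    show "\<bar>\<Sum>i<d. c i * Vf (Suc p) ?\<tau> (?X s) i\<bar> \<le> ?B * nrm d c" by linarith
  qed
  then have main: "nrm d (\<lambda>i. sg ?t' * w (rho ?t') i - taylor_step d P p T h u v i) \<le> h ^ Suc p * ?B"
    unfolding X0 using taylor_step_eq[of T u _ p h v] tp tu
    by (subst nrm_cong[where y = "\<lambda>i. sg ?t' * w (rho ?t') i - (\<Sum>m<Suc p. Vf m t v i / fact m * h ^ m)"]) auto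
  have s': "sg ?t' > 0" by (rule sg_pos[OF tp(2)])
  have "nrm d (\<lambda>l. w (rho ?t') l - taylor_step d P p T h u v l / sg ?t')
    = nrm d (\<lambda>l. (1 / sg ?t') * (sg ?t' * w (rho ?t') l - taylor_step d P p T h u v l))"
    using s' by (intro nrm_cong) (simp add: field_simps)
  also have "\<dots> = 1 / sg ?t' * nrm d (\<lambda>i. sg ?t' * w (rho ?t') i - taylor_step d P p T h u v i)"
    using s' by (simp only: nrm_scale) simp
  also have "\<dots> \<le> 2 / \<delta> * (h ^ Suc p * ?B)"
    by (intro mult_mono main inv_sg_le \<delta> t) (use \<delta> in auto)
  also have "\<dots> = h * ?e * (h ^ p * Ca * (2 / \<delta>) ^ (p + 2)) * nrm d (\<lambda>l. v l / sg t)
     + h * ?e * (h ^ p * (Ca * (2 / \<delta>) ^ (p + 2) * (R * b) + 2 / \<delta>\<^sup>2 * ?KB))"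
    by (simp add: algebra_simps power2_eq_square add_divide_distrib)
  finally show ?thesis .
qed

end

section \<open>The global error\<close>

text \<open>The functions of q = (1 + R)^2/delta that a prefactor C exp(C q) absorbs. Closure under
  sums, products and powers spares tracking explicit constants.\<close>

definition pexp :: "(real \<Rightarrow> real) \<Rightarrow> bool" where
  "pexp f \<longleftrightarrow> (\<exists>C>0. \<forall>q\<ge>1. 0 \<le> f q \<and> f q \<le> C * exp (C * q))"

lemma pexp_const: assumes "c \<ge> 0" shows "pexp (\<lambda>_. c)"
  unfolding pexp_def
proof (intro exI[of _ "c + 1"] conjI allI impI)
  fix q :: real assume "q \<ge> 1"
  then have "1 \<le> exp ((c + 1) * q)" using assms by simp
  then have "(c + 1) * 1 \<le> (c + 1) * exp ((c + 1) * q)" using assms by (intro mult_left_mono) auto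
  then show "c \<le> (c + 1) * exp ((c + 1) * q)" by simp
qed (use assms in auto)

lemma pexp_id: "pexp (\<lambda>q. q)"
  unfolding pexp_def
proof (intro exI[of _ 1] conjI allI impI)
  fix q :: real assume "q \<ge> 1"
  have "q \<le> exp q" using exp_ge_add_one_self[of q] by linarith
  then show "q \<le> 1 * exp (1 * q)" by simp
qed auto

lemma pexp_exp: assumes "c \<ge> 0" shows "pexp (\<lambda>q. exp (c * q))"
  unfolding pexp_def
proof (intro exI[of _ "c + 1"] conjI allI impI)
  fix q :: real assume q: "q \<ge> 1"
  have "1 * exp (c * q) \<le> (c + 1) * exp ((c + 1) * q)"
    using assms q by (intro mult_mono) (auto intro!: mult_right_mono)
  then show "exp (c * q) \<le> (c + 1) * exp ((c + 1) * q)" by simp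
qed (use assms in auto)

lemma pexp_add: assumes "pexp f" "pexp g" shows "pexp (\<lambda>q. f q + g q)"
proof -
  obtain A where A: "A > 0" "\<And>q. q \<ge> 1 \<Longrightarrow> 0 \<le> f q \<and> f q \<le> A * exp (A * q)" using assms(1) unfolding pexp_def by blast
  obtain B where B: "B > 0" "\<And>q. q \<ge> 1 \<Longrightarrow> 0 \<le> g q \<and> g q \<le> B * exp (B * q)" using assms(2) unfolding pexp_def by blast
  show ?thesis
    unfolding pexp_def
  proof (intro exI[of _ "A + B"] conjI allI impI)
    fix q :: real assume q: "q \<ge> 1"
    have "A * exp (A * q) \<le> A * exp ((A + B) * q)" "B * exp (B * q) \<le> B * exp ((A + B) * q)"
      using A(1) B(1) q by (auto intro!: mult_left_mono mult_right_mono)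
    then show "f q + g q \<le> (A + B) * exp ((A + B) * q)"
      using A(2)[OF q] B(2)[OF q] by (simp add: distrib_right)
    show "0 \<le> f q + g q" using A(2)[OF q] B(2)[OF q] by simp
  qed (use A B in auto)
qed

lemma pexp_mult: assumes "pexp f" "pexp g" shows "pexp (\<lambda>q. f q * g q)"
proof -
  obtain A where A: "A > 0" "\<And>q. q \<ge> 1 \<Longrightarrow> 0 \<le> f q \<and> f q \<le> A * exp (A * q)" using assms(1) unfolding pexp_def by blast
  obtain B where B: "B > 0" "\<And>q. q \<ge> 1 \<Longrightarrow> 0 \<le> g q \<and> g q \<le> B * exp (B * q)" using assms(2) unfolding pexp_def by blast
  show ?thesis
    unfolding pexp_def
  proof (intro exI[of _ "A * B + A + B"] conjI allI impI)
    fix q :: real assume q: "q \<ge> 1"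
    have "f q * g q \<le> (A * exp (A * q)) * (B * exp (B * q))"
      using A(2)[OF q] B(2)[OF q] A(1) by (intro mult_mono) auto
    also have "\<dots> = (A * B) * exp ((A + B) * q)" by (simp add: distrib_right exp_add)
    also have "\<dots> \<le> (A * B + A + B) * exp ((A * B + A + B) * q)"
      using A(1) B(1) q by (intro mult_mono) (auto intro!: mult_right_mono)
    finally show "f q * g q \<le> (A * B + A + B) * exp ((A * B + A + B) * q)" .
    show "0 \<le> f q * g q" using A(2)[OF q] B(2)[OF q] by simp
  qed (use A B in \<open>auto intro!: add_pos_pos\<close>)
qed

lemma pexp_power: assumes "pexp f" shows "pexp (\<lambda>q. f q ^ n)"
  by (induction n) (auto intro: pexp_const pexp_mult[OF assms])

lemma nn_integral_coupling_marginals: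
  assumes \<gamma>: "\<gamma> \<in> couplings d \<mu> \<nu>" and f: "f \<in> borel_measurable (Rd d)"
  shows "(\<integral>\<^sup>+z. f (fst z) \<partial>\<gamma>) = (\<integral>\<^sup>+x. f x \<partial>\<mu>)" and "(\<integral>\<^sup>+z. f (snd z) \<partial>\<gamma>) = (\<integral>\<^sup>+x. f x \<partial>\<nu>)"
proof -
  have s: "sets \<gamma> = sets (Rd d \<Otimes>\<^sub>M Rd d)" and d: "distr \<gamma> (Rd d) fst = \<mu>" "distr \<gamma> (Rd d) snd = \<nu>"
    using \<gamma> by (auto simp: couplings_def)
  have "fst \<in> \<gamma> \<rightarrow>\<^sub>M Rd d" unfolding measurable_cong_sets[OF s refl] by (rule measurable_fst)
  from nn_integral_distr_on[OF this f] show "(\<integral>\<^sup>+z. f (fst z) \<partial>\<gamma>) = (\<integral>\<^sup>+x. f x \<partial>\<mu>)" by (simp add: d)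
  have "snd \<in> \<gamma> \<rightarrow>\<^sub>M Rd d" unfolding measurable_cong_sets[OF s refl] by (rule measurable_snd)
  from nn_integral_distr_on[OF this f] show "(\<integral>\<^sup>+z. f (snd z) \<partial>\<gamma>) = (\<integral>\<^sup>+x. f x \<partial>\<nu>)" by (simp add: d)
qed

lemma coupling_map:
  assumes \<gamma>: "\<gamma> \<in> couplings d \<mu> \<nu>" and f: "f \<in> Rd d \<rightarrow>\<^sub>M Rd d" and g: "g \<in> Rd d \<rightarrow>\<^sub>M Rd d"
    and H: "H \<in> borel_measurable (Rd d \<Otimes>\<^sub>M Rd d)"
  shows "distr \<gamma> (Rd d \<Otimes>\<^sub>M Rd d) (\<lambda>z. (f (fst z), g (snd z))) \<in> couplings d (distr \<mu> (Rd d) f) (distr \<nu> (Rd d) g)"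
    and "(\<integral>\<^sup>+z. H z \<partial>distr \<gamma> (Rd d \<Otimes>\<^sub>M Rd d) (\<lambda>z. (f (fst z), g (snd z)))) = (\<integral>\<^sup>+z. H (f (fst z), g (snd z)) \<partial>\<gamma>)"
proof -
  have s: "sets \<gamma> = sets (Rd d \<Otimes>\<^sub>M Rd d)" and d: "\<mu> = distr \<gamma> (Rd d) fst" "\<nu> = distr \<gamma> (Rd d) snd"
    using \<gamma> by (auto simp: couplings_def)
  have fs: "fst \<in> \<gamma> \<rightarrow>\<^sub>M Rd d" "snd \<in> \<gamma> \<rightarrow>\<^sub>M Rd d"
    by (simp_all add: measurable_cong_sets[OF s refl])
  have m: "(\<lambda>z. (f (fst z), g (snd z))) \<in> \<gamma> \<rightarrow>\<^sub>M Rd d \<Otimes>\<^sub>M Rd d"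
    by (intro measurable_Pair measurable_compose[OF fs(1) f] measurable_compose[OF fs(2) g])
  show "(\<integral>\<^sup>+z. H z \<partial>distr \<gamma> (Rd d \<Otimes>\<^sub>M Rd d) (\<lambda>z. (f (fst z), g (snd z)))) = (\<integral>\<^sup>+z. H (f (fst z), g (snd z)) \<partial>\<gamma>)"
    by (rule nn_integral_distr_on[OF m H])
  show "distr \<gamma> (Rd d \<Otimes>\<^sub>M Rd d) (\<lambda>z. (f (fst z), g (snd z))) \<in> couplings d (distr \<mu> (Rd d) f) (distr \<nu> (Rd d) g)"
    unfolding couplings_def d
    by (auto simp: distr_distr[OF measurable_fst m] distr_distr[OF measurable_snd m] distr_distr[OF f fs(1)] distr_distr[OF g fs(2)]
        comp_def)
qed

lemma measurable_scaled_cost: "(\<lambda>z. ennreal ((nrm d (\<lambda>i. A * fst z i - B * snd z i))\<^sup>2)) \<in> borel_measurable (Rd d \<Otimes>\<^sub>M Rd d)"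
  by (intro measurable_compose[OF _ measurable_ennreal] borel_measurable_power borel_measurable_nrm borel_measurable_diff
      borel_measurable_times borel_measurable_const measurable_compose[OF measurable_fst measurable_Rd_component]
      measurable_compose[OF measurable_snd measurable_Rd_component])

section \<open>Propagation of the error through the steps of the scheme\<close>

context ud_prior
begin

text \<open>Distance in w-coordinates between the rescaled noised law and the scheme, witnessed by a
  single coupling; optimal couplings are thereby avoided.\<close>

definition near :: "real \<Rightarrow> (nat \<Rightarrow> real) measure \<Rightarrow> real \<Rightarrow> bool" where
  "near t \<nu> c \<longleftrightarrow> (\<exists>\<gamma>\<in>couplings d (mu (rho t)) \<nu>.
     (\<integral>\<^sup>+z. ennreal ((nrm d (\<lambda>i. fst z i - snd z i / sg t))\<^sup>2) \<partial>\<gamma>) \<le> ennreal (c\<^sup>2))"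

text \<open>A triangle inequality in L2 through the exact flow from the point of the scheme:
  \<open>flow_contraction\<close> handles the distance of the first component to this flow,
  \<open>local_error\<close> that of the flow to the scheme. The local error grows with the point of
  the scheme, whose norm is bounded through the first component, whence M + c.\<close>

lemma macro_step:
  assumes \<delta>: "0 < \<delta>" "\<delta> \<le> 1" and h: "0 < h" and t: "\<delta> \<le> t - h" and tu: "t = T - u" and b: "b = rho \<delta> + 1"
    and Ca: "Ca \<ge> 0" "\<And>\<rho>. \<rho> \<ge> 0 \<Longrightarrow> \<bar>poly (alp (Suc p)) \<rho>\<bar> \<le> Ca * \<rho>\<^sup>2 * (1 + \<rho>\<^sup>2) ^ p"
    and \<alpha>: "\<alpha> = h ^ p * Ca * (2 / \<delta>) ^ (p + 2)"
    and \<beta>: "\<beta> = h ^ p * (Ca * (2 / \<delta>) ^ (p + 2) * (R * b) + 2 / \<delta>\<^sup>2 * (R * Kb (eps (Suc p)) (2 * Suc p + 1) b))"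
    and e: "e = h * exp (- (t - h) / 2)"
    and M: "M > 0" "(\<integral>\<^sup>+w. ennreal ((nrm d w)\<^sup>2) \<partial>mu (rho t)) \<le> ennreal (M\<^sup>2)"
    and \<nu>: "sets \<nu> = sets (Rd d)" and near: "near t \<nu> c" and c: "c > 0"
    and c': "c' > exp (2 * b * R\<^sup>2 * (rho (t - h) - rho t)) * c + e * \<alpha> * (M + c) + e * \<beta>"
  shows "near (t - h) (distr \<nu> (Rd d) (taylor_step d P p T h u)) c'"
proof -
  let ?\<Phi> = "taylor_step d P p T h u"
  let ?E = "exp (2 * b * R\<^sup>2 * (rho (t - h) - rho t))"
  \<comment> \<open>A third of the slack: one share for the contraction and one for each of the two
    parts of the local error.\<close>
  define \<eta> where "\<eta> = (c' - (?E * c + e * \<alpha> * (M + c) + e * \<beta>)) / 3"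
  have \<eta>: "\<eta> > 0" using c' by (simp add: \<eta>_def)
  have tp: "0 < t" "0 < t - h" "\<delta> \<le> t" using \<delta> h t by auto
  have st: "sg t > 0" by (rule sg_pos[OF tp(1)])
  have b0: "b > 0" using rho_pos[OF \<delta>(1)] b by simp
  have \<alpha>0: "\<alpha> \<ge> 0" unfolding \<alpha> using h Ca \<delta> by (intro mult_nonneg_nonneg zero_le_power) auto
  have \<beta>0: "\<beta> \<ge> 0" unfolding \<beta> using h Ca \<delta> R_nonneg b0
    by (intro mult_nonneg_nonneg add_nonneg_nonneg Kb_nonneg zero_le_power divide_nonneg_nonneg) auto
  have e0: "e \<ge> 0" unfolding e using h by simp
  have rb: "rho t > 0" "rho t \<le> rho (t - h)" "rho (t - h) < b"
    using rho_pos[OF tp(1)] rho_antimono[of "t - h" t] rho_antimono[OF \<delta>(1) t] tp h b by auto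
  \<comment> \<open>The lower end of the flow interval only has to be positive and strictly below
    \<open>rho t\<close>.\<close>
  have "\<exists>\<psi>. (\<forall>v. flow (\<psi> v) (rho t / 2) b \<and> \<psi> v (rho t) = (\<lambda>l. v l / sg t)) \<and>
    (\<forall>r\<in>{rho t..b}. \<forall>l<d. (\<lambda>v. \<psi> v r l) \<in> borel_measurable (Rd d))"
    by (rule flow_family) (use rb st in auto)
  then obtain \<psi> where "\<forall>v. flow (\<psi> v) (rho t / 2) b \<and> \<psi> v (rho t) = (\<lambda>l. v l / sg t)"
    and "\<forall>r\<in>{rho t..b}. \<forall>l<d. (\<lambda>v. \<psi> v r l) \<in> borel_measurable (Rd d)" by blast
  then have \<psi>: "\<And>v. flow (\<psi> v) (rho t / 2) b" "\<And>v. \<psi> v (rho t) = (\<lambda>l. v l / sg t)"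
      "\<And>r l. r \<in> {rho t..b} \<Longrightarrow> l < d \<Longrightarrow> (\<lambda>v. \<psi> v r l) \<in> borel_measurable (Rd d)"
    by blast+
  obtain \<gamma> where \<gamma>: "\<gamma> \<in> couplings d (mu (rho t)) \<nu>"
      "(\<integral>\<^sup>+z. ennreal ((nrm d (\<lambda>i. fst z i - snd z i / sg t))\<^sup>2) \<partial>\<gamma>) \<le> ennreal (c\<^sup>2)"
    using near unfolding near_def by blast
  have s\<gamma>: "sets \<gamma> = sets (Rd d \<Otimes>\<^sub>M Rd d)" using \<gamma>(1) by (simp add: couplings_def)
  have "\<exists>\<gamma>'\<in>couplings d (mu (rho (t - h))) \<nu>. (\<integral>\<^sup>+z. ennreal (flow_cost \<psi> (rho (t - h)) z) \<partial>\<gamma>') \<le> ennreal ((?E * c + \<eta>)\<^sup>2)"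
  proof (rule flow_contraction[OF \<psi>(1) _ _ rb(2,3) _ \<nu> \<gamma>(1)])
    show "(\<integral>\<^sup>+z. ennreal (flow_cost \<psi> (rho t) z) \<partial>\<gamma>) \<le> ennreal (c\<^sup>2)"
      using \<gamma>(2) by (simp add: flow_cost_def \<psi>(2))
    have "exp (2 * (2 * b * R\<^sup>2) * (rho (t - h) - rho t)) * c\<^sup>2 = (?E * c)\<^sup>2"
      by (simp add: power_mult_distrib mult.assoc flip: exp_double)
    also have "\<dots> < (?E * c + \<eta>)\<^sup>2" using c \<eta> by (intro power_strict_mono) auto
    finally show "exp (2 * (2 * b * R\<^sup>2) * (rho (t - h) - rho t)) * c\<^sup>2 < (?E * c + \<eta>)\<^sup>2" .
  qed (use rb \<psi>(3) in auto)
  then obtain \<gamma>1 where g1: "\<gamma>1 \<in> couplings d (mu (rho (t - h))) \<nu>"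
      "(\<integral>\<^sup>+z. ennreal (flow_cost \<psi> (rho (t - h)) z) \<partial>\<gamma>1) \<le> ennreal ((?E * c + \<eta>)\<^sup>2)" by blast
  have s1: "sets \<gamma>1 = sets (Rd d \<Otimes>\<^sub>M Rd d)" using g1(1) by (simp add: couplings_def)
  let ?n = "\<lambda>v. nrm d (\<lambda>l. v l / sg t)"
  let ?l = "\<lambda>v. e * \<alpha> * ?n v + e * \<beta>"
  have nm: "?n \<in> borel_measurable (Rd d)"
    by (intro borel_measurable_nrm borel_measurable_divide borel_measurable_const measurable_Rd_component)
  have lm: "(\<lambda>v. ennreal ((?l v)\<^sup>2)) \<in> borel_measurable (Rd d)"
    by (intro measurable_compose[OF _ measurable_ennreal] borel_measurable_power borel_measurable_add borel_measurable_times
        borel_measurable_const nm)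
  have local: "nrm d (\<lambda>l. \<psi> v (rho (t - h)) l - ?\<Phi> v l / sg (t - h)) \<le> ?l v" for v
    unfolding \<alpha> \<beta> e by (rule local_error[OF \<delta> h t tu \<psi>(1) _ _ b \<psi>(2) Ca]) (use rb in auto)
  have "(\<integral>\<^sup>+w. ennreal ((nrm d w)\<^sup>2) \<partial>mu (rho t)) = (\<integral>\<^sup>+z. ennreal ((nrm d (fst z))\<^sup>2) \<partial>\<gamma>)"
    by (rule nn_integral_coupling_marginals(1)[OF \<gamma>(1) nrm_sq_measurable, symmetric])
  then have w2: "(\<integral>\<^sup>+z. ennreal ((nrm d (fst z))\<^sup>2) \<partial>\<gamma>) \<le> ennreal (M\<^sup>2)" using M(2) by simp
  have wm: "(\<lambda>z. nrm d (fst z)) \<in> borel_measurable \<gamma>"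
    unfolding measurable_cong_sets[OF s\<gamma> refl] by (intro borel_measurable_nrm measurable_fst_component)
  have am: "(\<lambda>z. nrm d (\<lambda>i. fst z i - snd z i / sg t)) \<in> borel_measurable \<gamma>"
    unfolding measurable_cong_sets[OF s\<gamma> refl]
    by (intro borel_measurable_nrm borel_measurable_diff borel_measurable_divide borel_measurable_const measurable_fst_component measurable_snd_component)
  have vm: "(\<lambda>z. ?n (snd z)) \<in> borel_measurable \<gamma>"
    unfolding measurable_cong_sets[OF s\<gamma> refl] by (rule measurable_compose[OF measurable_snd nm])
  have "(\<integral>\<^sup>+z. ennreal ((?n (snd z))\<^sup>2) \<partial>\<gamma>) \<le> (\<integral>\<^sup>+z. ennreal ((nrm d (fst z) + nrm d (\<lambda>i. fst z i - snd z i / sg t))\<^sup>2) \<partial>\<gamma>)"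
  proof (intro nn_integral_mono ennreal_leI power_mono)
    fix z :: "(nat \<Rightarrow> real) \<times> (nat \<Rightarrow> real)"
    have "nrm d (\<lambda>i. snd z i / sg t - 0) \<le> nrm d (\<lambda>i. snd z i / sg t - fst z i) + nrm d (\<lambda>i. fst z i - 0)"
      by (rule nrm_triangle_diff)
    then show "?n (snd z) \<le> nrm d (fst z) + nrm d (\<lambda>i. fst z i - snd z i / sg t)"
      using nrm_diff_commute[of "\<lambda>i. snd z i / sg t" "fst z" d] by simp
  qed simp
  also have "\<dots> \<le> ennreal ((M + c)\<^sup>2)" by (rule nn_integral_minkowski[OF wm am M(1) w2 c \<gamma>(2)])
  finally have n2: "(\<integral>\<^sup>+z. ennreal ((?n (snd z))\<^sup>2) \<partial>\<gamma>) \<le> ennreal ((M + c)\<^sup>2)" .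
  have l2: "(\<integral>\<^sup>+z. ennreal ((?l (snd z))\<^sup>2) \<partial>\<gamma>) \<le> ennreal (((e * \<alpha> * (M + c) + \<eta>) + (e * \<beta> + \<eta>))\<^sup>2)"
  proof (rule nn_integral_minkowski)
    have ea: "e * \<alpha> \<ge> 0" using e0 \<alpha>0 by simp
    have "(\<integral>\<^sup>+z. ennreal ((e * \<alpha> * ?n (snd z))\<^sup>2) \<partial>\<gamma>) = ennreal ((e * \<alpha>)\<^sup>2) * (\<integral>\<^sup>+z. ennreal ((?n (snd z))\<^sup>2) \<partial>\<gamma>)"
      using vm by (subst nn_integral_cmult[symmetric]) (auto simp: power_mult_distrib ennreal_mult')
    also have "\<dots> \<le> ennreal ((e * \<alpha>)\<^sup>2) * ennreal ((M + c)\<^sup>2)" by (intro mult_left_mono n2) simp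
    also have "\<dots> = ennreal ((e * \<alpha> * (M + c))\<^sup>2)" by (simp add: power_mult_distrib ennreal_mult')
    also have "\<dots> \<le> ennreal ((e * \<alpha> * (M + c) + \<eta>)\<^sup>2)"
      using mult_nonneg_nonneg[OF ea, of "M + c"] M(1) c \<eta> by (intro ennreal_leI power_mono) auto
    finally show "(\<integral>\<^sup>+z. ennreal ((e * \<alpha> * ?n (snd z))\<^sup>2) \<partial>\<gamma>) \<le> ennreal ((e * \<alpha> * (M + c) + \<eta>)\<^sup>2)" .
    show "e * \<alpha> * (M + c) + \<eta> > 0" using mult_nonneg_nonneg[OF ea, of "M + c"] M(1) c \<eta> by (intro add_nonneg_pos) auto
    show "e * \<beta> + \<eta> > 0" using e0 \<beta>0 \<eta> by (intro add_nonneg_pos mult_nonneg_nonneg) auto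
    have "(\<integral>\<^sup>+z. 1 \<partial>\<gamma>) = (\<integral>\<^sup>+x. 1 \<partial>mu (rho t))"
      using nn_integral_coupling_marginals(1)[OF \<gamma>(1), of "\<lambda>_. 1"] by simp
    then have "emeasure \<gamma> (space \<gamma>) = 1" using prob_space.emeasure_space_1[OF prob_space_mu] by simp
    then have "(\<integral>\<^sup>+z. ennreal ((e * \<beta>)\<^sup>2) \<partial>\<gamma>) = ennreal ((e * \<beta>)\<^sup>2)" by simp
    also have "\<dots> \<le> ennreal ((e * \<beta> + \<eta>)\<^sup>2)" using e0 \<beta>0 \<eta> by (intro ennreal_leI power_mono) auto
    finally show "(\<integral>\<^sup>+z. ennreal ((e * \<beta>)\<^sup>2) \<partial>\<gamma>) \<le> ennreal ((e * \<beta> + \<eta>)\<^sup>2)" .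
  qed (use vm in auto)
  \<comment> \<open>The local error depends on the second component alone, whose law is the same
    under both couplings.\<close>
  have l21: "(\<integral>\<^sup>+z. ennreal ((?l (snd z))\<^sup>2) \<partial>\<gamma>1) \<le> ennreal (((e * \<alpha> * (M + c) + \<eta>) + (e * \<beta> + \<eta>))\<^sup>2)"
    using l2 unfolding nn_integral_coupling_marginals(2)[OF \<gamma>(1) lm] nn_integral_coupling_marginals(2)[OF g1(1) lm] .
  have \<Phi>m: "?\<Phi> \<in> Rd d \<rightarrow>\<^sub>M Rd d" by (rule measurable_taylor_step) (use tu tp in simp)
  have H: "(\<lambda>z. ennreal ((nrm d (\<lambda>i. fst z i - snd z i / sg (t - h)))\<^sup>2)) \<in> borel_measurable (Rd d \<Otimes>\<^sub>M Rd d)"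
    using measurable_scaled_cost[where d = d and A = 1 and B = "1 / sg (t - h)"] by simp
  let ?\<gamma>2 = "distr \<gamma>1 (Rd d \<Otimes>\<^sub>M Rd d) (\<lambda>z. (fst z, ?\<Phi> (snd z)))"
  note cm = coupling_map[OF g1(1) measurable_ident \<Phi>m H, unfolded id_def]
  have "distr (mu (rho (t - h))) (Rd d) (\<lambda>x. x) = mu (rho (t - h))" by (rule distr_id2) (simp add: sets_mu)
  then have c2: "?\<gamma>2 \<in> couplings d (mu (rho (t - h))) (distr \<nu> (Rd d) ?\<Phi>)" using cm(1) by simp
  have "(\<integral>\<^sup>+z. ennreal ((nrm d (\<lambda>i. fst z i - snd z i / sg (t - h)))\<^sup>2) \<partial>?\<gamma>2)
    = (\<integral>\<^sup>+z. ennreal ((nrm d (\<lambda>i. fst z i - ?\<Phi> (snd z) i / sg (t - h)))\<^sup>2) \<partial>\<gamma>1)"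
    using cm(2) by simp
  also have "\<dots> \<le> (\<integral>\<^sup>+z. ennreal ((nrm d (\<lambda>i. fst z i - \<psi> (snd z) (rho (t - h)) i) + ?l (snd z))\<^sup>2) \<partial>\<gamma>1)"
  proof (intro nn_integral_mono ennreal_leI power_mono)
    fix z :: "(nat \<Rightarrow> real) \<times> (nat \<Rightarrow> real)"
    show "nrm d (\<lambda>i. fst z i - ?\<Phi> (snd z) i / sg (t - h)) \<le> nrm d (\<lambda>i. fst z i - \<psi> (snd z) (rho (t - h)) i) + ?l (snd z)"
      using nrm_triangle_diff[where d = d and x = "fst z" and z = "\<lambda>i. ?\<Phi> (snd z) i / sg (t - h)" and y = "\<psi> (snd z) (rho (t - h))"]
        local[of "snd z"] by linarith
  qed simp
  also have "\<dots> \<le> ennreal (((?E * c + \<eta>) + ((e * \<alpha> * (M + c) + \<eta>) + (e * \<beta> + \<eta>)))\<^sup>2)"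
  proof (rule nn_integral_minkowski)
    show "(\<lambda>z. nrm d (\<lambda>i. fst z i - \<psi> (snd z) (rho (t - h)) i)) \<in> borel_measurable \<gamma>1"
      unfolding measurable_cong_sets[OF s1 refl]
      by (intro borel_measurable_nrm borel_measurable_diff measurable_fst_component measurable_compose[OF measurable_snd \<psi>(3)])
        (use rb in auto)
    show "(\<lambda>z. ?l (snd z)) \<in> borel_measurable \<gamma>1"
      unfolding measurable_cong_sets[OF s1 refl]
      by (intro borel_measurable_add borel_measurable_times borel_measurable_const measurable_compose[OF measurable_snd nm])
    show "?E * c + \<eta> > 0" using c \<eta> by (intro add_pos_pos mult_pos_pos) auto
    show "e * \<alpha> * (M + c) + \<eta> + (e * \<beta> + \<eta>) > 0"
      using e0 \<alpha>0 \<beta>0 M(1) c \<eta> by (intro add_nonneg_pos add_pos_pos mult_nonneg_nonneg) auto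
  qed (use g1(2) l21 in \<open>auto simp: flow_cost_def\<close>)
  also have "(?E * c + \<eta>) + ((e * \<alpha> * (M + c) + \<eta>) + (e * \<beta> + \<eta>)) = c'" unfolding \<eta>_def by argo
  finally show ?thesis unfolding near_def using c2 by blast
qed

end

context ud_prior
begin

lemma measurable_taylor_iterate:
  assumes "\<And>n. n < m \<Longrightarrow> T - real n * h > 0"
  shows "taylor_iterate d P p T h m \<in> std_gaussian d \<rightarrow>\<^sub>M Rd d"
  using assms
proof (induction m)
  case 0
  show ?case
    unfolding measurable_cong_sets[OF sets_std_gaussian refl] taylor_iterate.simps
    by (rule measurable_ident[unfolded id_def])
next
  case (Suc m)
  show ?case
    unfolding taylor_iterate.simps
    by (rule measurable_compose[OF Suc.IH measurable_taylor_step]) (use Suc.prems in auto)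
qed

lemma taylor_law_Suc:
  assumes "\<And>n. n < Suc m \<Longrightarrow> T - real n * h > 0"
  shows "taylor_law d P p T h (Suc m) = distr (taylor_law d P p T h m) (Rd d) (taylor_step d P p T h (real m * h))"
proof -
  have i: "taylor_iterate d P p T h m \<in> std_gaussian d \<rightarrow>\<^sub>M Rd d"
    by (rule measurable_taylor_iterate) (use assms in auto)
  have s: "taylor_step d P p T h (real m * h) \<in> Rd d \<rightarrow>\<^sub>M Rd d"
    by (rule measurable_taylor_step) (use assms in auto)
  show ?thesis
    unfolding taylor_law_def distr_distr[OF s i] by (rule arg_cong[where f = "distr _ _"]) (auto simp: fun_eq_iff)
qed

text \<open>Discrete Gronwall. The contraction exponents telescope in rho, while the multiplicative
  and additive local errors accumulate through \<open>S n\<close>, the sum of h exp(-(t - h)/2) over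
  the steps.\<close>

lemma near_taylor_law:
  assumes \<delta>: "0 < \<delta>" "\<delta> \<le> 1" and h: "0 < h" "T = \<delta> + real N * h" and b: "b = rho \<delta> + 1"
    and Ca: "Ca \<ge> 0" "\<And>\<rho>. \<rho> \<ge> 0 \<Longrightarrow> \<bar>poly (alp (Suc p)) \<rho>\<bar> \<le> Ca * \<rho>\<^sup>2 * (1 + \<rho>\<^sup>2) ^ p"
    and \<alpha>: "\<alpha> = h ^ p * Ca * (2 / \<delta>) ^ (p + 2)"
    and \<beta>: "\<beta> = h ^ p * (Ca * (2 / \<delta>) ^ (p + 2) * (R * b) + 2 / \<delta>\<^sup>2 * (R * Kb (eps (Suc p)) (2 * Suc p + 1) b))"
    and M: "M > 0" "\<And>t. \<delta> \<le> t \<Longrightarrow> t \<le> T \<Longrightarrow> (\<integral>\<^sup>+w. ennreal ((nrm d w)\<^sup>2) \<partial>mu (rho t)) \<le> ennreal (M\<^sup>2)"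
    and c0: "c0 = 2 * exp (- T / 2) * sqrt (R\<^sup>2 + d) / sg T"
    and S: "\<And>n. S n = (\<Sum>k<n. h * exp (- (T - real (Suc k) * h) / 2))"
    and n: "n \<le> N"
    and c': "c' > exp (2 * b * R\<^sup>2 * (rho (T - real n * h) - rho T) + \<alpha> * S n) * (c0 + (\<alpha> * M + \<beta>) * S n)"
  shows "near (T - real n * h) (taylor_law d P p T h n) c'"
  using n c'
proof (induction n arbitrary: c')
  case 0
  have T: "T > 0" using \<delta> h by (simp add: add_pos_nonneg)
  have "\<exists>\<gamma>\<in>couplings d (mu (rho T)) (std_gaussian d).
    (\<integral>\<^sup>+z. ennreal ((nrm d (\<lambda>i. fst z i - snd z i / sg T))\<^sup>2) \<partial>\<gamma>) \<le> ennreal ((2 * exp (- T / 2) * sqrt (R\<^sup>2 + d) / sg T + (c' - c0))\<^sup>2)"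
    by (rule initial_coupling[OF T]) (use 0 S in simp)
  moreover have "taylor_law d P p T h 0 = std_gaussian d"
    unfolding taylor_law_def taylor_iterate.simps by (rule distr_id2) (simp add: sets_std_gaussian)
  ultimately show ?case by (simp add: near_def c0)
next
  case (Suc n)
  define t where "t = T - real n * h"
  have t': "T - real (Suc n) * h = t - h" by (simp add: t_def algebra_simps)
  have "real (Suc n) * h \<le> real N * h" using Suc.prems(1) h(1) by (intro mult_right_mono) auto
  then have th: "\<delta> \<le> t - h" using h(2) by (simp add: t_def algebra_simps)
  have tT: "t \<le> T" using h(1) by (simp add: t_def)
  have pos: "T - real k * h > 0" if "k < Suc n" for k
  proof -
    have "real k * h \<le> real n * h" using that h(1) by (intro mult_right_mono) auto
    then show ?thesis using th \<delta> h(1) unfolding t_def by linarith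
  qed
  define e where "e = h * exp (- (t - h) / 2)"
  define E where "E = exp (2 * b * R\<^sup>2 * (rho (t - h) - rho t))"
  define \<kappa> where "\<kappa> = \<alpha> * M + \<beta>"
  define A where "A = 2 * b * R\<^sup>2 * (rho t - rho T) + \<alpha> * S n"
  define X where "X = exp A * (c0 + \<kappa> * S n)"
  define Y where "Y = (E + e * \<alpha>) * X + e * \<kappa>"
  have b0: "b > 0" using rho_pos[OF \<delta>(1)] b by simp
  have \<alpha>0: "\<alpha> \<ge> 0" unfolding \<alpha> using h Ca \<delta> by (intro mult_nonneg_nonneg zero_le_power) auto
  have \<beta>0: "\<beta> \<ge> 0" unfolding \<beta> using h Ca \<delta> R_nonneg b0
    by (intro mult_nonneg_nonneg add_nonneg_nonneg Kb_nonneg zero_le_power divide_nonneg_nonneg) auto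
  have \<kappa>0: "\<kappa> \<ge> 0" unfolding \<kappa>_def using \<alpha>0 \<beta>0 M(1) by simp
  have e0: "e \<ge> 0" unfolding e_def using h by simp
  have S0: "S n \<ge> 0" unfolding S using h by (intro sum_nonneg) simp
  have T0: "T > 0" using tT th \<delta> h by linarith
  have c00: "c0 \<ge> 0" unfolding c0 using sg_pos[OF T0] by simp
  have X0: "X \<ge> 0" unfolding X_def using c00 \<kappa>0 S0 by simp
  have rr: "rho t \<le> rho (t - h)" "rho T \<le> rho t" using th \<delta> h tT by (auto intro!: rho_antimono)
  then have A0: "A \<ge> 0" unfolding A_def using b0 \<alpha>0 S0 by simp
  have E1: "E \<ge> 1" unfolding E_def using rr b0 by simp
  have SS: "S (Suc n) = S n + e" unfolding S e_def t'[symmetric] by simp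
  have AE: "exp (2 * b * R\<^sup>2 * (rho (t - h) - rho T) + \<alpha> * S (Suc n)) = E * exp (e * \<alpha>) * exp A"
    unfolding E_def A_def SS exp_add[symmetric] by (simp add: algebra_simps)
  have "E + e * \<alpha> \<le> E * (1 + e * \<alpha>)" using mult_right_mono[OF E1, of "e * \<alpha>"] e0 \<alpha>0 by (simp add: algebra_simps)
  also have "\<dots> \<le> E * exp (e * \<alpha>)" using E1 by (intro mult_left_mono exp_ge_add_one_self) auto
  finally have le: "E + e * \<alpha> \<le> E * exp (e * \<alpha>)" .
  have ge1: "1 \<le> E * exp (e * \<alpha>) * exp A"
    using E1 e0 \<alpha>0 A0 mult_mono[of 1 E 1 "exp (e * \<alpha>)"] mult_mono[of 1 "E * exp (e * \<alpha>)" 1 "exp A"] by simp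
  have "Y \<le> (E * exp (e * \<alpha>)) * X + (E * exp (e * \<alpha>) * exp A) * (e * \<kappa>)"
    unfolding Y_def using le X0 mult_right_mono[OF ge1, of "e * \<kappa>"] e0 \<kappa>0 by (intro add_mono mult_right_mono) auto
  also have "\<dots> = (E * exp (e * \<alpha>) * exp A) * (c0 + \<kappa> * S (Suc n))" by (simp add: X_def SS algebra_simps)
  also have "\<dots> < c'" using Suc.prems(2) unfolding t' AE \<kappa>_def .
  finally have Y: "Y < c'" .
  \<comment> \<open>A bound for the previous step strictly above \<open>X\<close>; the factor E + e
    alpha turns its excess into half of the slack c' - Y.\<close>
  define c where "c = X + (c' - Y) / (2 * (E + e * \<alpha>))"
  have Ep: "E + e * \<alpha> > 0" using E1 e0 \<alpha>0 by (intro add_pos_nonneg) auto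
  have cX: "c > X" using Y Ep by (simp add: c_def)
  have "near t (taylor_law d P p T h n) c"
    unfolding t_def by (rule Suc.IH) (use Suc.prems(1) cX in \<open>auto simp: X_def A_def \<kappa>_def t_def\<close>)
  moreover have "c' > E * c + e * \<alpha> * (M + c) + e * \<beta>"
  proof -
    have "E * c + e * \<alpha> * (M + c) + e * \<beta> = (E + e * \<alpha>) * c + e * \<kappa>" by (simp add: \<kappa>_def algebra_simps)
    also have "(E + e * \<alpha>) * c = (E + e * \<alpha>) * X + (c' - Y) / 2"
    proof -
      have "K * (X + r / (2 * K)) = K * X + r / 2" if "K > 0" for K r :: real using that by (simp add: field_simps)
      from this[OF Ep] show ?thesis unfolding c_def .
    qed
    also have "(E + e * \<alpha>) * X + (c' - Y) / 2 + e * \<kappa> = (Y + c') / 2"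
      unfolding Y_def by argo
    also have "\<dots> < c'" using Y by simp
    finally show ?thesis .
  qed
  ultimately have nr: "near t (taylor_law d P p T h n) c"
    and lt: "c' > E * c + e * \<alpha> * (M + c) + e * \<beta>" by blast+
  have law: "taylor_law d P p T h (Suc n) = distr (taylor_law d P p T h n) (Rd d) (taylor_step d P p T h (real n * h))"
    by (rule taylor_law_Suc) (rule pos)
  show ?case
    unfolding t' law
  proof (rule macro_step[OF \<delta> h(1) th t_def b Ca \<alpha> \<beta> e_def M(1) M(2) _ nr _ lt[unfolded E_def]])
    show "\<delta> \<le> t" using th h(1) by simp
  qed (use tT X0 cX in \<open>auto simp: taylor_law_def\<close>)
qed

text \<open>Returning to x multiplies distances by sg, which is at most 1.\<close>

lemma W2_le_near:
  assumes \<delta>: "0 < \<delta>" and near: "near \<delta> \<nu> c" and \<nu>: "sets \<nu> = sets (Rd d)" and c: "c \<ge> 0"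
  shows "W2 d (noised_law d P \<delta>) \<nu> \<le> ennreal c"
proof -
  obtain \<gamma> where \<gamma>: "\<gamma> \<in> couplings d (mu (rho \<delta>)) \<nu>"
    "(\<integral>\<^sup>+z. ennreal ((nrm d (\<lambda>i. fst z i - snd z i / sg \<delta>))\<^sup>2) \<partial>\<gamma>) \<le> ennreal (c\<^sup>2)"
    using near unfolding near_def by blast
  have s: "sg \<delta> > 0" "sg \<delta> \<le> 1" using sg_pos[OF \<delta>] by (simp_all add: sg_def)
  have H: "(\<lambda>z. ennreal ((dist_d d (fst z) (snd z))\<^sup>2)) \<in> borel_measurable (Rd d \<Otimes>\<^sub>M Rd d)"
    using measurable_scaled_cost[where d = d and A = 1 and B = 1] by (simp add: dist_d_def)
  note cm = coupling_map[OF \<gamma>(1) measurable_scale[of "sg \<delta>"] measurable_ident H, unfolded id_def]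
  let ?\<gamma> = "distr \<gamma> (Rd d \<Otimes>\<^sub>M Rd d) (\<lambda>z. (\<lambda>i\<in>{..<d}. sg \<delta> * fst z i, snd z))"
  have "distr \<nu> (Rd d) (\<lambda>x. x) = \<nu>" by (rule distr_id2[OF \<nu>[symmetric]])
  then have mem: "?\<gamma> \<in> couplings d (noised_law d P \<delta>) \<nu>" using cm(1) noised_law_eq_mu[OF \<delta>] by simp
  have "(\<integral>\<^sup>+z. ennreal ((dist_d d (fst z) (snd z))\<^sup>2) \<partial>?\<gamma>)
    = (\<integral>\<^sup>+z. ennreal ((dist_d d (\<lambda>i\<in>{..<d}. sg \<delta> * fst z i) (snd z))\<^sup>2) \<partial>\<gamma>)" using cm(2) by simp
  also have "\<dots> \<le> (\<integral>\<^sup>+z. ennreal ((nrm d (\<lambda>i. fst z i - snd z i / sg \<delta>))\<^sup>2) \<partial>\<gamma>)"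
  proof (intro nn_integral_mono ennreal_leI power_mono)
    fix z :: "(nat \<Rightarrow> real) \<times> (nat \<Rightarrow> real)"
    have "dist_d d (\<lambda>i\<in>{..<d}. sg \<delta> * fst z i) (snd z) = nrm d (\<lambda>i. sg \<delta> * (fst z i - snd z i / sg \<delta>))"
      unfolding dist_d_def using s by (intro nrm_cong) (simp add: right_diff_distrib)
    also have "\<dots> = sg \<delta> * nrm d (\<lambda>i. fst z i - snd z i / sg \<delta>)" using s by (simp add: nrm_scale)
    also have "\<dots> \<le> nrm d (\<lambda>i. fst z i - snd z i / sg \<delta>)" using s by (intro mult_left_le_one_le) auto
    finally show "dist_d d (\<lambda>i\<in>{..<d}. sg \<delta> * fst z i) (snd z) \<le> nrm d (\<lambda>i. fst z i - snd z i / sg \<delta>)" .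
  qed (simp add: dist_d_def)
  also note \<gamma>(2)
  finally have "(INF \<gamma>\<in>couplings d (noised_law d P \<delta>) \<nu>. \<integral>\<^sup>+z. ennreal ((dist_d d (fst z) (snd z))\<^sup>2) \<partial>\<gamma>) \<le> ennreal (c\<^sup>2)" (is "?I \<le> _")
    by (rule INF_lower2[OF mem])
  moreover from this have "?I < \<infinity>" by (rule order.strict_trans1) simp
  ultimately have "sqrt (enn2real ?I) \<le> c" using c by (auto intro!: real_le_lsqrt enn2real_leI)
  then show ?thesis using \<open>?I < \<infinity>\<close> by (auto simp: W2_def sqrt_ennreal_def intro!: ennreal_leI)
qed

text \<open>A geometric sum bounded uniformly in T: since exp(-h/2) <= 1 - h/4 for h <= 1, the
  decrease of the constant 4 pays exactly for the new summand.\<close>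

lemma step_sum_le:
  assumes "0 < h" "h \<le> 1"
  shows "(\<Sum>k<n. h * exp (- (T - real (Suc k) * h) / 2)) \<le> 4 * exp (- (T - real n * h) / 2)"
proof (induction n)
  case (Suc n)
  let ?y = "exp (- (T - real (Suc n) * h) / 2)"
  have "exp (- (T - real n * h) / 2) = exp (- h / 2) * ?y" unfolding exp_add[symmetric] by (simp add: field_simps)
  also have "\<dots> \<le> (1 - h / 4) * ?y"
  proof (intro mult_right_mono)
    have "1 \<le> (1 + h / 2) * (1 - h / 4)" using assms mult_left_mono[of h 1 h] by (simp add: algebra_simps)
    also have "\<dots> \<le> exp (h / 2) * (1 - h / 4)" using assms by (intro mult_right_mono) auto
    finally show "exp (- h / 2) \<le> 1 - h / 4" by (simp add: exp_minus field_simps)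
  qed simp
  finally show ?case using Suc by (simp add: left_diff_distrib)
qed simp

lemma W2_taylor_law_le:
  assumes \<delta>: "0 < \<delta>" "\<delta> \<le> 1" and h: "0 < h" "h \<le> 1" "T = \<delta> + real N * h" and b: "b = rho \<delta> + 1"
    and Ca: "Ca \<ge> 0" "\<And>\<rho>. \<rho> \<ge> 0 \<Longrightarrow> \<bar>poly (alp (Suc p)) \<rho>\<bar> \<le> Ca * \<rho>\<^sup>2 * (1 + \<rho>\<^sup>2) ^ p"
    and \<alpha>: "\<alpha> = h ^ p * Ca * (2 / \<delta>) ^ (p + 2)"
    and \<beta>: "\<beta> = h ^ p * (Ca * (2 / \<delta>) ^ (p + 2) * (R * b) + 2 / \<delta>\<^sup>2 * (R * Kb (eps (Suc p)) (2 * Suc p + 1) b))"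
    and M: "M > 0" "\<And>t. \<delta> \<le> t \<Longrightarrow> t \<le> T \<Longrightarrow> (\<integral>\<^sup>+w. ennreal ((nrm d w)\<^sup>2) \<partial>mu (rho t)) \<le> ennreal (M\<^sup>2)"
  shows "W2 d (noised_law d P \<delta>) (taylor_law d P p T h N)
    \<le> ennreal (exp (2 * b\<^sup>2 * R\<^sup>2 + 4 * \<alpha>) * (4 / \<delta> * (exp (- T / 2) * sqrt (R\<^sup>2 + d)) + 4 * (\<alpha> * M + \<beta>)))"
proof (rule ennreal_le_epsilon)
  fix \<eta> :: real assume \<eta>: "\<eta> > 0"
  let ?B = "exp (2 * b\<^sup>2 * R\<^sup>2 + 4 * \<alpha>) * (4 / \<delta> * (exp (- T / 2) * sqrt (R\<^sup>2 + d)) + 4 * (\<alpha> * M + \<beta>))"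
  define S where "S = (\<lambda>n. \<Sum>k<n. h * exp (- (T - real (Suc k) * h) / 2))"
  define c0 where "c0 = 2 * exp (- T / 2) * sqrt (R\<^sup>2 + d) / sg T"
  have \<delta>T: "\<delta> \<le> T" using h by simp
  have TN: "T - real N * h = \<delta>" using h by simp
  have "S N \<le> 4 * exp (- \<delta> / 2)" using step_sum_le[OF h(1,2), of T N] unfolding TN S_def .
  also have "\<dots> \<le> 4" using \<delta> by simp
  finally have S4: "S N \<le> 4" .
  have S0: "S N \<ge> 0" unfolding S_def using h by (intro sum_nonneg) simp
  have b0: "b > 0" using rho_pos[OF \<delta>(1)] b by simp
  have \<alpha>0: "\<alpha> \<ge> 0" unfolding \<alpha> using h Ca \<delta> by (intro mult_nonneg_nonneg zero_le_power) auto
  have \<beta>0: "\<beta> \<ge> 0" unfolding \<beta> using h Ca \<delta> R_nonneg b0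
    by (intro mult_nonneg_nonneg add_nonneg_nonneg Kb_nonneg zero_le_power divide_nonneg_nonneg) auto
  have sT: "sg T > 0" using \<delta> \<delta>T by (intro sg_pos) auto
  have "c0 = 2 * (exp (- T / 2) * sqrt (R\<^sup>2 + d)) * (1 / sg T)" by (simp add: c0_def)
  also have "\<dots> \<le> 2 * (exp (- T / 2) * sqrt (R\<^sup>2 + d)) * (2 / \<delta>)"
    by (intro mult_left_mono inv_sg_le[OF \<delta> \<delta>T]) auto
  finally have c0: "c0 \<le> 4 / \<delta> * (exp (- T / 2) * sqrt (R\<^sup>2 + d))" by simp
  have c00: "c0 \<ge> 0" unfolding c0_def using sT by simp
  have "exp (2 * b * R\<^sup>2 * (rho (T - real N * h) - rho T) + \<alpha> * S N) * (c0 + (\<alpha> * M + \<beta>) * S N) \<le> ?B"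
  proof (intro mult_mono)
    have "rho \<delta> - rho T \<le> b" using rho_pos[of T] \<delta> \<delta>T by (simp add: b)
    then have "2 * b * R\<^sup>2 * (rho \<delta> - rho T) \<le> 2 * b * R\<^sup>2 * b" using b0 by (intro mult_left_mono) auto
    also have "\<dots> = 2 * b\<^sup>2 * R\<^sup>2" by (simp add: power2_eq_square)
    finally show "exp (2 * b * R\<^sup>2 * (rho (T - real N * h) - rho T) + \<alpha> * S N) \<le> exp (2 * b\<^sup>2 * R\<^sup>2 + 4 * \<alpha>)"
      unfolding TN using mult_left_mono[OF S4 \<alpha>0] by simp
    show "c0 + (\<alpha> * M + \<beta>) * S N \<le> 4 / \<delta> * (exp (- T / 2) * sqrt (R\<^sup>2 + d)) + 4 * (\<alpha> * M + \<beta>)"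
      using c0 mult_left_mono[OF S4, of "\<alpha> * M + \<beta>"] \<alpha>0 \<beta>0 M(1) by simp
    show "0 \<le> c0 + (\<alpha> * M + \<beta>) * S N" using c00 \<alpha>0 \<beta>0 M(1) S0 by simp
  qed simp
  then have lt: "exp (2 * b * R\<^sup>2 * (rho (T - real N * h) - rho T) + \<alpha> * S N) * (c0 + (\<alpha> * M + \<beta>) * S N) < ?B + \<eta>"
    using \<eta> by linarith
  have B0: "?B \<ge> 0" using \<alpha>0 \<beta>0 M(1) \<delta> by (intro mult_nonneg_nonneg add_nonneg_nonneg) auto
  have "near (T - real N * h) (taylor_law d P p T h N) (?B + \<eta>)"
    by (rule near_taylor_law[where S = S and n = N, OF \<delta> h(1,3) b Ca \<alpha> \<beta> M c0_def _ order_refl lt]) (simp_all add: S_def)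
  then have "W2 d (noised_law d P \<delta>) (taylor_law d P p T h N) \<le> ennreal (?B + \<eta>)"
    unfolding TN using B0 \<eta> by (intro W2_le_near \<delta>(1)) (auto simp: taylor_law_def)
  then show "W2 d (noised_law d P \<delta>) (taylor_law d P p T h N) \<le> ennreal ?B + ennreal \<eta>"
    using B0 \<eta> by simp
qed

end

section \<open>Constants as functions of (1 + R)^2/delta\<close>

text \<open>Dominates \<open>Kb\<close> at rho = b, using 1 + R^2 <= q, 1 + b <= 3 q and b^2 R^2/2
  <= 2 q.\<close>

definition Kq :: "ex \<Rightarrow> nat \<Rightarrow> real \<Rightarrow> real \<Rightarrow> real" where
  "Kq e n D q = cst e * (q * (3 * q)) ^ dg e * ((2 * real (dg e)) ^ dg e * exp (1/2)) * (D * exp (2 * q)) ^ n"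

text \<open>All constants of the global bound written in q alone, so that \<open>pexp\<close> turns
  them into C exp(C q).\<close>

definition prefactor :: "real \<Rightarrow> nat \<Rightarrow> real \<Rightarrow> real \<Rightarrow> real" where
  "prefactor Ca p D q = exp ((8 + 4 * (Ca * 2 ^ (p + 2))) * q) * (4 * q + 4 * (Ca * (2 * q) ^ (p + 3) +
     (Ca * (2 * q) ^ (p + 2) * (q * (2 * q)) + 2 * q\<^sup>2 * (q * Kq (eps (Suc p)) (2 * Suc p + 1) D q))))"

lemma pexp_prefactor: assumes "Ca \<ge> 0" "D \<ge> 0" shows "pexp (prefactor Ca p D)"
  unfolding prefactor_def Kq_def
  by (intro pexp_add pexp_mult pexp_power pexp_const pexp_id pexp_exp) (use assms cst_nonneg in auto)

context ud_prior
begin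

lemma W2_prefactor:
  assumes p: "p \<ge> 1" and \<delta>: "0 < \<delta>" "\<delta> \<le> 1" and h: "0 < h" "T = \<delta> + real N * h"
    and small: "h * ((1 + R) / \<delta>)\<^sup>2 \<le> 1"
    and Ca: "Ca \<ge> 0" "\<And>\<rho>. \<rho> \<ge> 0 \<Longrightarrow> \<bar>poly (alp (Suc p)) \<rho>\<bar> \<le> Ca * \<rho>\<^sup>2 * (1 + \<rho>\<^sup>2) ^ p"
  shows "W2 d (noised_law d P \<delta>) (taylor_law d P p T h N) \<le> ennreal (prefactor Ca p D ((1 + R)\<^sup>2 / \<delta>) *
    (exp (- T / 2) * sqrt (R\<^sup>2 + d) + h ^ p * (moment_sup d P \<delta> T / \<delta> ^ (p + 1) + ((1 + R) / \<delta>) ^ (2 * p + 1))))"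
proof -
  define q where "q = (1 + R)\<^sup>2 / \<delta>"
  define m where "m = moment_sup d P \<delta> T"
  define b where "b = rho \<delta> + 1"
  define \<alpha> where "\<alpha> = h ^ p * Ca * (2 / \<delta>) ^ (p + 2)"
  define K where "K = Kb (eps (Suc p)) (2 * Suc p + 1) b"
  define \<beta> where "\<beta> = h ^ p * (Ca * (2 / \<delta>) ^ (p + 2) * (R * b) + 2 / \<delta>\<^sup>2 * (R * K))"
  define W where "W = m / \<delta> ^ (p + 1) + ((1 + R) / \<delta>) ^ (2 * p + 1)"
  define G where "G = Ca * (2 * q) ^ (p + 3) + (Ca * (2 * q) ^ (p + 2) * (q * (2 * q)) + 2 * q\<^sup>2 * (q * Kq (eps (Suc p)) (2 * Suc p + 1) D q))"
  define x where "x = exp (- T / 2) * sqrt (R\<^sup>2 + d)"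
  have R: "R \<ge> 0" by (rule R_nonneg)
  have R1: "(1 + R)\<^sup>2 \<ge> 1" using R power_mono[of 1 "1 + R" 2] by simp
  have q\<delta>: "1 / \<delta> \<le> q" unfolding q_def using R1 \<delta> by (intro divide_right_mono) auto
  have qR: "(1 + R)\<^sup>2 \<le> q" unfolding q_def using \<delta> R1 mult_left_mono[of \<delta> 1 "(1 + R)\<^sup>2"] by (simp add: field_simps)
  have q1: "q \<ge> 1" using qR R1 by simp
  have "(1 + R)\<^sup>2 = 1 + R\<^sup>2 + 2 * R" by (simp add: power2_sum)
  then have Rq: "R \<le> q" "1 + R\<^sup>2 \<le> q" using qR R zero_le_power2[of R] by linarith+
  have rp: "rho \<delta> > 0" by (rule rho_pos[OF \<delta>(1)])
  have rs: "(rho \<delta>)\<^sup>2 \<le> 1 / \<delta>" by (rule rho_sq_le[OF \<delta> order_refl])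
  have "(rho \<delta>)\<^sup>2 \<le> q * 1" using rs q\<delta> by simp
  also have "\<dots> \<le> q * q" using q1 by (intro mult_left_mono) auto
  finally have "(rho \<delta>)\<^sup>2 \<le> q\<^sup>2" by (simp only: power2_eq_square)
  then have "rho \<delta> \<le> q" by (rule power2_le_imp_le) (use q1 in simp)
  then have b: "0 < b" "b \<le> 2 * q" "1 + b \<le> 3 * q" using rp q1 by (auto simp: b_def)
  have "b\<^sup>2 \<le> 2 * (rho \<delta>)\<^sup>2 + 2" using sum_squares_bound[of "rho \<delta>" 1] by (simp add: b_def power2_sum)
  also have "\<dots> \<le> 4 / \<delta>" using rs \<delta> mult_left_mono[of 1 "1 / \<delta>" 2] by simp
  finally have "b\<^sup>2 * R\<^sup>2 \<le> 4 / \<delta> * (1 + R)\<^sup>2" using R \<delta> by (intro mult_mono power_mono) auto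
  then have b2: "b\<^sup>2 * R\<^sup>2 \<le> 4 * q" by (simp add: q_def)
  \<comment> \<open>The step size condition enters here, through 1 + R >= 1.\<close>
  have hd: "h \<le> \<delta>\<^sup>2"
  proof -
    have "h * (1 / \<delta>)\<^sup>2 \<le> h * ((1 + R) / \<delta>)\<^sup>2" using h \<delta> R by (intro mult_left_mono power_mono divide_right_mono) auto
    then show ?thesis using small \<delta> by (simp add: power_divide divide_simps split: if_splits)
  qed
  have h1: "h \<le> 1" using hd \<delta> power_le_one[of \<delta> 2] by linarith
  have m0: "m \<ge> 0"
  proof -
    have "0 \<le> sqrt (\<integral>x. (nrm d x)\<^sup>2 \<partial>noised_law d P \<delta>)" by (auto intro!: Bochner_Integration.integral_nonneg)
    also have "\<dots> \<le> m" unfolding m_def using \<delta> h by (intro moment_sup_ge) auto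
    finally show ?thesis .
  qed
  \<comment> \<open>m + 1 in place of m, because the second moment bound has to be strictly
    positive; the extra 1 is absorbed by the power of Lambda in \<open>W1\<close>.\<close>
  have M: "2 / \<delta> * (m + 1) > 0" using \<delta> m0 by simp
  have M2: "(\<integral>\<^sup>+w. ennreal ((nrm d w)\<^sup>2) \<partial>mu (rho t)) \<le> ennreal ((2 / \<delta> * (m + 1))\<^sup>2)" if "\<delta> \<le> t" "t \<le> T" for t
  proof -
    have "(\<integral>\<^sup>+w. ennreal ((nrm d w)\<^sup>2) \<partial>mu (rho t)) \<le> ennreal ((2 / \<delta> * m)\<^sup>2)"
      unfolding m_def by (rule mu_second_moment[OF \<delta> that])
    also have "\<dots> \<le> ennreal ((2 / \<delta> * (m + 1))\<^sup>2)" using \<delta> m0 by (intro ennreal_leI power_mono mult_left_mono) auto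
    finally show ?thesis .
  qed
  have d2: "2 / \<delta> \<le> 2 * q" using q\<delta> mult_left_mono[of "1 / \<delta>" q 2] by simp
  \<comment> \<open>The Gronwall exponent must stay linear in q: h <= delta^2 and p >= 1 give h^p /
    delta^(p + 2) <= 1/delta.\<close>
  have \<alpha>q: "\<alpha> \<le> Ca * 2 ^ (p + 2) * q"
  proof -
    have "h ^ p \<le> (\<delta>\<^sup>2) ^ p" using hd h by (intro power_mono) auto
    also have "\<dots> = \<delta> ^ (2 * p)" by (simp add: power_mult)
    also have "\<dots> \<le> \<delta> ^ (p + 1)" using p \<delta> by (intro power_decreasing) auto
    finally have "h ^ p / \<delta> ^ (p + 2) \<le> \<delta> ^ (p + 1) / \<delta> ^ (p + 2)" using \<delta> by (intro divide_right_mono) auto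
    also have "\<dots> = 1 / \<delta>" using \<delta> by simp
    finally have *: "h ^ p / \<delta> ^ (p + 2) \<le> q" using q\<delta> by simp
    have "\<alpha> = Ca * 2 ^ (p + 2) * (h ^ p / \<delta> ^ (p + 2))" by (simp add: \<alpha>_def power_divide)
    also have "\<dots> \<le> Ca * 2 ^ (p + 2) * q" using * Ca by (intro mult_left_mono) auto
    finally show ?thesis .
  qed
  have K0: "K \<ge> 0" unfolding K_def using b by (intro Kb_nonneg) simp
  have Kq: "K \<le> Kq (eps (Suc p)) (2 * Suc p + 1) D q"
    unfolding K_def Kb_def Kq_def
  proof (intro mult_mono power_mono order_refl)
    show "exp (b\<^sup>2 / 2 * R\<^sup>2) \<le> exp (2 * q)" using b2 by simp
  qed (use Rq b R q1 D_ge_1 in \<open>auto intro!: mult_nonneg_nonneg zero_le_power cst_nonneg add_nonneg_nonneg\<close>)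
  have G0: "G \<ge> 0" unfolding G_def using Ca q1 K0 Kq by (intro add_nonneg_nonneg mult_nonneg_nonneg) auto
  have W1: "m + 1 \<le> W"
  proof -
    have "\<delta> ^ (p + 1) \<le> 1" using \<delta> by (intro power_le_one) auto
    then have "m \<le> m / \<delta> ^ (p + 1)" using m0 \<delta> mult_left_mono[of "\<delta> ^ (p + 1)" 1 m] by (simp add: field_simps)
    moreover have "1 \<le> ((1 + R) / \<delta>) ^ (2 * p + 1)" using R \<delta> by (intro one_le_power) (simp add: field_simps)
    ultimately show ?thesis unfolding W_def by linarith
  qed
  have "\<alpha> * (2 / \<delta> * (m + 1)) + \<beta> = h ^ p * (Ca * (2 / \<delta>) ^ (p + 3) * (m + 1) + (Ca * (2 / \<delta>) ^ (p + 2) * (R * b) + 2 * (1 / \<delta>)\<^sup>2 * (R * K)) * 1)"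
    by (simp add: \<alpha>_def \<beta>_def eval_nat_numeral algebra_simps)
  also have "\<dots> \<le> h ^ p * (Ca * (2 * q) ^ (p + 3) * (m + 1) +
      (Ca * (2 * q) ^ (p + 2) * (q * (2 * q)) + 2 * q\<^sup>2 * (q * Kq (eps (Suc p)) (2 * Suc p + 1) D q)) * (m + 1))"
    using h Ca m0 R b \<delta> q1 K0 Kq q\<delta> d2 Rq
    by (intro mult_left_mono add_mono mult_mono power_mono order_refl) (auto intro!: mult_nonneg_nonneg add_nonneg_nonneg)
  also have "\<dots> = h ^ p * (G * (m + 1))" by (simp add: G_def distrib_right)
  also have "\<dots> \<le> h ^ p * (G * W)" using h G0 W1 by (intro mult_left_mono) auto
  finally have \<kappa>: "\<alpha> * (2 / \<delta> * (m + 1)) + \<beta> \<le> G * (h ^ p * W)" by (simp add: mult.left_commute)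
  have x0: "x \<ge> 0" by (simp add: x_def)
  have W0: "h ^ p * W \<ge> 0" using W1 m0 h by simp
  have \<kappa>0: "0 \<le> \<alpha> * (2 / \<delta> * (m + 1)) + \<beta>"
    unfolding \<alpha>_def \<beta>_def using \<delta> h Ca m0 R b K0 by (intro add_nonneg_nonneg mult_nonneg_nonneg) auto
  have "exp (2 * b\<^sup>2 * R\<^sup>2 + 4 * \<alpha>) * (4 / \<delta> * x + 4 * (\<alpha> * (2 / \<delta> * (m + 1)) + \<beta>))
      \<le> exp ((8 + 4 * (Ca * 2 ^ (p + 2))) * q) * (4 * q * x + 4 * (G * (h ^ p * W)))"
  proof (intro mult_mono add_mono order_refl \<kappa>)
    have "2 * b\<^sup>2 * R\<^sup>2 + 4 * \<alpha> \<le> 8 * q + 4 * (Ca * 2 ^ (p + 2) * q)" using b2 \<alpha>q by simp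
    also have "\<dots> = (8 + 4 * (Ca * 2 ^ (p + 2))) * q" by (simp add: algebra_simps)
    finally show "exp (2 * b\<^sup>2 * R\<^sup>2 + 4 * \<alpha>) \<le> exp ((8 + 4 * (Ca * 2 ^ (p + 2))) * q)" by simp
    show "4 / \<delta> \<le> 4 * q" using q\<delta> mult_left_mono[of "1 / \<delta>" q 4] by simp
    show "0 \<le> 4 / \<delta> * x + 4 * (\<alpha> * (2 / \<delta> * (m + 1)) + \<beta>)"
      using \<delta> x0 \<kappa>0 by simp
  qed (use x0 q1 \<kappa>0 in auto)
  also have "\<dots> \<le> exp ((8 + 4 * (Ca * 2 ^ (p + 2))) * q) * ((4 * q + 4 * G) * (x + h ^ p * W))"
  proof (intro mult_left_mono)
    have "0 \<le> 4 * q * (h ^ p * W) + 4 * G * x" using q1 G0 x0 W0 by simp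
    then show "4 * q * x + 4 * (G * (h ^ p * W)) \<le> (4 * q + 4 * G) * (x + h ^ p * W)" by (simp add: algebra_simps)
  qed simp
  also have "\<dots> = prefactor Ca p D q * (x + h ^ p * W)" by (simp add: prefactor_def G_def)
  finally have "exp (2 * b\<^sup>2 * R\<^sup>2 + 4 * \<alpha>) * (4 / \<delta> * x + 4 * (\<alpha> * (2 / \<delta> * (m + 1)) + \<beta>)) \<le> prefactor Ca p D q * (x + h ^ p * W)" .
  then show ?thesis
    using W2_taylor_law_le[OF \<delta> h(1) h1 h(2) b_def Ca \<alpha>_def \<beta>_def[unfolded K_def] M M2]
    unfolding x_def[symmetric] m_def[symmetric] W_def[symmetric] q_def[symmetric]
    by (blast intro: order_trans ennreal_leI)
qed

end

theorem theorem4p1: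
  fixes p :: nat and D :: real
  assumes "p \<ge> 1" and "D \<ge> 1"
  shows "\<exists>(C :: real) (C' :: real \<Rightarrow> real \<Rightarrow> real).
    C > 0 \<and> (\<forall>R \<delta>. C' R \<delta> > 0) \<and>
    (\<forall>(d :: nat) (P0 :: (nat \<Rightarrow> real) measure) (R :: real) (\<delta> :: real) (T :: real) (N :: nat) (h :: real) (\<Lambda> :: real).
       d \<ge> 1 \<longrightarrow> prob_space P0 \<longrightarrow> sets P0 = sets (Rd d) \<longrightarrow>
       supp d P0 \<subseteq> {x. L2_set x {..<d} \<le> R} \<longrightarrow>
       doubling_UD d P0 D \<longrightarrow>
       0 < \<delta> \<longrightarrow> \<delta> \<le> 1 \<longrightarrow> \<delta> < T \<longrightarrow> N \<ge> 1 \<longrightarrow>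
       h = (T - \<delta>) / real N \<longrightarrow> \<Lambda> = (1 + R) / \<delta> \<longrightarrow> h * \<Lambda>\<^sup>2 \<le> 1 \<longrightarrow>
       W2 d (noised_law d P0 \<delta>) (taylor_law d P0 p T h N)
         \<le> ennreal (C * exp (C * ((1 + R)\<^sup>2 / \<delta>)) *
             (exp (- T / 2) * sqrt (R\<^sup>2 + real d)
              + h ^ p * (moment_sup d P0 \<delta> T / \<delta> ^ (p + 1) + \<Lambda> ^ (2 * p + 1))))
       \<and> moment_sup d P0 \<delta> T \<le> R + sqrt (real d)
       \<and> W2 d (noised_law d P0 \<delta>) (taylor_law d P0 p T h N)
         \<le> ennreal (C' R \<delta> * (exp (- T / 2) * sqrt (R\<^sup>2 + real d) + h ^ p * (1 + sqrt (real d)))))"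
proof -
  \<comment> \<open>\<open>Ca\<close>, and with it \<open>C\<close>, is fixed before the dimension,
    the prior and the other parameters, so it depends on \<open>p\<close> and \<open>D\<close>
    only.\<close>
  obtain Ca where Ca: "Ca \<ge> 0" "\<And>\<rho>. \<rho> \<ge> 0 \<Longrightarrow> \<bar>poly (alp (Suc p)) \<rho>\<bar> \<le> Ca * \<rho>\<^sup>2 * (1 + \<rho>\<^sup>2) ^ p"
    using alp_bound[of p] by blast
  have "pexp (prefactor Ca p D)" using Ca(1) assms(2) by (intro pexp_prefactor) auto
  then obtain C where C: "C > 0" "\<And>q. q \<ge> 1 \<Longrightarrow> prefactor Ca p D q \<le> C * exp (C * q)"
    unfolding pexp_def by blast
  \<comment> \<open>The absolute values keep \<open>A\<close> at least 1 for all real arguments, so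
    that \<open>C'\<close> is positive everywhere.\<close>
  define A where "A = (\<lambda>R \<delta> :: real. 1 + \<bar>(1 + R) / \<delta> ^ (p + 1)\<bar> + \<bar>((1 + R) / \<delta>) ^ (2 * p + 1)\<bar>)"
  define C' where "C' = (\<lambda>R \<delta> :: real. C * exp (C * ((1 + R)\<^sup>2 / \<delta>)) * A R \<delta>)"
  have A1: "A R \<delta> \<ge> 1" for R \<delta> by (simp add: A_def)
  then have A0: "A R \<delta> > 0" for R \<delta> by (rule order.strict_trans2[OF zero_less_one])
  show ?thesis
  proof (rule exI[of _ C], rule exI[of _ C'], intro conjI allI impI)
    show "C > 0" by fact
    show "C' R \<delta> > 0" for R \<delta> using C(1) A0 by (simp add: C'_def)
  next
    fix d P0 R \<delta> T N and h \<Lambda> :: real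
    assume d: "d \<ge> 1" and P0: "prob_space P0" "sets P0 = sets (Rd d)"
      and supp: "supp d P0 \<subseteq> {x. nrm d x \<le> R}" and UD: "doubling_UD d P0 D"
      and \<delta>: "0 < \<delta>" "\<delta> \<le> 1" and T: "\<delta> < T" and N: "N \<ge> 1" and h: "h = (T - \<delta>) / real N"
      and \<Lambda>: "\<Lambda> = (1 + R) / \<delta>" and small: "h * \<Lambda>\<^sup>2 \<le> 1"
    interpret P0: prob_space P0 by fact
    have AE: "AE y in P0. nrm d y \<le> R" using AE_supp[OF P0] by (rule AE_mp) (use supp in auto)
    \<comment> \<open>An event of probability 1 is nonempty; a point of norm at most R forces R >=
      0.\<close>
    have "\<exists>y. nrm d y \<le> R"
    proof (rule ccontr)
      assume "\<nexists>y. nrm d y \<le> R"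
      with AE have "AE y in P0. False" by simp
      then show False by simp
    qed
    then have R: "R \<ge> 0" using order_trans[OF L2_set_nonneg] by blast
    interpret ud_prior P0 d R D
      by unfold_locales (use P0 R AE supp UD in auto)
    let ?x = "exp (- T / 2) * sqrt (R\<^sup>2 + real d)" and ?q = "(1 + R)\<^sup>2 / \<delta>"
    let ?m = "moment_sup d P0 \<delta> T"
    have h': "0 < h" "T = \<delta> + real N * h" using T N by (simp_all add: h)
    have R1: "(1 + R)\<^sup>2 \<ge> 1" using R power_mono[of 1 "1 + R" 2] by simp
    then have q: "?q \<ge> 1" using \<delta> by (simp add: field_simps)
    show m: "?m \<le> R + sqrt (real d)" by (rule moment_sup_le[OF \<delta>(1) T])
    have "0 \<le> sqrt (\<integral>x. (nrm d x)\<^sup>2 \<partial>noised_law d P0 \<delta>)" by (auto intro!: Bochner_Integration.integral_nonneg)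
    also have "\<dots> \<le> ?m" using \<delta> T by (intro moment_sup_ge) auto
    finally have m0: "?m \<ge> 0" .
    have \<Lambda>0: "\<Lambda> \<ge> 0" using \<Lambda> R \<delta> by simp
    have "W2 d (noised_law d P0 \<delta>) (taylor_law d P0 p T h N)
      \<le> ennreal (prefactor Ca p D ?q * (?x + h ^ p * (?m / \<delta> ^ (p + 1) + \<Lambda> ^ (2 * p + 1))))"
      unfolding \<Lambda> by (rule W2_prefactor[OF assms(1) \<delta> h' small[unfolded \<Lambda>] Ca])
    also have "\<dots> \<le> ennreal (C * exp (C * ?q) * (?x + h ^ p * (?m / \<delta> ^ (p + 1) + \<Lambda> ^ (2 * p + 1))))"
      using h'(1) m0 \<delta> \<Lambda>0 by (intro ennreal_leI mult_right_mono C(2) q add_nonneg_nonneg mult_nonneg_nonneg) auto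
    finally show *: "W2 d (noised_law d P0 \<delta>) (taylor_law d P0 p T h N)
      \<le> ennreal (C * exp (C * ?q) * (?x + h ^ p * (?m / \<delta> ^ (p + 1) + \<Lambda> ^ (2 * p + 1))))" .
    have "R + sqrt d \<le> (1 + R) * (1 + sqrt d)" using R by (simp add: algebra_simps)
    then have "?m / \<delta> ^ (p + 1) \<le> (1 + R) * (1 + sqrt d) / \<delta> ^ (p + 1)"
      using m \<delta> by (intro divide_right_mono) auto
    also have "\<dots> = \<bar>(1 + R) / \<delta> ^ (p + 1)\<bar> * (1 + sqrt d)" using R \<delta> by simp
    finally have 1: "?m / \<delta> ^ (p + 1) \<le> \<bar>(1 + R) / \<delta> ^ (p + 1)\<bar> * (1 + sqrt d)" .
    have 2: "\<Lambda> ^ (2 * p + 1) \<le> \<bar>\<Lambda> ^ (2 * p + 1)\<bar> * (1 + sqrt d)"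
      using \<Lambda>0 by (simp add: mult_left_mono distrib_left del: power_Suc power_add)
    have "?m / \<delta> ^ (p + 1) + \<Lambda> ^ (2 * p + 1) \<le> A R \<delta> * (1 + sqrt d)"
    proof -
      have "A R \<delta> * (1 + sqrt d) = (1 + sqrt d) + \<bar>(1 + R) / \<delta> ^ (p + 1)\<bar> * (1 + sqrt d) + \<bar>\<Lambda> ^ (2 * p + 1)\<bar> * (1 + sqrt d)"
        unfolding A_def \<Lambda> distrib_right[of _ _ "1 + sqrt d"] mult_1_left ..
      moreover have "0 \<le> 1 + sqrt d" by simp
      ultimately show ?thesis using 1 2 by linarith
    qed
    then have "h ^ p * (?m / \<delta> ^ (p + 1) + \<Lambda> ^ (2 * p + 1)) \<le> h ^ p * (A R \<delta> * (1 + sqrt d))"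
      using h'(1) by (intro mult_left_mono) auto
    moreover have "1 * ?x \<le> A R \<delta> * ?x" by (intro mult_right_mono A1) auto
    moreover have "A R \<delta> * (?x + h ^ p * (1 + sqrt d)) = A R \<delta> * ?x + h ^ p * (A R \<delta> * (1 + sqrt d))"
      by (simp only: distrib_left[of "A R \<delta>" ?x] mult.left_commute[of "h ^ p"])
    ultimately have "?x + h ^ p * (?m / \<delta> ^ (p + 1) + \<Lambda> ^ (2 * p + 1)) \<le> A R \<delta> * (?x + h ^ p * (1 + sqrt d))"
      by linarith
    then have "C * exp (C * ?q) * (?x + h ^ p * (?m / \<delta> ^ (p + 1) + \<Lambda> ^ (2 * p + 1))) \<le> C' R \<delta> * (?x + h ^ p * (1 + sqrt d))"
      unfolding C'_def mult.assoc using C(1) by (intro mult_left_mono) auto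
    then show "W2 d (noised_law d P0 \<delta>) (taylor_law d P0 p T h N) \<le> ennreal (C' R \<delta> * (?x + h ^ p * (1 + sqrt (real d))))"
      by (rule order_trans[OF * ennreal_leI])
  qed
qed

end
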